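(* Let $G$ be a group, $Y\subseteq G$ a finite set containing at least two elements which generates $G$ as a semigroup, and $F:Y\to\mathbb R$ a function. Assume that the abelianization $G/[G,G]$ has rank $n\ge1$ and that $F(s)>0$ for all $s\in Y$. Then the set of abelian $\mathrm{KMS}_\infty$ states for $\alpha^F$ on $O_Y(G)$ is a compact convex set affinely homeomorphic to the set of Borel probability measures on the $(n-1)$-sphere $S^{n-1}$.
   Context: Words: $Y^0=\{\emptyset\}$; for $t=(t_1,\dots,t_k)\in Y^k$ put $\overline t=t_1t_2\cdots t_k\in G$ and $F(t)=\sum_{j=1}^k F(t_j)$; $\overline{\emptyset}=e_0$ (the neutral element of $G$), $F(\emptyset)=0$. $O_Y$ is the Cuntz algebra generated by isometries $V_s$, $s\in Y$, with $\sum_{s\in Y}V_sV_s^*=1$; $V_t=V_{t_1}\cdots V_{t_k}$, $V_\emptyset=1$. $O_Y(G)\subseteq O_Y$ is the $C^*$-subalgebra which is the closed linear span of the elements $V_tV_u^*$, $t,u\in\bigcup_{k\ge0}Y^k$, with $\overline t=\overline u$. $\alpha^F$ is the one-parameter group of automorphisms of $O_Y$ with $\alpha^F_r(V_wV_u^* )=e^{ir(F(w)-F(u))}V_wV_u^*$, $r\in\mathbb R$; it leaves $O_Y(G)$ globally invariant and $\alpha^F$ also denotes its restriction to $O_Y(G)$. For $\beta\in\mathbb R$, a state $\omega$ on $O_Y(G)$ is a $\beta$-KMS state for $\alpha^F$ if there is a dense $\alpha^F$-invariant $*$-subalgebra $\mathcal A$ of $O_Y(G)$ consisting of analytic elements for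 $\alpha^F$ with $\omega(ab)=\omega(b\,\alpha^F_{i\beta}(a))$ for all $a,b\in\mathcal A$. To a $\beta$-KMS state $\omega$ is associated the vector $\psi:G\to[0,\infty)$ given by $\psi_{\overline t}=e^{\beta F(t)}\omega(V_tV_t^* )$ (independent of the choice of word $t$ representing the group element). The $\beta$-KMS state $\omega$ is abelian when $\psi_{hgk}=\psi_{hkg}$ for all $h,g,k\in G$. A state $\omega$ on $O_Y(G)$ is an abelian $\mathrm{KMS}_\infty$ state for $\alpha^F$ when there are a sequence $\{\beta_k\}\subseteq\mathbb R$ with $\beta_k\to\infty$ and, for each $k$, an abelian $\beta_k$-KMS state $\omega_k$ for $\alpha^F$ such that $\omega_k\to\omega$ in the weak*-topology. Sets of states carry the weak*-topology, as do sets of Borel probability measures; $S^{n-1}=\{v\in\mathbb R^n:\|v\|=1\}$. *)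

theory Defs
  imports "HOL-Analysis.Analysis" "HOL-Algebra.Generated_Groups" "HOL-Algebra.FiniteProduct"
begin

section \<open>Unital C*-algebras\<close>

class unital_cstar_algebra = real_normed_algebra_1 + banach +
  fixes scaleC :: "complex \<Rightarrow> 'a \<Rightarrow> 'a" (infixr "*\<^sub>C" 75)
    and star :: "'a \<Rightarrow> 'a"
  assumes scaleC_add_right: "c *\<^sub>C (x + y) = c *\<^sub>C x + c *\<^sub>C y"
    and scaleC_add_left: "(c + d) *\<^sub>C x = c *\<^sub>C x + d *\<^sub>C x"
    and scaleC_scaleC: "c *\<^sub>C d *\<^sub>C x = (c * d) *\<^sub>C x"
    and scaleC_of_real: "complex_of_real r *\<^sub>C x = r *\<^sub>R x"
    and mult_scaleC_left: "(c *\<^sub>C x) * y = c *\<^sub>C (x * y)"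
    and mult_scaleC_right: "x * (c *\<^sub>C y) = c *\<^sub>C (x * y)"
    and norm_scaleC: "norm (c *\<^sub>C x) = cmod c * norm x"
    and star_star: "star (star x) = x"
    and star_add: "star (x + y) = star x + star y"
    and star_scaleC: "star (c *\<^sub>C x) = cnj c *\<^sub>C star x"
    and star_mult: "star (x * y) = star y * star x"
    and cstar_identity: "norm (star x * x) = (norm x)\<^sup>2"

definition complex_subspace :: "'a::unital_cstar_algebra set \<Rightarrow> bool" where
  "complex_subspace A \<longleftrightarrow>
     0 \<in> A \<and> (\<forall>x\<in>A. \<forall>y\<in>A. x + y \<in> A) \<and> (\<forall>c. \<forall>x\<in>A. c *\<^sub>C x \<in> A)"

definition star_subalgebra :: "'a::unital_cstar_algebra set \<Rightarrow> bool" where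
  "star_subalgebra A \<longleftrightarrow>
     complex_subspace A \<and> (\<forall>x\<in>A. \<forall>y\<in>A. x * y \<in> A) \<and> (\<forall>x\<in>A. star x \<in> A)"

definition star_automorphism :: "'a::unital_cstar_algebra set \<Rightarrow> ('a \<Rightarrow> 'a) \<Rightarrow> bool" where
  "star_automorphism A \<phi> \<longleftrightarrow> bij_betw \<phi> A A \<and>
     (\<forall>x\<in>A. \<forall>y\<in>A. \<phi> (x + y) = \<phi> x + \<phi> y) \<and>
     (\<forall>c. \<forall>x\<in>A. \<phi> (c *\<^sub>C x) = c *\<^sub>C \<phi> x) \<and>
     (\<forall>x\<in>A. \<forall>y\<in>A. \<phi> (x * y) = \<phi> x * \<phi> y) \<and>
     (\<forall>x\<in>A. \<phi> (star x) = star (\<phi> x))"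

text \<open>As usual for C*-algebras, one-parameter groups of automorphisms are strongly continuous.\<close>

definition one_parameter_group :: "'a::unital_cstar_algebra set \<Rightarrow> (real \<Rightarrow> 'a \<Rightarrow> 'a) \<Rightarrow> bool" where
  "one_parameter_group A \<alpha> \<longleftrightarrow>
     (\<forall>r. star_automorphism A (\<alpha> r)) \<and>
     (\<forall>x\<in>A. \<alpha> 0 x = x) \<and>
     (\<forall>r s. \<forall>x\<in>A. \<alpha> (r + s) x = \<alpha> r (\<alpha> s x)) \<and>
     (\<forall>x\<in>A. continuous_on UNIV (\<lambda>r. \<alpha> r x))"

section \<open>States and the weak*-topology\<close>

text \<open>
  In this section \<open>A\<close> is a C*-subalgebra containing the unit of the ambient algebra. Functionals
  on \<open>A\<close> are extensional, so that distinct functions represent distinct functionals. For a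
  positive functional, having norm one amounts to taking the value \<open>1\<close> at the unit.
\<close>

definition states :: "'a::unital_cstar_algebra set \<Rightarrow> ('a \<Rightarrow> complex) set" where
  "states A = {\<omega> \<in> extensional A.
     (\<forall>x\<in>A. \<forall>y\<in>A. \<omega> (x + y) = \<omega> x + \<omega> y) \<and>
     (\<forall>c. \<forall>x\<in>A. \<omega> (c *\<^sub>C x) = c * \<omega> x) \<and>
     (\<forall>x\<in>A. \<omega> (star x * x) \<in> \<real>\<^sub>\<ge>\<^sub>0) \<and>
     \<omega> 1 = 1}"

definition state_topology :: "'a::unital_cstar_algebra set \<Rightarrow> ('a \<Rightarrow> complex) topology" where
  "state_topology A = subtopology (product_topology (\<lambda>_. euclidean) A) (states A)"

definition mix_functionals ::
  "'a set \<Rightarrow> real \<Rightarrow> ('a \<Rightarrow> complex) \<Rightarrow> ('a \<Rightarrow> complex) \<Rightarrow> 'a \<Rightarrow> complex" where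
  "mix_functionals A t \<omega> \<omega>' =
     (\<lambda>x\<in>A. complex_of_real (1 - t) * \<omega> x + complex_of_real t * \<omega>' x)"

definition convex_functionals :: "'a set \<Rightarrow> ('a \<Rightarrow> complex) set \<Rightarrow> bool" where
  "convex_functionals A K \<longleftrightarrow>
     (\<forall>\<omega>\<in>K. \<forall>\<omega>'\<in>K. \<forall>t\<in>{0..1}. mix_functionals A t \<omega> \<omega>' \<in> K)"

section \<open>KMS states\<close>

definition complex_differentiable_at :: "(complex \<Rightarrow> 'a::unital_cstar_algebra) \<Rightarrow> complex \<Rightarrow> bool" where
  "complex_differentiable_at f z \<longleftrightarrow>
     (\<exists>d. ((\<lambda>w. inverse (w - z) *\<^sub>C (f w - f z)) \<longlongrightarrow> d) (at z))"

definition entire_extension ::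
  "'a::unital_cstar_algebra set \<Rightarrow> (real \<Rightarrow> 'a \<Rightarrow> 'a) \<Rightarrow> 'a \<Rightarrow> (complex \<Rightarrow> 'a) \<Rightarrow> bool" where
  "entire_extension A \<alpha> x f \<longleftrightarrow>
     (\<forall>z. f z \<in> A) \<and> (\<forall>r. f (complex_of_real r) = \<alpha> r x) \<and> (\<forall>z. complex_differentiable_at f z)"

definition analytic_elements ::
  "'a::unital_cstar_algebra set \<Rightarrow> (real \<Rightarrow> 'a \<Rightarrow> 'a) \<Rightarrow> 'a set" where
  "analytic_elements A \<alpha> = {x \<in> A. \<exists>f. entire_extension A \<alpha> x f}"

text \<open>The entire extension is unique by the identity theorem, so the description below is proper
  for analytic elements.\<close>

definition complex_flow ::
  "'a::unital_cstar_algebra set \<Rightarrow> (real \<Rightarrow> 'a \<Rightarrow> 'a) \<Rightarrow> complex \<Rightarrow> 'a \<Rightarrow> 'a" where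
  "complex_flow A \<alpha> z x = (THE f. entire_extension A \<alpha> x f) z"

definition KMS_states ::
  "'a::unital_cstar_algebra set \<Rightarrow> (real \<Rightarrow> 'a \<Rightarrow> 'a) \<Rightarrow> real \<Rightarrow> ('a \<Rightarrow> complex) set" where
  "KMS_states A \<alpha> \<beta> = {\<omega> \<in> states A.
     \<exists>D. D \<subseteq> A \<and> star_subalgebra D \<and> A \<subseteq> closure D \<and>
         (\<forall>r. \<alpha> r ` D \<subseteq> D) \<and> D \<subseteq> analytic_elements A \<alpha> \<and>
         (\<forall>a\<in>D. \<forall>b\<in>D. \<omega> (a * b) = \<omega> (b * complex_flow A \<alpha> (\<i> * complex_of_real \<beta>) a))}"

section \<open>The Cuntz algebra \<open>O\<^sub>Y\<close>, the subalgebra \<open>O\<^sub>Y(G)\<close> and the flow\<close>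

text \<open>A word in \<open>Y\<close> is an element of \<^term>\<open>lists Y\<close>.\<close>

definition word_value :: "('g, 'b) monoid_scheme \<Rightarrow> 'g list \<Rightarrow> 'g" where
  "word_value G t = foldr (mult G) t (one G)"

definition word_weight :: "('g \<Rightarrow> real) \<Rightarrow> 'g list \<Rightarrow> real" where
  "word_weight F t = (\<Sum>s\<leftarrow>t. F s)"

definition word_isometry :: "('g \<Rightarrow> 'a::monoid_mult) \<Rightarrow> 'g list \<Rightarrow> 'a" where
  "word_isometry V t = prod_list (map V t)"

definition generates_as_semigroup :: "('g, 'b) monoid_scheme \<Rightarrow> 'g set \<Rightarrow> bool" where
  "generates_as_semigroup G Y \<longleftrightarrow> carrier G = {word_value G t | t. t \<in> lists Y \<and> t \<noteq> []}"

text \<open>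
  For a finite set \<open>Y\<close> with at least two elements the C*-algebra generated by a Cuntz family
  indexed by \<open>Y\<close> is, by Cuntz's uniqueness theorem, determined up to an isomorphism preserving
  the generators. Hence \<open>O\<^sub>Y\<close> is taken to be the C*-algebra generated by an arbitrary Cuntz family
  in an arbitrary unital C*-algebra.
\<close>

definition cuntz_family :: "'g set \<Rightarrow> ('g \<Rightarrow> 'a::unital_cstar_algebra) \<Rightarrow> bool" where
  "cuntz_family Y V \<longleftrightarrow>
     (\<forall>s\<in>Y. star (V s) * V s = 1) \<and> (\<Sum>s\<in>Y. V s * star (V s)) = 1"

definition cuntz_algebra :: "'g set \<Rightarrow> ('g \<Rightarrow> 'a::unital_cstar_algebra) \<Rightarrow> 'a set" where
  "cuntz_algebra Y V = (\<lambda>A. star_subalgebra A \<and> closed A) hull (V ` Y)"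

definition cuntz_group_algebra ::
  "('g, 'b) monoid_scheme \<Rightarrow> 'g set \<Rightarrow> ('g \<Rightarrow> 'a::unital_cstar_algebra) \<Rightarrow> 'a set" where
  "cuntz_group_algebra G Y V = closure (complex_subspace hull
     {word_isometry V t * star (word_isometry V u) | t u.
        t \<in> lists Y \<and> u \<in> lists Y \<and> word_value G t = word_value G u})"

text \<open>The formula together with continuity determines \<open>\<alpha> r\<close> on \<open>O\<^sub>Y\<close>; values of \<open>\<alpha> r\<close> outside \<open>O\<^sub>Y\<close>
  are irrelevant.\<close>

definition cuntz_flow ::
  "'g set \<Rightarrow> ('g \<Rightarrow> 'a::unital_cstar_algebra) \<Rightarrow> ('g \<Rightarrow> real) \<Rightarrow> (real \<Rightarrow> 'a \<Rightarrow> 'a) \<Rightarrow> bool" where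
  "cuntz_flow Y V F \<alpha> \<longleftrightarrow>
     one_parameter_group (cuntz_algebra Y V) \<alpha> \<and>
     (\<forall>r. \<forall>w\<in>lists Y. \<forall>u\<in>lists Y.
        \<alpha> r (word_isometry V w * star (word_isometry V u)) =
        cis (r * (word_weight F w - word_weight F u)) *\<^sub>C
          (word_isometry V w * star (word_isometry V u)))"

section \<open>Abelian KMS states and their limits\<close>

text \<open>For a KMS state the value below does not depend on the word chosen to represent \<open>g\<close>.\<close>

definition KMS_vector ::
  "('g, 'b) monoid_scheme \<Rightarrow> 'g set \<Rightarrow> ('g \<Rightarrow> 'a::unital_cstar_algebra) \<Rightarrow> ('g \<Rightarrow> real) \<Rightarrow> real \<Rightarrow>
     ('a \<Rightarrow> complex) \<Rightarrow> 'g \<Rightarrow> real" where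
  "KMS_vector G Y V F \<beta> \<omega> g =
     (let t = (SOME t. t \<in> lists Y \<and> word_value G t = g)
      in exp (\<beta> * word_weight F t) * Re (\<omega> (word_isometry V t * star (word_isometry V t))))"

definition abelian_KMS_states ::
  "('g, 'b) monoid_scheme \<Rightarrow> 'g set \<Rightarrow> ('g \<Rightarrow> 'a::unital_cstar_algebra) \<Rightarrow> ('g \<Rightarrow> real) \<Rightarrow>
     (real \<Rightarrow> 'a \<Rightarrow> 'a) \<Rightarrow> real \<Rightarrow> ('a \<Rightarrow> complex) set" where
  "abelian_KMS_states G Y V F \<alpha> \<beta> = {\<omega> \<in> KMS_states (cuntz_group_algebra G Y V) \<alpha> \<beta>.
     \<forall>h\<in>carrier G. \<forall>g\<in>carrier G. \<forall>k\<in>carrier G.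
       KMS_vector G Y V F \<beta> \<omega> (h \<otimes>\<^bsub>G\<^esub> g \<otimes>\<^bsub>G\<^esub> k) = KMS_vector G Y V F \<beta> \<omega> (h \<otimes>\<^bsub>G\<^esub> k \<otimes>\<^bsub>G\<^esub> g)}"

definition abelian_KMS_infinity_states ::
  "('g, 'b) monoid_scheme \<Rightarrow> 'g set \<Rightarrow> ('g \<Rightarrow> 'a::unital_cstar_algebra) \<Rightarrow> ('g \<Rightarrow> real) \<Rightarrow>
     (real \<Rightarrow> 'a \<Rightarrow> 'a) \<Rightarrow> ('a \<Rightarrow> complex) set" where
  "abelian_KMS_infinity_states G Y V F \<alpha> = {\<omega> \<in> states (cuntz_group_algebra G Y V).
     \<exists>(\<beta> :: nat \<Rightarrow> real) \<omega>s. filterlim \<beta> at_top sequentially \<and>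
       (\<forall>k. \<omega>s k \<in> abelian_KMS_states G Y V F \<alpha> (\<beta> k)) \<and>
       limitin (state_topology (cuntz_group_algebra G Y V)) \<omega>s \<omega> sequentially}"

section \<open>Rank of an abelian group\<close>

definition int_independent :: "('g, 'b) monoid_scheme \<Rightarrow> 'g set \<Rightarrow> bool" where
  "int_independent A S \<longleftrightarrow> finite S \<and> S \<subseteq> carrier A \<and>
     (\<forall>k :: 'g \<Rightarrow> int. finprod A (\<lambda>s. s [^]\<^bsub>A\<^esub> k s) S = \<one>\<^bsub>A\<^esub> \<longrightarrow> (\<forall>s\<in>S. k s = 0))"

definition has_rank :: "('g, 'b) monoid_scheme \<Rightarrow> nat \<Rightarrow> bool" where
  "has_rank A n \<longleftrightarrow> (\<exists>S. int_independent A S \<and> card S = n) \<and>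
     (\<forall>S. int_independent A S \<longrightarrow> card S \<le> n)"

section \<open>Borel probability measures on a compact set\<close>

definition borel_probabilities :: "'b::topological_space set \<Rightarrow> 'b measure set" where
  "borel_probabilities S =
     {\<mu>. sets \<mu> = sets (restrict_space borel S) \<and> emeasure \<mu> (space \<mu>) = 1}"

text \<open>The initial topology for the maps \<open>\<mu> \<mapsto> \<integral>f d\<mu>\<close>, with \<open>f\<close> ranging over the real functions that
  are continuous on \<open>S\<close>; it is the weak*-topology for compact \<open>S\<close>.\<close>

definition probability_topology :: "'b::topological_space set \<Rightarrow> 'b measure topology" where
  "probability_topology S = pullback_topology (borel_probabilities S)
     (\<lambda>\<mu>. \<lambda>f\<in>{f :: 'b \<Rightarrow> real. continuous_on S f}. integral\<^sup>L \<mu> f)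
     (product_topology (\<lambda>_. euclidean) {f. continuous_on S f})"

definition affinely_homeomorphic_to_probabilities ::
  "'a::unital_cstar_algebra set \<Rightarrow> ('a \<Rightarrow> complex) set \<Rightarrow> 'b::topological_space set \<Rightarrow> bool" where
  "affinely_homeomorphic_to_probabilities A K S \<longleftrightarrow>
     (\<exists>\<Phi>. homeomorphic_map (subtopology (state_topology A) K) (probability_topology S) \<Phi> \<and>
       (\<forall>\<omega>\<in>K. \<forall>\<omega>'\<in>K. \<forall>t\<in>{0..1}. \<forall>B\<in>sets (restrict_space borel S).
          measure (\<Phi> (mix_functionals A t \<omega> \<omega>')) B =
            (1 - t) * measure (\<Phi> \<omega>) B + t * measure (\<Phi> \<omega>') B))"

end

theory Submission
  imports Defs "HOL-Complex_Analysis.Complex_Analysis"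
begin

text \<open>
  For \<open>\<beta> > 0\<close> a \<open>\<beta>\<close>-KMS state vanishes on \<open>V\<^sub>tV\<^sub>u\<^sup>*\<close> for \<open>t \<noteq> u\<close>, so it is determined by the numbers
  \<open>p t = \<omega>(V\<^sub>tV\<^sub>t\<^sup>*)\<close>, which are the cylinder probabilities of a random sequence of letters. The
  sequence is exchangeable when the state is abelian, and de Finetti's theorem writes \<open>p\<close> as a mixture
  of product laws. The KMS relations force almost every weight vector \<open>q\<close> of the mixture to be a Gibbs
  vector \<open>q\<^sub>s = exp (\<xi>\<cdot>\<pi> s - \<beta> F s)\<close>, where \<open>\<pi>\<close> maps \<open>G\<close> to \<open>\<real>\<^sup>n\<close> through the abelianization.

  For large \<open>\<beta>\<close> the direction of the mean of \<open>\<pi>\<close> under \<open>q\<close> parametrises the Gibbs vectors by the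
  sphere, and the limits of Gibbs vectors as \<open>\<beta> \<rightarrow> \<infinity>\<close> are again parametrised by the sphere in this
  way. A limit of mixtures of Gibbs vectors is a mixture of these limits, because a polynomial in \<open>q\<close>
  is asymptotically bounded by its maximum over them; conversely such a mixture is the limit of
  the mixtures of the Gibbs vectors with the same directions. The mixing measure on the sphere is unique
  and depends continuously on the state by the Stone--Weierstrass theorem.
\<close>

section \<open>C*-algebras\<close>

text \<open>Two obstacles shape the proof. The KMS identity is only given on some dense subalgebra,
  which need not contain the elements \<open>W t * star (W u)\<close>. It is carried over to them
  because they are eigenvectors of the flow: if an entire function is bounded on a strip and nearly
  constant on each edge, the two constants nearly agree. At zero temperature, coordinates of Gibbs
  vectors may tend to zero, and then no vector \<xi> survives in the limit. What survives are
  relations between monomials with nonnegative real exponents, and \<open>Ground\<close> is defined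
  by these. Real exponents are essential since the injectivity proof uses the vectors themselves as
  exponents: if \<open>mean q = c *\<^sub>R mean q'\<close>, the relation between the exponents
  \<open>q\<close> and \<open>c * q'\<close> makes a positive combination of the two relative
  entropies of \<open>q\<close> and \<open>q'\<close> vanish. The same combination settles
  injectivity at finite \<beta>. Surjectivity at finite \<beta> is a maximisation over a sublevel
  set of the partition function, and it passes to the limit by compactness.\<close>

lemma scaleC_zero_left [simp]: "0 *\<^sub>C (x::'a::unital_cstar_algebra) = 0"
  using scaleC_of_real[of 0 x] by simp

lemma scaleC_one [simp]: "1 *\<^sub>C (x::'a::unital_cstar_algebra) = x"
  using scaleC_of_real[of 1 x] by simp

lemma scaleC_zero_right [simp]: "c *\<^sub>C (0::'a::unital_cstar_algebra) = 0"
  using scaleC_add_right[of c 0 "0::'a"] by simp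

lemma scaleC_minus_left: "(- c) *\<^sub>C (x::'a::unital_cstar_algebra) = - (c *\<^sub>C x)"
  using scaleC_add_left[of c "- c" x] by (simp add: eq_neg_iff_add_eq_0 add.commute)

lemma scaleC_minus_right: "c *\<^sub>C (- (x::'a::unital_cstar_algebra)) = - (c *\<^sub>C x)"
  using scaleC_add_right[of c x "- x"] by (simp add: eq_neg_iff_add_eq_0 add.commute)

lemma scaleC_diff_right: "c *\<^sub>C (x - (y::'a::unital_cstar_algebra)) = c *\<^sub>C x - c *\<^sub>C y"
  using scaleC_add_right[of c x "- y"] by (simp add: scaleC_minus_right)

lemma scaleC_diff_left: "(c - d) *\<^sub>C (x::'a::unital_cstar_algebra) = c *\<^sub>C x - d *\<^sub>C x"
  using scaleC_add_left[of c "- d" x] by (simp add: scaleC_minus_left)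

lemma scaleC_cancel_one: "c *\<^sub>C (1::'a::unital_cstar_algebra) = d *\<^sub>C 1 \<longleftrightarrow> c = d"
proof
  assume "c *\<^sub>C (1::'a) = d *\<^sub>C 1"
  then have "norm ((c - d) *\<^sub>C (1::'a)) = 0" by (simp add: scaleC_diff_left)
  then show "c = d" by (simp add: norm_scaleC)
qed simp

lemma bounded_linear_scaleC: "bounded_linear (\<lambda>x::'a::unital_cstar_algebra. c *\<^sub>C x)"
proof (rule bounded_linear_intro[where K = "cmod c"])
  show "c *\<^sub>C (r *\<^sub>R x) = r *\<^sub>R (c *\<^sub>C x)" for r and x :: 'a
    by (metis mult.commute scaleC_of_real scaleC_scaleC)
qed (simp_all add: scaleC_add_right norm_scaleC mult.commute)

lemma star_zero [simp]: "star (0::'a::unital_cstar_algebra) = 0"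
  using star_add[of 0 "0::'a"] by simp

lemma star_minus: "star (- (x::'a::unital_cstar_algebra)) = - star x"
  using star_add[of x "- x"] by (simp add: eq_neg_iff_add_eq_0 add.commute)

lemma star_diff: "star (x - (y::'a::unital_cstar_algebra)) = star x - star y"
  using star_add[of x "- y"] by (simp add: star_minus)

lemma star_one [simp]: "star (1::'a::unital_cstar_algebra) = 1"
  by (metis mult.left_neutral mult.right_neutral star_mult star_star)

lemma star_scaleR: "star (r *\<^sub>R (x::'a::unital_cstar_algebra)) = r *\<^sub>R star x"
  using star_scaleC[of "complex_of_real r" x] by (simp add: scaleC_of_real)

lemma star_power: "star ((x::'a::unital_cstar_algebra) ^ n) = star x ^ n"
  by (induction n) (auto simp: star_mult power_commutes)

lemma norm_star [simp]: "norm (star (x::'a::unital_cstar_algebra)) = norm x"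
proof -
  have le: "norm y \<le> norm (star y)" for y :: 'a
  proof (cases "y = 0")
    case False
    have "norm y * norm y \<le> norm (star y) * norm y"
      using norm_mult_ineq[of "star y" y] by (simp add: cstar_identity power2_eq_square)
    then show ?thesis using False by (simp add: mult_le_cancel_right)
  qed simp
  show ?thesis using le[of x] le[of "star x"] by (simp add: star_star)
qed

lemma bounded_linear_star: "bounded_linear (star :: 'a::unital_cstar_algebra \<Rightarrow> 'a)"
  by (rule bounded_linear_intro[where K = 1]) (simp_all add: star_add star_scaleR)

lemma star_subalgebraD:
  assumes "star_subalgebra A"
  shows "0 \<in> A" "x \<in> A \<Longrightarrow> y \<in> A \<Longrightarrow> x + y \<in> A" "x \<in> A \<Longrightarrow> c *\<^sub>C x \<in> A"
    "x \<in> A \<Longrightarrow> y \<in> A \<Longrightarrow> x * y \<in> A" "x \<in> A \<Longrightarrow> star x \<in> A"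
  using assms unfolding star_subalgebra_def complex_subspace_def by auto

lemma complex_subspaceD:
  assumes "complex_subspace A"
  shows "0 \<in> A" "x \<in> A \<Longrightarrow> y \<in> A \<Longrightarrow> x + y \<in> A" "x \<in> A \<Longrightarrow> c *\<^sub>C x \<in> A"
    "x \<in> A \<Longrightarrow> r *\<^sub>R x \<in> A" "x \<in> A \<Longrightarrow> - x \<in> A" "x \<in> A \<Longrightarrow> y \<in> A \<Longrightarrow> x - y \<in> A"
    "(\<And>i. i \<in> I \<Longrightarrow> f i \<in> A) \<Longrightarrow> sum f I \<in> A"
proof -
  show 0: "0 \<in> A" and add: "\<And>x y. x \<in> A \<Longrightarrow> y \<in> A \<Longrightarrow> x + y \<in> A"
    and sc: "\<And>c x. x \<in> A \<Longrightarrow> c *\<^sub>C x \<in> A"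
    using assms unfolding complex_subspace_def by auto
  show "x \<in> A \<Longrightarrow> r *\<^sub>R x \<in> A" using sc[of x "complex_of_real r"] by (simp add: scaleC_of_real)
  have m: "x \<in> A \<Longrightarrow> - x \<in> A" for x using sc[of x "-1"] by (simp add: scaleC_minus_left)
  then show "x \<in> A \<Longrightarrow> - x \<in> A" .
  show "x \<in> A \<Longrightarrow> y \<in> A \<Longrightarrow> x - y \<in> A" using add[of x "- y"] m[of y] by simp
  show "(\<And>i. i \<in> I \<Longrightarrow> f i \<in> A) \<Longrightarrow> sum f I \<in> A"
    by (induction I rule: infinite_finite_induct) (auto simp: 0 add)
qed

text \<open>The ratio of consecutive coefficients is \<open>(1/2 - n) / (n + 1)\<close>, of modulus
  at most one. This crude bound is enough to dominate the square root series by a geometric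
  series.\<close>

lemma gbinomial_half_le_1: "\<bar>(1/2::real) gchoose n\<bar> \<le> 1"
proof (induction n)
  case (Suc n)
  have "of_nat (Suc n) * ((1/2::real) gchoose Suc n) = (1/2 - of_nat n) * ((1/2) gchoose n)"
    using gbinomial_mult_1[of "1/2::real" n] by (simp add: algebra_simps)
  then have "(real n + 1) * \<bar>(1/2::real) gchoose Suc n\<bar> = \<bar>1/2 - real n\<bar> * \<bar>(1/2) gchoose n\<bar>"
    by (metis abs_mult abs_of_nat add.commute of_nat_Suc)
  also have "\<dots> \<le> (real n + 1) * 1"
    using Suc by (intro mult_mono) auto
  finally show ?case by (simp add: mult_le_cancel_left)
qed simp

text \<open>The square root is the binomial series of \<open>(1 - h) powr (1/2)\<close>, which converges in norm.\<close>

lemma square_root_one_minus: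
  fixes h :: "'a::unital_cstar_algebra"
  assumes "norm h < 1" "star h = h" "star_subalgebra A" "closed A" "1 \<in> A" "h \<in> A"
  obtains k where "k \<in> A" "star k = k" "k * k = 1 - h" "\<forall>x. x * h = h * x \<longrightarrow> x * k = k * x"
proof -
  define a where "a n = (-1) ^ n * ((1/2::real) gchoose n)" for n
  define f where "f n = a n *\<^sub>R h ^ n" for n
  have sub: "complex_subspace A" using assms(3) by (simp add: star_subalgebra_def)
  have hn: "h ^ n \<in> A" for n
    using assms by (induction n) (auto intro: star_subalgebraD)
  have fA: "f n \<in> A" for n unfolding f_def by (intro complex_subspaceD(4) sub hn)
  have nf: "norm (f n) \<le> norm h ^ n" for n
  proof -
    have "norm (f n) \<le> 1 * norm h ^ n"
      unfolding f_def a_def norm_scaleR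
      by (intro mult_mono norm_power_ineq) (auto simp: abs_mult power_abs gbinomial_half_le_1)
    then show ?thesis by simp
  qed
  have sn: "summable (\<lambda>n. norm (f n))"
    by (rule summable_comparison_test'[of "\<lambda>n. norm h ^ n" 0])
       (use assms(1) nf in \<open>auto intro: summable_geometric\<close>)
  then have sf: "summable f" by (rule summable_norm_cancel)
  define k where "k = suminf f"
  have lim: "(\<lambda>n. \<Sum>i<n. f i) \<longlonglongrightarrow> k" unfolding k_def using sf by (rule summable_LIMSEQ)
  have 1: "k \<in> A"
    by (rule closed_sequentially[OF assms(4) _ lim]) (intro complex_subspaceD(7) sub fA)
  have 2: "star k = k"
  proof -
    have "star k = (\<Sum>n. star (f n))"
      unfolding k_def using bounded_linear.suminf[OF bounded_linear_star sf] by simp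
    also have "(\<lambda>n. star (f n)) = f" unfolding f_def by (simp add: star_scaleR star_power assms(2))
    finally show ?thesis by (simp add: k_def)
  qed
  \<comment> \<open>Vandermonde's identity turns the coefficient of \<open>h ^ n\<close> into
    \<open>(-1) ^ n * (1 choose n)\<close>, which vanishes from \<open>n = 2\<close> on.\<close>
  have c: "(\<Sum>i\<le>n. f i * f (n - i)) = (if n = 0 then 1 else if n = 1 then - h else 0)" for n
  proof -
    have "(\<Sum>i\<le>n. f i * f (n - i)) = (\<Sum>i\<le>n. (a i * a (n - i)) *\<^sub>R h ^ n)"
      by (rule sum.cong) (auto simp: f_def power_add[symmetric])
    also have "\<dots> = (\<Sum>i\<le>n. a i * a (n - i)) *\<^sub>R h ^ n" by (simp add: scaleR_sum_left)
    also have "(\<Sum>i\<le>n. a i * a (n - i)) = (\<Sum>i\<le>n. (-1) ^ n * (((1/2) gchoose i) * ((1/2) gchoose (n - i))))"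
    proof (rule sum.cong)
      fix i assume "i \<in> {..n}"
      then have "(-1::real) ^ n = (-1) ^ i * (-1) ^ (n - i)" by (simp add: power_add[symmetric])
      then show "a i * a (n - i) = (-1) ^ n * (((1/2) gchoose i) * ((1/2) gchoose (n - i)))"
        by (simp add: a_def)
    qed simp
    also have "\<dots> = (-1) ^ n * ((1::real) gchoose n)"
      using gbinomial_Vandermonde[of "1/2::real" "1/2" n]
      by (simp add: sum_distrib_left[symmetric] atMost_atLeast0)
    also have "(1::real) gchoose n = of_nat (1 choose n)"
      using binomial_gbinomial[of 1 n, where ?'a = real] by simp
    finally have e: "(\<Sum>i\<le>n. f i * f (n - i)) = ((-1) ^ n * of_nat (1 choose n)) *\<^sub>R h ^ n" .
    consider "n = 0" | "n = 1" | "n > 1" by linarith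
    then show ?thesis by cases (use e in \<open>auto simp: binomial_eq_0\<close>)
  qed
  have "(\<lambda>n. if n = 0 then 1 else if n = 1 then - h else 0) sums (k * k)"
    using Cauchy_product_sums[OF sn sn] unfolding c k_def .
  moreover have "(\<lambda>n. if n = 0 then 1 else if n = 1 then - h else 0) sums
      (\<Sum>n\<in>{0,1::nat}. if n = 0 then 1 else if n = 1 then - h else 0)"
    by (rule sums_finite) auto
  ultimately have 3: "k * k = 1 - h" by (simp add: sums_unique2)
  \<comment> \<open>Commutation is recorded because \<open>h + \<i> *\<^sub>C k\<close>, with
    \<open>k\<close> a root of \<open>1 - h * h\<close>, is shown to be isometric only when
    \<open>h\<close> and \<open>k\<close> commute.\<close>
  have 4: "\<forall>x. x * h = h * x \<longrightarrow> x * k = k * x"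
  proof (intro allI impI)
    fix x assume that: "x * h = h * x"
    have p: "x * h ^ n = h ^ n * x" for n
    proof (induction n)
      case (Suc n)
      have "x * h ^ Suc n = (x * h) * h ^ n" by (simp add: mult.assoc)
      also have "\<dots> = h * (x * h ^ n)" by (simp only: that mult.assoc)
      finally show ?case by (simp add: Suc mult.assoc)
    qed simp
    have "x * k = (\<Sum>n. x * f n)" "k * x = (\<Sum>n. f n * x)"
      unfolding k_def using sf by (simp_all add: suminf_mult suminf_mult2)
    then show "x * k = k * x" by (simp add: f_def p)
  qed
  show thesis by (rule that[OF 1 2 3 4])
qed

text \<open>The element \<open>u = a + \<i> *\<^sub>C b\<close> satisfies
  \<open>star u * u = 1\<close>, so it has norm one, and \<open>a\<close> is the mean of
  \<open>u\<close> and its adjoint.\<close>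

lemma norm_le_1_of_sum_squares:
  fixes a b :: "'a::unital_cstar_algebra"
  assumes "star a = a" "star b = b" "a * b = b * a" "a * a + b * b = 1"
  shows "norm a \<le> 1"
proof -
  define u where "u = a + \<i> *\<^sub>C b"
  have su: "star u = a - \<i> *\<^sub>C b"
    by (simp add: u_def star_add star_scaleC assms scaleC_minus_left)
  have "star u * u = a * a + \<i> *\<^sub>C (a * b) - (\<i> *\<^sub>C (b * a) + (\<i> * \<i>) *\<^sub>C (b * b))"
    unfolding su unfolding u_def
    by (simp add: left_diff_distrib distrib_left mult_scaleC_left mult_scaleC_right scaleC_scaleC
        scaleC_add_right scaleC_diff_right)
  also have "\<dots> = 1" using assms(4) by (simp add: assms(3) scaleC_minus_left)
  finally have "(norm u)\<^sup>2 = 1\<^sup>2" using cstar_identity[of u] by simp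
  then have "norm u = 1" by (rule power2_eq_imp_eq) auto
  moreover have "u + star u = 2 *\<^sub>R a" unfolding su unfolding u_def by (simp add: scaleR_2)
  ultimately have "norm (2 *\<^sub>R a) \<le> 1 + 1"
    by (metis norm_star norm_triangle_ineq)
  then show ?thesis by simp
qed

lemma norm_mult_self_less_1:
  fixes h :: "'a::real_normed_algebra"
  assumes "norm h < 1"
  shows "norm (h * h) < 1"
proof -
  have "norm (h * h) \<le> norm h * norm h" by (rule norm_mult_ineq)
  also have "\<dots> \<le> norm h * 1" by (rule mult_left_mono) (use assms in auto)
  finally show ?thesis using assms by simp
qed

text \<open>The preceding bound applies to the self-adjoint root \<open>k\<close> of
  \<open>1 - h * h\<close>, with \<open>h\<close> as its partner, and \<open>k * k\<close> inherits
  the bound.\<close>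

lemma norm_one_minus_square_le_1:
  fixes h :: "'a::unital_cstar_algebra"
  assumes "star h = h" "norm h < 1"
  shows "norm (1 - h * h) \<le> 1"
proof -
  have "norm (h * h) < 1"
    using assms by (simp add: norm_mult_self_less_1)
  note 1 = this
  have 2: "star (h * h) = h * h" by (simp add: star_mult assms)
  have 3: "star_subalgebra (UNIV :: 'a set)"
    by (simp add: star_subalgebra_def complex_subspace_def)
  obtain k where k: "star k = k" "k * k = 1 - h * h"
    "\<forall>x. x * (h * h) = (h * h) * x \<longrightarrow> x * k = k * x"
    by (rule square_root_one_minus[OF 1 2 3 closed_UNIV UNIV_I UNIV_I]) blast
  have "norm k \<le> 1"
    by (rule norm_le_1_of_sum_squares[of k h]) (use k assms k(3)[rule_format, of h] in \<open>auto simp: mult.assoc\<close>)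
  then have "norm (k * k) \<le> 1"
    by (meson dual_order.trans mult_le_one norm_ge_zero norm_mult_ineq)
  then show ?thesis by (simp add: k)
qed

text \<open>
  The decisive case is \<open>z\<^sup>*z = -1\<close>: then \<open>e = -zz\<^sup>*\<close> is a projection of norm one, and the real and
  imaginary parts of \<open>z\<close> have squares summing to \<open>-(1 + e)/2\<close>, although \<open>\<parallel>2 - a\<^sup>2 - b\<^sup>2\<parallel> \<le> 2\<close> for
  self-adjoint \<open>a\<close>, \<open>b\<close> of small norm.
\<close>

lemma star_mult_self_neq_minus_1: "star z * z \<noteq> (- 1 :: 'a::unital_cstar_algebra)"
proof
  assume z: "star z * z = - 1"
  have nz: "norm z = 1"
    using cstar_identity[of z] z by (metis norm_ge_zero norm_minus_cancel norm_one power2_eq_imp_eq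
        power_one zero_le_one)
  define e where "e = - (z * star z)"
  have ee: "e * e = e"
  proof -
    have "e * e = z * (star z * z) * star z" by (simp add: e_def mult.assoc)
    also have "\<dots> = e" by (simp add: z e_def)
    finally show ?thesis .
  qed
  have ne: "norm e = 1"
    using cstar_identity[of "star z"] nz by (simp add: e_def star_star)
  \<comment> \<open>The factors 1/4 leave \<open>a\<close> and \<open>b\<close> with norm at most
    1/2, so that the preceding lemma applies to both.\<close>
  define a where "a = (1/4) *\<^sub>R (z + star z)"
  define b where "b = (- \<i> / 4) *\<^sub>C (z - star z)"
  have sa: "star a = a" by (simp add: a_def star_scaleR star_add star_star add.commute)
  have sb: "star b = b"
    by (simp add: b_def star_scaleC star_diff star_star scaleC_minus_left scaleC_diff_right)
  have na: "norm a < 1"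
    using norm_triangle_ineq[of z "star z"] nz by (simp add: a_def)
  have nb: "norm b < 1"
    using norm_triangle_ineq4[of z "star z"] nz by (simp add: b_def norm_scaleC norm_divide)
  have "norm (1 - a * a) \<le> 1" "norm (1 - b * b) \<le> 1"
    by (rule norm_one_minus_square_le_1; fact)+
  then have n2: "norm ((1 - a * a) + (1 - b * b)) \<le> 2"
    using norm_triangle_ineq[of "1 - a * a" "1 - b * b"] by linarith
  have aa: "a * a = (1/16) *\<^sub>R (z * z + z * star z + star z * z + star z * star z)"
    by (simp add: a_def algebra_simps)
  have "b * b = ((- \<i> / 4) * (- \<i> / 4)) *\<^sub>C ((z - star z) * (z - star z))"
    by (simp add: b_def mult_scaleC_left mult_scaleC_right scaleC_scaleC)
  also have "(- \<i> / 4) * (- \<i> / 4) = complex_of_real (- 1 / 16)" by (simp add: complex_eq_iff)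
  finally have bb: "b * b = (- 1/16) *\<^sub>R (z * z - z * star z - star z * z + star z * star z)"
    by (simp only: scaleC_of_real) (simp add: algebra_simps)
  have "a * a + b * b = (1/8) *\<^sub>R (z * star z + star z * z)"
    unfolding aa bb by (simp add: algebra_simps flip: scaleR_add_left)
  also have "\<dots> = (- 1/8) *\<^sub>R (1 + e)" by (simp add: z e_def algebra_simps)
  finally have ab: "a * a + b * b = (- 1/8) *\<^sub>R (1 + e)" .
  have "(1 - a * a) + (1 - b * b) = 2 *\<^sub>R 1 - (a * a + b * b)" by (simp add: scaleR_2)
  then have "(1 - a * a) + (1 - b * b) = 2 *\<^sub>R 1 + (1/8) *\<^sub>R (1 + e)" by (simp only: ab) simp
  \<comment> \<open>On multiples of \<open>e\<close> the sum acts as the scalar 9/4, which exceeds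
    its norm bound 2.\<close>
  then have "((1 - a * a) + (1 - b * b)) * e = 2 *\<^sub>R e + (1/8) *\<^sub>R (e + e)"
    by (simp only:) (simp add: distrib_right ee)
  also have "\<dots> = (9/4) *\<^sub>R e" by (simp add: scaleR_add_left[symmetric] scaleR_2[symmetric])
  finally have "((1 - a * a) + (1 - b * b)) * e = (9/4) *\<^sub>R e" .
  then have "norm (((1 - a * a) + (1 - b * b)) * e) = 9/4" by (simp add: ne)
  moreover have "norm (((1 - a * a) + (1 - b * b)) * e) \<le> 2 * 1"
    using n2 ne norm_mult_ineq[of "(1 - a * a) + (1 - b * b)" e] by simp
  ultimately show False by simp
qed

text \<open>A negative scalar could be rescaled to -1, which the previous lemma excludes. In this
  form positivity is used for the states constructed below, whose values are averages of scalars
  obtained by compression.\<close>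

lemma star_mult_self_scalar_nonneg:
  fixes y :: "'a::unital_cstar_algebra"
  assumes "star y * y = c *\<^sub>C 1"
  shows "c \<in> \<real>\<^sub>\<ge>\<^sub>0"
proof -
  have "star (star y * y) = star y * y" by (simp add: star_mult star_star)
  then have "cnj c *\<^sub>C (1::'a) = c *\<^sub>C 1" by (simp add: assms star_scaleC)
  then have "cnj c = c" by (simp add: scaleC_cancel_one)
  then have c: "c = complex_of_real (Re c)" by (simp add: complex_eq_iff)
  have "Re c \<ge> 0"
  proof (rule ccontr)
    assume neg: "\<not> Re c \<ge> 0"
    define z where "z = (1 / sqrt (- Re c)) *\<^sub>R y"
    have "star z * z = (1 / (- Re c)) *\<^sub>R (star y * y)"
      using neg by (simp add: z_def star_scaleR)
    also have "star y * y = Re c *\<^sub>R 1" using assms c by (metis scaleC_of_real)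
    finally have "star z * z = - 1" using neg by simp
    then show False using star_mult_self_neq_minus_1 by blast
  qed
  with c show ?thesis by (metis nonneg_Reals_of_real_iff)
qed

text \<open>A self-adjoint contraction \<open>h\<close> extends to a unitary \<open>h + i k\<close>, which is mapped to a unitary.\<close>

lemma star_homomorphism_contractive:
  fixes \<phi> :: "'a::unital_cstar_algebra \<Rightarrow> 'a"
  assumes A: "star_subalgebra A" "closed A" "1 \<in> A"
    and \<phi>: "star_automorphism A \<phi>" "\<phi> 1 = 1" and x: "x \<in> A"
  shows "norm (\<phi> x) \<le> norm x"
proof -
  have add: "\<And>x y. x \<in> A \<Longrightarrow> y \<in> A \<Longrightarrow> \<phi> (x + y) = \<phi> x + \<phi> y"
    and sc: "\<And>c x. x \<in> A \<Longrightarrow> \<phi> (c *\<^sub>C x) = c *\<^sub>C \<phi> x"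
    and mul: "\<And>x y. x \<in> A \<Longrightarrow> y \<in> A \<Longrightarrow> \<phi> (x * y) = \<phi> x * \<phi> y"
    and st: "\<And>x. x \<in> A \<Longrightarrow> \<phi> (star x) = star (\<phi> x)"
    using \<phi> unfolding star_automorphism_def by auto
  have sub: "complex_subspace A" using A(1) by (simp add: star_subalgebra_def)
  have unit: "norm (\<phi> h) \<le> 1" if h: "h \<in> A" "star h = h" "norm h < 1" for h
  proof -
    have hh1: "norm (h * h) < 1"
      using h by (simp add: norm_mult_self_less_1)
    have hh: "h * h \<in> A" using h A by (auto intro: star_subalgebraD)
    have sh: "star (h * h) = h * h" by (simp add: star_mult h)
    obtain k where k: "k \<in> A" "star k = k" "k * k = 1 - h * h"
      "\<forall>x. x * (h * h) = (h * h) * x \<longrightarrow> x * k = k * x"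
      by (rule square_root_one_minus[OF hh1 sh A hh]) blast
    show ?thesis
    proof (rule norm_le_1_of_sum_squares[of "\<phi> h" "\<phi> k"])
      show "\<phi> h * \<phi> k = \<phi> k * \<phi> h"
        using k(4)[rule_format, of h] h(1) k(1) by (metis mul mult.assoc)
      have "k * k \<in> A" using k(1) by (intro star_subalgebraD(4)[OF A(1)])
      then have "\<phi> h * \<phi> h + \<phi> k * \<phi> k = \<phi> (h * h + k * k)"
        using h(1) k(1) by (simp only: add[OF hh] mul)
      then show "\<phi> h * \<phi> h + \<phi> k * \<phi> k = 1" using k(3) \<phi>(2) by simp
    qed (use h(1,2) k(1,2) st in \<open>metis+\<close>)
  qed
  have sa: "norm (\<phi> h) \<le> norm h" if h: "h \<in> A" "star h = h" for h
  proof (rule field_le_epsilon)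
    fix e :: real assume e: "e > 0"
    \<comment> \<open>Dividing by \<open>norm h + e\<close> instead of \<open>norm h\<close> makes
      the norm strictly less than one and covers \<open>h = 0\<close>.\<close>
    define r where "r = norm h + e"
    have r: "r > 0" using e by (simp add: r_def add_nonneg_pos)
    have "norm (\<phi> ((1/r) *\<^sub>R h)) \<le> 1"
      by (rule unit) (use h r e in \<open>auto simp: star_scaleR sub complex_subspaceD(4) r_def\<close>)
    also have "\<phi> ((1/r) *\<^sub>R h) = (1/r) *\<^sub>R \<phi> h"
      using sc[of h "complex_of_real (1/r)"] h by (simp only: scaleC_of_real)
    finally show "norm (\<phi> h) \<le> norm h + e" using r by (simp add: r_def field_simps)
  qed
  have sx: "star x * x \<in> A" using A x by (auto intro: star_subalgebraD)
  have "(norm (\<phi> x))\<^sup>2 = norm (star (\<phi> x) * \<phi> x)" by (simp add: cstar_identity)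
  also have "star (\<phi> x) * \<phi> x = \<phi> (star x * x)"
    using x A by (simp add: mul st star_subalgebraD)
  also have "norm \<dots> \<le> norm (star x * x)"
    by (rule sa) (use sx in \<open>auto simp: star_mult star_star\<close>)
  also have "\<dots> = (norm x)\<^sup>2" by (simp add: cstar_identity)
  finally show ?thesis using power2_le_imp_le by auto
qed

section \<open>States\<close>

lemma statesD:
  assumes "\<omega> \<in> states A"
  shows "\<omega> \<in> extensional A" "x \<in> A \<Longrightarrow> y \<in> A \<Longrightarrow> \<omega> (x + y) = \<omega> x + \<omega> y"
    "x \<in> A \<Longrightarrow> \<omega> (c *\<^sub>C x) = c * \<omega> x" "x \<in> A \<Longrightarrow> \<omega> (star x * x) \<in> \<real>\<^sub>\<ge>\<^sub>0" "\<omega> 1 = 1"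
  using assms unfolding states_def by auto

lemma state_diff:
  assumes "\<omega> \<in> states A" "complex_subspace A" "x \<in> A" "y \<in> A"
  shows "\<omega> (x - y) = \<omega> x - \<omega> y"
proof -
  have "\<omega> (x + (-1) *\<^sub>C y) = \<omega> x + (-1) * \<omega> y"
    using assms by (simp add: statesD complex_subspaceD)
  then show ?thesis by (simp add: scaleC_minus_left)
qed

lemma state_zero:
  assumes "\<omega> \<in> states A" "complex_subspace A"
  shows "\<omega> 0 = 0"
  using state_diff[OF assms, of 0 0] complex_subspaceD(1)[OF assms(2)] by simp

text \<open>For self-adjoint \<open>h\<close> of norm below one, \<open>1 - h\<close> is the square
  of a self-adjoint element of \<open>A\<close>, so its value is nonnegative. In general a phase
  makes \<open>\<omega> x\<close> nonnegative, and then only the self-adjoint part of the rotated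
  element contributes.\<close>

lemma state_norm_le:
  fixes A :: "'a::unital_cstar_algebra set"
  assumes \<omega>: "\<omega> \<in> states A" and A: "star_subalgebra A" "closed A" "1 \<in> A" and x: "x \<in> A"
  shows "cmod (\<omega> x) \<le> norm x"
proof -
  have sub: "complex_subspace A" using A(1) by (simp add: star_subalgebra_def)
  have unit: "1 - \<omega> h \<in> \<real>\<^sub>\<ge>\<^sub>0" if h: "h \<in> A" "star h = h" "norm h < 1" for h
  proof -
    obtain k where k: "k \<in> A" "star k = k" "k * k = 1 - h"
      using square_root_one_minus[of h A] A h by metis
    then have "\<omega> (1 - h) \<in> \<real>\<^sub>\<ge>\<^sub>0" using statesD(4)[OF \<omega>, of k] by simp
    then show ?thesis using state_diff[OF \<omega> sub A(3) h(1)] statesD(5)[OF \<omega>] by simp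
  qed
  have real_le: "Im (\<omega> h) = 0 \<and> Re (\<omega> h) \<le> norm h" if h: "h \<in> A" "star h = h" for h
  proof -
    have *: "Im (\<omega> h) = 0 \<and> Re (\<omega> h) \<le> norm h + e" if e: "e > 0" for e
    proof -
      define r where "r = norm h + e"
      have r: "r > 0" using e by (simp add: r_def add_nonneg_pos)
      have "1 - \<omega> ((1/r) *\<^sub>R h) \<in> \<real>\<^sub>\<ge>\<^sub>0"
        by (rule unit) (use h r e in \<open>auto simp: star_scaleR sub complex_subspaceD(4) r_def\<close>)
      also have "\<omega> ((1/r) *\<^sub>R h) = complex_of_real (1/r) * \<omega> h"
        using statesD(3)[OF \<omega> h(1), of "complex_of_real (1/r)"] by (simp only: scaleC_of_real)
      finally have "Im (\<omega> h) / r = 0" "Re (\<omega> h) / r \<le> 1"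
        by (auto simp: complex_nonneg_Reals_iff)
      then show ?thesis using r by (simp add: r_def field_simps)
    qed
    show ?thesis using *[of 1] by (auto intro: field_le_epsilon dest: *)
  qed
  obtain c where c: "cmod c = 1" "c * \<omega> x = complex_of_real (cmod (\<omega> x))"
  proof (cases "\<omega> x = 0")
    case True then show ?thesis using that[of 1] by simp
  next
    case False
    have "cnj (\<omega> x) * \<omega> x = complex_of_real ((cmod (\<omega> x))\<^sup>2)"
      by (metis complex_norm_square mult.commute of_real_power)
    then show ?thesis
      using False that[of "cnj (\<omega> x) / cmod (\<omega> x)"] by (simp add: norm_divide power2_eq_square)
  qed
  define y where "y = c *\<^sub>C x"
  have yA: "y \<in> A" "star y \<in> A" using x A by (auto simp: y_def intro: star_subalgebraD)
  define a where "a = (1/2) *\<^sub>R (y + star y)"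
  define b where "b = (- \<i> / 2) *\<^sub>C (y - star y)"
  have aA: "a \<in> A" "b \<in> A" using yA by (auto simp: a_def b_def intro!: complex_subspaceD[OF sub])
  have sa: "star a = a" by (simp add: a_def star_scaleR star_add star_star add.commute)
  have sb: "star b = b"
    by (simp add: b_def star_scaleC star_diff star_star scaleC_minus_left scaleC_diff_right)
  have "\<i> *\<^sub>C b = (1/2::complex) *\<^sub>C (y - star y)" by (simp add: b_def scaleC_scaleC)
  also have "\<dots> = (1/2) *\<^sub>R (y - star y)" using scaleC_of_real[of "1/2" "y - star y"] by simp
  finally have "a + \<i> *\<^sub>C b = (1/2) *\<^sub>R ((y + star y) + (y - star y))"
    by (simp only: a_def scaleR_add_right)
  also have "\<dots> = y" by (simp add: scaleR_2[symmetric])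
  finally have "a + \<i> *\<^sub>C b = y" .
  then have "\<omega> y = \<omega> a + \<i> * \<omega> b" using statesD[OF \<omega>] aA complex_subspaceD(3)[OF sub] by metis
  moreover have "\<omega> y = complex_of_real (cmod (\<omega> x))"
    using statesD(3)[OF \<omega> x, of c] c by (simp add: y_def)
  ultimately have "cmod (\<omega> x) = Re (\<omega> a)"
    using real_le[OF aA(1) sa] real_le[OF aA(2) sb] by (simp add: complex_eq_iff)
  also have "\<dots> \<le> norm a" using real_le[OF aA(1) sa] by simp
  also have "\<dots> \<le> norm y" using norm_triangle_ineq[of y "star y"] by (simp add: a_def)
  also have "\<dots> = norm x" by (simp add: y_def norm_scaleC c)
  finally show ?thesis .
qed

lemma state_tendsto:
  assumes \<omega>: "\<omega> \<in> states A" and A: "star_subalgebra A" "closed A" "1 \<in> A"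
    and f: "(f \<longlongrightarrow> l) F" "l \<in> A" "\<And>x. f x \<in> A"
  shows "((\<lambda>x. \<omega> (f x)) \<longlongrightarrow> \<omega> l) F"
proof -
  have "((\<lambda>x. \<omega> (f x) - \<omega> l) \<longlongrightarrow> 0) F"
  proof (rule Lim_null_comparison)
    show "\<forall>\<^sub>F x in F. norm (\<omega> (f x) - \<omega> l) \<le> norm (f x - l)"
    proof (rule always_eventually, rule allI)
      fix x
      have sub: "complex_subspace A" using A(1) by (simp add: star_subalgebra_def)
      have "norm (\<omega> (f x - l)) \<le> norm (f x - l)"
        by (rule state_norm_le[OF \<omega> A]) (use f sub in \<open>auto intro: complex_subspaceD\<close>)
      then show "norm (\<omega> (f x) - \<omega> l) \<le> norm (f x - l)"
        using state_diff[OF \<omega> sub f(3) f(2)] by simp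
    qed
    show "((\<lambda>x. norm (f x - l)) \<longlongrightarrow> 0) F" using f(1) by (simp add: LIM_zero tendsto_norm_zero)
  qed
  then show ?thesis by (rule LIM_zero_cancel)
qed

section \<open>Entire functions with values in a C*-algebra\<close>

text \<open>Zorn's lemma is applied to the graphs of functionals of norm at most one on subspaces.\<close>

lemma separating_functional:
  fixes x0 :: "'a::real_normed_vector"
  assumes "x0 \<noteq> 0"
  obtains \<phi> :: "'a \<Rightarrow> real" where "bounded_linear \<phi>" "\<phi> x0 \<noteq> 0"
proof -
  \<comment> \<open>The norm bound makes each of these subspaces the graph of a function, since it
    forces \<open>t = 0\<close> whenever \<open>x = 0\<close>.\<close>
  define \<A> where "\<A> = {g :: ('a \<times> real) set. subspace g \<and> (\<forall>(x, t)\<in>g. \<bar>t\<bar> \<le> norm x) \<and> (x0, norm x0) \<in> g}"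
  have "\<exists>M\<in>\<A>. \<forall>X\<in>\<A>. M \<subseteq> X \<longrightarrow> X = M"
  proof (rule subset_Zorn_nonempty)
    have "\<bar>t\<bar> \<le> norm x" if "(x, t) \<in> span {(x0, norm x0)}" for x t
      using that by (auto simp: span_singleton abs_mult)
    then have "span {(x0, norm x0)} \<in> \<A>" by (auto simp: \<A>_def span_base)
    then show "\<A> \<noteq> {}" by blast
  next
    fix C assume C: "C \<noteq> {}" "subset.chain \<A> C"
    have sub: "subspace g" if "g \<in> C" for g using that C unfolding subset_chain_def \<A>_def by blast
    have "subspace (\<Union>C)"
    proof (rule subspaceI)
      show "0 \<in> \<Union>C" using C(1) sub subspace_0 by blast
    next
      fix x y assume "x \<in> \<Union>C" "y \<in> \<Union>C"
      then obtain g h where "g \<in> C" "h \<in> C" "x \<in> g" "y \<in> h" by blast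
      moreover from this have "g \<subseteq> h \<or> h \<subseteq> g" using C(2) by (auto simp: subset_chain_def)
      ultimately show "x + y \<in> \<Union>C" using sub subspace_add by blast
    next
      fix c :: real and x assume "x \<in> \<Union>C"
      then show "c *\<^sub>R x \<in> \<Union>C" using sub subspace_mul by blast
    qed
    then show "\<Union>C \<in> \<A>" using C unfolding subset_chain_def \<A>_def by blast
  qed
  then obtain g where g: "g \<in> \<A>" and max: "\<And>h. h \<in> \<A> \<Longrightarrow> g \<subseteq> h \<Longrightarrow> h = g" by blast
  have sub: "subspace g" and le: "\<And>x t. (x, t) \<in> g \<Longrightarrow> \<bar>t\<bar> \<le> norm x" and x0: "(x0, norm x0) \<in> g"
    using g by (auto simp: \<A>_def)
  have uniq: "t = t'" if "(x, t) \<in> g" "(x, t') \<in> g" for x t t'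
    using le[of 0 "t - t'"] subspace_diff[OF sub that] by simp
  have ex: "\<exists>t. (y, t) \<in> g" for y
  proof (rule ccontr)
    assume no: "\<nexists>t. (y, t) \<in> g"
    \<comment> \<open>An extension sending \<open>y\<close> to \<open>c\<close> keeps the bound if
      \<open>c\<close> lies between \<open>- t - norm (x + y)\<close> and
      \<open>norm (x + y) - t\<close> for all \<open>(x, t)\<close> in \<open>g\<close>. The
      triangle inequality separates the two sets of bounds.\<close>
    define L where "L = {- t - norm (x + y) | x t. (x, t) \<in> g}"
    have bd: "l \<le> norm (x + y) - t" if "l \<in> L" "(x, t) \<in> g" for l x t
    proof -
      obtain x1 t1 where 1: "(x1, t1) \<in> g" "l = - t1 - norm (x1 + y)" using \<open>l \<in> L\<close> by (auto simp: L_def)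
      have "t - t1 \<le> norm (x - x1)" using le[of "x - x1" "t - t1"] subspace_diff[OF sub that(2) 1(1)] by simp
      also have "\<dots> \<le> norm (x + y) + norm (x1 + y)"
        using norm_triangle_ineq4[of "x + y" "x1 + y"] by simp
      finally show ?thesis using 1 by simp
    qed
    have Lne: "L \<noteq> {}" using x0 by (auto simp: L_def)
    have Lbd: "bdd_above L" using bd[OF _ x0] by (rule bdd_aboveI)
    define c where "c = Sup L"
    have c: "\<bar>t + c\<bar> \<le> norm (x + y)" if "(x, t) \<in> g" for x t
    proof -
      have "c \<le> norm (x + y) - t" unfolding c_def by (rule cSup_least[OF Lne]) (use bd that in blast)
      moreover have "- t - norm (x + y) \<le> c" unfolding c_def
        by (rule cSup_upper[OF _ Lbd]) (use that in \<open>auto simp: L_def\<close>)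
      ultimately show ?thesis by linarith
    qed
    define h where "h = {(x + r *\<^sub>R y, t + r * c) | x t r. (x, t) \<in> g}"
    have gh: "g \<subseteq> h" unfolding h_def by (force intro: exI[of _ 0])
    have "subspace h"
    proof (rule subspaceI)
      show "0 \<in> h" using gh subspace_0[OF sub] by blast
    next
      fix u v assume "u \<in> h" "v \<in> h"
      then obtain x t r x' t' r' where "(x, t) \<in> g" "u = (x + r *\<^sub>R y, t + r * c)"
        "(x', t') \<in> g" "v = (x' + r' *\<^sub>R y, t' + r' * c)" unfolding h_def by blast
      moreover have "(x + x', t + t') \<in> g" using subspace_add[OF sub calculation(1,3)] by simp
      ultimately show "u + v \<in> h" unfolding h_def
        by (intro CollectI exI[of _ "x + x'"] exI[of _ "t + t'"] exI[of _ "r + r'"]) (auto simp: algebra_simps)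
    next
      fix k u assume "u \<in> h"
      then obtain x t r where "(x, t) \<in> g" "u = (x + r *\<^sub>R y, t + r * c)" by (auto simp: h_def)
      moreover have "(k *\<^sub>R x, k * t) \<in> g" using subspace_mul[OF sub calculation(1), of k] by simp
      ultimately show "k *\<^sub>R u \<in> h" unfolding h_def
        by (intro CollectI exI[of _ "k *\<^sub>R x"] exI[of _ "k * t"] exI[of _ "k * r"]) (auto simp: algebra_simps)
    qed
    moreover have "\<bar>s\<bar> \<le> norm z" if zs: "(z, s) \<in> h" for z s
    proof -
      obtain x t r where xt: "(x, t) \<in> g" "z = x + r *\<^sub>R y" "s = t + r * c" using zs unfolding h_def by blast
      show ?thesis
      proof (cases "r = 0")
        case False
        have "(x /\<^sub>R r, t / r) \<in> g" using subspace_mul[OF sub xt(1), of "inverse r"] by (simp add: field_simps)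
        then have "\<bar>r\<bar> * \<bar>t / r + c\<bar> \<le> \<bar>r\<bar> * norm (x /\<^sub>R r + y)" by (intro mult_left_mono c) auto
        also have "\<bar>r\<bar> * \<bar>t / r + c\<bar> = \<bar>s\<bar>" using False xt by (simp add: abs_mult[symmetric] algebra_simps)
        also have "\<bar>r\<bar> * norm (x /\<^sub>R r + y) = norm z"
          using False xt by (simp add: norm_scaleR[symmetric] scaleR_add_right del: norm_scaleR)
        finally show ?thesis .
      qed (use xt le in auto)
    qed
    ultimately have "h \<in> \<A>" using gh x0 by (auto simp: \<A>_def)
    then have "h = g" using gh by (rule max)
    moreover have "(y, c) \<in> h" unfolding h_def using subspace_0[OF sub]
      by (intro CollectI exI[of _ 0] exI[of _ 1]) (auto simp: zero_prod_def)
    ultimately show False using no by blast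
  qed
  define \<phi> where "\<phi> x = (THE t. (x, t) \<in> g)" for x
  have \<phi>: "(x, \<phi> x) \<in> g" for x unfolding \<phi>_def by (rule theI') (use ex uniq in blast)
  have \<phi>_eq: "\<phi> x = t" if "(x, t) \<in> g" for x t using uniq \<phi> that by blast
  show thesis
  proof (rule that)
    show "bounded_linear \<phi>"
    proof (rule bounded_linear_intro[where K = 1])
      show "\<phi> (x + y) = \<phi> x + \<phi> y" for x y
        using subspace_add[OF sub \<phi>[of x] \<phi>[of y]] by (intro \<phi>_eq) simp
      show "\<phi> (r *\<^sub>R x) = r *\<^sub>R \<phi> x" for r x
        using subspace_mul[OF sub \<phi>[of x], of r] by (intro \<phi>_eq) simp
      show "norm (\<phi> x) \<le> norm x * 1" for x using le[OF \<phi>[of x]] by simp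
    qed
    show "\<phi> x0 \<noteq> 0" using \<phi>_eq[OF x0] assms by simp
  qed
qed

text \<open>Reduces vector-valued entire functions to scalar ones. Linearity is asked on
  \<open>A\<close> only, since states are linear only there; closedness keeps the limits of the
  difference quotients in \<open>A\<close>.\<close>

lemma holomorphic_functional_comp:
  fixes f :: "complex \<Rightarrow> 'a::unital_cstar_algebra" and \<psi> :: "'a \<Rightarrow> complex"
  assumes A: "complex_subspace A" "closed A"
    and add: "\<And>x y. x \<in> A \<Longrightarrow> y \<in> A \<Longrightarrow> \<psi> (x + y) = \<psi> x + \<psi> y"
    and sc: "\<And>c x. x \<in> A \<Longrightarrow> \<psi> (c *\<^sub>C x) = c * \<psi> x"
    and bd: "\<And>x. x \<in> A \<Longrightarrow> cmod (\<psi> x) \<le> K * norm x"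
    and f: "\<And>z. f z \<in> A" "\<And>z. complex_differentiable_at f z"
  shows "(\<lambda>z. \<psi> (f z)) holomorphic_on UNIV"
proof -
  have diff: "\<psi> (x - y) = \<psi> x - \<psi> y" if "x \<in> A" "y \<in> A" for x y
    using add[of x "(-1) *\<^sub>C y"] sc[of y "-1"] that A by (simp add: complex_subspaceD scaleC_minus_left)
  have "(\<lambda>z. \<psi> (f z)) field_differentiable at z" for z
  proof -
    obtain d where d: "((\<lambda>w. inverse (w - z) *\<^sub>C (f w - f z)) \<longlongrightarrow> d) (at z)"
      using f(2)[of z] by (auto simp: complex_differentiable_at_def)
    define q where "q w = inverse (w - z) *\<^sub>C (f w - f z)" for w
    have qA: "q w \<in> A" for w unfolding q_def by (intro complex_subspaceD[OF A(1)] f)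
    have lim: "(q \<longlongrightarrow> d) (at z)" using d unfolding q_def .
    have dA: "d \<in> A" by (rule Lim_in_closed_set[OF A(2) _ _ lim]) (auto simp: qA)
    have "((\<lambda>w. \<psi> (q w) - \<psi> d) \<longlongrightarrow> 0) (at z)"
    proof (rule Lim_null_comparison)
      show "\<forall>\<^sub>F w in at z. norm (\<psi> (q w) - \<psi> d) \<le> K * norm (q w - d)"
        using bd complex_subspaceD(6)[OF A(1) qA dA] diff[OF qA dA] by (metis (no_types, lifting) always_eventually)
      show "((\<lambda>w. K * norm (q w - d)) \<longlongrightarrow> 0) (at z)"
        using tendsto_mult_left[OF tendsto_norm_zero[OF LIM_zero[OF lim]], of K] by simp
    qed
    then have "((\<lambda>w. \<psi> (q w)) \<longlongrightarrow> \<psi> d) (at z)" by (rule LIM_zero_cancel)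
    moreover have "\<psi> (q w) = (\<psi> (f w) - \<psi> (f z)) / (w - z)" for w
      unfolding q_def sc[OF complex_subspaceD(6)[OF A(1) f(1)[of w] f(1)[of z]]] diff[OF f(1) f(1)]
      by (simp add: divide_inverse)
    ultimately have "((\<lambda>z. \<psi> (f z)) has_field_derivative \<psi> d) (at z)"
      by (simp add: has_field_derivative_iff)
    then show ?thesis by (auto simp: field_differentiable_def)
  qed
  then show ?thesis by (simp add: holomorphic_on_def field_differentiable_at_within)
qed

text \<open>A real functional separating two values is complexified as
  \<open>\<phi> x - \<i> * \<phi> (\<i> *\<^sub>C x)\<close>, and the scalar identity theorem
  applies because the real line has an accumulation point.\<close>

lemma entire_functions_eqI:
  fixes f g :: "complex \<Rightarrow> 'a::unital_cstar_algebra"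
  assumes f: "\<And>z. complex_differentiable_at f z" and g: "\<And>z. complex_differentiable_at g z"
    and eq: "\<And>r. f (complex_of_real r) = g (complex_of_real r)"
  shows "f = g"
proof (rule ccontr)
  assume "f \<noteq> g"
  then obtain z where z: "f z \<noteq> g z" by blast
  obtain \<phi> :: "'a \<Rightarrow> real" where \<phi>: "bounded_linear \<phi>" "\<phi> (f z - g z) \<noteq> 0"
    using separating_functional[of "f z - g z"] z by auto
  interpret \<phi>: bounded_linear \<phi> by (rule \<phi>)
  obtain K where K: "\<And>x. norm (\<phi> x) \<le> norm x * K" using \<phi>.bounded by blast
  define \<psi> where "\<psi> x = Complex (\<phi> x) (- \<phi> (\<i> *\<^sub>C x))" for x
  have \<psi>_add: "\<psi> (x + y) = \<psi> x + \<psi> y" for x y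
    by (simp add: \<psi>_def scaleC_add_right \<phi>.add complex_eq_iff)
  have scR: "\<phi> (complex_of_real r *\<^sub>C x) = r * \<phi> x" for r x by (simp add: scaleC_of_real \<phi>.scaleR)
  have cx: "c *\<^sub>C x = complex_of_real (Re c) *\<^sub>C x + complex_of_real (Im c) *\<^sub>C (\<i> *\<^sub>C x)" for c and x :: 'a
    using complex_eq[of c] by (metis mult.commute scaleC_add_left scaleC_scaleC)
  have \<psi>_sc: "\<psi> (c *\<^sub>C x) = c * \<psi> x" for c x
  proof -
    have 1: "\<phi> (c *\<^sub>C x) = Re c * \<phi> x + Im c * \<phi> (\<i> *\<^sub>C x)" for c and x
      using cx[of c x] by (simp only: \<phi>.add scR)
    have "\<phi> (\<i> *\<^sub>C \<i> *\<^sub>C x) = - \<phi> x" by (simp add: scaleC_scaleC scaleC_minus_left \<phi>.neg)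
    then have 2: "\<phi> (\<i> *\<^sub>C c *\<^sub>C x) = Re c * \<phi> (\<i> *\<^sub>C x) - Im c * \<phi> x"
      using 1[of c "\<i> *\<^sub>C x"] by (simp add: scaleC_scaleC mult.commute)
    show ?thesis by (simp add: \<psi>_def 1[of c x] 2 complex_eq_iff)
  qed
  have \<psi>_bd: "cmod (\<psi> x) \<le> (2 * K) * norm x" for x
  proof -
    have "cmod (\<psi> x) \<le> \<bar>Re (\<psi> x)\<bar> + \<bar>Im (\<psi> x)\<bar>" by (rule cmod_le)
    also have "\<dots> \<le> norm x * K + norm (\<i> *\<^sub>C x) * K"
      using K[of x] K[of "\<i> *\<^sub>C x"] by (auto simp: \<psi>_def)
    finally show ?thesis by (simp add: norm_scaleC algebra_simps)
  qed
  have hol: "(\<lambda>z. \<psi> (h z)) holomorphic_on UNIV" if "\<And>z. complex_differentiable_at h z" for h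
  proof (rule holomorphic_functional_comp[of UNIV \<psi> "2 * K" h])
    show "complex_subspace (UNIV :: 'a set)" by (simp add: complex_subspace_def)
  qed (use that \<psi>_add \<psi>_sc \<psi>_bd in auto)
  have "\<psi> (f z) - \<psi> (g z) = 0"
  proof (rule analytic_continuation[where f = "\<lambda>z. \<psi> (f z) - \<psi> (g z)" and w = z and U = "range complex_of_real" and S = UNIV and \<xi> = 0])
    show "(\<lambda>z. \<psi> (f z) - \<psi> (g z)) holomorphic_on UNIV"
      by (intro holomorphic_intros hol f g)
    show "0 islimpt range complex_of_real"
      unfolding islimpt_approachable
    proof (intro allI impI)
      fix e :: real assume "e > 0"
      then show "\<exists>x'\<in>range complex_of_real. x' \<noteq> 0 \<and> dist x' 0 < e"
        by (intro bexI[of _ "complex_of_real (e/2)"] rangeI) auto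
    qed
  qed (auto simp: eq)
  then have "\<psi> (f z - g z) = 0"
    using \<psi>_add[of "f z - g z" "g z"] by simp
  then show False using \<phi>(2) by (simp add: \<psi>_def complex_eq_iff)
qed

lemma complex_flow_eq:
  assumes "entire_extension A \<alpha> x f"
  shows "complex_flow A \<alpha> z x = f z"
proof -
  have "(THE f. entire_extension A \<alpha> x f) = f"
    using assms by (intro the_equality entire_functions_eqI) (auto simp: entire_extension_def)
  then show ?thesis by (simp add: complex_flow_def)
qed

lemma complex_differentiable_at_compose_linear:
  fixes f :: "complex \<Rightarrow> 'a::unital_cstar_algebra" and \<phi> :: "'a \<Rightarrow> 'a"
  assumes A: "complex_subspace A" "closed A"
    and add: "\<And>x y. x \<in> A \<Longrightarrow> y \<in> A \<Longrightarrow> \<phi> (x + y) = \<phi> x + \<phi> y"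
    and sc: "\<And>c x. x \<in> A \<Longrightarrow> \<phi> (c *\<^sub>C x) = c *\<^sub>C \<phi> x"
    and bd: "\<And>x. x \<in> A \<Longrightarrow> norm (\<phi> x) \<le> norm x"
    and f: "\<And>z. f z \<in> A" "complex_differentiable_at f z"
  shows "complex_differentiable_at (\<lambda>z. \<phi> (f z)) z"
proof -
  have diff: "\<phi> (x - y) = \<phi> x - \<phi> y" if "x \<in> A" "y \<in> A" for x y
    using add[of x "(-1) *\<^sub>C y"] sc[of y "-1"] that A by (simp add: complex_subspaceD scaleC_minus_left)
  obtain d where d: "((\<lambda>w. inverse (w - z) *\<^sub>C (f w - f z)) \<longlongrightarrow> d) (at z)"
    using f(2) by (auto simp: complex_differentiable_at_def)
  define q where "q w = inverse (w - z) *\<^sub>C (f w - f z)" for w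
  have qA: "q w \<in> A" for w unfolding q_def by (intro complex_subspaceD[OF A(1)] f)
  have lim: "(q \<longlongrightarrow> d) (at z)" using d unfolding q_def .
  have dA: "d \<in> A" by (rule Lim_in_closed_set[OF A(2) _ _ lim]) (auto simp: qA)
  have "((\<lambda>w. \<phi> (q w) - \<phi> d) \<longlongrightarrow> 0) (at z)"
  proof (rule Lim_null_comparison)
    show "\<forall>\<^sub>F w in at z. norm (\<phi> (q w) - \<phi> d) \<le> norm (q w - d)"
      using bd complex_subspaceD(6)[OF A(1) qA dA] diff[OF qA dA] by (metis (no_types, lifting) always_eventually)
    show "((\<lambda>w. norm (q w - d)) \<longlongrightarrow> 0) (at z)"
      by (rule tendsto_norm_zero[OF LIM_zero[OF lim]])
  qed
  then have "((\<lambda>w. \<phi> (q w)) \<longlongrightarrow> \<phi> d) (at z)" by (rule LIM_zero_cancel)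
  moreover have "\<phi> (q w) = inverse (w - z) *\<^sub>C (\<phi> (f w) - \<phi> (f z))" for w
    unfolding q_def using sc[OF complex_subspaceD(6)[OF A(1) f(1)[of w] f(1)[of z]]] diff[OF f(1) f(1)] by simp
  ultimately show ?thesis by (auto simp: complex_differentiable_at_def)
qed

lemma complex_differentiable_at_shift:
  assumes "complex_differentiable_at f (z + c)"
  shows "complex_differentiable_at (\<lambda>z. f (z + c)) z"
proof -
  obtain d where d: "((\<lambda>w. inverse (w - (z + c)) *\<^sub>C (f w - f (z + c))) \<longlongrightarrow> d) (at (z + c))"
    using assms by (auto simp: complex_differentiable_at_def)
  have "((\<lambda>w. inverse (w - z) *\<^sub>C (f (w + c) - f (z + c))) \<longlongrightarrow> d) (at z)"
    using LIM_offset[OF d, of c] by (simp add: algebra_simps)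
  then show ?thesis by (auto simp: complex_differentiable_at_def)
qed

lemma complex_differentiable_at_imp_isCont:
  assumes "complex_differentiable_at f z"
  shows "isCont f z"
proof -
  obtain d where d: "((\<lambda>w. inverse (w - z) *\<^sub>C (f w - f z)) \<longlongrightarrow> d) (at z)"
    using assms by (auto simp: complex_differentiable_at_def)
  have "((\<lambda>w. cmod (w - z) * norm (inverse (w - z) *\<^sub>C (f w - f z))) \<longlongrightarrow> cmod (z - z) * norm d) (at z)"
    by (intro tendsto_intros d)
  then have lim: "((\<lambda>w. cmod (w - z) * norm (inverse (w - z) *\<^sub>C (f w - f z))) \<longlongrightarrow> 0) (at z)"
    by simp
  have "((\<lambda>w. norm (f w - f z)) \<longlongrightarrow> 0) (at z)"
    by (rule Lim_transform_eventually[OF lim])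
       (auto simp: eventually_at_filter norm_scaleC norm_inverse)
  then show ?thesis by (simp add: isCont_def LIM_zero_iff tendsto_norm_zero_iff)
qed

lemma complex_differentiable_at_add:
  assumes "complex_differentiable_at f z" "complex_differentiable_at g z"
  shows "complex_differentiable_at (\<lambda>z. f z + g z) z"
proof -
  obtain d e where d: "((\<lambda>w. inverse (w - z) *\<^sub>C (f w - f z)) \<longlongrightarrow> d) (at z)"
    and e: "((\<lambda>w. inverse (w - z) *\<^sub>C (g w - g z)) \<longlongrightarrow> e) (at z)"
    using assms by (auto simp: complex_differentiable_at_def)
  have "((\<lambda>w. inverse (w - z) *\<^sub>C (f w + g w - (f z + g z))) \<longlongrightarrow> d + e) (at z)"
    using tendsto_add[OF d e] by (simp add: scaleC_add_right[symmetric] algebra_simps)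
  then show ?thesis by (auto simp: complex_differentiable_at_def)
qed

lemma complex_differentiable_at_scaleC:
  assumes "h field_differentiable at z"
  shows "complex_differentiable_at (\<lambda>z. h z *\<^sub>C x) z"
proof -
  obtain d where "((\<lambda>w. (h w - h z) / (w - z)) \<longlongrightarrow> d) (at z)"
    using assms by (auto simp: field_differentiable_def has_field_derivative_iff)
  moreover have "bounded_linear (\<lambda>c. c *\<^sub>C x)"
    by (rule bounded_linear_intro[where K = "norm x"])
       (auto simp: scaleC_add_left norm_scaleC scaleR_conv_of_real scaleC_scaleC[symmetric] scaleC_of_real)
  ultimately have "((\<lambda>w. ((h w - h z) / (w - z)) *\<^sub>C x) \<longlongrightarrow> d *\<^sub>C x) (at z)"
    by (rule bounded_linear.tendsto[rotated])
  then have "((\<lambda>w. inverse (w - z) *\<^sub>C (h w *\<^sub>C x - h z *\<^sub>C x)) \<longlongrightarrow> d *\<^sub>C x) (at z)"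
    by (simp add: scaleC_diff_left[symmetric] scaleC_scaleC field_simps)
  then show ?thesis by (auto simp: complex_differentiable_at_def)
qed

section \<open>KMS states\<close>

text \<open>The difference of the two constants is estimated by the means of a primitive of \<open>f\<close> over long
  horizontal segments, whose ends are joined by vertical segments of bounded contribution.\<close>

lemma strip_boundary_means:
  fixes f :: "complex \<Rightarrow> complex"
  assumes f: "f holomorphic_on UNIV"
    and up: "\<And>r. cmod (f (Complex r \<beta>) - c1) \<le> e1"
    and low: "\<And>r. cmod (f (Complex r 0) - c2) \<le> e2"
    and strip: "\<And>r y. y \<in> closed_segment 0 \<beta> \<Longrightarrow> cmod (f (Complex r y)) \<le> C"
  shows "cmod (c1 - c2) \<le> e1 + e2"
proof -
  obtain g where g: "\<And>z. (g has_field_derivative f z) (at z)"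
    using holomorphic_convex_primitive'[OF convex_UNIV open_UNIV f] by auto
  have hor: "cmod (g (Complex T y) - g (Complex 0 y) - c * T) \<le> e * T"
    if "T > 0" "\<And>r. cmod (f (Complex r y) - c) \<le> e" for T y c e
  proof -
    have cv: "convex {z. Im z = y}"
      by (auto simp: convex_def algebra_simps) (metis distrib_right mult.left_neutral)
    have "cmod ((g (Complex T y) - c * Complex T y) - (g (Complex 0 y) - c * Complex 0 y))
        \<le> e * cmod (Complex T y - Complex 0 y)"
    proof (rule field_differentiable_bound[OF cv, where f' = "\<lambda>z. f z - c"])
      fix z assume "z \<in> {z. Im z = y}"
      then have "z = Complex (Re z) y" by (simp add: complex_eq_iff)
      then show "cmod (f z - c) \<le> e" using that(2)[of "Re z"] by simp
      show "((\<lambda>z. g z - c * z) has_field_derivative f z - c) (at z within {z. Im z = y})"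
        by (auto intro!: derivative_eq_intros has_field_derivative_at_within[OF g])
    qed auto
    moreover have "c * Complex T y - c * Complex 0 y = c * T"
      by (simp add: right_diff_distrib[symmetric] complex_eq_iff)
    moreover have "cmod (Complex T y - Complex 0 y) = T" using that by (simp add: complex_diff norm_complex_def)
    ultimately show ?thesis by (simp add: algebra_simps)
  qed
  have ver: "cmod (g (Complex T \<beta>) - g (Complex T 0)) \<le> C * \<bar>\<beta>\<bar>" for T
  proof -
    have "cmod (g (Complex T \<beta>) - g (Complex T 0)) \<le> C * cmod (Complex T \<beta> - Complex T 0)"
    proof (rule field_differentiable_bound[of "closed_segment (Complex T 0) (Complex T \<beta>)" g f])
      fix z assume "z \<in> closed_segment (Complex T 0) (Complex T \<beta>)"
      then obtain u where u: "0 \<le> u" "u \<le> 1" "z = (1 - u) *\<^sub>R Complex T 0 + u *\<^sub>R Complex T \<beta>"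
        by (auto simp: in_segment)
      then have "z = Complex T (u * \<beta>)" by (simp add: complex_eq_iff algebra_simps)
      moreover have "u * \<beta> \<in> closed_segment 0 \<beta>" using u by (auto simp: in_segment)
      ultimately show "cmod (f z) \<le> C" using strip by simp
      show "(g has_field_derivative f z) (at z within closed_segment (Complex T 0) (Complex T \<beta>))"
        by (rule has_field_derivative_at_within[OF g])
    qed auto
    then show ?thesis by (simp add: complex_diff norm_complex_def)
  qed
  have main: "cmod (c1 - c2) \<le> (e1 + e2) + 2 * (C * \<bar>\<beta>\<bar>) / T" if "T > 0" for T
  proof -
    let ?a = "g (Complex T \<beta>) - g (Complex 0 \<beta>) - c1 * T"
    let ?b = "g (Complex T 0) - g (Complex 0 0) - c2 * T"
    let ?v = "g (Complex T \<beta>) - g (Complex T 0)" and ?w = "g (Complex 0 \<beta>) - g (Complex 0 0)"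
    have "(c1 - c2) * T = ?v - ?w - ?a + ?b" by (simp add: algebra_simps)
    moreover have "cmod (v - w - a + b) \<le> cmod v + cmod w + cmod a + cmod b" for v w a b
      using norm_triangle_ineq[of "v - w - a" b] norm_triangle_ineq4[of "v - w" a]
        norm_triangle_ineq4[of v w] by linarith
    ultimately have "cmod ((c1 - c2) * T) \<le> cmod ?v + cmod ?w + cmod ?a + cmod ?b" by metis
    also have "\<dots> \<le> C * \<bar>\<beta>\<bar> + C * \<bar>\<beta>\<bar> + e1 * T + e2 * T"
      using ver[of T] ver[of 0] hor[OF that up] hor[OF that low] by linarith
    finally have "cmod (c1 - c2) * T \<le> (e1 + e2) * T + 2 * (C * \<bar>\<beta>\<bar>)"
      using that by (simp add: norm_mult distrib_right)
    then show ?thesis using that by (simp add: field_simps)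
  qed
  have "((\<lambda>T. (e1 + e2) + 2 * (C * \<bar>\<beta>\<bar>) / T) \<longlongrightarrow> (e1 + e2) + 0) at_top"
    by (intro tendsto_intros real_tendsto_divide_at_top[OF tendsto_const] filterlim_ident)
  moreover have "\<forall>\<^sub>F T in at_top. cmod (c1 - c2) \<le> (e1 + e2) + 2 * (C * \<bar>\<beta>\<bar>) / T"
    using eventually_gt_at_top[of 0] by eventually_elim (rule main)
  ultimately show ?thesis using tendsto_lowerbound by fastforce
qed

text \<open>The element \<open>x\<close> may lie outside the subalgebra \<open>D\<close> on which
  the KMS identity is given. If \<open>a\<close> in \<open>D\<close> is close to \<open>x\<close>,
  then \<open>cis (- (r * l)) *\<^sub>C \<alpha> r a\<close> stays close to \<open>x\<close>
  uniformly in \<open>r\<close>, since \<open>x\<close> is an eigenvector and the flow is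
  contractive. Hence \<open>exp (- \<i> * z * l) * \<omega> (b * f z)\<close> is nearly constant on
  each edge of the strip between 0 and \<open>\<i> * \<beta>\<close>, and the two constants nearly
  agree.\<close>

lemma KMS_state_eigenvector:
  fixes A B :: "'a::unital_cstar_algebra set"
  assumes B: "star_subalgebra B" "closed B" "1 \<in> B"
    and A: "star_subalgebra A" "closed A" "1 \<in> A" "A \<subseteq> B"
    and \<alpha>: "one_parameter_group B \<alpha>" "\<And>r. \<alpha> r 1 = 1"
    and \<omega>: "\<omega> \<in> KMS_states A \<alpha> \<beta>"
    and x: "x \<in> A" "\<And>r. \<alpha> r x = cis (r * l) *\<^sub>C x" and b: "b \<in> A"
  shows "\<omega> (x * b) = exp (- \<beta> * l) * \<omega> (b * x)"
proof -
  have \<omega>s: "\<omega> \<in> states A" using \<omega> by (simp add: KMS_states_def)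
  obtain D where D: "D \<subseteq> A" "A \<subseteq> closure D" "\<And>r. \<alpha> r ` D \<subseteq> D" "D \<subseteq> analytic_elements A \<alpha>"
    and kms: "\<And>a b. a \<in> D \<Longrightarrow> b \<in> D \<Longrightarrow> \<omega> (a * b) = \<omega> (b * complex_flow A \<alpha> (\<i> * complex_of_real \<beta>) a)"
    using \<omega> unfolding KMS_states_def by blast
  have subB: "complex_subspace B" and subA: "complex_subspace A"
    using A(1) B(1) by (auto simp: star_subalgebra_def)
  have aut: "star_automorphism B (\<alpha> r)" for r using \<alpha> by (simp add: one_parameter_group_def)
  have add: "\<And>r x y. x \<in> B \<Longrightarrow> y \<in> B \<Longrightarrow> \<alpha> r (x + y) = \<alpha> r x + \<alpha> r y"
    and sc: "\<And>r c x. x \<in> B \<Longrightarrow> \<alpha> r (c *\<^sub>C x) = c *\<^sub>C \<alpha> r x"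
    and grp: "\<And>r s x. x \<in> B \<Longrightarrow> \<alpha> (r + s) x = \<alpha> r (\<alpha> s x)"
    using \<alpha> unfolding one_parameter_group_def star_automorphism_def by auto
  have con: "norm (\<alpha> r x) \<le> norm x" if "x \<in> B" for r x
    by (rule star_homomorphism_contractive[OF B aut \<alpha>(2) that])
  have diff: "\<alpha> r (x - y) = \<alpha> r x - \<alpha> r y" if "x \<in> B" "y \<in> B" for r x y
    using add[of x "(-1) *\<^sub>C y" r] sc[of y r "-1"] that subB by (simp add: complex_subspaceD scaleC_minus_left)
  have est: "cmod (exp (\<beta> * l) * \<omega> (x * b) - \<omega> (b * x)) \<le> (exp (\<beta> * l) + 1) * (norm (a - x) * norm b)"
    if a: "a \<in> D" and b: "b \<in> D" for a b
  proof -
    have aA: "a \<in> A" and bA: "b \<in> A" using a b D by auto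
    obtain f where f: "entire_extension A \<alpha> a f" using a D(4) by (auto simp: analytic_elements_def)
    have fA: "f z \<in> A" and fr: "f (complex_of_real r) = \<alpha> r a" and fd: "complex_differentiable_at f z" for z r
      using f by (auto simp: entire_extension_def)
    have shift: "entire_extension A \<alpha> (\<alpha> r a) (\<lambda>z. f (z + r))" for r
      unfolding entire_extension_def
    proof (intro conjI allI)
      show "f (complex_of_real s + complex_of_real r) = \<alpha> s (\<alpha> r a)" for s
        using grp[of a s r] fr[of "s + r"] aA A(4) by auto
    qed (auto intro: fA complex_differentiable_at_shift fd)
    \<comment> \<open>Both sides are entire in \<open>z\<close> and agree on the real line. This
      reduces the bound of \<open>f\<close> on the strip to the compact segment from 0 to
      \<open>\<i> * \<beta>\<close>.\<close>
    have move: "f (z + r) = \<alpha> r (f z)" for z r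
    proof -
      have "(\<lambda>z. f (z + complex_of_real r)) = (\<lambda>z. \<alpha> r (f z))"
      proof (rule entire_functions_eqI)
        show "complex_differentiable_at (\<lambda>z. f (z + complex_of_real r)) z" for z
          by (rule complex_differentiable_at_shift[OF fd])
        show "complex_differentiable_at (\<lambda>z. \<alpha> r (f z)) z" for z
          by (rule complex_differentiable_at_compose_linear[OF subB B(2) add sc con])
             (use fA A(4) fd in auto)
        show "f (complex_of_real s + complex_of_real r) = \<alpha> r (f (complex_of_real s))" for s
          using fr[of "s + r"] fr[of s] grp[of a r s] aA A(4) by (auto simp: add.commute)
      qed
      then show ?thesis by meson
    qed
    define h where "h z = exp (- \<i> * z * l) * \<omega> (b * f z)" for z
    have hol: "h holomorphic_on UNIV" unfolding h_def
    proof (intro holomorphic_intros)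
      show "(\<lambda>z. \<omega> (b * f z)) holomorphic_on UNIV"
      proof (rule holomorphic_functional_comp[OF subA A(2), where \<psi> = "\<lambda>y. \<omega> (b * y)" and K = "norm b"])
        fix x y c assume xy: "x \<in> A" "y \<in> A"
        have bx: "b * x \<in> A" "b * y \<in> A" using xy bA by (auto intro: star_subalgebraD[OF A(1)])
        show "\<omega> (b * (x + y)) = \<omega> (b * x) + \<omega> (b * y)" using statesD(2)[OF \<omega>s bx] by (simp add: distrib_left)
      next
        fix x c assume xy: "x \<in> A"
        have bx: "b * x \<in> A" using xy bA by (auto intro: star_subalgebraD[OF A(1)])
        show "\<omega> (b * (c *\<^sub>C x)) = c * \<omega> (b * x)" using statesD(3)[OF \<omega>s bx] by (simp add: mult_scaleC_right)
        show "cmod (\<omega> (b * x)) \<le> norm b * norm x"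
          using state_norm_le[OF \<omega>s A(1-3) bx] norm_mult_ineq[of b x] by linarith
      qed (auto intro: fA fd)
    qed
    have part: "cmod (cis (- (r * l)) * \<omega> (\<alpha> r a * b) - \<omega> (x * b)) \<le> norm (a - x) * norm b
        \<and> cmod (cis (- (r * l)) * \<omega> (b * \<alpha> r a) - \<omega> (b * x)) \<le> norm (a - x) * norm b" for r
    proof -
      define y where "y = cis (- (r * l)) *\<^sub>C \<alpha> r a"
      have arA: "\<alpha> r a \<in> A" using a D by blast
      have yA: "y \<in> A" unfolding y_def by (intro complex_subspaceD subA arA)
      have xe: "x = cis (- (r * l)) *\<^sub>C \<alpha> r x" by (simp add: x scaleC_scaleC cis_mult)
      have "y - x = cis (- (r * l)) *\<^sub>C \<alpha> r (a - x)"
        by (subst xe) (use aA x(1) A(4) in \<open>auto simp: y_def diff scaleC_diff_right subset_iff\<close>)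
      then have n: "norm (y - x) \<le> norm (a - x)"
        using con[of "a - x" r] aA x(1) A(4) subB by (auto simp: norm_scaleC complex_subspaceD subset_iff)
      have "\<omega> (y * b) - \<omega> (x * b) = \<omega> ((y - x) * b)" "\<omega> (b * y) - \<omega> (b * x) = \<omega> (b * (y - x))"
        using state_diff[OF \<omega>s subA, of "y * b" "x * b"] state_diff[OF \<omega>s subA, of "b * y" "b * x"]
          yA bA x(1) A(1) by (auto simp: algebra_simps star_subalgebraD)
      moreover have "cmod (\<omega> ((y - x) * b)) \<le> norm (y - x) * norm b"
        using state_norm_le[OF \<omega>s A(1-3), of "(y - x) * b"] norm_mult_ineq[of "y - x" b]
          star_subalgebraD(4)[OF A(1) complex_subspaceD(6)[OF subA yA x(1)] bA] by linarith
      moreover have "cmod (\<omega> (b * (y - x))) \<le> norm b * norm (y - x)"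
        using state_norm_le[OF \<omega>s A(1-3), of "b * (y - x)"] norm_mult_ineq[of b "y - x"]
          star_subalgebraD(4)[OF A(1) bA complex_subspaceD(6)[OF subA yA x(1)]] by linarith
      moreover have "\<omega> (y * b) = cis (- (r * l)) * \<omega> (\<alpha> r a * b)"
        using statesD(3)[OF \<omega>s star_subalgebraD(4)[OF A(1) arA bA]] by (simp add: y_def mult_scaleC_left)
      moreover have "\<omega> (b * y) = cis (- (r * l)) * \<omega> (b * \<alpha> r a)"
        using statesD(3)[OF \<omega>s star_subalgebraD(4)[OF A(1) bA arA]] by (simp add: y_def mult_scaleC_right)
      ultimately show ?thesis using mult_right_mono[OF n, of "norm b"] by (auto simp: mult.commute)
    qed
    have e1: "exp (- \<i> * Complex r y * l) = exp (y * l) * cis (- (r * l))" for r y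
      by (simp add: exp_eq_polar mult_ac)
    \<comment> \<open>Invariance of \<open>D\<close> under the flow provides the KMS identity for
      every \<open>\<alpha> r a\<close>, that is, at every point of the upper edge.\<close>
    have hup: "h (Complex r \<beta>) = exp (\<beta> * l) * (cis (- (r * l)) * \<omega> (\<alpha> r a * b))" for r
    proof -
      have arD: "\<alpha> r a \<in> D" using a D by blast
      have "\<omega> (\<alpha> r a * b) = \<omega> (b * f (\<i> * \<beta> + r))"
        using kms[OF arD b] complex_flow_eq[OF shift[of r], of "\<i> * \<beta>"] by simp
      also have "\<i> * \<beta> + r = Complex r \<beta>" by (simp add: complex_eq_iff)
      finally show ?thesis unfolding h_def e1 by simp
    qed
    have hlow: "h (Complex r 0) = cis (- (r * l)) * \<omega> (b * \<alpha> r a)" for r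
      unfolding h_def e1 using fr[of r] by (simp add: complex_of_real_def one_complex.code[symmetric])
    obtain C where C: "\<And>z. z \<in> closed_segment 0 (\<i> * \<beta>) \<Longrightarrow> norm (f z) \<le> C"
    proof -
      have "compact (f ` closed_segment 0 (\<i> * \<beta>))"
        by (intro compact_continuous_image continuous_at_imp_continuous_on ballI
            complex_differentiable_at_imp_isCont fd) auto
      then show ?thesis using that compact_imp_bounded bounded_iff by (metis imageI)
    qed
    have strip: "cmod (h (Complex r y)) \<le> exp (\<bar>\<beta>\<bar> * \<bar>l\<bar>) * (norm b * C)" if y: "y \<in> closed_segment 0 \<beta>" for r y
    proof -
      obtain u where u: "0 \<le> u" "u \<le> 1" "y = u * \<beta>" using y by (auto simp: in_segment)
      have "\<i> * y \<in> closed_segment 0 (\<i> * \<beta>)" unfolding in_segment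
        using u by (intro conjI exI[of _ u]) (auto simp: complex_eq_iff)
      then have "norm (f (\<i> * y)) \<le> C" by (rule C)
      moreover have "f (Complex r y) = \<alpha> r (f (\<i> * y))"
        using move[of "\<i> * y" r] by (metis add.commute complex_eq mult.commute complex.sel)
      ultimately have fC: "norm (f (Complex r y)) \<le> C" using con[of "f (\<i> * y)" r] fA A(4) by force
      have "\<bar>y\<bar> \<le> \<bar>\<beta>\<bar>" using u by (simp add: abs_mult mult_left_le_one_le)
      then have "y * l \<le> \<bar>\<beta>\<bar> * \<bar>l\<bar>" by (metis abs_ge_self abs_mult abs_ge_zero mult_right_mono order_trans)
      then have "exp (y * l) \<le> exp (\<bar>\<beta>\<bar> * \<bar>l\<bar>)" by simp
      moreover have "cmod (\<omega> (b * f (Complex r y))) \<le> norm b * C"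
        using state_norm_le[OF \<omega>s A(1-3) star_subalgebraD(4)[OF A(1) bA fA]] norm_mult_ineq[of b "f (Complex r y)"]
          mult_left_mono[OF fC, of "norm b"] by (meson norm_ge_zero order_trans)
      ultimately show ?thesis unfolding h_def e1 norm_mult by (auto intro!: mult_mono)
    qed
    have "cmod (exp (\<beta> * l) * \<omega> (x * b) - \<omega> (b * x))
        \<le> exp (\<beta> * l) * (norm (a - x) * norm b) + norm (a - x) * norm b"
    proof (rule strip_boundary_means[OF hol, where \<beta> = \<beta>])
      show "cmod (h (Complex r \<beta>) - exp (\<beta> * l) * \<omega> (x * b)) \<le> exp (\<beta> * l) * (norm (a - x) * norm b)" for r
      proof -
        have "h (Complex r \<beta>) - exp (\<beta> * l) * \<omega> (x * b)
            = exp (\<beta> * l) * (cis (- (r * l)) * \<omega> (\<alpha> r a * b) - \<omega> (x * b))"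
          unfolding hup by (simp add: algebra_simps)
        then have "cmod (h (Complex r \<beta>) - exp (\<beta> * l) * \<omega> (x * b))
            = exp (\<beta> * l) * cmod (cis (- (r * l)) * \<omega> (\<alpha> r a * b) - \<omega> (x * b))"
          by (simp add: norm_mult)
        then show ?thesis using part[of r] by (auto intro: mult_left_mono)
      qed
      show "cmod (h (Complex r 0) - \<omega> (b * x)) \<le> norm (a - x) * norm b" for r
        unfolding hlow using part by blast
    qed (rule strip)
    then show ?thesis by (simp add: algebra_simps)
  qed
  have inD: "exp (\<beta> * l) * \<omega> (x * b) = \<omega> (b * x)" if b: "b \<in> D" for b
  proof -
    obtain a where a: "\<And>n. a n \<in> D" "a \<longlonglongrightarrow> x" using x(1) D(2) closure_sequential by blast
    have "(\<lambda>n. (exp (\<beta> * l) + 1) * (norm (a n - x) * norm b)) \<longlonglongrightarrow> (exp (\<beta> * l) + 1) * (norm (x - x) * norm b)"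
      by (intro tendsto_intros a)
    then have "cmod (exp (\<beta> * l) * \<omega> (x * b) - \<omega> (b * x)) \<le> (exp (\<beta> * l) + 1) * (norm (x - x) * norm b)"
      by (rule tendsto_lowerbound) (use est[OF a(1) b] in auto)
    then show ?thesis by simp
  qed
  obtain c where c: "\<And>n. c n \<in> D" "c \<longlonglongrightarrow> b" using b D(2) closure_sequential by blast
  have cA: "c n \<in> A" for n using c D by blast
  have "(\<lambda>n. exp (\<beta> * l) * \<omega> (x * c n)) \<longlonglongrightarrow> exp (\<beta> * l) * \<omega> (x * b)"
    by (intro tendsto_intros state_tendsto[OF \<omega>s A(1-3)] c star_subalgebraD(4)[OF A(1)] x b cA)
  moreover have "(\<lambda>n. \<omega> (c n * x)) \<longlonglongrightarrow> \<omega> (b * x)"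
    by (intro tendsto_intros state_tendsto[OF \<omega>s A(1-3)] c star_subalgebraD(4)[OF A(1)] x b cA)
  ultimately have "exp (\<beta> * l) * \<omega> (x * b) = \<omega> (b * x)"
    using inD[OF c(1)] LIMSEQ_unique by auto
  then have "exp (- \<beta> * l) * \<omega> (b * x) = exp (- \<beta> * l) * exp (\<beta> * l) * \<omega> (x * b)" by (simp add: mult_ac)
  also have "\<dots> = \<omega> (x * b)" by (simp add: exp_minus mult_ac flip: exp_of_real of_real_mult)
  finally show ?thesis by simp
qed

section \<open>The Cuntz relations\<close>

text \<open>
  Write \<open>2h = s - t\<close> with the contractions \<open>s = 1 + h\<close> and \<open>t = 1 - h\<close>. Multiplication by
  \<open>((s + t)/2)\<^sup>M = 1\<close> turns \<open>s - t\<close> into a combination of the contractions \<open>s\<^sup>k t\<^sup>M\<^sup>-\<^sup>k\<close> whose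
  coefficients are increments of a binomial distribution, and their absolute values sum to
  \<open>O(1/\<surd>M)\<close>.
\<close>

lemma unit_extreme_point:
  fixes h :: "'a::real_normed_algebra_1"
  assumes "norm (1 + h) \<le> 1" "norm (1 - h) \<le> 1"
  shows "h = 0"
proof -
  define s t where "s = 1 + h" and "t = 1 - h"
  have st2: "s + t = 2 *\<^sub>R 1" by (auto simp: s_def t_def scaleR_2)
  define E where "E M = (\<Sum>k\<le>M. real (M choose k) *\<^sub>R (s ^ k * t ^ (M - k)))" for M
  have Et: "E M * t = (\<Sum>k\<le>M. real (M choose k) *\<^sub>R (s ^ k * t ^ (Suc M - k)))" for M
    unfolding E_def sum_distrib_right
    by (rule sum.cong) (auto simp: mult.assoc Suc_diff_le power_commutes)
  have sE: "s * E M = (\<Sum>k\<le>M. real (M choose k) *\<^sub>R (s ^ Suc k * t ^ (M - k)))" for M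
    unfolding E_def sum_distrib_left by (rule sum.cong) (auto simp: mult.assoc)
  have E: "E M = 2 ^ M *\<^sub>R 1" for M
  proof (induction M)
    case (Suc M)
    have "E (Suc M) = t ^ Suc M + (\<Sum>k\<le>M. (real (M choose k) + real (M choose Suc k)) *\<^sub>R (s ^ Suc k * t ^ (M - k)))"
      unfolding E_def sum.atMost_Suc_shift by simp
    also have "\<dots> = s * E M + (t ^ Suc M + (\<Sum>k\<le>M. real (M choose Suc k) *\<^sub>R (s ^ Suc k * t ^ (M - k))))"
      unfolding sE by (simp add: scaleR_add_left sum.distrib)
    also have "t ^ Suc M + (\<Sum>k\<le>M. real (M choose Suc k) *\<^sub>R (s ^ Suc k * t ^ (M - k))) =
        (\<Sum>k\<le>Suc M. real (M choose k) *\<^sub>R (s ^ k * t ^ (Suc M - k)))"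
      unfolding sum.atMost_Suc_shift by simp
    also have "\<dots> = E M * t" unfolding Et by simp
    also have "s * E M + E M * t = 2 ^ M *\<^sub>R (s + t)" by (simp add: Suc scaleR_add_right)
    also have "\<dots> = 2 ^ Suc M *\<^sub>R 1" by (simp add: st2)
    finally show ?case .
  qed (simp add: E_def)
  \<comment> \<open>The factor \<open>2 * k - Suc M\<close> is split as
    \<open>k - (Suc M - k)\<close>: weighting by \<open>k\<close> produces \<open>s * E M\<close>,
    weighting by \<open>Suc M - k\<close> produces \<open>E M * t\<close>, and \<open>E M\<close> is
    a scalar.\<close>
  have Q: "(\<Sum>k\<le>Suc M. (real (Suc M choose k) * (2 * real k - real (Suc M))) *\<^sub>R (s ^ k * t ^ (Suc M - k)))
      = (real (Suc M) * 2 ^ M) *\<^sub>R (s - t)" for M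
  proof -
    have 1: "(\<Sum>k\<le>Suc M. (real k * real (Suc M choose k)) *\<^sub>R (s ^ k * t ^ (Suc M - k)))
        = real (Suc M) *\<^sub>R (s * E M)"
    proof -
      have "real (Suc k) * real (Suc M choose Suc k) = real (Suc M) * real (M choose k)" for k
        by (metis Suc_times_binomial of_nat_mult)
      then show ?thesis unfolding sum.atMost_Suc_shift sE scaleR_sum_right by simp
    qed
    have 2: "(\<Sum>k\<le>Suc M. (real (Suc M - k) * real (Suc M choose k)) *\<^sub>R (s ^ k * t ^ (Suc M - k)))
        = real (Suc M) *\<^sub>R (E M * t)"
    proof -
      have "real (Suc M - k) * real (Suc M choose k) = real (Suc M) * real (M choose k)" for k
        by (metis binomial_absorb_comp diff_Suc_1 of_nat_mult)
      then have "(\<Sum>k\<le>Suc M. (real (Suc M - k) * real (Suc M choose k)) *\<^sub>R (s ^ k * t ^ (Suc M - k))) =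
        (\<Sum>k\<le>Suc M. (real (Suc M) * real (M choose k)) *\<^sub>R (s ^ k * t ^ (Suc M - k)))" by (simp only:)
      also have "\<dots> = real (Suc M) *\<^sub>R (E M * t)" unfolding Et scaleR_sum_right by simp
      finally show ?thesis .
    qed
    have "(\<Sum>k\<le>Suc M. (real (Suc M choose k) * (2 * real k - real (Suc M))) *\<^sub>R (s ^ k * t ^ (Suc M - k)))
      = (\<Sum>k\<le>Suc M. (real k * real (Suc M choose k)) *\<^sub>R (s ^ k * t ^ (Suc M - k))) -
        (\<Sum>k\<le>Suc M. (real (Suc M - k) * real (Suc M choose k)) *\<^sub>R (s ^ k * t ^ (Suc M - k)))"
      unfolding sum_subtractf[symmetric] scaleR_diff_left[symmetric]
      by (rule sum.cong) (auto simp: of_nat_diff algebra_simps)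
    then show ?thesis unfolding 1 2 by (simp add: E scaleR_diff_right mult.commute)
  qed
  have pc: "norm (x ^ k) \<le> 1" if "norm x \<le> 1" for x :: 'a and k
    using norm_power_ineq[of x k] power_le_one[OF norm_ge_zero that, of k] by linarith
  have bound: "norm (s - t) \<le> 2 / sqrt (real (Suc M))" for M
  proof -
    let ?m = "real (Suc M)"
    let ?B = "\<lambda>k. Bernstein (Suc M) k (1/2)"
    have B: "?B k = real (Suc M choose k) / 2 ^ Suc M" if "k \<le> Suc M" for k
    proof -
      have "(1/2::real) ^ k * (1 - 1/2) ^ (Suc M - k) = (1/2) ^ (k + (Suc M - k))"
        by (simp add: power_add)
      also have "k + (Suc M - k) = Suc M" using that by simp
      finally show ?thesis unfolding Bernstein_def by (simp only: mult.assoc) (simp add: power_one_over)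
    qed
    have "norm ((?m * 2 ^ M) *\<^sub>R (s - t)) \<le>
        (\<Sum>k\<le>Suc M. norm ((real (Suc M choose k) * (2 * real k - ?m)) *\<^sub>R (s ^ k * t ^ (Suc M - k))))"
      unfolding Q[symmetric] by (rule norm_sum)
    also have "\<dots> \<le> (\<Sum>k\<le>Suc M. real (Suc M choose k) * \<bar>2 * real k - ?m\<bar>)"
    proof (rule sum_mono)
      fix k
      have "norm (s ^ k * t ^ (Suc M - k)) \<le> norm (s ^ k) * norm (t ^ (Suc M - k))" by (rule norm_mult_ineq)
      also have "\<dots> \<le> 1 * 1" using assms by (intro mult_mono pc) (auto simp: s_def t_def)
      finally show "norm ((real (Suc M choose k) * (2 * real k - ?m)) *\<^sub>R (s ^ k * t ^ (Suc M - k)))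
          \<le> real (Suc M choose k) * \<bar>2 * real k - ?m\<bar>"
        by (simp add: abs_mult mult_left_le)
    qed
    also have "\<dots> = 2 ^ Suc M * (\<Sum>k\<le>Suc M. ?B k * \<bar>2 * real k - ?m\<bar>)"
      unfolding sum_distrib_left by (rule sum.cong) (auto simp: B)
    \<comment> \<open>The variance of \<open>2 * k - m\<close> under the symmetric binomial law with
      \<open>m = Suc M\<close> trials is \<open>m\<close>, so \<open>c = sqrt m\<close> is the right
      choice in \<open>\<bar>x\<bar> \<le> (x\<^sup>2 / c + c) / 2\<close>.\<close>
    also have "(\<Sum>k\<le>Suc M. ?B k * \<bar>2 * real k - ?m\<bar>) \<le>
        (\<Sum>k\<le>Suc M. ?B k * (((2 * real k - ?m)\<^sup>2 / sqrt ?m + sqrt ?m) / 2))"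
    proof (intro sum_mono mult_left_mono)
      fix k
      have "0 \<le> (\<bar>2 * real k - ?m\<bar> - sqrt ?m)\<^sup>2 / sqrt ?m" by simp
      then show "\<bar>2 * real k - ?m\<bar> \<le> ((2 * real k - ?m)\<^sup>2 / sqrt ?m + sqrt ?m) / 2"
        by (simp add: power2_diff field_simps del: of_nat_Suc)
      show "0 \<le> ?B k" by (rule Bernstein_nonneg) auto
    qed
    also have "\<dots> = ((\<Sum>k\<le>Suc M. ?B k * (2 * real k - ?m)\<^sup>2) / sqrt ?m + (\<Sum>k\<le>Suc M. ?B k) * sqrt ?m) / 2"
      unfolding sum_divide_distrib sum_distrib_right sum.distrib[symmetric]
      by (rule sum.cong) (simp_all add: distrib_left add_divide_distrib del: of_nat_Suc)
    also have "(\<Sum>k\<le>Suc M. ?B k * (2 * real k - ?m)\<^sup>2) =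
       4 * (\<Sum>k\<le>Suc M. real k * (real k - 1) * ?B k) + (4 - 4 * ?m) * (\<Sum>k\<le>Suc M. real k * ?B k) + ?m\<^sup>2 * (\<Sum>k\<le>Suc M. ?B k)"
      unfolding sum_distrib_left sum.distrib[symmetric]
      by (rule sum.cong) (auto simp: power2_eq_square algebra_simps)
    also have "\<dots> = ?m"
      unfolding sum_kk_Bernstein sum_k_Bernstein sum_Bernstein by (simp add: power2_eq_square field_simps)
    also have "(?m / sqrt ?m + (\<Sum>k\<le>Suc M. ?B k) * sqrt ?m) / 2 = sqrt ?m"
      unfolding sum_Bernstein by (simp add: real_div_sqrt)
    finally have "?m * 2 ^ M * norm (s - t) \<le> 2 ^ Suc M * sqrt ?m" by (simp add: mult_left_mono)
    then have "?m * norm (s - t) \<le> 2 * sqrt ?m" by simp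
    then have "norm (s - t) \<le> 2 * sqrt ?m / ?m" by (simp add: field_simps del: of_nat_Suc)
    also have "\<dots> = 2 / sqrt ?m" by (metis real_sqrt_mult_self of_nat_0_le_iff abs_of_nat mult_divide_mult_cancel_right
          divide_divide_eq_left nonzero_mult_div_cancel_right divide_inverse mult.assoc real_div_sqrt inverse_divide)
    finally show ?thesis .
  qed
  have "(\<lambda>M. 2 / sqrt (real (Suc M))) \<longlonglongrightarrow> 0"
    by (intro real_tendsto_divide_at_top[OF tendsto_const] filterlim_compose[OF sqrt_at_top]
        filterlim_compose[OF filterlim_real_sequentially] filterlim_Suc)
  then have "norm (s - t) \<le> 0" by (rule tendsto_lowerbound) (use bound in auto)
  then have "2 *\<^sub>R h = 0" by (simp add: s_def t_def scaleR_2)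
  then show ?thesis by simp
qed

text \<open>Compressing the sum of the range projections by \<open>V r\<close> gives positive
  elements \<open>y i\<close>, and those with \<open>i \<noteq> r\<close> have sum zero. Each
  \<open>1 - y i\<close> is a contraction. So \<open>1 + y s /\<^sub>R m\<close> is a mean of
  contractions, with \<open>m\<close> the number of remaining letters, while
  \<open>1 - y s /\<^sub>R m\<close> is one by convexity; as the unit is an extreme point,
  \<open>y s = 0\<close>.\<close>

lemma cuntz_orthogonal:
  fixes V :: "'g \<Rightarrow> 'a::unital_cstar_algebra"
  assumes "finite Y" "cuntz_family Y V" "s \<in> Y" "r \<in> Y" "s \<noteq> r"
  shows "star (V s) * V r = 0"
proof -
  have iso: "star (V s) * V s = 1" if "s \<in> Y" for s
    using assms that by (auto simp: cuntz_family_def)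
  have one: "(\<Sum>s\<in>Y. V s * star (V s)) = 1"
    using assms by (auto simp: cuntz_family_def)
  define y where "y i = star (V r) * V i * star (V i) * V r" for i
  have "(\<Sum>i\<in>Y. y i) = star (V r) * (\<Sum>s\<in>Y. V s * star (V s)) * V r"
    by (simp add: y_def sum_distrib_left sum_distrib_right mult.assoc)
  also have "\<dots> = 1" using one iso assms by simp
  finally have "y r + (\<Sum>i\<in>Y - {r}. y i) = 1" using assms sum.remove[of Y r y] by simp
  moreover have "y r = 1" using iso[OF assms(4)] by (simp add: y_def mult.assoc)
  ultimately have "(\<Sum>i\<in>Y - {r}. y i) = 0" by simp
  then have sum0: "y s + (\<Sum>i\<in>Y - {r} - {s}. y i) = 0"
    using assms sum.remove[of "Y - {r}" s y] by simp
  have nV: "norm (V i) = 1" if "i \<in> Y" for i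
    using cstar_identity[of "V i"] iso[OF that] power2_eq_imp_eq[of "norm (V i)" 1] by simp
  have contr: "norm (1 - y i) \<le> 1" if i: "i \<in> Y" for i
  proof -
    define p where "p = 1 - V i * star (V i)"
    have sp: "star p = p" by (simp add: p_def star_diff star_mult star_star)
    have "V i * star (V i) * (V i * star (V i)) = V i * (star (V i) * V i) * star (V i)" by (simp add: mult.assoc)
    then have "p * p = p" by (simp add: p_def algebra_simps iso[OF i])
    then have "(norm p)\<^sup>2 = norm p" using cstar_identity[of p] sp by simp
    then have np: "norm p \<le> 1" by (cases "norm p = 0") (auto simp: power2_eq_square)
    have "1 - y i = star (V r) * p * V r"
      using iso[OF assms(4)] by (simp add: p_def y_def algebra_simps mult.assoc)
    also have "norm \<dots> \<le> norm (star (V r)) * norm p * norm (V r)"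
      by (meson norm_mult_ineq mult_right_mono norm_ge_zero order_trans)
    finally show ?thesis using np nV[OF assms(4)] by simp
  qed
  define S where "S = Y - {r} - {s}"
  have "y s = 0"
  proof (cases "S = {}")
    case True then show ?thesis using sum0 by (simp add: S_def[symmetric])
  next
    case False
    define m where "m = real (card S)"
    have "finite S" using assms by (simp add: S_def)
    then have "0 < card S" using False by (simp add: card_gt_0_iff)
    then have m: "m \<ge> 1" by (simp add: m_def)
    have "y s /\<^sub>R m = 0"
    proof (rule unit_extreme_point)
      have "m *\<^sub>R (1 + y s /\<^sub>R m) = (\<Sum>i\<in>S. 1 - y i)"
      proof -
        have "m *\<^sub>R (1 + y s /\<^sub>R m) = m *\<^sub>R 1 + y s" using m by (simp add: scaleR_add_right)
        also have "\<dots> = m *\<^sub>R 1 - sum y S"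
          using sum0 by (simp add: S_def eq_neg_iff_add_eq_0[symmetric])
        also have "\<dots> = (\<Sum>i\<in>S. 1 - y i)" by (simp add: sum_subtractf m_def scaleR_conv_of_real)
        finally show ?thesis .
      qed
      then have "norm (m *\<^sub>R (1 + y s /\<^sub>R m)) \<le> (\<Sum>i\<in>S. norm (1 - y i))" by (metis norm_sum)
      also have "\<dots> \<le> (\<Sum>i\<in>S. 1)" by (intro sum_mono contr) (auto simp: S_def)
      finally show "norm (1 + y s /\<^sub>R m) \<le> 1" using m by (simp add: m_def)
      have "1 - y s /\<^sub>R m = (1 - inverse m) *\<^sub>R 1 + inverse m *\<^sub>R (1 - y s)" by (simp add: algebra_simps)
      also have "norm \<dots> \<le> norm ((1 - inverse m) *\<^sub>R (1::'a)) + norm (inverse m *\<^sub>R (1 - y s))"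
        by (rule norm_triangle_ineq)
      also have "\<dots> \<le> (1 - inverse m) + inverse m * 1"
        unfolding norm_scaleR using m contr[OF assms(3)]
        by (intro add_mono mult_left_mono) (auto simp: field_simps mult_left_mono)
      finally show "norm (1 - y s /\<^sub>R m) \<le> 1" by simp
    qed
    then show ?thesis using m by simp
  qed
  moreover have "y s = star (star (V s) * V r) * (star (V s) * V r)"
    by (simp add: y_def star_mult star_star mult.assoc)
  ultimately show ?thesis using cstar_identity[of "star (V s) * V r"] by simp
qed

section \<open>Words in the Cuntz isometries\<close>

lemma word_isometry_simps [simp]:
  "word_isometry V [] = 1" "word_isometry V (s # t) = V s * word_isometry V t"
  "word_isometry V (t @ u) = word_isometry V t * word_isometry V u"
  by (auto simp: word_isometry_def)

lemma word_weight_simps [simp]: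
  "word_weight F [] = 0" "word_weight F (s # t) = F s + word_weight F t"
  "word_weight F (t @ u) = word_weight F t + word_weight F u"
  by (auto simp: word_weight_def)

lemma word_value_simps [simp]:
  "word_value G [] = \<one>\<^bsub>G\<^esub>" "word_value G (s # t) = s \<otimes>\<^bsub>G\<^esub> word_value G t"
  by (auto simp: word_value_def)

locale cuntz = group G for G :: "('g, 'b) monoid_scheme" (structure) +
  fixes Y :: "'g set" and V :: "'g \<Rightarrow> 'a::unital_cstar_algebra"
  assumes finite_Y: "finite Y" and Y_carrier: "Y \<subseteq> carrier G" and card_Y: "card Y \<ge> 2"
    and cuntz_V: "cuntz_family Y V"
begin

abbreviation W :: "'g list \<Rightarrow> 'a" where "W \<equiv> word_isometry V"
abbreviation val :: "'g list \<Rightarrow> 'g" where "val \<equiv> word_value G"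

lemma val_closed: "t \<in> lists Y \<Longrightarrow> val t \<in> carrier G"
  using Y_carrier by (induction t) auto

lemma val_append: "t \<in> lists Y \<Longrightarrow> u \<in> lists Y \<Longrightarrow> val (t @ u) = val t \<otimes> val u"
  using Y_carrier val_closed by (induction t) (auto simp: m_assoc subset_iff)

lemma star_W_W: "t \<in> lists Y \<Longrightarrow> star (W t) * W t = 1"
proof (induction t)
  case (Cons s t)
  have "star (W (s # t)) * W (s # t) = star (W t) * (star (V s) * V s) * W t"
    by (simp add: star_mult mult.assoc)
  then show ?case using Cons cuntz_V by (auto simp: cuntz_family_def)
qed simp

lemma star_W_W_append: "t \<in> lists Y \<Longrightarrow> star (W t) * W (t @ u) = W u"
  by (simp add: mult.assoc[symmetric] star_W_W)

lemma star_W_append_W: "t \<in> lists Y \<Longrightarrow> star (W (t @ u)) * W t = star (W u)"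
  by (simp add: star_mult mult.assoc star_W_W)

lemma star_W_W_differ:
  assumes "t \<in> lists Y" "u \<in> lists Y" "i < length t" "i < length u" "t ! i \<noteq> u ! i"
  shows "star (W t) * W u = 0"
  using assms
proof (induction t arbitrary: u i)
  case (Cons s t)
  then obtain r u' where u: "u = r # u'" by (cases u) auto
  have e: "star (W (s # t)) * W u = star (W t) * (star (V s) * V r) * W u'"
    by (simp add: u star_mult mult.assoc)
  show ?case
  proof (cases "s = r")
    case True
    then have "i \<noteq> 0" using Cons.prems(4) u True by (metis nth_Cons_0)
    then obtain j where j: "i = Suc j" by (cases i) auto
    have "star (W t) * W u' = 0" using Cons.prems by (intro Cons.IH[of u' j]) (auto simp: u j)
    then show ?thesis unfolding e using True Cons.prems cuntz_V u by (simp add: cuntz_family_def)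
  next
    case False
    then have "star (V s) * V r = 0"
      using Cons u cuntz_orthogonal[OF finite_Y cuntz_V, of s r] by auto
    then show ?thesis unfolding e by simp
  qed
qed simp

lemma norm_W: "t \<in> lists Y \<Longrightarrow> norm (W t) = 1"
  using cstar_identity[of "W t"] star_W_W[of t] power2_eq_imp_eq[of "norm (W t)" 1] by simp

text \<open>For words in \<open>Y\<close>, the product \<open>star (W u) * W w\<close> is
  \<open>W x\<close>, \<open>star (W x)\<close> or zero in the respective cases.\<close>

lemma words_comparable:
  obtains x where "w = u @ x" | x where "u = w @ x" "x \<noteq> []"
  | i where "i < length u" "i < length w" "u ! i \<noteq> w ! i"
proof (induction u arbitrary: w thesis)
  case (Cons s u)
  show ?case
  proof (cases w)
    case (Cons r w')
    note w = this
    show ?thesis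
    proof (cases "s = r")
      case True
      show ?thesis
      proof (rule Cons.IH[of w'])
        show thesis if "w' = u @ x" for x using Cons.prems(1)[of x] that True w by simp
        show thesis if "u = w' @ x" "x \<noteq> []" for x using Cons.prems(2)[of x] that True w by simp
        show thesis if "i < length u" "i < length w'" "u ! i \<noteq> w' ! i" for i
          using Cons.prems(3)[of "Suc i"] that w by simp
      qed
    qed (use Cons.prems(3)[of 0] w in auto)
  qed (use Cons.prems(2)[of "s # u"] in auto)
qed auto

end

section \<open>The algebra \<open>O\<^sub>Y(G)\<close> and its states\<close>

lemma scaleC_If:
  "c *\<^sub>C (if P then 1 else 0) = (if P then c else 0) *\<^sub>C (1::'a::unital_cstar_algebra)"
  by simp

text \<open>The norm bound makes \<open>f\<close> uniformly continuous, hence extensible to the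
  closure. Positivity passes over because \<open>star x * x\<close> is the limit of the elements
  \<open>star (a n) * a n\<close>.\<close>

lemma state_extension:
  fixes D :: "'a::unital_cstar_algebra set" and f :: "'a \<Rightarrow> complex"
  assumes D: "star_subalgebra D" "1 \<in> D"
    and add: "\<And>x y. x \<in> D \<Longrightarrow> y \<in> D \<Longrightarrow> f (x + y) = f x + f y"
    and sc: "\<And>c x. x \<in> D \<Longrightarrow> f (c *\<^sub>C x) = c * f x"
    and bd: "\<And>x. x \<in> D \<Longrightarrow> cmod (f x) \<le> norm x"
    and pos: "\<And>x. x \<in> D \<Longrightarrow> f (star x * x) \<in> \<real>\<^sub>\<ge>\<^sub>0"
    and one: "f 1 = 1"
  shows "\<exists>\<omega>\<in>states (closure D). \<forall>x\<in>D. \<omega> x = f x"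
proof -
  have sub: "complex_subspace D" using D by (simp add: star_subalgebra_def)
  have diff: "f (x - y) = f x - f y" if "x \<in> D" "y \<in> D" for x y
    using add[of x "(-1) *\<^sub>C y"] sc[of y "-1"] that sub by (simp add: complex_subspaceD scaleC_minus_left)
  have "uniformly_continuous_on D f"
    unfolding uniformly_continuous_on_def
  proof (intro allI impI)
    fix e :: real assume "e > 0"
    then show "\<exists>d>0. \<forall>x\<in>D. \<forall>x'\<in>D. dist x' x < d \<longrightarrow> dist (f x') (f x) < e"
      using bd[OF complex_subspaceD(6)[OF sub]] diff
      by (intro exI[of _ e]) (fastforce simp: dist_norm)
  qed
  then obtain g where g: "uniformly_continuous_on (closure D) g" "\<And>x. x \<in> D \<Longrightarrow> f x = g x"
    using uniformly_continuous_on_extension_on_closure[of D f] by metis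
  define \<omega> where "\<omega> = restrict g (closure D)"
  have cont: "continuous_on (closure D) g" using g(1) by (rule uniformly_continuous_imp_continuous)
  have lim: "(\<lambda>n. f (x n)) \<longlonglongrightarrow> \<omega> l" if "\<And>n. x n \<in> D" "x \<longlonglongrightarrow> l" for x l
  proof -
    have "l \<in> closure D" using that closure_sequential by blast
    then have "(\<lambda>n. g (x n)) \<longlonglongrightarrow> g l"
      using that closure_subset[of D]
      by (intro continuous_on_tendsto_compose[OF cont that(2)]) (auto simp: subset_iff)
    then show ?thesis using g(2)[OF that(1)] \<open>l \<in> closure D\<close> by (simp add: \<omega>_def)
  qed
  have eq: "\<omega> x = f x" if "x \<in> D" for x using g(2)[OF that] closure_subset[of D] that by (auto simp: \<omega>_def)
  have "\<omega> \<in> states (closure D)"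
    unfolding states_def
  proof (intro CollectI conjI ballI allI)
    fix x y assume "x \<in> closure D" "y \<in> closure D"
    then obtain a b where a: "\<And>n. a n \<in> D" "a \<longlonglongrightarrow> x" and b: "\<And>n. b n \<in> D" "b \<longlonglongrightarrow> y"
      unfolding closure_sequential by blast
    have "(\<lambda>n. f (a n + b n)) \<longlonglongrightarrow> \<omega> (x + y)"
      by (rule lim) (use a b sub in \<open>auto intro: tendsto_add complex_subspaceD\<close>)
    then show "\<omega> (x + y) = \<omega> x + \<omega> y"
      using tendsto_add[OF lim[OF a] lim[OF b]] add a b LIMSEQ_unique by fastforce
  next
    fix c x assume "x \<in> closure D"
    then obtain a where a: "\<And>n. a n \<in> D" "a \<longlonglongrightarrow> x" unfolding closure_sequential by blast
    have "(\<lambda>n. f (c *\<^sub>C a n)) \<longlonglongrightarrow> \<omega> (c *\<^sub>C x)"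
      by (rule lim) (use a sub bounded_linear.tendsto[OF bounded_linear_scaleC a(2)] in \<open>auto intro: complex_subspaceD\<close>)
    then show "\<omega> (c *\<^sub>C x) = c * \<omega> x"
      using tendsto_mult_left[OF lim[OF a], of c] sc a LIMSEQ_unique by fastforce
  next
    fix x assume "x \<in> closure D"
    then obtain a where a: "\<And>n. a n \<in> D" "a \<longlonglongrightarrow> x" unfolding closure_sequential by blast
    have "(\<lambda>n. f (star (a n) * a n)) \<longlonglongrightarrow> \<omega> (star x * x)"
      by (rule lim)
         (use a D(1) bounded_linear.tendsto[OF bounded_linear_star a(2)] in
          \<open>auto intro: star_subalgebraD tendsto_mult\<close>)
    then show "\<omega> (star x * x) \<in> \<real>\<^sub>\<ge>\<^sub>0"
      by (rule closed_sequentially[OF closed_nonneg_Reals_complex, rotated]) (use pos a in auto)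
  next
    show "\<omega> 1 = 1" using eq[OF D(2)] one by simp
  qed (simp add: \<omega>_def)
  then show ?thesis using eq by blast
qed

context cuntz
begin

definition words :: "nat \<Rightarrow> 'g list set" where
  "words N = {t \<in> lists Y. length t = N}"

lemma finite_words: "finite (words N)"
  using finite_lists_length_eq[OF finite_Y, of N] by (simp add: words_def lists_eq_set Collect_conj_eq conj_commute)

text \<open>A finite linear combination of elements \<open>V\<^sub>tV\<^sub>u\<^sup>*\<close> is encoded as a list of triples \<open>(c, t, u)\<close>.\<close>

definition combination :: "(complex \<times> 'g list \<times> 'g list) list \<Rightarrow> 'a" where
  "combination l = (\<Sum>(c, t, u)\<leftarrow>l. c *\<^sub>C (W t * star (W u)))"

definition admissible :: "(complex \<times> 'g list \<times> 'g list) list \<Rightarrow> bool" where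
  "admissible l \<longleftrightarrow> (\<forall>(c, t, u)\<in>set l. t \<in> lists Y \<and> u \<in> lists Y \<and> val t = val u)"

definition D0 :: "'a set" where "D0 = combination ` Collect admissible"

lemma combination_simps [simp]:
  "combination [] = 0" "combination ((c, t, u) # l) = c *\<^sub>C (W t * star (W u)) + combination l"
  "combination (l @ l') = combination l + combination l'"
  by (auto simp: combination_def)

lemma admissible_simps [simp]:
  "admissible []"
  "admissible ((c, t, u) # l) \<longleftrightarrow> t \<in> lists Y \<and> u \<in> lists Y \<and> val t = val u \<and> admissible l"
  "admissible (l @ l') \<longleftrightarrow> admissible l \<and> admissible l'"
  by (auto simp: admissible_def ball_Un simp del: in_lists_conv_set)

lemma combination_induct [consumes 1, case_names Nil Cons]:
  assumes "admissible l" "P []"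
    "\<And>c t u l. t \<in> lists Y \<Longrightarrow> u \<in> lists Y \<Longrightarrow> val t = val u \<Longrightarrow> admissible l \<Longrightarrow> P l \<Longrightarrow> P ((c, t, u) # l)"
  shows "P l"
  using assms(1) by (induction l) (auto intro: assms(2,3))

lemma D0_gen: "t \<in> lists Y \<Longrightarrow> u \<in> lists Y \<Longrightarrow> val t = val u \<Longrightarrow> W t * star (W u) \<in> D0"
  unfolding D0_def by (intro image_eqI[of _ _ "[(1, t, u)]"]) auto

lemma D0_subspace: "complex_subspace D0"
  unfolding complex_subspace_def
proof (intro conjI ballI allI)
  show "0 \<in> D0" unfolding D0_def by (intro image_eqI[of _ _ "[]"]) auto
next
  fix x y assume "x \<in> D0" "y \<in> D0"
  then obtain l l' where "admissible l" "x = combination l" "admissible l'" "y = combination l'"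
    by (auto simp: D0_def)
  then show "x + y \<in> D0" unfolding D0_def by (intro image_eqI[of _ _ "l @ l'"]) auto
next
  fix c x assume "x \<in> D0"
  then obtain l where l: "admissible l" "x = combination l" by (auto simp: D0_def)
  from l(1) have "c *\<^sub>C combination l = combination (map (\<lambda>(d, t, u). (c * d, t, u)) l) \<and>
      admissible (map (\<lambda>(d, t, u). (c * d, t, u)) l)"
    by (induction l rule: combination_induct) (auto simp: scaleC_add_right scaleC_scaleC)
  then show "c *\<^sub>C x \<in> D0" using l by (auto simp: D0_def)
qed

lemma D0_hull: "D0 = complex_subspace hull
     {W t * star (W u) | t u. t \<in> lists Y \<and> u \<in> lists Y \<and> val t = val u}"
proof (rule hull_unique[symmetric])
  fix D assume D: "{W t * star (W u) | t u. t \<in> lists Y \<and> u \<in> lists Y \<and> val t = val u} \<subseteq> D" "complex_subspace D"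
  show "D0 \<subseteq> D"
  proof
    fix x assume "x \<in> D0"
    then obtain l where l: "admissible l" "x = combination l" by (auto simp: D0_def)
    from l(1) have "combination l \<in> D"
      by (induction l rule: combination_induct) (use D in \<open>auto intro!: complex_subspaceD[OF D(2)]\<close>)
    then show "x \<in> D" using l by simp
  qed
qed (use D0_gen D0_subspace in auto)

definition A where "A = cuntz_group_algebra G Y V"

lemma A_closure: "A = closure D0"
  by (simp add: A_def cuntz_group_algebra_def D0_hull)

lemma one_D0: "1 \<in> D0"
  using D0_gen[of "[]" "[]"] by simp

lemma D0_mult_gen:
  assumes "t \<in> lists Y" "u \<in> lists Y" "val t = val u" "w \<in> lists Y" "v \<in> lists Y" "val w = val v"
  shows "W t * star (W u) * (W w * star (W v)) \<in> D0"
proof -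
  have e: "W t * star (W u) * (W w * star (W v)) = W t * (star (W u) * W w) * star (W v)" by (simp add: mult.assoc)
  show ?thesis
  proof (rule words_comparable[of w u])
    fix x assume x: "w = u @ x"
    have xY: "x \<in> lists Y" using assms x by auto
    have "star (W u) * W w = W x" unfolding x by (rule star_W_W_append) fact
    then have "W t * star (W u) * (W w * star (W v)) = W (t @ x) * star (W v)" unfolding e by simp
    moreover have "val (t @ x) = val v" using assms x xY by (simp add: val_append)
    ultimately show ?thesis using D0_gen[of "t @ x" v] assms xY by simp
  next
    fix x assume x: "u = w @ x"
    have xY: "x \<in> lists Y" using assms x by auto
    have "star (W u) * W w = star (W x)" unfolding x by (rule star_W_append_W) fact
    then have "W t * star (W u) * (W w * star (W v)) = W t * star (W (v @ x))" unfolding e by (simp add: star_mult mult.assoc)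
    moreover have "val t = val (v @ x)" using assms x xY by (simp add: val_append)
    ultimately show ?thesis using D0_gen[of t "v @ x"] assms xY by simp
  next
    fix i assume "i < length u" "i < length w" "u ! i \<noteq> w ! i"
    then have "star (W u) * W w = 0" using assms by (intro star_W_W_differ) auto
    then show ?thesis unfolding e using complex_subspaceD(1)[OF D0_subspace] by simp
  qed
qed

lemma D0_star_subalgebra: "star_subalgebra D0"
  unfolding star_subalgebra_def
proof (intro conjI ballI D0_subspace)
  fix x y assume "x \<in> D0" "y \<in> D0"
  then obtain l l' where l: "admissible l" "x = combination l" and l': "admissible l'" "y = combination l'"
    by (auto simp: D0_def)
  have 1: "W t * star (W u) * combination l' \<in> D0" if "t \<in> lists Y" "u \<in> lists Y" "val t = val u" for t u
    using l'(1)
    by (induction l' rule: combination_induct)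
       (use that in \<open>auto simp: distrib_left mult_scaleC_right intro!: complex_subspaceD[OF D0_subspace] D0_mult_gen\<close>)
  have "combination l * combination l' \<in> D0"
    using l(1)
    by (induction l rule: combination_induct)
       (auto simp: distrib_right mult_scaleC_left intro!: complex_subspaceD[OF D0_subspace] 1)
  then show "x * y \<in> D0" using l l' by simp
next
  fix x assume "x \<in> D0"
  then obtain l where l: "admissible l" "x = combination l" by (auto simp: D0_def)
  have "star (combination l) \<in> D0"
    using l(1)
    by (induction l rule: combination_induct)
       (auto simp: star_add star_scaleC star_mult star_star intro!: complex_subspaceD[OF D0_subspace] D0_gen)
  then show "star x \<in> D0" using l by simp
qed

lemma star_subalgebra_closure:
  assumes "star_subalgebra D"
  shows "star_subalgebra (closure D :: 'a set)"
proof -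
  have sub: "complex_subspace D" using assms by (simp add: star_subalgebra_def)
  show ?thesis
    unfolding star_subalgebra_def complex_subspace_def
  proof (intro conjI ballI allI)
    show "0 \<in> closure D" using star_subalgebraD(1)[OF assms] closure_subset by blast
  next
    fix x y assume "x \<in> closure D" "y \<in> closure D"
    then obtain a b where a: "\<And>n. a n \<in> D" "a \<longlonglongrightarrow> x" and b: "\<And>n. b n \<in> D" "b \<longlonglongrightarrow> y"
      unfolding closure_sequential by blast
    show "x + y \<in> closure D" unfolding closure_sequential
      using a b assms by (intro exI[of _ "\<lambda>n. a n + b n"]) (auto intro: tendsto_add star_subalgebraD)
    show "x * y \<in> closure D" unfolding closure_sequential
      using a b assms by (intro exI[of _ "\<lambda>n. a n * b n"]) (auto intro: tendsto_mult star_subalgebraD)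
  next
    fix c x assume "x \<in> closure D"
    then obtain a where a: "\<And>n. a n \<in> D" "a \<longlonglongrightarrow> x" unfolding closure_sequential by blast
    show "c *\<^sub>C x \<in> closure D" unfolding closure_sequential
      using a assms bounded_linear.tendsto[OF bounded_linear_scaleC a(2)]
      by (intro exI[of _ "\<lambda>n. c *\<^sub>C a n"]) (auto intro: star_subalgebraD)
  next
    fix x assume "x \<in> closure D"
    then obtain a where a: "\<And>n. a n \<in> D" "a \<longlonglongrightarrow> x" unfolding closure_sequential by blast
    show "star x \<in> closure D" unfolding closure_sequential
      using a assms bounded_linear.tendsto[OF bounded_linear_star a(2)]
      by (intro exI[of _ "\<lambda>n. star (a n)"]) (auto intro: star_subalgebraD)
  qed
qed

lemma A_star_subalgebra: "star_subalgebra A" and closed_A: "closed A" and one_A: "1 \<in> A"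
  using star_subalgebra_closure[OF D0_star_subalgebra] one_D0 closure_subset[of D0]
  by (auto simp: A_closure)

lemmas A_props = A_star_subalgebra closed_A one_A

lemma A_subspace: "complex_subspace A"
  using A_star_subalgebra by (simp add: star_subalgebra_def)

lemma D0_subset_A: "D0 \<subseteq> A"
  by (simp add: A_closure closure_subset)

lemma A_gen: "t \<in> lists Y \<Longrightarrow> u \<in> lists Y \<Longrightarrow> val t = val u \<Longrightarrow> W t * star (W u) \<in> A"
  using D0_gen D0_subset_A by blast

lemma state_combination:
  assumes "\<omega> \<in> states A" "admissible l"
  shows "\<omega> (combination l) = (\<Sum>(c, t, u)\<leftarrow>l. c * \<omega> (W t * star (W u)))"
  using assms(2)
proof (induction l rule: combination_induct)
  case Nil show ?case using state_zero[OF assms(1) A_subspace] by simp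
next
  case (Cons c t u l)
  have "W t * star (W u) \<in> A" "combination l \<in> A" using Cons A_gen D0_subset_A by (auto simp: D0_def)
  then show ?case using Cons.IH statesD(2,3)[OF assms(1)] complex_subspaceD(3)[OF A_subspace] by simp
qed

lemma state_eqI:
  assumes "\<omega> \<in> states A" "\<omega>' \<in> states A"
    and "\<And>t u. t \<in> lists Y \<Longrightarrow> u \<in> lists Y \<Longrightarrow> val t = val u \<Longrightarrow> \<omega> (W t * star (W u)) = \<omega>' (W t * star (W u))"
  shows "\<omega> = \<omega>'"
proof (rule extensionalityI)
  show "\<omega> \<in> extensional A" "\<omega>' \<in> extensional A" using assms statesD by auto
  fix x assume "x \<in> A"
  then obtain a where a: "\<And>n. a n \<in> D0" "a \<longlonglongrightarrow> x" unfolding A_closure closure_sequential by blast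
  have aA: "a n \<in> A" for n using a D0_subset_A by blast
  have "\<omega> (a n) = \<omega>' (a n)" for n
  proof -
    obtain l where l: "admissible l" "a n = combination l" using a(1)[of n] by (auto simp: D0_def)
    have "map (\<lambda>(c, t, u). c * \<omega> (W t * star (W u))) l = map (\<lambda>(c, t, u). c * \<omega>' (W t * star (W u))) l"
      using l(1) assms(3) by (induction l rule: combination_induct) auto
    then show ?thesis
      unfolding l(2) state_combination[OF assms(1) l(1)] state_combination[OF assms(2) l(1)] by (rule arg_cong)
  qed
  then show "\<omega> x = \<omega>' x"
    using state_tendsto[OF assms(1) A_props a(2) \<open>x \<in> A\<close> aA] state_tendsto[OF assms(2) A_props a(2) \<open>x \<in> A\<close> aA]
      LIMSEQ_unique by auto
qed

subsection \<open>Diagonal states\<close>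

text \<open>The probability of the word \<open>t\<close> when its letters are independent with law
  \<open>q\<close>.\<close>

definition mon :: "('g \<Rightarrow> real) \<Rightarrow> 'g list \<Rightarrow> real" where
  "mon q t = prod_list (map q t)"

lemma mon_simps [simp]:
  "mon q [] = 1" "mon q (s # t) = q s * mon q t" "mon q (t @ u) = mon q t * mon q u"
  by (auto simp: mon_def)

definition prob_vector :: "('g \<Rightarrow> real) \<Rightarrow> bool" where
  "prob_vector q \<longleftrightarrow> (\<forall>s\<in>Y. q s \<ge> 0) \<and> (\<Sum>s\<in>Y. q s) = 1"

lemma mon_nonneg: "prob_vector q \<Longrightarrow> t \<in> lists Y \<Longrightarrow> mon q t \<ge> 0"
  by (induction t) (auto simp: prob_vector_def)

lemma prob_vector_le_1: "prob_vector q \<Longrightarrow> s \<in> Y \<Longrightarrow> q s \<le> 1"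
  using member_le_sum[of s Y q] finite_Y by (auto simp: prob_vector_def)

lemma mon_le_1: "prob_vector q \<Longrightarrow> t \<in> lists Y \<Longrightarrow> mon q t \<le> 1"
proof (induction t)
  case (Cons s t)
  then show ?case using prob_vector_le_1[of q s] mon_nonneg[of q t] by (auto intro!: mult_le_one)
qed simp

lemma words_Suc: "words (Suc N) = (\<lambda>(t, s). t @ [s]) ` (words N \<times> Y)"
proof (intro equalityI subsetI)
  fix t assume t: "t \<in> words (Suc N)"
  then have ne: "t \<noteq> []" by (auto simp: words_def)
  then have "t = butlast t @ [last t]" by simp
  moreover have "butlast t \<in> words N" "last t \<in> Y"
    using t ne by (auto simp: words_def dest: in_set_butlastD)
  ultimately show "t \<in> (\<lambda>(t, s). t @ [s]) ` (words N \<times> Y)" by (metis (mono_tags) SigmaI case_prod_conv image_eqI)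
qed (auto simp: words_def)

lemma sum_words_Suc: "(\<Sum>t\<in>words (Suc N). f t) = (\<Sum>t\<in>words N. \<Sum>s\<in>Y. f (t @ [s]))"
  unfolding words_Suc by (subst sum.reindex) (auto simp: inj_on_def sum.cartesian_product case_prod_beta)

text \<open>Consistency of the product laws: every further letter only contributes a factor of total
  mass one.\<close>

lemma sum_mon_prefix:
  assumes q: "prob_vector q" and w: "w \<in> lists Y" "length w \<le> N"
  shows "(\<Sum>t\<in>words N. if take (length w) t = w then mon q t else 0) = mon q w"
  using w(2)
proof (induction N rule: dec_induct)
  case base
  have "(\<Sum>t\<in>words (length w). if take (length w) t = w then mon q t else 0) = (\<Sum>t\<in>words (length w). if t = w then mon q t else 0)"
    by (rule sum.cong) (auto simp: words_def)
  then show ?case using finite_words w by (simp add: words_def)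
next
  case (step N)
  have "(\<Sum>t\<in>words (Suc N). if take (length w) t = w then mon q t else 0) =
      (\<Sum>t\<in>words N. \<Sum>s\<in>Y. (if take (length w) t = w then mon q t else 0) * q s)"
    unfolding sum_words_Suc by (intro sum.cong) (use step in \<open>auto simp: words_def\<close>)
  also have "\<dots> = (\<Sum>t\<in>words N. if take (length w) t = w then mon q t else 0)"
    using q by (simp add: sum_distrib_left[symmetric] prob_vector_def)
  finally show ?case using step by simp
qed

text \<open>
  The compression by \<open>V\<^sub>t\<^sub>\<gamma>\<close> with \<open>\<gamma> = a\<^sup>Nb\<close> kills \<open>V\<^sub>wV\<^sub>u\<^sup>*\<close> also when \<open>w\<close> and \<open>u\<close> are prefixes of \<open>t\<close> of
  different lengths, since \<open>\<gamma>\<close> does not overlap with its shift by at most \<open>N\<close> places.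
\<close>

lemma compression_gen:
  assumes ab: "a \<in> Y" "b \<in> Y" "a \<noteq> b" and t: "t \<in> words N"
    and w: "w \<in> lists Y" "length w \<le> N" and u: "u \<in> lists Y" "length u \<le> N"
    and \<gamma>: "\<gamma> = replicate N a @ [b]"
  shows "star (W (t @ \<gamma>)) * (W w * star (W u)) * W (t @ \<gamma>) = (if w = u \<and> take (length w) t = w then 1 else 0)"
proof -
  have tY: "t \<in> lists Y" "length t = N" and \<gamma>Y: "\<gamma> \<in> lists Y" using t ab \<gamma> by (auto simp: words_def)
  have pre: "star (W (t @ \<gamma>)) * W v = (if take (length v) t = v then star (W (drop (length v) t @ \<gamma>)) else 0)"
    if v: "v \<in> lists Y" "length v \<le> N" for v
  proof (cases "take (length v) t = v")
    case True
    then have "t @ \<gamma> = v @ (drop (length v) t @ \<gamma>)" by (metis append.assoc append_take_drop_id)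
    then have "star (W (t @ \<gamma>)) * W v = star (W (drop (length v) t @ \<gamma>))"
      by (metis star_W_append_W v(1))
    then show ?thesis using True by simp
  next
    case False
    then obtain i where i: "i < length v" "v ! i \<noteq> t ! i"
      using v(2) tY(2) by (metis (no_types, lifting) length_take min.absorb2 nth_equalityI nth_take)
    have "star (W (t @ \<gamma>)) * W v = 0"
      by (rule star_W_W_differ[where i = i]) (use i v tY \<gamma>Y in \<open>auto simp: nth_append\<close>)
    then show ?thesis using False by simp
  qed
  have "star (W u) * W (t @ \<gamma>) = star (star (W (t @ \<gamma>)) * W u)" by (simp only: star_mult star_star)
  then have pre': "star (W u) * W (t @ \<gamma>) = (if take (length u) t = u then W (drop (length u) t @ \<gamma>) else 0)"
    unfolding pre[OF u] by (simp only: star_star star_zero split: if_split) simp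
  have e: "star (W (t @ \<gamma>)) * (W w * star (W u)) * W (t @ \<gamma>) = (star (W (t @ \<gamma>)) * W w) * (star (W u) * W (t @ \<gamma>))"
    by (simp only: mult.assoc)
  show ?thesis
  proof (cases "take (length w) t = w \<and> take (length u) t = u")
    case both: True
    have "star (W (drop (length w) t @ \<gamma>)) * W (drop (length u) t @ \<gamma>) = (if w = u then 1 else 0)"
    proof (cases "length w = length u")
      case True
      then have "w = u" using both by metis
      moreover have "drop (length u) t @ \<gamma> \<in> lists Y" using tY \<gamma>Y by (auto dest: in_set_dropD)
      ultimately show ?thesis using star_W_W[of "drop (length u) t @ \<gamma>"] by (simp only: if_True simp_thms)
    next
      case False
      have nth: "(drop (length v) t @ \<gamma>) ! i = (if i < 2 * N - length v then a else b)"
        if "length v \<le> N" "N - length v \<le> i" "i \<le> 2 * N - length v" for v i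
        using that tY(2) by (auto simp: nth_append \<gamma>)
      \<comment> \<open>At this position the word with the longer prefix removed has its final
        letter \<open>b\<close>, while the other word is still inside its block of letters
        \<open>a\<close>.\<close>
      define i where "i = 2 * N - max (length w) (length u)"
      have "star (W (drop (length w) t @ \<gamma>)) * W (drop (length u) t @ \<gamma>) = 0"
      proof (rule star_W_W_differ[where i = i])
        show "(drop (length w) t @ \<gamma>) ! i \<noteq> (drop (length u) t @ \<gamma>) ! i"
          using False w(2) u(2) ab(3) by (subst (1 2) nth) (auto simp: i_def)
      qed (use tY \<gamma>Y w u in \<open>auto simp: i_def \<gamma> dest: in_set_dropD\<close>)
      then show ?thesis using False by auto
    qed
    then show ?thesis unfolding e pre[OF w] pre' using both by simp
  qed (unfold e pre[OF w] pre', auto)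
qed

text \<open>The intended value of the product state with letter law \<open>q\<close>, computed from
  a code. That it depends only on the encoded element is \<open>diag_cong\<close>.\<close>

definition diag :: "('g \<Rightarrow> real) \<Rightarrow> (complex \<times> 'g list \<times> 'g list) list \<Rightarrow> complex" where
  "diag q l = (\<Sum>(c, w, u)\<leftarrow>l. if w = u then c * complex_of_real (mon q w) else 0)"

lemma diag_simps [simp]:
  "diag q [] = 0" "diag q ((c, w, u) # l) = (if w = u then c * complex_of_real (mon q w) else 0) + diag q l"
  "diag q (l @ l') = diag q l + diag q l'"
  by (auto simp: diag_def)

text \<open>The diagonal functional is the mean of scalar compressions over all words of length
  \<open>N\<close>, weighted by the product law. Independence of the code, the norm bound and
  positivity are all read off from this formula.\<close>

lemma compression_combination:
  assumes q: "prob_vector q" and l: "admissible l" "\<forall>(c, w, u)\<in>set l. length w \<le> N \<and> length u \<le> N"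
    and ab: "a \<in> Y" "b \<in> Y" "a \<noteq> b" and \<gamma>: "\<gamma> = replicate N a @ [b]"
  shows "\<exists>\<delta>. (\<forall>t\<in>words N. star (W (t @ \<gamma>)) * combination l * W (t @ \<gamma>) = \<delta> t *\<^sub>C 1) \<and>
    (\<Sum>t\<in>words N. complex_of_real (mon q t) * \<delta> t) = diag q l"
proof -
  define \<delta> where "\<delta> t = (\<Sum>(c, w, u)\<leftarrow>l. if w = u \<and> take (length w) t = w then c else 0)" for t
  have "star (W (t @ \<gamma>)) * combination l * W (t @ \<gamma>) = \<delta> t *\<^sub>C 1" if t: "t \<in> words N" for t
    using l unfolding \<delta>_def
  proof (induction l rule: combination_induct)
    case (Cons c w u l)
    have "star (W (t @ \<gamma>)) * combination ((c, w, u) # l) * W (t @ \<gamma>) =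
        c *\<^sub>C (star (W (t @ \<gamma>)) * (W w * star (W u)) * W (t @ \<gamma>)) + star (W (t @ \<gamma>)) * combination l * W (t @ \<gamma>)"
      by (simp only: combination_simps distrib_left distrib_right mult_scaleC_left mult_scaleC_right)
    also have "star (W (t @ \<gamma>)) * (W w * star (W u)) * W (t @ \<gamma>) = (if w = u \<and> take (length w) t = w then 1 else 0)"
      by (rule compression_gen[OF ab t _ _ _ _ \<gamma>]) (use Cons in auto)
    also have "c *\<^sub>C (if w = u \<and> take (length w) t = w then 1 else 0) =
        (if w = u \<and> take (length w) t = w then c else 0) *\<^sub>C (1::'a)" by (rule scaleC_If)
    also have "star (W (t @ \<gamma>)) * combination l * W (t @ \<gamma>) =
        (\<Sum>(c, w, u)\<leftarrow>l. if w = u \<and> take (length w) t = w then c else 0) *\<^sub>C 1"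
      using Cons by auto
    finally show ?case by (simp only: list.map sum_list.Cons scaleC_add_left prod.case)
  qed simp
  moreover have "(\<Sum>t\<in>words N. complex_of_real (mon q t) * \<delta> t) = diag q l"
    using l unfolding \<delta>_def
  proof (induction l rule: combination_induct)
    case (Cons c w u l)
    have "(\<Sum>t\<in>words N. complex_of_real (mon q t) * (if w = u \<and> take (length w) t = w then c else 0)) =
        (if w = u then c * complex_of_real (\<Sum>t\<in>words N. if take (length w) t = w then mon q t else 0) else 0)"
      unfolding of_real_sum sum_distrib_left by (auto intro!: sum.cong)
    also have "\<dots> = (if w = u then c * complex_of_real (mon q w) else 0)"
    proof -
      have "(\<Sum>t\<in>words N. if take (length w) t = w then mon q t else 0) = mon q w"
        by (rule sum_mon_prefix[OF q]) (use Cons in auto)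
      then show ?thesis by (simp only:)
    qed
    finally show ?case using Cons by (simp add: distrib_left sum.distrib)
  qed simp
  ultimately show ?thesis by blast
qed

lemma max_length_exists: "\<exists>N. \<forall>(c, w, u)\<in>set l. length w \<le> N \<and> length u \<le> N"
proof (induction l)
  case (Cons x l)
  then obtain N where N: "\<forall>(c, w, u)\<in>set l. length w \<le> N \<and> length u \<le> N" by (elim exE)
  obtain c w u where x: "x = (c, w, u)" by (cases x) auto
  show ?case using N unfolding x
    by (intro exI[of _ "max N (max (length w) (length u))"]) (auto split: prod.splits simp: le_max_iff_disj)
qed simp

lemma two_letters: obtains a b where "a \<in> Y" "b \<in> Y" "a \<noteq> b"
proof -
  obtain a where a: "a \<in> Y" using card_Y by fastforce
  moreover have "card (Y - {a}) \<ge> 1" using card_Y a finite_Y by simp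
  then obtain b where "b \<in> Y - {a}" by (metis card.empty ex_in_conv not_one_le_zero)
  ultimately show thesis using that by blast
qed

lemma diag_cong:
  assumes q: "prob_vector q" and l: "admissible l" "admissible l'" "combination l = combination l'"
  shows "diag q l = diag q l'"
proof -
  obtain N where N: "\<forall>(c, w, u)\<in>set (l @ l'). length w \<le> N \<and> length u \<le> N"
    using max_length_exists[of "l @ l'"] by (elim exE) (rule that)
  then have N1: "\<forall>(c, w, u)\<in>set l. length w \<le> N \<and> length u \<le> N" and N2: "\<forall>(c, w, u)\<in>set l'. length w \<le> N \<and> length u \<le> N"
    by auto
  obtain a b where ab: "a \<in> Y" "b \<in> Y" "a \<noteq> b" by (rule two_letters)
  obtain \<delta> where 1: "\<forall>t\<in>words N. star (W (t @ replicate N a @ [b])) * combination l * W (t @ replicate N a @ [b]) = \<delta> t *\<^sub>C 1"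
    "(\<Sum>t\<in>words N. complex_of_real (mon q t) * \<delta> t) = diag q l"
    using compression_combination[OF q l(1) N1 ab refl] by (elim exE conjE) (rule that)
  obtain \<epsilon> where 2: "\<forall>t\<in>words N. star (W (t @ replicate N a @ [b])) * combination l' * W (t @ replicate N a @ [b]) = \<epsilon> t *\<^sub>C 1"
    "(\<Sum>t\<in>words N. complex_of_real (mon q t) * \<epsilon> t) = diag q l'"
    using compression_combination[OF q l(2) N2 ab refl] by (elim exE conjE) (rule that)
  have "\<delta> t = \<epsilon> t" if "t \<in> words N" for t
    using 1(1)[rule_format, OF that] 2(1)[rule_format, OF that] l(3) scaleC_cancel_one by metis
  then have "(\<Sum>t\<in>words N. complex_of_real (mon q t) * \<delta> t) = (\<Sum>t\<in>words N. complex_of_real (mon q t) * \<epsilon> t)" by (intro sum.cong) auto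
  then show ?thesis using 1(2) 2(2) by simp
qed

lemma sum_mon_words: "prob_vector q \<Longrightarrow> (\<Sum>t\<in>words N. mon q t) = 1"
  using sum_mon_prefix[of q "[]" N] by simp

lemma diag_norm_le:
  assumes q: "prob_vector q" and l: "admissible l"
  shows "cmod (diag q l) \<le> norm (combination l)"
proof -
  obtain N where N: "\<forall>(c, w, u)\<in>set l. length w \<le> N \<and> length u \<le> N"
    using max_length_exists[of l] by (elim exE) (rule that)
  obtain a b where ab: "a \<in> Y" "b \<in> Y" "a \<noteq> b" by (rule two_letters)
  define \<gamma> where "\<gamma> = replicate N a @ [b]"
  obtain \<delta> where 1: "\<forall>t\<in>words N. star (W (t @ \<gamma>)) * combination l * W (t @ \<gamma>) = \<delta> t *\<^sub>C 1"
    "(\<Sum>t\<in>words N. complex_of_real (mon q t) * \<delta> t) = diag q l"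
    using compression_combination[OF q l N ab \<gamma>_def] by (elim exE conjE) (rule that)
  have d: "cmod (\<delta> t) \<le> norm (combination l)" if t: "t \<in> words N" for t
  proof -
    have "t @ \<gamma> \<in> lists Y" using t ab by (auto simp: words_def \<gamma>_def)
    then have n: "norm (W (t @ \<gamma>)) = 1" by (rule norm_W)
    have "cmod (\<delta> t) = norm (\<delta> t *\<^sub>C (1::'a))" by (simp add: norm_scaleC)
    also have "\<dots> = norm (star (W (t @ \<gamma>)) * combination l * W (t @ \<gamma>))" by (simp only: 1(1)[rule_format, OF t])
    also have "\<dots> \<le> norm (star (W (t @ \<gamma>))) * norm (combination l) * norm (W (t @ \<gamma>))"
      by (meson norm_mult_ineq mult_right_mono norm_ge_zero order_trans)
    finally show ?thesis unfolding norm_star n by simp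
  qed
  have "cmod (diag q l) \<le> (\<Sum>t\<in>words N. cmod (complex_of_real (mon q t) * \<delta> t))" unfolding 1(2)[symmetric] by (rule norm_sum)
  also have "\<dots> \<le> (\<Sum>t\<in>words N. mon q t * norm (combination l))"
    using d mon_nonneg[OF q] by (intro sum_mono) (auto simp: norm_mult words_def intro!: mult_left_mono)
  finally show ?thesis using sum_mon_words[OF q, of N] by (simp add: sum_distrib_right[symmetric])
qed

lemma diag_positive:
  assumes q: "prob_vector q" and l: "admissible l" "combination l = star x * x"
  shows "diag q l \<in> \<real>\<^sub>\<ge>\<^sub>0"
proof -
  obtain N where N: "\<forall>(c, w, u)\<in>set l. length w \<le> N \<and> length u \<le> N"
    using max_length_exists[of l] by (elim exE) (rule that)
  obtain a b where ab: "a \<in> Y" "b \<in> Y" "a \<noteq> b" by (rule two_letters)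
  define \<gamma> where "\<gamma> = replicate N a @ [b]"
  obtain \<delta> where 1: "\<forall>t\<in>words N. star (W (t @ \<gamma>)) * combination l * W (t @ \<gamma>) = \<delta> t *\<^sub>C 1"
    "(\<Sum>t\<in>words N. complex_of_real (mon q t) * \<delta> t) = diag q l"
    using compression_combination[OF q l(1) N ab \<gamma>_def] by (elim exE conjE) (rule that)
  have "\<delta> t \<in> \<real>\<^sub>\<ge>\<^sub>0" if t: "t \<in> words N" for t
  proof (rule star_mult_self_scalar_nonneg)
    show "star (x * W (t @ \<gamma>)) * (x * W (t @ \<gamma>)) = \<delta> t *\<^sub>C 1"
      unfolding 1(1)[rule_format, OF t, symmetric] l(2) by (simp only: star_mult mult.assoc)
  qed
  moreover have "mon q t \<ge> 0" if "t \<in> words N" for t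
    using mon_nonneg[OF q, of t] that by (simp add: words_def)
  ultimately show ?thesis unfolding 1(2)[symmetric]
    by (auto simp: complex_nonneg_Reals_iff intro!: sum_nonneg mult_nonneg_nonneg)
qed

lemma product_state_exists:
  assumes q: "prob_vector q"
  shows "\<exists>\<omega>\<in>states A. \<forall>t\<in>lists Y. \<forall>u\<in>lists Y. val t = val u \<longrightarrow>
    \<omega> (W t * star (W u)) = (if t = u then complex_of_real (mon q t) else 0)"
proof -
  define f where "f x = diag q (SOME l. admissible l \<and> combination l = x)" for x
  have f: "f (combination l) = diag q l" if "admissible l" for l
  proof -
    have "admissible (SOME l'. admissible l' \<and> combination l' = combination l) \<and>
        combination (SOME l'. admissible l' \<and> combination l' = combination l) = combination l"
      by (rule someI[of _ l]) (use that in simp)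
    then show ?thesis unfolding f_def by (intro diag_cong[OF q] that) auto
  qed
  have "\<exists>\<omega>\<in>states (closure D0). \<forall>x\<in>D0. \<omega> x = f x"
  proof (rule state_extension[OF D0_star_subalgebra one_D0])
    fix x y assume "x \<in> D0" "y \<in> D0"
    then obtain l l' where l: "admissible l" "x = combination l" "admissible l'" "y = combination l'"
      by (auto simp: D0_def)
    then show "f (x + y) = f x + f y" using f[of "l @ l'"] f[of l] f[of l'] by simp
  next
    fix c x assume "x \<in> D0"
    then obtain l where l: "admissible l" "x = combination l" by (auto simp: D0_def)
    define l' where "l' = map (\<lambda>(d, t, u). (c * d, t, u)) l"
    have "c *\<^sub>C combination l = combination l' \<and> admissible l' \<and> diag q l' = c * diag q l"
      using l(1) unfolding l'_def
      by (induction l rule: combination_induct) (auto simp: scaleC_add_right scaleC_scaleC distrib_left)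
    then show "f (c *\<^sub>C x) = c * f x" using l f by metis
  next
    fix x assume x: "x \<in> D0"
    then show "cmod (f x) \<le> norm x" using diag_norm_le[OF q] f by (auto simp: D0_def)
    have "star x * x \<in> D0" using x star_subalgebraD[OF D0_star_subalgebra] by blast
    then obtain l where "admissible l" "star x * x = combination l" by (auto simp: D0_def)
    then show "f (star x * x) \<in> \<real>\<^sub>\<ge>\<^sub>0" using diag_positive[OF q] f by metis
  next
    show "f 1 = 1" using f[of "[(1, [], [])]"] by simp
  qed
  then obtain \<omega> where \<omega>: "\<omega> \<in> states A" "\<And>x. x \<in> D0 \<Longrightarrow> \<omega> x = f x" by (auto simp: A_closure)
  show ?thesis
  proof (intro bexI[OF _ \<omega>(1)] ballI impI)
    fix t u assume tu: "t \<in> lists Y" "u \<in> lists Y" "val t = val u"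
    then show "\<omega> (W t * star (W u)) = (if t = u then complex_of_real (mon q t) else 0)"
      using \<omega>(2)[OF D0_gen[OF tu]] f[of "[(1, t, u)]"] by simp
  qed
qed

definition product_state :: "('g \<Rightarrow> real) \<Rightarrow> 'a \<Rightarrow> complex" where
  "product_state q = (SOME \<omega>. \<omega> \<in> states A \<and> (\<forall>t\<in>lists Y. \<forall>u\<in>lists Y. val t = val u \<longrightarrow>
    \<omega> (W t * star (W u)) = (if t = u then complex_of_real (mon q t) else 0)))"

lemma product_state:
  assumes "prob_vector q"
  shows "product_state q \<in> states A"
    and "t \<in> lists Y \<Longrightarrow> u \<in> lists Y \<Longrightarrow> val t = val u \<Longrightarrow>
      product_state q (W t * star (W u)) = (if t = u then complex_of_real (mon q t) else 0)"
  using someI_ex[OF product_state_exists[OF assms, unfolded Bex_def]] unfolding product_state_def by auto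

lemma product_state_combination:
  assumes "prob_vector q" "admissible l"
  shows "product_state q (combination l) = diag q l"
  unfolding state_combination[OF product_state(1)[OF assms(1)] assms(2)] using assms(2)
  by (induction l rule: combination_induct) (auto simp: product_state(2)[OF assms(1)])

text \<open>On \<open>D0\<close> the value is a polynomial in the weights. Since states are
  contractive, one approximation of \<open>x\<close> in \<open>D0\<close> serves all weight vectors
  at once.\<close>

lemma product_state_tendsto:
  assumes q: "\<And>n. prob_vector (q n)" "prob_vector q'" and lim: "\<And>s. s \<in> Y \<Longrightarrow> ((\<lambda>n. q n s) \<longlongrightarrow> q' s) F"
    and x: "x \<in> A"
  shows "((\<lambda>n. product_state (q n) x) \<longlongrightarrow> product_state q' x) F"
  unfolding tendsto_iff
proof (intro allI impI)
  fix e :: real assume e: "e > 0"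
  obtain y where y: "y \<in> D0" "dist y x < e / 4"
    using x e unfolding A_closure closure_approachable by (meson divide_pos_pos zero_less_numeral)
  obtain l where l: "admissible l" "y = combination l" using y by (auto simp: D0_def)
  have yA: "y \<in> A" using y D0_subset_A by blast
  have near: "dist (product_state p x) (product_state p y) \<le> e / 4" if "prob_vector p" for p
  proof -
    have s: "product_state p \<in> states A" by (rule product_state(1)[OF that])
    have "dist (product_state p x) (product_state p y) = cmod (product_state p (x - y))"
      using state_diff[OF s A_subspace x yA] by (simp add: dist_norm)
    also have "\<dots> \<le> norm (x - y)"
      by (rule state_norm_le[OF s A_props]) (use x yA complex_subspaceD(6)[OF A_subspace] in blast)
    finally show ?thesis using y by (simp add: dist_norm norm_minus_commute)
  qed
  have m: "((\<lambda>n. mon (q n) t) \<longlongrightarrow> mon q' t) F" if "t \<in> lists Y" for t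
    using that by (induction t) (auto intro!: tendsto_intros lim)
  have "((\<lambda>n. diag (q n) l) \<longlongrightarrow> diag q' l) F"
    using l(1) by (induction l rule: combination_induct) (auto intro!: tendsto_intros m)
  then have "\<forall>\<^sub>F n in F. dist (diag (q n) l) (diag q' l) < e / 4" by (rule tendstoD) (use e in simp)
  then show "\<forall>\<^sub>F n in F. dist (product_state (q n) x) (product_state q' x) < e"
  proof eventually_elim
    case (elim n)
    then have "dist (product_state (q n) y) (product_state q' y) < e / 4"
      using product_state_combination[OF q(1) l(1)] product_state_combination[OF q(2) l(1)] l(2) by simp
    then show ?case
      using near[OF q(1), of n] near[OF q(2)] e
        dist_triangle[of "product_state (q n) x" "product_state q' x" "product_state (q n) y"]
        dist_triangle[of "product_state (q n) y" "product_state q' x" "product_state q' y"]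
      by (simp add: dist_commute)
  qed
qed

end

section \<open>KMS states on \<open>O\<^sub>Y(G)\<close>\<close>

lemma star_subalgebra_Inter:
  "(\<And>A. A \<in> T \<Longrightarrow> star_subalgebra A) \<Longrightarrow> star_subalgebra (\<Inter>T)"
  unfolding star_subalgebra_def complex_subspace_def by blast

locale cuntz_dynamics = cuntz G Y V for G :: "('g, 'b) monoid_scheme" (structure)
    and Y :: "'g set" and V :: "'g \<Rightarrow> 'a::unital_cstar_algebra" +
  fixes F :: "'g \<Rightarrow> real" and \<alpha> :: "real \<Rightarrow> 'a \<Rightarrow> 'a"
  assumes generates: "generates_as_semigroup G Y"
    and flow: "cuntz_flow Y V F \<alpha>" and F_pos: "s \<in> Y \<Longrightarrow> F s > 0"
begin

abbreviation wt :: "'g list \<Rightarrow> real" where "wt \<equiv> word_weight F"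

definition B where "B = cuntz_algebra Y V"

lemma B_props: "star_subalgebra B" "closed B" "1 \<in> B"
proof -
  have "star_subalgebra B \<and> closed B"
    unfolding B_def cuntz_algebra_def
    by (rule hull_in) (auto intro: star_subalgebra_Inter)
  then show 1: "star_subalgebra B" "closed B" by auto
  obtain s where s: "s \<in> Y" using two_letters by blast
  then have "V s \<in> B" unfolding B_def cuntz_algebra_def by (intro hull_inc) auto
  then have "star (V s) * V s \<in> B" using star_subalgebraD[OF 1(1)] by blast
  then show "1 \<in> B" using cuntz_V s by (simp add: cuntz_family_def)
qed

lemma B_subspace: "complex_subspace B"
  using B_props by (simp add: star_subalgebra_def)

lemma W_in_B: "t \<in> lists Y \<Longrightarrow> W t \<in> B"
proof (induction t)
  case (Cons s t)
  then have "V s \<in> B" unfolding B_def cuntz_algebra_def by (intro hull_inc) auto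
  then show ?case using Cons star_subalgebraD(4)[OF B_props(1)] by auto
qed (simp add: B_props)

lemma A_subset_B: "A \<subseteq> B"
proof -
  have "D0 \<subseteq> B"
    unfolding D0_hull
  proof (rule hull_minimal)
    have "W t * star (W u) \<in> B" if "t \<in> lists Y" "u \<in> lists Y" for t u
      using that by (intro star_subalgebraD[OF B_props(1)] W_in_B)
    then show "{W t * star (W u) | t u. t \<in> lists Y \<and> u \<in> lists Y \<and> val t = val u} \<subseteq> B" by blast
  qed (rule B_subspace)
  then show ?thesis unfolding A_closure using B_props(2) by (rule closure_minimal)
qed

lemma one_parameter: "one_parameter_group B \<alpha>"
  and \<alpha>_gen: "t \<in> lists Y \<Longrightarrow> u \<in> lists Y \<Longrightarrow>
    \<alpha> r (W t * star (W u)) = cis (r * (wt t - wt u)) *\<^sub>C (W t * star (W u))"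
  using flow by (auto simp: cuntz_flow_def B_def)

lemma \<alpha>_one: "\<alpha> r 1 = 1"
  using \<alpha>_gen[of "[]" "[]" r] by simp

lemma \<alpha>_add: "x \<in> B \<Longrightarrow> y \<in> B \<Longrightarrow> \<alpha> r (x + y) = \<alpha> r x + \<alpha> r y"
  and \<alpha>_scaleC: "x \<in> B \<Longrightarrow> \<alpha> r (c *\<^sub>C x) = c *\<^sub>C \<alpha> r x"
  using one_parameter unfolding one_parameter_group_def star_automorphism_def by auto

text \<open>The flow at the complex time \<open>z\<close>, acting on codes.\<close>

definition twist :: "complex \<Rightarrow> (complex \<times> 'g list \<times> 'g list) list \<Rightarrow> (complex \<times> 'g list \<times> 'g list) list" where
  "twist z = map (\<lambda>(c, t, u). (c * exp (\<i> * z * complex_of_real (wt t - wt u)), t, u))"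

lemma twist_simps [simp]:
  "twist z [] = []" "twist z ((c, t, u) # l) = (c * exp (\<i> * z * complex_of_real (wt t - wt u)), t, u) # twist z l"
  by (auto simp: twist_def)

lemma admissible_twist: "admissible l \<Longrightarrow> admissible (twist z l)"
  by (induction l rule: combination_induct) auto

lemma combination_in_D0: "admissible l \<Longrightarrow> combination l \<in> D0"
  by (auto simp: D0_def)

lemma combination_in_A: "admissible l \<Longrightarrow> combination l \<in> A"
  using combination_in_D0 D0_subset_A by blast

lemma \<alpha>_combination: "admissible l \<Longrightarrow> \<alpha> r (combination l) = combination (twist (complex_of_real r) l)"
proof (induction l rule: combination_induct)
  case Nil
  show ?case using \<alpha>_scaleC[OF B_props(3), of r 0] by simp
next
  case (Cons c t u l)
  have "W t * star (W u) \<in> B" "combination l \<in> B"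
    using A_gen[OF Cons(1-3)] combination_in_A[OF Cons(4)] A_subset_B by auto
  moreover from this have "c *\<^sub>C (W t * star (W u)) \<in> B" by (intro complex_subspaceD[OF B_subspace])
  ultimately show ?case
    using Cons by (simp add: \<alpha>_add \<alpha>_scaleC \<alpha>_gen scaleC_scaleC cis_conv_exp mult.assoc)
qed

lemma entire_extension_combination:
  assumes "admissible l"
  shows "entire_extension A \<alpha> (combination l) (\<lambda>z. combination (twist z l))"
  unfolding entire_extension_def
proof (intro conjI allI)
  show "combination (twist z l) \<in> A" for z by (rule combination_in_A[OF admissible_twist[OF assms]])
  show "combination (twist (complex_of_real r) l) = \<alpha> r (combination l)" for r
    by (rule \<alpha>_combination[OF assms, symmetric])
  show "complex_differentiable_at (\<lambda>z. combination (twist z l)) z" for z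
    using assms
  proof (induction l rule: combination_induct)
    case Nil
    then show ?case using complex_differentiable_at_scaleC[of "\<lambda>_. 0" z 0] by simp
  next
    case (Cons c t u l)
    have "complex_differentiable_at (\<lambda>z. (c * exp (\<i> * z * complex_of_real (wt t - wt u))) *\<^sub>C (W t * star (W u))) z"
      by (intro complex_differentiable_at_scaleC holomorphic_on_imp_differentiable_at[of _ UNIV] holomorphic_intros) auto
    then show ?case using complex_differentiable_at_add Cons by fastforce
  qed
qed

subsection \<open>Diagonal KMS states\<close>

text \<open>By the Cuntz relations the product is zero or again of the form
  \<open>W a * star (W b)\<close>, and it is diagonal exactly when both words acquire the same
  extension \<open>x\<close>.\<close>

lemma diagonal_state_product:
  assumes \<omega>: "\<And>t u. t \<in> lists Y \<Longrightarrow> u \<in> lists Y \<Longrightarrow> val t = val u \<Longrightarrow>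
      \<omega> (W t * star (W u)) = (if t = u then complex_of_real (\<phi> t) else 0)" and \<omega>0: "\<omega> 0 = 0"
    and w: "t \<in> lists Y" "u \<in> lists Y" "val t = val u" "w \<in> lists Y" "v \<in> lists Y" "val w = val v"
  shows "\<omega> (W t * star (W u) * (W w * star (W v))) =
    (if \<exists>x. w = u @ x \<and> v = t @ x then \<phi> v else if \<exists>x. u = w @ x \<and> t = v @ x then \<phi> t else 0)"
proof -
  have e: "W t * star (W u) * (W w * star (W v)) = W t * (star (W u) * W w) * star (W v)" by (simp add: mult.assoc)
  show ?thesis
  proof (rule words_comparable[of w u])
    fix x assume x: "w = u @ x"
    have xY: "x \<in> lists Y" using w x by auto
    have "star (W u) * W w = W x" unfolding x by (rule star_W_W_append) fact
    then have "W t * star (W u) * (W w * star (W v)) = W (t @ x) * star (W v)" unfolding e by simp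
    moreover have "val (t @ x) = val v" using w x xY by (simp add: val_append)
    ultimately show ?thesis using \<omega>[of "t @ x" v] w xY x by auto
  next
    fix x assume x: "u = w @ x" "x \<noteq> []"
    have xY: "x \<in> lists Y" using w x by auto
    have "star (W u) * W w = star (W x)" unfolding x by (rule star_W_append_W) fact
    then have "W t * star (W u) * (W w * star (W v)) = W t * star (W (v @ x))" unfolding e by (simp add: star_mult mult.assoc)
    moreover have "val t = val (v @ x)" using w x xY by (simp add: val_append)
    ultimately show ?thesis using \<omega>[of t "v @ x"] w xY x by auto
  next
    fix i assume i: "i < length u" "i < length w" "u ! i \<noteq> w ! i"
    then have "star (W u) * W w = 0" using w by (intro star_W_W_differ) auto
    then have "\<omega> (W t * star (W u) * (W w * star (W v))) = 0" unfolding e using \<omega>0 by simp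
    moreover have "\<not> (\<exists>x. w = u @ x)" "\<not> (\<exists>x. u = w @ x)" using i by (auto simp: nth_append)
    ultimately show ?thesis by auto
  qed
qed

text \<open>\<open>D0\<close> serves as the dense subalgebra of analytic elements. The two orders of
  a product of generators are diagonal for the same overlaps, and \<open>rel\<close> converts one
  value into the other with the factor produced by the flow at
  \<open>\<i> * \<beta>\<close>.\<close>

lemma diagonal_KMS_state:
  assumes \<omega>s: "\<omega> \<in> states A"
    and \<omega>: "\<And>t u. t \<in> lists Y \<Longrightarrow> u \<in> lists Y \<Longrightarrow> val t = val u \<Longrightarrow>
      \<omega> (W t * star (W u)) = (if t = u then complex_of_real (\<phi> t) else 0)"
    and rel: "\<And>t u. t \<in> lists Y \<Longrightarrow> u \<in> lists Y \<Longrightarrow> val t = val u \<Longrightarrow> exp (\<beta> * wt t) * \<phi> t = exp (\<beta> * wt u) * \<phi> u"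
  shows "\<omega> \<in> KMS_states A \<alpha> \<beta>"
proof -
  have \<omega>0: "\<omega> 0 = 0" by (rule state_zero[OF \<omega>s A_subspace])
  have rel': "\<phi> t = exp (- \<beta> * (wt t - wt u)) * \<phi> u" if "t \<in> lists Y" "u \<in> lists Y" "val t = val u" for t u
  proof -
    have "exp (- \<beta> * (wt t - wt u)) = exp (- \<beta> * wt t) * exp (\<beta> * wt u)"
      by (simp add: mult_exp_exp algebra_simps)
    then have "exp (- \<beta> * (wt t - wt u)) * \<phi> u = exp (- \<beta> * wt t) * (exp (\<beta> * wt t) * \<phi> t)"
      using rel[OF that] by simp
    also have "\<dots> = (exp (- \<beta> * wt t) * exp (\<beta> * wt t)) * \<phi> t" by (simp only: mult.assoc)
    also have "\<dots> = \<phi> t" by (simp add: mult_exp_exp)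
    finally show ?thesis by simp
  qed
  have gen: "\<omega> (W t * star (W u) * (W w * star (W v))) =
      exp (- \<beta> * (wt t - wt u)) * \<omega> (W w * star (W v) * (W t * star (W u)))"
    if tu: "t \<in> lists Y" "u \<in> lists Y" "val t = val u" "w \<in> lists Y" "v \<in> lists Y" "val w = val v" for t u w v
  proof -
    have 1: "\<omega> (W t * star (W u) * (W w * star (W v))) =
      (if \<exists>x. w = u @ x \<and> v = t @ x then \<phi> v else if \<exists>x. u = w @ x \<and> t = v @ x then \<phi> t else 0)"
      by (rule diagonal_state_product[OF \<omega> \<omega>0 tu])
    have 2: "\<omega> (W w * star (W v) * (W t * star (W u))) =
      (if \<exists>x. t = v @ x \<and> u = w @ x then \<phi> u else if \<exists>x. v = t @ x \<and> w = u @ x then \<phi> w else 0)"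
      by (rule diagonal_state_product[OF \<omega> \<omega>0 tu(4-6) tu(1-3)])
    consider (a) x where "w = u @ x" "v = t @ x"
      | (b) x where "u = w @ x" "t = v @ x" "\<not> (\<exists>x. w = u @ x \<and> v = t @ x)"
      | (c) "\<not> (\<exists>x. w = u @ x \<and> v = t @ x)" "\<not> (\<exists>x. u = w @ x \<and> t = v @ x)"
      by blast
    then show ?thesis
    proof cases
      case a
      have r: "\<phi> v = exp (- \<beta> * (wt t - wt u)) * \<phi> w" using rel'[of v w] tu a by simp
      \<comment> \<open>Both alternatives of \<open>2\<close> can hold together only for an empty
        overlap, and then they give the same value.\<close>
      have "(\<exists>x. t = v @ x \<and> u = w @ x) \<Longrightarrow> u = w" using a by auto
      then show ?thesis unfolding 1 2 using a r by (auto simp: if_distrib)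
    next
      case b
      have "\<phi> t = exp (- \<beta> * (wt t - wt u)) * \<phi> u" by (rule rel'[OF tu(1-3)])
      then show ?thesis unfolding 1 2 using b by auto
    next
      case c
      have d: "\<not> (\<exists>x. t = v @ x \<and> u = w @ x)" "\<not> (\<exists>x. v = t @ x \<and> w = u @ x)" using c by blast+
      show ?thesis
        unfolding 1 2 if_not_P[OF c(1)] if_not_P[OF c(2)] if_not_P[OF d(1)] if_not_P[OF d(2)] by simp
    qed
  qed
  have mA: "x * y \<in> A" if "x \<in> A" "y \<in> A" for x y using that star_subalgebraD[OF A_star_subalgebra] by blast
  have kms1: "\<omega> (W t * star (W u) * combination l) = exp (- \<beta> * (wt t - wt u)) * \<omega> (combination l * (W t * star (W u)))"
    if tu: "t \<in> lists Y" "u \<in> lists Y" "val t = val u" and l: "admissible l" for t u l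
    using l
  proof (induction l rule: combination_induct)
    case (Cons c w v l)
    have "W t * star (W u) \<in> A" "W w * star (W v) \<in> A" "combination l \<in> A"
      using Cons tu A_gen combination_in_A by auto
    then show ?case using Cons.IH gen[OF tu Cons(1-3)]
      by (simp add: distrib_left distrib_right mult_scaleC_left mult_scaleC_right statesD[OF \<omega>s] mA
          complex_subspaceD[OF A_subspace])
  qed (simp add: \<omega>0)
  have kms: "\<omega> (combination l * combination l') = \<omega> (combination l' * combination (twist (\<i> * \<beta>) l))"
    if l: "admissible l" "admissible l'" for l l'
    using l(1)
  proof (induction l rule: combination_induct)
    case (Cons c t u l)
    have m: "W t * star (W u) \<in> A" "combination l' \<in> A" "combination l \<in> A" "combination (twist (\<i> * \<beta>) l) \<in> A"
      using Cons l A_gen combination_in_A admissible_twist by auto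
    have e: "exp (\<i> * (\<i> * complex_of_real \<beta>) * complex_of_real (wt t - wt u)) = complex_of_real (exp (- \<beta> * (wt t - wt u)))"
      by (simp add: exp_of_real mult.assoc[symmetric] flip: of_real_mult of_real_minus of_real_diff)
    have "\<omega> (combination ((c, t, u) # l) * combination l') =
        c * \<omega> (W t * star (W u) * combination l') + \<omega> (combination l * combination l')"
      using m by (simp add: distrib_right mult_scaleC_left statesD[OF \<omega>s] mA complex_subspaceD[OF A_subspace])
    also have "\<dots> = \<omega> (combination l' * combination (twist (\<i> * \<beta>) ((c, t, u) # l)))"
      using m unfolding Cons.IH kms1[OF Cons(1-3) l(2)] twist_simps combination_simps e
      by (simp add: distrib_left mult_scaleC_right statesD[OF \<omega>s] mA complex_subspaceD[OF A_subspace])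
    finally show ?case .
  qed (simp add: \<omega>0)
  show ?thesis
    unfolding KMS_states_def
  proof (intro CollectI conjI \<omega>s exI[of _ D0] D0_star_subalgebra D0_subset_A allI ballI)
    show "A \<subseteq> closure D0" by (simp add: A_closure)
    show "\<alpha> r ` D0 \<subseteq> D0" for r
      using \<alpha>_combination admissible_twist by (auto simp: D0_def)
    show "D0 \<subseteq> analytic_elements A \<alpha>"
      using entire_extension_combination D0_subset_A by (auto simp: D0_def analytic_elements_def)
    fix a b assume "a \<in> D0" "b \<in> D0"
    then obtain l l' where l: "admissible l" "a = combination l" "admissible l'" "b = combination l'"
      by (auto simp: D0_def)
    then show "\<omega> (a * b) = \<omega> (b * complex_flow A \<alpha> (\<i> * complex_of_real \<beta>) a)"
      using kms[OF l(1,3)] complex_flow_eq[OF entire_extension_combination[OF l(1)]] by simp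
  qed
qed

lemma wt_pos: "t \<in> lists Y \<Longrightarrow> t \<noteq> [] \<Longrightarrow> wt t > 0"
proof (induction t)
  case (Cons s t)
  then show ?case using F_pos[of s] by (cases "t = []") auto
qed simp

definition state_vector :: "('a \<Rightarrow> complex) \<Rightarrow> 'g list \<Rightarrow> real" where
  "state_vector \<omega> t = Re (\<omega> (W t * star (W t)))"

lemma state_vector_real:
  assumes \<omega>: "\<omega> \<in> states A" and t: "t \<in> lists Y"
  shows "\<omega> (W t * star (W t)) = complex_of_real (state_vector \<omega> t)" "state_vector \<omega> t \<ge> 0"
proof -
  have "star (W t * star (W t)) * (W t * star (W t)) = W t * (star (W t) * W t) * star (W t)"
    by (simp add: star_mult star_star mult.assoc)
  then have "star (W t * star (W t)) * (W t * star (W t)) = W t * star (W t)" by (simp add: star_W_W[OF t])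
  then have "\<omega> (W t * star (W t)) \<in> \<real>\<^sub>\<ge>\<^sub>0" using statesD(4)[OF \<omega> A_gen[OF t t refl]] by simp
  then show "\<omega> (W t * star (W t)) = complex_of_real (state_vector \<omega> t)" "state_vector \<omega> t \<ge> 0"
    by (auto simp: state_vector_def complex_nonneg_Reals_iff complex_eq_iff)
qed

lemma state_vector_Nil: "\<omega> \<in> states A \<Longrightarrow> state_vector \<omega> [] = 1"
  by (simp add: state_vector_def statesD)

lemma state_vector_sum:
  assumes \<omega>: "\<omega> \<in> states A" and t: "t \<in> lists Y"
  shows "(\<Sum>s\<in>Y. state_vector \<omega> (t @ [s])) = state_vector \<omega> t"
proof -
  have sum: "\<omega> (\<Sum>i\<in>I. f i) = (\<Sum>i\<in>I. \<omega> (f i))" if "\<And>i. i \<in> I \<Longrightarrow> f i \<in> A" for f and I :: "'g set"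
    using that
    by (induction I rule: infinite_finite_induct)
       (auto simp: state_zero[OF \<omega> A_subspace] statesD(2)[OF \<omega>] complex_subspaceD(7)[OF A_subspace])
  have "W t * star (W t) = W t * (\<Sum>s\<in>Y. V s * star (V s)) * star (W t)"
    using cuntz_V by (simp add: cuntz_family_def)
  also have "\<dots> = (\<Sum>s\<in>Y. W (t @ [s]) * star (W (t @ [s])))"
    by (simp add: sum_distrib_left sum_distrib_right star_mult mult.assoc)
  finally have "W t * star (W t) = (\<Sum>s\<in>Y. W (t @ [s]) * star (W (t @ [s])))" .
  moreover have "\<omega> (\<Sum>s\<in>Y. W (t @ [s]) * star (W (t @ [s]))) = (\<Sum>s\<in>Y. \<omega> (W (t @ [s]) * star (W (t @ [s]))))"
    by (rule sum) (use t in \<open>intro A_gen, auto\<close>)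
  ultimately show ?thesis by (simp add: state_vector_def)
qed

text \<open>If the weights differ, the KMS identity with the unit multiplies the value by a factor
  other than one. If they agree, positivity of \<open>F\<close> keeps either word from being a
  proper prefix of the other, so their ranges are orthogonal, and the identity with
  \<open>W u * star (W u)\<close> gives zero. The relation between diagonal values is the identity
  with \<open>W u * star (W t)\<close>.\<close>

lemma KMS_state_diagonal:
  assumes \<omega>: "\<omega> \<in> KMS_states A \<alpha> \<beta>" and \<beta>: "\<beta> > 0"
    and tu: "t \<in> lists Y" "u \<in> lists Y" "val t = val u"
  shows "t \<noteq> u \<Longrightarrow> \<omega> (W t * star (W u)) = 0"
    and "exp (\<beta> * wt t) * state_vector \<omega> t = exp (\<beta> * wt u) * state_vector \<omega> u"
proof -
  have \<omega>s: "\<omega> \<in> states A" using \<omega> by (simp add: KMS_states_def)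
  have kms: "\<omega> (W t * star (W u) * b) = exp (- \<beta> * (wt t - wt u)) * \<omega> (b * (W t * star (W u)))" if "b \<in> A" for b
    by (rule KMS_state_eigenvector[OF B_props A_props A_subset_B one_parameter \<alpha>_one \<omega> A_gen[OF tu] \<alpha>_gen[OF tu(1,2)] that])
  show "\<omega> (W t * star (W u)) = 0" if ne: "t \<noteq> u"
  proof (cases "wt t = wt u")
    case False
    have "\<omega> (W t * star (W u)) = exp (- \<beta> * (wt t - wt u)) * \<omega> (W t * star (W u))" using kms[OF one_A] by simp
    moreover have "exp (- \<beta> * (wt t - wt u)) \<noteq> 1" using False \<beta> by simp
    ultimately show ?thesis by (metis mult_cancel_right1 of_real_eq_1_iff)
  next
    case True
    have "star (W u) * W t = 0"
    proof (rule words_comparable[of t u])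
      fix x assume "t = u @ x"
      then show ?thesis using True ne wt_pos[of x] tu by (cases "x = []") auto
    next
      fix x assume "u = t @ x" "x \<noteq> []"
      then show ?thesis using True wt_pos[of x] tu by auto
    next
      fix i assume "i < length u" "i < length t" "u ! i \<noteq> t ! i"
      then show ?thesis using tu by (intro star_W_W_differ) auto
    qed
    then have "W u * star (W u) * (W t * star (W u)) = 0"
      by (metis (no_types, lifting) mult.assoc mult_zero_left mult_zero_right)
    moreover have "W t * star (W u) * (W u * star (W u)) = W t * (star (W u) * W u) * star (W u)" by (simp only: mult.assoc)
    ultimately show ?thesis
      using kms[OF A_gen[OF tu(2,2) refl]] star_W_W[OF tu(2)] state_zero[OF \<omega>s A_subspace] by simp
  qed
  have "W t * star (W u) * (W u * star (W t)) = W t * (star (W u) * W u) * star (W t)"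
    "W u * star (W t) * (W t * star (W u)) = W u * (star (W t) * W t) * star (W u)" by (simp_all only: mult.assoc)
  then have "\<omega> (W t * star (W t)) = exp (- \<beta> * (wt t - wt u)) * \<omega> (W u * star (W u))"
    using kms[OF A_gen[OF tu(2,1) tu(3)[symmetric]]] star_W_W tu by simp
  then have "state_vector \<omega> t = exp (- \<beta> * (wt t - wt u)) * state_vector \<omega> u"
    by (simp add: state_vector_def)
  then have "exp (\<beta> * wt t) * state_vector \<omega> t =
      (exp (\<beta> * wt t) * exp (- \<beta> * (wt t - wt u))) * state_vector \<omega> u" by (simp only: mult.assoc)
  also have "exp (\<beta> * wt t) * exp (- \<beta> * (wt t - wt u)) = exp (\<beta> * wt u)"
    by (simp add: mult_exp_exp algebra_simps)
  finally show "exp (\<beta> * wt t) * state_vector \<omega> t = exp (\<beta> * wt u) * state_vector \<omega> u" .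
qed

subsection \<open>Abelian KMS states\<close>

lemma val_surj: "g \<in> carrier G \<Longrightarrow> \<exists>t\<in>lists Y. val t = g"
  using generates by (auto simp: generates_as_semigroup_def)

lemma KMS_vector_eq:
  assumes "\<And>t. t \<in> lists Y \<Longrightarrow> exp (\<beta> * wt t) * state_vector \<omega> t = \<psi> (val t)" "g \<in> carrier G"
  shows "KMS_vector G Y V F \<beta> \<omega> g = \<psi> g"
proof -
  define t where "t = (SOME t. t \<in> lists Y \<and> val t = g)"
  have "t \<in> lists Y \<and> val t = g" unfolding t_def by (rule someI_ex) (use val_surj[OF assms(2)] in blast)
  then show ?thesis using assms(1)[of t] by (simp add: KMS_vector_def t_def[symmetric] state_vector_def)
qed

lemma abelian_KMS_stateI:
  assumes \<omega>s: "\<omega> \<in> states A"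
    and \<omega>: "\<And>t u. t \<in> lists Y \<Longrightarrow> u \<in> lists Y \<Longrightarrow> val t = val u \<Longrightarrow> t \<noteq> u \<Longrightarrow> \<omega> (W t * star (W u)) = 0"
    and \<psi>: "\<And>t. t \<in> lists Y \<Longrightarrow> exp (\<beta> * wt t) * state_vector \<omega> t = \<psi> (val t)"
    and ab: "\<And>h g k. h \<in> carrier G \<Longrightarrow> g \<in> carrier G \<Longrightarrow> k \<in> carrier G \<Longrightarrow> \<psi> (h \<otimes> g \<otimes> k) = \<psi> (h \<otimes> k \<otimes> g)"
  shows "\<omega> \<in> abelian_KMS_states G Y V F \<alpha> \<beta>"
proof -
  have "\<omega> \<in> KMS_states A \<alpha> \<beta>"
    by (rule diagonal_KMS_state[OF \<omega>s, where \<phi> = "state_vector \<omega>"])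
       (use \<omega> \<psi> state_vector_real(1)[OF \<omega>s] in auto)
  moreover have "KMS_vector G Y V F \<beta> \<omega> g = \<psi> g" if "g \<in> carrier G" for g
    by (rule KMS_vector_eq[OF \<psi> that])
  ultimately show ?thesis unfolding abelian_KMS_states_def A_def[symmetric] using ab by auto
qed

text \<open>Letters are moved to the front one at a time; the group element \<open>h\<close> in the
  induction collects the letters already in place. Words with the same letters have the same weight,
  so invariance of the KMS vector becomes invariance of the probabilities.\<close>

lemma abelian_KMS_state_exchangeable:
  assumes \<omega>: "\<omega> \<in> abelian_KMS_states G Y V F \<alpha> \<beta>" and \<beta>: "\<beta> > 0"
    and tu: "t \<in> lists Y" "u \<in> lists Y" "mset t = mset u"
  shows "state_vector \<omega> t = state_vector \<omega> u"
proof -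
  have k: "\<omega> \<in> KMS_states A \<alpha> \<beta>" using \<omega> by (simp add: abelian_KMS_states_def A_def)
  define \<psi> where "\<psi> = KMS_vector G Y V F \<beta> \<omega>"
  have \<psi>: "exp (\<beta> * wt t) * state_vector \<omega> t = \<psi> (val t)" if t: "t \<in> lists Y" for t
  proof -
    define u where "u = (SOME u. u \<in> lists Y \<and> val u = val t)"
    have "u \<in> lists Y \<and> val u = val t" unfolding u_def by (rule someI_ex) (use t in blast)
    then show ?thesis
      using KMS_state_diagonal(2)[OF k \<beta> t, of u]
      by (simp add: \<psi>_def KMS_vector_def u_def[symmetric] state_vector_def)
  qed
  have ab: "\<psi> (h \<otimes> (g \<otimes> k)) = \<psi> (h \<otimes> (k \<otimes> g))" if "h \<in> carrier G" "g \<in> carrier G" "k \<in> carrier G" for h g k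
    using \<omega> that by (simp add: abelian_KMS_states_def \<psi>_def m_assoc)
  have "\<psi> (h \<otimes> val t) = \<psi> (h \<otimes> val u)" if "h \<in> carrier G" for h
    using tu that
  proof (induction u arbitrary: t h)
    case (Cons s u)
    obtain t1 t2 where t: "t = t1 @ s # t2"
      using Cons.prems(3) by (metis list.set_intros(1) set_mset_mset split_list)
    have sY: "s \<in> carrier G" using Cons.prems Y_carrier by auto
    have tY: "t1 \<in> lists Y" "t2 \<in> lists Y" using Cons.prems t by auto
    note c = val_closed[OF tY(1)] val_closed[OF tY(2)] sY Cons.prems(4)
    have "\<psi> (h \<otimes> val t) = \<psi> (h \<otimes> (val t1 \<otimes> (s \<otimes> val t2)))"
      using tY Cons.prems by (subst t, subst val_append) auto
    also have "\<dots> = \<psi> (h \<otimes> ((s \<otimes> val t2) \<otimes> val t1))" using c by (intro ab) auto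
    also have "\<dots> = \<psi> ((h \<otimes> s) \<otimes> (val t2 \<otimes> val t1))" using c by (simp add: m_assoc)
    also have "\<dots> = \<psi> ((h \<otimes> s) \<otimes> (val t1 \<otimes> val t2))" using c by (intro ab) auto
    also have "\<dots> = \<psi> ((h \<otimes> s) \<otimes> val (t1 @ t2))" using tY by (simp add: val_append)
    also have "\<dots> = \<psi> ((h \<otimes> s) \<otimes> val u)"
      by (rule Cons.IH) (use Cons.prems c tY t in auto)
    also have "\<dots> = \<psi> (h \<otimes> val (s # u))" using c val_closed[of u] Cons.prems by (simp add: m_assoc)
    finally show ?case .
  qed simp
  from this[of \<one>] have "\<psi> (val t) = \<psi> (val u)" using tu val_closed by simp
  moreover have "wt t = wt u" using tu(3) unfolding word_weight_def by (metis mset_map sum_mset_sum_list)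
  ultimately have "exp (\<beta> * wt u) * state_vector \<omega> t = exp (\<beta> * wt u) * state_vector \<omega> u"
    using \<psi>[OF tu(1)] \<psi>[OF tu(2)] by simp
  then show ?thesis by simp
qed

end

section \<open>De Finetti's theorem for finite alphabets\<close>

text \<open>
  The law of an exchangeable sequence is realised on \<open>[0,1)\<close> by nested intervals \<open>I r\<close> of length
  \<open>p r\<close>, where \<open>r\<close> lists the letters seen so far, the last one first. The predictive probabilities
  \<open>k r s\<close> of the next letter form a bounded martingale, and along a subsequence they converge almost
  everywhere to the directing random distribution.
\<close>

locale exchangeable =
  fixes Y :: "'g set" and p :: "'g list \<Rightarrow> real"
  assumes finite_alphabet: "finite Y"
    and p_nonneg: "r \<in> lists Y \<Longrightarrow> p r \<ge> 0" and p_Nil: "p [] = 1"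
    and p_sum: "r \<in> lists Y \<Longrightarrow> (\<Sum>s\<in>Y. p (s # r)) = p r"
    and p_perm: "t \<in> lists Y \<Longrightarrow> u \<in> lists Y \<Longrightarrow> mset t = mset u \<Longrightarrow> p t = p u"
begin

definition paths :: "nat \<Rightarrow> 'g list set" where
  "paths n = {r \<in> lists Y. length r = n}"

lemma finite_paths: "finite (paths n)"
  using finite_lists_length_eq[OF finite_alphabet, of n] by (simp add: paths_def lists_eq_set Collect_conj_eq conj_commute)

lemma paths_lists: "r \<in> paths n \<Longrightarrow> r \<in> lists Y"
  by (simp add: paths_def)

lemma paths_0: "paths 0 = {[]}" by (auto simp: paths_def)

lemma paths_Suc: "paths (Suc n) = (\<lambda>(r, s). s # r) ` (paths n \<times> Y)"
  by (auto simp: paths_def length_Suc_conv image_iff)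

lemma sum_paths_Suc: "(\<Sum>r\<in>paths (Suc n). f r) = (\<Sum>r\<in>paths n. \<Sum>s\<in>Y. f (s # r))"
  unfolding paths_Suc by (subst sum.reindex) (auto simp: inj_on_def sum.cartesian_product case_prod_beta)

lemma sum_paths_add: "(\<Sum>r\<in>paths (j + n). f r) = (\<Sum>r\<in>paths n. \<Sum>u\<in>paths j. f (u @ r))"
proof (induction j arbitrary: f)
  case (Suc j)
  have "(\<Sum>r\<in>paths (Suc j + n). f r) = (\<Sum>r\<in>paths (j + n). \<Sum>s\<in>Y. f (s # r))"
    using sum_paths_Suc[of f "j + n"] by simp
  also have "\<dots> = (\<Sum>r\<in>paths n. \<Sum>u\<in>paths j. \<Sum>s\<in>Y. f (s # u @ r))" by (rule Suc)
  also have "\<dots> = (\<Sum>r\<in>paths n. \<Sum>u\<in>paths (Suc j). f (u @ r))" unfolding sum_paths_Suc by simp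
  finally show ?case .
qed (simp add: paths_0)

lemma sum_p_extend: "r \<in> lists Y \<Longrightarrow> (\<Sum>u\<in>paths j. p (u @ r)) = p r"
proof (induction j)
  case (Suc j)
  have "(\<Sum>u\<in>paths (Suc j). p (u @ r)) = (\<Sum>u\<in>paths j. \<Sum>s\<in>Y. p (s # (u @ r)))" unfolding sum_paths_Suc by simp
  also have "\<dots> = (\<Sum>u\<in>paths j. p (u @ r))"
  proof (rule sum.cong)
    fix u assume "u \<in> paths j"
    then have "u @ r \<in> lists Y" using Suc.prems paths_lists[of u j] by simp
    then show "(\<Sum>s\<in>Y. p (s # (u @ r))) = p (u @ r)" by (rule p_sum)
  qed simp
  finally show ?case using Suc by simp
qed (simp add: paths_0)

lemma sum_p_paths: "(\<Sum>r\<in>paths n. p r) = 1"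
  using sum_p_extend[of "[]" n] p_Nil by simp

text \<open>After a prefix of probability zero the quotient is 0 by convention, so the values over
  all letters are only known to sum to at most one.\<close>

definition k :: "'g list \<Rightarrow> 'g \<Rightarrow> real" where "k r s = p (s # r) / p r"

lemma p_Cons_le: "r \<in> lists Y \<Longrightarrow> s \<in> Y \<Longrightarrow> p (s # r) \<le> p r"
  using member_le_sum[of s Y "\<lambda>s. p (s # r)"] finite_alphabet p_nonneg p_sum[of r] by auto

lemma p_k: "r \<in> lists Y \<Longrightarrow> s \<in> Y \<Longrightarrow> p r * k r s = p (s # r)"
  using p_Cons_le[of r s] p_nonneg[of "s # r"] by (auto simp: k_def)

lemma k_bounds: "r \<in> lists Y \<Longrightarrow> s \<in> Y \<Longrightarrow> 0 \<le> k r s" "r \<in> lists Y \<Longrightarrow> s \<in> Y \<Longrightarrow> k r s \<le> 1"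
  using p_Cons_le[of r s] p_nonneg[of "s # r"] p_nonneg[of r] by (auto simp: k_def divide_le_eq)

lemma sum_k_le: "r \<in> lists Y \<Longrightarrow> (\<Sum>s\<in>Y. k r s) \<le> 1"
  unfolding k_def sum_divide_distrib[symmetric] p_sum by simp

text \<open>By exchangeability the letter \<open>s\<close> may be drawn before the block
  \<open>u\<close>, whose probabilities then sum out.\<close>

lemma martingale:
  assumes r: "r \<in> lists Y" "s \<in> Y"
  shows "(\<Sum>u\<in>paths j. p (u @ r) * k (u @ r) s) = p r * k r s"
proof -
  have "(\<Sum>u\<in>paths j. p (u @ r) * k (u @ r) s) = (\<Sum>u\<in>paths j. p (u @ (s # r)))"
  proof (rule sum.cong)
    fix u assume "u \<in> paths j"
    then have u: "u \<in> lists Y" by (rule paths_lists)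
    have "p (u @ r) * k (u @ r) s = p (s # u @ r)" using u r by (intro p_k) auto
    also have "\<dots> = p (u @ (s # r))" by (rule p_perm) (use u r in auto)
    finally show "p (u @ r) * k (u @ r) s = p (u @ (s # r))" .
  qed simp
  also have "\<dots> = p (s # r)" by (rule sum_p_extend) (use r in auto)
  finally show ?thesis using p_k[OF r] by simp
qed

text \<open>Second moment of the predictive probability after \<open>n\<close> letters. Martingale
  increments are orthogonal, so its growth is exactly the mean squared increment.\<close>

definition e :: "'g \<Rightarrow> nat \<Rightarrow> real" where "e s n = (\<Sum>r\<in>paths n. p r * (k r s)\<^sup>2)"

lemma e_diff:
  assumes s: "s \<in> Y"
  shows "(\<Sum>r\<in>paths n. \<Sum>u\<in>paths j. p (u @ r) * (k (u @ r) s - k r s)\<^sup>2) = e s (j + n) - e s n"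
proof -
  have "(\<Sum>u\<in>paths j. p (u @ r) * (k (u @ r) s - k r s)\<^sup>2) =
     (\<Sum>u\<in>paths j. p (u @ r) * (k (u @ r) s)\<^sup>2) - p r * (k r s)\<^sup>2" if r: "r \<in> paths n" for r
  proof -
    have "(\<Sum>u\<in>paths j. p (u @ r) * (k (u @ r) s - k r s)\<^sup>2) =
      (\<Sum>u\<in>paths j. p (u @ r) * (k (u @ r) s)\<^sup>2) - 2 * k r s * (\<Sum>u\<in>paths j. p (u @ r) * k (u @ r) s)
       + (k r s)\<^sup>2 * (\<Sum>u\<in>paths j. p (u @ r))"
      unfolding sum_distrib_left sum_subtractf[symmetric] sum.distrib[symmetric]
      by (rule sum.cong) (auto simp: power2_eq_square algebra_simps)
    also have "\<dots> = (\<Sum>u\<in>paths j. p (u @ r) * (k (u @ r) s)\<^sup>2) - p r * (k r s)\<^sup>2"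
      using martingale[OF paths_lists[OF r] s] sum_p_extend[OF paths_lists[OF r]]
      by (simp add: power2_eq_square algebra_simps)
    finally show ?thesis .
  qed
  then show ?thesis unfolding e_def by (simp add: sum_subtractf sum_paths_add)
qed

lemma e_Cauchy:
  assumes s: "s \<in> Y" and \<epsilon>: "\<epsilon> > 0"
  shows "\<exists>N. \<forall>n\<ge>N. \<forall>j. e s (j + n) - e s n < \<epsilon>"
proof -
  have mono: "e s n \<le> e s (j + n)" for n j
  proof -
    have "0 \<le> (\<Sum>r\<in>paths n. \<Sum>u\<in>paths j. p (u @ r) * (k (u @ r) s - k r s)\<^sup>2)"
      using paths_lists by (intro sum_nonneg mult_nonneg_nonneg p_nonneg) auto
    then show ?thesis using e_diff[OF s] by simp
  qed
  have "incseq (e s)" unfolding incseq_Suc_iff using mono[of _ 1] by simp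
  moreover have "e s n \<le> 1" for n
  proof -
    have "e s n \<le> (\<Sum>r\<in>paths n. p r * 1)" unfolding e_def
      using k_bounds[OF paths_lists s] p_nonneg[OF paths_lists]
      by (intro sum_mono mult_left_mono) (auto simp: power_le_one)
    then show ?thesis by (simp add: sum_p_paths)
  qed
  ultimately obtain l where "e s \<longlonglongrightarrow> l" using incseq_convergent by metis
  then have "Cauchy (e s)" by (rule LIMSEQ_imp_Cauchy)
  then obtain N where "\<forall>m\<ge>N. \<forall>n\<ge>N. dist (e s m) (e s n) < \<epsilon>" using \<epsilon> unfolding Cauchy_def by blast
  have "e s (j + n) - e s n < \<epsilon>" if "n \<ge> N" for n j
  proof -
    have "dist (e s (j + n)) (e s n) < \<epsilon>"
      using \<open>\<forall>m\<ge>N. \<forall>n\<ge>N. dist (e s m) (e s n) < \<epsilon>\<close> that by simp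
    then show ?thesis by (simp add: dist_real_def)
  qed
  then show ?thesis by blast
qed

subsection \<open>The interval model\<close>

definition idx :: "'g \<Rightarrow> nat" where "idx = (SOME f. inj_on f Y)"

lemma inj_idx: "inj_on idx Y"
  unfolding idx_def using finite_imp_inj_to_nat_seg[OF finite_alphabet] by (intro someI_ex[of "\<lambda>f. inj_on f Y"]) auto

primrec L :: "'g list \<Rightarrow> real" where
  "L [] = 0"
| "L (s # r) = L r + (\<Sum>s'\<in>{s' \<in> Y. idx s' < idx s}. p (s' # r))"

definition I :: "'g list \<Rightarrow> real set" where "I r = {L r ..< L r + p r}"

lemma I_Cons_subset:
  assumes r: "r \<in> lists Y" "s \<in> Y"
  shows "I (s # r) \<subseteq> I r"
proof -
  have "(\<Sum>s'\<in>{s' \<in> Y. idx s' < idx s}. p (s' # r)) + p (s # r) = (\<Sum>s'\<in>insert s {s' \<in> Y. idx s' < idx s}. p (s' # r))"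
    using finite_alphabet by simp
  also have "\<dots> \<le> (\<Sum>s'\<in>Y. p (s' # r))"
    using finite_alphabet r p_nonneg by (intro sum_mono2) auto
  also have "\<dots> = p r" by (rule p_sum[OF r(1)])
  finally have "(\<Sum>s'\<in>{s' \<in> Y. idx s' < idx s}. p (s' # r)) + p (s # r) \<le> p r" .
  moreover have "(\<Sum>s'\<in>{s' \<in> Y. idx s' < idx s}. p (s' # r)) \<ge> 0" using r p_nonneg by (intro sum_nonneg) auto
  ultimately show ?thesis by (auto simp: I_def)
qed

lemma I_append_subset: "u \<in> lists Y \<Longrightarrow> r \<in> lists Y \<Longrightarrow> I (u @ r) \<subseteq> I r"
proof (induction u)
  case (Cons s u)
  then show ?case using I_Cons_subset[of "u @ r" s] by auto
qed simp

lemma I_subset: "r \<in> lists Y \<Longrightarrow> I r \<subseteq> {0..<1}"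
  using I_append_subset[of r "[]"] by (simp add: I_def p_Nil)

lemma I_siblings:
  assumes "r \<in> lists Y" "s \<in> Y" "s' \<in> Y" "idx s < idx s'"
  shows "I (s # r) \<inter> I (s' # r) = {}"
proof -
  have "(\<Sum>v\<in>{v \<in> Y. idx v < idx s}. p (v # r)) + p (s # r) = (\<Sum>v\<in>insert s {v \<in> Y. idx v < idx s}. p (v # r))"
    using finite_alphabet by simp
  also have "\<dots> \<le> (\<Sum>v\<in>{v \<in> Y. idx v < idx s'}. p (v # r))"
    using finite_alphabet assms p_nonneg by (intro sum_mono2) auto
  finally show ?thesis by (auto simp: I_def)
qed

lemma I_disjoint: "r \<in> paths n \<Longrightarrow> r' \<in> paths n \<Longrightarrow> r \<noteq> r' \<Longrightarrow> I r \<inter> I r' = {}"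
proof (induction n arbitrary: r r')
  case (Suc n)
  then obtain s t s' t' where r: "r = s # t" "r' = s' # t'" "s \<in> Y" "s' \<in> Y" "t \<in> paths n" "t' \<in> paths n"
    by (auto simp: paths_Suc)
  show ?case
  proof (cases "t = t'")
    case True
    then have "idx s \<noteq> idx s'" using Suc.prems r inj_idx by (auto simp: inj_on_def)
    then show ?thesis
      using I_siblings[of t s s'] I_siblings[of t s' s] True r paths_lists by (auto simp: neq_iff)
  next
    case False
    then have "I t \<inter> I t' = {}" using Suc.IH r by blast
    then show ?thesis using I_Cons_subset[of t s] I_Cons_subset[of t' s'] r paths_lists by blast
  qed
qed (simp add: paths_0)

definition M :: "real measure" where "M = restrict_space lborel {0..<1}"

lemma space_M: "space M = {0..<1}" by (simp add: M_def space_restrict_space)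

lemma I_sets: "r \<in> lists Y \<Longrightarrow> I r \<in> sets M"
  using I_subset[of r] by (simp add: M_def sets_restrict_space_iff I_def)

lemma measure_I: "r \<in> lists Y \<Longrightarrow> measure M (I r) = p r"
  unfolding M_def using I_subset[of r] p_nonneg[of r] by (subst measure_restrict_space) (auto simp: I_def)

lemma emeasure_M: "emeasure M (space M) = 1"
  unfolding space_M unfolding M_def by (subst emeasure_restrict_space) auto

sublocale finite_measure M
  by (rule finite_measureI) (simp add: emeasure_M)

lemma measure_M: "measure M (space M) = 1"
  by (simp add: measure_def emeasure_M)

text \<open>A function \<open>h\<close> of the first \<open>n\<close> letters, viewed as a random
  variable on the interval.\<close>

definition S :: "nat \<Rightarrow> ('g list \<Rightarrow> real) \<Rightarrow> real \<Rightarrow> real" where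
  "S n h x = (\<Sum>r\<in>paths n. h r * indicator (I r) x)"

lemma S_eval:
  assumes "r \<in> paths n" "x \<in> I r"
  shows "S n h x = h r"
proof -
  have "S n h x = (\<Sum>r'\<in>paths n. if r' = r then h r' else 0)"
    unfolding S_def by (rule sum.cong) (use assms I_disjoint[of r n] in \<open>auto simp: indicator_def\<close>)
  then show ?thesis using assms finite_paths by simp
qed

lemma S_zero: "(\<And>r. r \<in> paths n \<Longrightarrow> x \<notin> I r) \<Longrightarrow> S n h x = 0"
  by (simp add: S_def)

lemma S_cases:
  obtains (one) r where "r \<in> paths n" "x \<in> I r" "\<And>h. S n h x = h r" | (zero) "\<And>h. S n h x = 0"
  using S_eval S_zero by metis

text \<open>Since the newest letter stands first, the first \<open>n\<close> letters drawn are
  recovered from a longer path by \<open>drop j\<close>.\<close>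

lemma S_mult: "S (j + n) g x * S n h x = S (j + n) (\<lambda>r. g r * h (drop j r)) x"
proof (cases rule: S_cases[of "j + n" x])
  case (one r)
  have "take j r \<in> lists Y" "drop j r \<in> lists Y" "length (drop j r) = n"
    using one(1) by (auto simp: paths_def dest: in_set_takeD in_set_dropD)
  moreover from this have "x \<in> I (drop j r)" using I_append_subset[of "take j r" "drop j r"] one(2) by auto
  ultimately have "S n h x = h (drop j r)" by (intro S_eval) (auto simp: paths_def)
  then show ?thesis using one(3) by simp
qed simp

lemma S_measurable [measurable]: "S n h \<in> borel_measurable M"
  unfolding S_def
  by (intro borel_measurable_sum borel_measurable_times borel_measurable_const borel_measurable_indicator I_sets paths_lists)

lemma S_integral: "integrable M (S n h)" "integral\<^sup>L M (S n h) = (\<Sum>r\<in>paths n. h r * p r)"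
proof -
  have i: "integrable M (\<lambda>x. h r * indicator (I r) x)" if "r \<in> paths n" for r
    by (intro integrable_mult_right integrable_real_indicator I_sets[OF paths_lists[OF that]])
       (simp add: emeasure_eq_measure)
  then show "integrable M (S n h)" unfolding S_def by (intro Bochner_Integration.integrable_sum)
  show "integral\<^sup>L M (S n h) = (\<Sum>r\<in>paths n. h r * p r)"
    unfolding S_def using i
    by (subst Bochner_Integration.integral_sum)
       (auto intro!: sum.cong simp: measure_I[OF paths_lists] I_sets[OF paths_lists]
         Int_absorb2 sets.sets_into_space)
qed

definition pred :: "nat \<Rightarrow> 'g \<Rightarrow> real \<Rightarrow> real" where "pred n s = S n (\<lambda>r. k r s)"

lemma pred_measurable [measurable]: "pred n s \<in> borel_measurable M"
  by (simp add: pred_def)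

lemma pred_bounds:
  assumes "s \<in> Y" shows "0 \<le> pred n s x" "pred n s x \<le> 1"
  using assms k_bounds paths_lists unfolding pred_def
  by (cases rule: S_cases[of n x]; force)+

lemma sum_pred_le: "(\<Sum>s\<in>Y. pred n s x) \<le> 1"
  using sum_k_le paths_lists unfolding pred_def by (cases rule: S_cases[of n x]; force)

lemma pred_L2:
  assumes s: "s \<in> Y"
  shows "integrable M (\<lambda>x. (pred (j + n) s x - pred n s x)\<^sup>2)"
    "(LINT x|M. (pred (j + n) s x - pred n s x)\<^sup>2) = e s (j + n) - e s n"
proof -
  have eq: "(pred (j + n) s x - pred n s x)\<^sup>2 =
     S (j + n) (\<lambda>r. (k r s)\<^sup>2) x - 2 * S (j + n) (\<lambda>r. k r s * k (drop j r) s) x + S n (\<lambda>r. (k r s)\<^sup>2) x" for x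
    using S_mult[of 0 "j + n" "\<lambda>r. k r s" x "\<lambda>r. k r s"] S_mult[of 0 n "\<lambda>r. k r s" x "\<lambda>r. k r s"]
      S_mult[of j n "\<lambda>r. k r s" x "\<lambda>r. k r s"]
    by (simp add: pred_def power2_eq_square algebra_simps)
  show "integrable M (\<lambda>x. (pred (j + n) s x - pred n s x)\<^sup>2)"
    unfolding eq by (intro Bochner_Integration.integrable_add Bochner_Integration.integrable_diff integrable_mult_right S_integral)
  have "(LINT x|M. (pred (j + n) s x - pred n s x)\<^sup>2) =
      (\<Sum>r\<in>paths (j + n). (k r s)\<^sup>2 * p r) - 2 * (\<Sum>r\<in>paths (j + n). k r s * k (drop j r) s * p r) + (\<Sum>r\<in>paths n. (k r s)\<^sup>2 * p r)"
    unfolding eq using S_integral by simp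
  also have "(\<Sum>r\<in>paths (j + n). k r s * k (drop j r) s * p r) = (\<Sum>r\<in>paths n. \<Sum>u\<in>paths j. k r s * (p (u @ r) * k (u @ r) s))"
    unfolding sum_paths_add by (intro sum.cong) (auto simp: paths_def)
  also have "\<dots> = (\<Sum>r\<in>paths n. (k r s)\<^sup>2 * p r)"
    unfolding sum_distrib_left[symmetric]
    by (rule sum.cong) (auto simp: martingale[OF paths_lists s] power2_eq_square)
  finally show "(LINT x|M. (pred (j + n) s x - pred n s x)\<^sup>2) = e s (j + n) - e s n"
    by (simp add: e_def mult.commute)
qed

text \<open>Takes the role of the Cauchy-Schwarz inequality in passing from mean squares to mean
  absolute values; \<open>c\<close> is chosen as a bound for the root mean square.\<close>

lemma abs_le_square_mean: "c > 0 \<Longrightarrow> \<bar>x\<bar> \<le> (x\<^sup>2 / c + c) / (2::real)"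
proof -
  assume c: "c > 0"
  have "0 \<le> (\<bar>x\<bar> - c)\<^sup>2 / c" using c by simp
  then show ?thesis using c by (simp add: power2_diff field_simps) (simp add: power2_eq_square)
qed

lemma pred_L1:
  assumes s: "s \<in> Y" and c: "c > 0" "e s (j + n) - e s n \<le> c\<^sup>2"
  shows "integrable M (\<lambda>x. \<bar>pred (j + n) s x - pred n s x\<bar>)"
    "(LINT x|M. \<bar>pred (j + n) s x - pred n s x\<bar>) \<le> c"
proof -
  show i: "integrable M (\<lambda>x. \<bar>pred (j + n) s x - pred n s x\<bar>)"
    unfolding pred_def by (intro integrable_abs Bochner_Integration.integrable_diff S_integral)
  have "(LINT x|M. \<bar>pred (j + n) s x - pred n s x\<bar>) \<le> (LINT x|M. ((pred (j + n) s x - pred n s x)\<^sup>2 / c + c) / 2)"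
    by (rule integral_mono[OF i]) (use pred_L2(1)[OF s] abs_le_square_mean[OF c(1)] in auto)
  also have "\<dots> = ((e s (j + n) - e s n) / c + c) / 2"
    using pred_L2[OF s] by (simp add: measure_M)
  also have "\<dots> \<le> (c\<^sup>2 / c + c) / 2" using c by (intro divide_right_mono add_mono) auto
  also have "\<dots> = c" using c by (simp add: power2_eq_square)
  finally show "(LINT x|M. \<bar>pred (j + n) s x - pred n s x\<bar>) \<le> c" .
qed

text \<open>By exchangeability a letter may be drawn after the letters \<open>u\<close> instead of before them, which
  changes its predictive probability by little.\<close>

lemma moment_limit:
  assumes "t \<in> lists Y" "u \<in> lists Y"
  shows "(\<lambda>n. \<Sum>r\<in>paths n. p (u @ r) * prod_list (map (k r) t)) \<longlonglongrightarrow> p (u @ t)"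
  using assms
proof (induction t arbitrary: u)
  case Nil
  have "(\<Sum>r\<in>paths n. p (u @ r)) = p u" for n
  proof -
    have "(\<Sum>r\<in>paths n. p (u @ r)) = (\<Sum>r\<in>paths n. p (r @ u))"
    proof (rule sum.cong)
      fix r assume "r \<in> paths n"
      then have "r \<in> lists Y" by (rule paths_lists)
      then show "p (u @ r) = p (r @ u)" using Nil by (intro p_perm) auto
    qed simp
    then show ?thesis using sum_p_extend Nil by simp
  qed
  then show ?case by simp
next
  case (Cons s t)
  have s: "s \<in> Y" and t: "t \<in> lists Y" using Cons by auto
  define j where "j = length u"
  have uj: "u \<in> paths j" using Cons by (simp add: paths_def j_def)
  define a where "a n = (\<Sum>r\<in>paths n. p (u @ r) * prod_list (map (k r) (s # t)))" for n
  define b where "b n = (\<Sum>r\<in>paths n. p ((s # u) @ r) * prod_list (map (k r) t))" for n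
  have mon: "0 \<le> prod_list (map (k r) t) \<and> prod_list (map (k r) t) \<le> 1" if "r \<in> lists Y" for r
    using t by (induction t) (auto intro!: mult_nonneg_nonneg mult_le_one k_bounds that)
  have lb: "b \<longlonglongrightarrow> p ((s # u) @ t)" unfolding b_def by (rule Cons.IH) (use Cons in auto)
  have diff: "\<bar>a n - b n\<bar> \<le> c" if c: "c > 0" "e s (j + n) - e s n \<le> c\<^sup>2" for n c
  proof -
    have "a n - b n = (\<Sum>r\<in>paths n. p (u @ r) * (k r s - k (u @ r) s) * prod_list (map (k r) t))"
      unfolding a_def b_def sum_subtractf[symmetric]
    proof (rule sum.cong)
      fix r assume "r \<in> paths n"
      then have "p ((s # u) @ r) = p (u @ r) * k (u @ r) s" using p_k[of "u @ r" s] Cons paths_lists by auto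
      then show "p (u @ r) * prod_list (map (k r) (s # t)) - p ((s # u) @ r) * prod_list (map (k r) t) =
        p (u @ r) * (k r s - k (u @ r) s) * prod_list (map (k r) t)" by (simp add: algebra_simps)
    qed simp
    also have "\<bar>\<dots>\<bar> \<le> (\<Sum>r\<in>paths n. \<bar>p (u @ r) * (k r s - k (u @ r) s) * prod_list (map (k r) t)\<bar>)"
      by (rule sum_abs)
    also have "\<dots> \<le> (\<Sum>r\<in>paths n. p (u @ r) * (((k (u @ r) s - k r s)\<^sup>2 / c + c) / 2))"
    proof (rule sum_mono)
      fix r assume "r \<in> paths n"
      then have r: "r \<in> lists Y" by (rule paths_lists)
      have pu: "p (u @ r) \<ge> 0" using p_nonneg[of "u @ r"] r Cons by auto
      have "\<bar>p (u @ r) * (k r s - k (u @ r) s) * prod_list (map (k r) t)\<bar> =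
         p (u @ r) * (\<bar>k (u @ r) s - k r s\<bar> * prod_list (map (k r) t))"
        using pu mon[OF r] by (simp add: abs_mult abs_minus_commute)
      also have "\<dots> \<le> p (u @ r) * (\<bar>k (u @ r) s - k r s\<bar> * 1)"
        using pu mon[OF r] by (intro mult_left_mono) auto
      also have "\<dots> \<le> p (u @ r) * (((k (u @ r) s - k r s)\<^sup>2 / c + c) / 2)"
        using abs_le_square_mean[OF c(1)] pu by (intro mult_left_mono) auto
      finally show "\<bar>p (u @ r) * (k r s - k (u @ r) s) * prod_list (map (k r) t)\<bar> \<le>
          p (u @ r) * (((k (u @ r) s - k r s)\<^sup>2 / c + c) / 2)" .
    qed
    \<comment> \<open>The fixed word \<open>u\<close> is one of the paths of length
      \<open>j\<close>. Summing over all of them only enlarges the bound and produces an increment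
      of \<open>e\<close>.\<close>
    also have "\<dots> \<le> (\<Sum>r\<in>paths n. \<Sum>u\<in>paths j. p (u @ r) * (((k (u @ r) s - k r s)\<^sup>2 / c + c) / 2))"
    proof (intro sum_mono)
      fix r assume r: "r \<in> paths n"
      show "p (u @ r) * (((k (u @ r) s - k r s)\<^sup>2 / c + c) / 2) \<le>
          (\<Sum>u\<in>paths j. p (u @ r) * (((k (u @ r) s - k r s)\<^sup>2 / c + c) / 2))"
        by (rule member_le_sum[OF uj _ finite_paths])
           (use c(1) p_nonneg r paths_lists in \<open>auto intro!: mult_nonneg_nonneg add_nonneg_nonneg\<close>)
    qed
    also have "\<dots> = ((\<Sum>r\<in>paths n. \<Sum>u\<in>paths j. p (u @ r) * (k (u @ r) s - k r s)\<^sup>2) / c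
        + c * (\<Sum>r\<in>paths n. \<Sum>u\<in>paths j. p (u @ r))) / 2"
      unfolding sum_divide_distrib sum_distrib_left sum.distrib[symmetric]
      by (intro sum.cong) (auto simp: field_simps)
    also have "\<dots> = ((e s (j + n) - e s n) / c + c) / 2"
      unfolding e_diff[OF s] sum_paths_add[symmetric] sum_p_paths by simp
    also have "\<dots> \<le> (c\<^sup>2 / c + c) / 2" using c by (intro divide_right_mono add_mono) auto
    also have "\<dots> = c" using c by (simp add: power2_eq_square)
    finally show ?thesis .
  qed
  have "(\<lambda>n. a n - b n) \<longlonglongrightarrow> 0"
  proof (rule LIMSEQ_I)
    fix \<epsilon> :: real assume \<epsilon>: "\<epsilon> > 0"
    obtain N where N: "\<forall>n\<ge>N. \<forall>j. e s (j + n) - e s n < (\<epsilon> / 2)\<^sup>2" using e_Cauchy[OF s, of "(\<epsilon> / 2)\<^sup>2"] \<epsilon> by auto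
    have "\<bar>a n - b n\<bar> \<le> \<epsilon> / 2" if "n \<ge> N" for n
      by (rule diff) (use N that \<epsilon> in \<open>auto intro: less_imp_le\<close>)
    then show "\<exists>no. \<forall>n\<ge>no. norm (a n - b n - 0) < \<epsilon>" using \<epsilon> by (intro exI[of _ N]) fastforce
  qed
  then have "(\<lambda>n. b n + (a n - b n)) \<longlonglongrightarrow> p ((s # u) @ t) + 0" by (intro tendsto_add lb)
  moreover have "p ((s # u) @ t) = p (u @ s # t)" by (rule p_perm) (use Cons in auto)
  ultimately show ?case by (simp add: a_def)
qed

text \<open>Along \<open>\<nu>\<close> the increments of the predictive probabilities have mean
  absolute value at most \<open>(1/2) ^ i\<close>, so almost everywhere they are absolutely
  summable. The moments of the limits come from \<open>moment_limit\<close> by dominated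
  convergence.\<close>

theorem de_finetti:
  shows "\<exists>q :: 'g \<Rightarrow> real \<Rightarrow> real. (\<forall>s\<in>Y. q s \<in> borel_measurable M) \<and>
    (AE x in M. (\<forall>s\<in>Y. 0 \<le> q s x) \<and> (\<Sum>s\<in>Y. q s x) = 1) \<and>
    (\<forall>t\<in>lists Y. integrable M (\<lambda>x. prod_list (map (\<lambda>s. q s x) t)) \<and>
       (LINT x|M. prod_list (map (\<lambda>s. q s x) t)) = p t)"
proof -
  have "\<exists>N. \<forall>s\<in>Y. \<forall>n\<ge>N. \<forall>j. e s (j + n) - e s n < ((1/2) ^ i)\<^sup>2" for i
  proof -
    have "\<forall>s\<in>Y. \<exists>N. \<forall>n\<ge>N. \<forall>j. e s (j + n) - e s n < ((1/2) ^ i)\<^sup>2" using e_Cauchy by simp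
    then obtain N where N: "\<forall>s\<in>Y. \<forall>n\<ge>N s. \<forall>j. e s (j + n) - e s n < ((1/2) ^ i)\<^sup>2" by metis
    have "N s \<le> (\<Sum>s\<in>Y. N s)" if "s \<in> Y" for s by (rule member_le_sum) (use that finite_alphabet in auto)
    then show ?thesis using N by (intro exI[of _ "\<Sum>s\<in>Y. N s"]) (meson order_trans)
  qed
  then obtain N where N: "\<And>i s n j. s \<in> Y \<Longrightarrow> n \<ge> N i \<Longrightarrow> e s (j + n) - e s n < ((1/2) ^ i)\<^sup>2" by metis
  \<comment> \<open>The cumulative sum keeps \<open>\<nu> i\<close> above \<open>N i\<close> and
    increasing; the summand \<open>i\<close> makes it unbounded.\<close>
  define \<nu> where "\<nu> i = i + (\<Sum>l\<le>i. N l)" for i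
  have \<nu>N: "\<nu> i \<ge> N i" for i using member_le_sum[of i "{..i}" N] by (simp add: \<nu>_def)
  have \<nu>Suc: "\<nu> (Suc i) = (1 + N (Suc i)) + \<nu> i" for i by (simp add: \<nu>_def)
  have \<nu>lim: "filterlim \<nu> at_top sequentially"
    by (rule filterlim_at_top_mono[OF filterlim_ident]) (simp add: \<nu>_def)
  define q where "q s x = lim (\<lambda>i. pred (\<nu> i) s x)" for s x
  have conv: "AE x in M. (\<lambda>i. pred (\<nu> i) s x) \<longlonglongrightarrow> q s x" if s: "s \<in> Y" for s
  proof -
    define d where "d i x = \<bar>pred (\<nu> (Suc i)) s x - pred (\<nu> i) s x\<bar>" for i x
    have dm [measurable]: "d i \<in> borel_measurable M" for i unfolding d_def by measurable
    have d: "integrable M (d i)" "integral\<^sup>L M (d i) \<le> (1/2) ^ i" for i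
      using pred_L1[OF s, of "(1/2) ^ i" "1 + N (Suc i)" "\<nu> i"] N[OF s \<nu>N, of "1 + N (Suc i)" i]
      unfolding d_def \<nu>Suc by auto
    have "(\<integral>\<^sup>+x. (\<Sum>i. ennreal (d i x)) \<partial>M) = (\<Sum>i. \<integral>\<^sup>+x. ennreal (d i x) \<partial>M)"
      by (rule nn_integral_suminf) measurable
    also have "\<dots> = (\<Sum>i. ennreal (integral\<^sup>L M (d i)))"
      by (intro suminf_cong nn_integral_eq_integral d(1)) (simp add: d_def)
    also have "\<dots> \<le> (\<Sum>i. ennreal ((1/2) ^ i))"
      using d(2) by (intro suminf_le ennreal_leI) auto
    also have "\<dots> = ennreal (\<Sum>i. (1/2) ^ i)"
      by (rule suminf_ennreal2) (auto intro: summable_geometric)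
    also have "\<dots> < \<infinity>" by simp
    finally have "(\<integral>\<^sup>+x. (\<Sum>i. ennreal (d i x)) \<partial>M) \<noteq> \<infinity>" by simp
    then have "AE x in M. (\<Sum>i. ennreal (d i x)) \<noteq> \<infinity>"
      by (intro nn_integral_PInf_AE) auto
    then show ?thesis
    proof eventually_elim
      case (elim x)
      then have "summable (\<lambda>i. d i x)" by (intro summable_suminf_not_top) (auto simp: d_def)
      then have "summable (\<lambda>i. pred (\<nu> (Suc i)) s x - pred (\<nu> i) s x)"
        unfolding d_def by (rule summable_rabs_cancel)
      then have "convergent (\<lambda>n. \<Sum>i<n. pred (\<nu> (Suc i)) s x - pred (\<nu> i) s x)"
        by (simp add: summable_iff_convergent)
      then have "convergent (\<lambda>n. pred (\<nu> n) s x - pred (\<nu> 0) s x)"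
        using sum_lessThan_telescope[of "\<lambda>i. pred (\<nu> i) s x"] by simp
      then have "convergent (\<lambda>n. pred (\<nu> n) s x)"
        by (simp add: convergent_diff_const_right_iff)
      then show ?case by (simp add: q_def convergent_LIMSEQ_iff)
    qed
  qed
  have qm: "q s \<in> borel_measurable M" for s
    unfolding q_def by (rule borel_measurable_lim_metric) measurable
  have conv_all: "AE x in M. \<forall>s\<in>Y. (\<lambda>i. pred (\<nu> i) s x) \<longlonglongrightarrow> q s x"
    using conv finite_alphabet by (intro AE_finite_allI)
  have mom: "integrable M (\<lambda>x. prod_list (map (\<lambda>s. q s x) t)) \<and> (LINT x|M. prod_list (map (\<lambda>s. q s x) t)) = p t"
    if t: "t \<in> lists Y" for t
  proof (cases "t = []")
    case True then show ?thesis by (simp add: p_Nil measure_M)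
  next
    case False
    \<comment> \<open>Outside all intervals the predictive probabilities are 0 and \<open>S\<close>
      vanishes too; this matches a product of them only if the word is not empty.\<close>
    have pl: "prod_list (map (\<lambda>s. pred n s x) t) = S n (\<lambda>r. prod_list (map (k r) t)) x" for n x
      using False by (cases rule: S_cases[of n x]) (simp_all add: pred_def map_replicate_const prod_list_replicate)
    have m1: "(\<lambda>x. prod_list (map (\<lambda>s. q s x) t)) \<in> borel_measurable M"
      by (induction t) (auto intro: borel_measurable_times qm)
    have m2: "(\<lambda>x. prod_list (map (\<lambda>s. pred (\<nu> i) s x) t)) \<in> borel_measurable M" for i unfolding pl by measurable
    have lim: "AE x in M. (\<lambda>i. prod_list (map (\<lambda>s. pred (\<nu> i) s x) t)) \<longlonglongrightarrow> prod_list (map (\<lambda>s. q s x) t)"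
      using conv_all
    proof eventually_elim
      case (elim x)
      then show ?case using t by (induction t) (auto intro!: tendsto_mult)
    qed
    have bd: "norm (prod_list (map (\<lambda>s. pred (\<nu> i) s x) t)) \<le> 1" for i x
      using t by (induction t) (auto simp: abs_mult pred_bounds intro!: mult_le_one)
    have "integrable M (\<lambda>x. prod_list (map (\<lambda>s. q s x) t))"
      by (rule integrable_dominated_convergence[OF m1 m2 _ lim, where w = "\<lambda>_. 1"]) (use bd in auto)
    moreover have "(\<lambda>i. LINT x|M. prod_list (map (\<lambda>s. pred (\<nu> i) s x) t)) \<longlonglongrightarrow> (LINT x|M. prod_list (map (\<lambda>s. q s x) t))"
      by (rule integral_dominated_convergence[OF m1 m2 _ lim, where w = "\<lambda>_. 1"]) (use bd in auto)
    moreover have "(LINT x|M. prod_list (map (\<lambda>s. pred (\<nu> i) s x) t)) = (\<Sum>r\<in>paths (\<nu> i). p ([] @ r) * prod_list (map (k r) t))" for i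
      unfolding pl S_integral(2) by (simp add: mult.commute)
    moreover have "(\<lambda>i. \<Sum>r\<in>paths (\<nu> i). p ([] @ r) * prod_list (map (k r) t)) \<longlonglongrightarrow> p ([] @ t)"
      by (rule filterlim_compose[OF moment_limit[OF t] \<nu>lim]) simp
    ultimately show ?thesis using LIMSEQ_unique by auto
  qed
  have nn: "AE x in M. (\<forall>s\<in>Y. 0 \<le> q s x) \<and> (\<Sum>s\<in>Y. q s x) \<le> 1"
    using conv_all
  proof eventually_elim
    case (elim x)
    have "0 \<le> q s x" if "s \<in> Y" for s
      by (rule tendsto_lowerbound[of "\<lambda>i. pred (\<nu> i) s x" _ sequentially]) (use elim that pred_bounds in auto)
    moreover have "(\<lambda>i. \<Sum>s\<in>Y. pred (\<nu> i) s x) \<longlonglongrightarrow> (\<Sum>s\<in>Y. q s x)" using elim by (intro tendsto_sum) auto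
    then have "(\<Sum>s\<in>Y. q s x) \<le> 1" by (rule tendsto_upperbound) (use sum_pred_le in auto)
    ultimately show ?case by blast
  qed
  have qi: "integrable M (q s)" "integral\<^sup>L M (q s) = p [s]" if "s \<in> Y" for s
    using mom[of "[s]"] that by auto
  \<comment> \<open>The limit only inherits total mass at most one. The defect is nonnegative with
    integral \<open>1 - (\<Sum>s\<in>Y. p [s]) = 0\<close>, so it vanishes almost
    everywhere.\<close>
  have "AE x in M. 1 - (\<Sum>s\<in>Y. q s x) = 0"
  proof (rule integral_nonneg_eq_0_iff_AE[THEN iffD1])
    show "integrable M (\<lambda>x. 1 - (\<Sum>s\<in>Y. q s x))"
      using qi by (intro Bochner_Integration.integrable_diff Bochner_Integration.integrable_sum) auto
    show "AE x in M. 0 \<le> 1 - (\<Sum>s\<in>Y. q s x)" using nn by auto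
    have "(LINT x|M. 1 - (\<Sum>s\<in>Y. q s x)) = 1 - (\<Sum>s\<in>Y. p [s])"
      using qi by (subst Bochner_Integration.integral_diff) (auto simp: Bochner_Integration.integral_sum measure_M)
    also have "(\<Sum>s\<in>Y. p [s]) = 1" using p_sum[of "[]"] p_Nil by simp
    finally show "(LINT x|M. 1 - (\<Sum>s\<in>Y. q s x)) = 0" by simp
  qed
  then have "AE x in M. (\<forall>s\<in>Y. 0 \<le> q s x) \<and> (\<Sum>s\<in>Y. q s x) = 1" using nn by eventually_elim auto
  then show ?thesis using qm mom by (intro exI[of _ q]) auto
qed

end

section \<open>The abelianization\<close>

context comm_group
begin

lemma finprod_int_pow:
  assumes "finite S" "f \<in> S \<rightarrow> carrier G"
  shows "finprod G (\<lambda>s. f s [^] (c::int)) S = finprod G f S [^] c"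
  using assms by (induction S rule: finite_induct) (auto simp: int_pow_distrib Pi_def)

lemma additive_int_pow:
  fixes c :: "'a \<Rightarrow> real"
  assumes c: "\<And>x y. x \<in> carrier G \<Longrightarrow> y \<in> carrier G \<Longrightarrow> c (x \<otimes> y) = c x + c y" and x: "x \<in> carrier G"
  shows "c (x [^] (m::int)) = m * c x"
proof -
  have one: "c \<one> = 0" using c[of \<one> \<one>] by simp
  have nat: "c (x [^] (n::nat)) = n * c x" for n
    by (induction n) (auto simp: one c x algebra_simps)
  have inv: "c (inv y) = - c y" if "y \<in> carrier G" for y
    using c[of "inv y" y] that one by (simp add: eq_neg_iff_add_eq_0)
  show ?thesis
  proof (cases "m \<ge> 0")
    case True
    then obtain n where "m = int n" using nonneg_int_cases by blast
    then show ?thesis by (simp add: int_pow_int nat)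
  next
    case False
    then have "m = - int (nat (- m))" by simp
    then obtain n where "m = - int n" ..
    then show ?thesis using x by (simp add: int_pow_neg_int nat inv)
  qed
qed

lemma additive_finprod:
  fixes c :: "'a \<Rightarrow> real"
  assumes c: "\<And>x y. x \<in> carrier G \<Longrightarrow> y \<in> carrier G \<Longrightarrow> c (x \<otimes> y) = c x + c y"
    and S: "finite S" "f \<in> S \<rightarrow> carrier G"
  shows "c (finprod G f S) = (\<Sum>s\<in>S. c (f s))"
  using S
proof (induction S rule: finite_induct)
  case empty
  show ?case using c[of \<one> \<one>] by simp
next
  case (insert s S)
  then show ?case using c[of "f s" "finprod G f S"] by (auto simp: Pi_def)
qed

text \<open>A maximal independent family yields rational coordinates, through which every additive
  function factors.\<close>

lemma rank_coordinates:
  assumes "has_rank G CARD('n::finite)"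
  shows "\<exists>\<pi> :: 'a \<Rightarrow> real ^ 'n. (\<forall>x\<in>carrier G. \<forall>y\<in>carrier G. \<pi> (x \<otimes> y) = \<pi> x + \<pi> y) \<and>
    (\<forall>i. \<exists>x\<in>carrier G. \<pi> x = axis i 1) \<and>
    (\<forall>c :: 'a \<Rightarrow> real. (\<forall>x\<in>carrier G. \<forall>y\<in>carrier G. c (x \<otimes> y) = c x + c y) \<longrightarrow>
       (\<exists>\<xi>. \<forall>x\<in>carrier G. c x = \<xi> \<bullet> \<pi> x))"
proof -
  obtain S where S: "int_independent G S" "card S = CARD('n)" and max: "\<And>S. int_independent G S \<Longrightarrow> card S \<le> CARD('n)"
    using assms by (auto simp: has_rank_def)
  have fS: "finite S" and SG: "S \<subseteq> carrier G" using S by (auto simp: int_independent_def)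
  obtain b :: "'n \<Rightarrow> 'a" where b: "bij_betw b UNIV S"
    using S(2) fS by (metis finite_same_card_bij finite_class.finite_UNIV)
  have indep: "\<forall>s\<in>S. k s = 0" if "finprod G (\<lambda>s. s [^] (k s :: int)) S = \<one>" for k
    using S(1) that by (simp add: int_independent_def)
  define P where "P k = finprod G (\<lambda>s. s [^] (k s :: int)) S" for k
  have Pc [simp]: "P k \<in> carrier G" for k unfolding P_def using SG by (intro finprod_closed) auto
  have P_add: "P (\<lambda>s. k s + k' s) = P k \<otimes> P k'" for k k'
  proof -
    have "P (\<lambda>s. k s + k' s) = finprod G (\<lambda>s. s [^] k s \<otimes> s [^] k' s) S"
      unfolding P_def using SG by (intro finprod_cong') (auto simp: int_pow_mult)
    then show ?thesis unfolding P_def using SG by (simp add: finprod_multf Pi_def subset_iff)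
  qed
  have P_pow: "P (\<lambda>s. k s * m) = P k [^] m" for k and m :: int
  proof -
    have "P (\<lambda>s. k s * m) = finprod G (\<lambda>s. (s [^] k s) [^] m) S"
      unfolding P_def using SG by (intro finprod_cong') (auto simp: int_pow_pow)
    then show ?thesis unfolding P_def using SG fS by (subst (asm) finprod_int_pow) auto
  qed
  have P_inj: "k s = k' s" if "P k = P k'" "s \<in> S" for k k' s
  proof -
    have "P (\<lambda>s. (k s - k' s) + k' s) = P (\<lambda>s. k s - k' s) \<otimes> P k'" by (rule P_add)
    then have "P k' = P (\<lambda>s. k s - k' s) \<otimes> P k'" using that(1) by simp
    then have "P (\<lambda>s. k s - k' s) = \<one>" using l_cancel_one'[OF Pc Pc] by simp
    then have "\<forall>s\<in>S. k s - k' s = 0" unfolding P_def by (rule indep)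
    then show ?thesis using that(2) by simp
  qed
  \<comment> \<open>By maximality of \<open>S\<close>, some nonzero power of each element lies in
    the subgroup generated by \<open>S\<close>; dividing the exponents by that power gives its
    coordinates.\<close>
  have ex: "\<exists>m k. m \<noteq> 0 \<and> y [^] (m::int) = P k" if y: "y \<in> carrier G" for y
  proof (cases "y \<in> S")
    case True
    have "P (\<lambda>s. if s = y then 1 else 0) = finprod G (\<lambda>s. if y = s then s else \<one>) S"
      unfolding P_def using SG by (intro finprod_cong') (auto simp: subset_iff)
    also have "\<dots> = y" using finprod_singleton[OF True fS, of "\<lambda>s. s"] SG by auto
    finally show ?thesis using y by (intro exI[of _ 1] exI[of _ "\<lambda>s. if s = y then 1 else 0"]) auto
  next
    case False
    have "\<not> int_independent G (insert y S)" using max[of "insert y S"] False fS S(2) by auto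
    then obtain k where k: "finprod G (\<lambda>s. s [^] (k s :: int)) (insert y S) = \<one>" "\<exists>s\<in>insert y S. k s \<noteq> 0"
      using fS SG y unfolding int_independent_def by auto
    have kk: "y [^] k y \<otimes> P k = \<one>"
      using k(1) False fS SG y unfolding P_def by (subst (asm) finprod_insert) auto
    have "k y \<noteq> 0"
    proof
      assume "k y = 0"
      then have "P k = \<one>" using kk by simp
      then have "\<forall>s\<in>S. k s = 0" using S(1) unfolding int_independent_def P_def by blast
      then show False using k(2) \<open>k y = 0\<close> by auto
    qed
    moreover have "y [^] k y = inv (P k)" using kk y by (simp add: inv_equality)
    moreover have "inv (P k) = P (\<lambda>s. k s * (- 1))" unfolding P_pow by (simp add: int_pow_neg)
    ultimately show ?thesis by metis
  qed
  define R where "R y v \<longleftrightarrow> (\<exists>m k. m \<noteq> 0 \<and> y [^] (m::int) = P k \<and> v = (\<chi> i. real_of_int (k (b i)) / real_of_int m))"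
    for y and v :: "real ^ 'n"
  have bS: "b i \<in> S" for i using b by (auto simp: bij_betw_def)
  have R_unique: "v = v'" if y: "y \<in> carrier G" and R: "R y v" "R y v'" for y v v'
  proof -
    obtain m k m' k' where 1: "m \<noteq> 0" "y [^] m = P k" "v = (\<chi> i. real_of_int (k (b i)) / real_of_int m)"
      "m' \<noteq> 0" "y [^] m' = P k'" "v' = (\<chi> i. real_of_int (k' (b i)) / real_of_int m')"
      using R unfolding R_def by blast
    have "P (\<lambda>s. k s * m') = P (\<lambda>s. k' s * m)"
      unfolding P_pow using 1 y by (metis int_pow_pow mult.commute)
    then have "k (b i) * m' = k' (b i) * m" for i using P_inj bS by metis
    then have "real_of_int (k (b i)) * real_of_int m' = real_of_int (k' (b i)) * real_of_int m" for i
      by (metis of_int_mult)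
    then show ?thesis using 1 by (simp add: vec_eq_iff frac_eq_eq)
  qed
  define \<pi> where "\<pi> y = (THE v. R y v)" for y
  have \<pi>_eq: "\<pi> y = v" if "y \<in> carrier G" "R y v" for y v
    unfolding \<pi>_def using R_unique that by (intro the_equality) auto
  have R\<pi>: "R y (\<pi> y)" if y: "y \<in> carrier G" for y
  proof -
    obtain m k where "m \<noteq> 0" "y [^] (m::int) = P k" using ex[OF y] by blast
    then have "R y (\<chi> i. real_of_int (k (b i)) / real_of_int m)" unfolding R_def by blast
    then show ?thesis using \<pi>_eq[OF y] by simp
  qed
  have add: "\<pi> (x \<otimes> y) = \<pi> x + \<pi> y" if xy: "x \<in> carrier G" "y \<in> carrier G" for x y
  proof -
    obtain m k m' k' where 1: "m \<noteq> 0" "x [^] m = P k" "\<pi> x = (\<chi> i. real_of_int (k (b i)) / real_of_int m)"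
      "m' \<noteq> 0" "y [^] m' = P k'" "\<pi> y = (\<chi> i. real_of_int (k' (b i)) / real_of_int m')"
      using R\<pi>[OF xy(1)] R\<pi>[OF xy(2)] unfolding R_def by auto
    show ?thesis
    proof (rule \<pi>_eq)
      have "(x \<otimes> y) [^] (m * m') = (x [^] m) [^] m' \<otimes> (y [^] m') [^] m"
        using xy by (simp add: int_pow_distrib int_pow_pow mult.commute)
      also have "\<dots> = P (\<lambda>s. k s * m' + k' s * m)" by (simp add: 1 P_add P_pow)
      finally show "R (x \<otimes> y) (\<pi> x + \<pi> y)"
        unfolding R_def using 1
        by (intro exI[of _ "m * m'"] exI[of _ "\<lambda>s. k s * m' + k' s * m"])
           (auto simp: vec_eq_iff add_frac_eq mult.commute)
    qed (use xy in auto)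
  qed
  have basis: "\<pi> (b i) = axis i 1" for i
  proof (rule \<pi>_eq)
    show bi: "b i \<in> carrier G" using bS SG by auto
    have "P (\<lambda>s. if s = b i then 1 else 0) = finprod G (\<lambda>s. if b i = s then s else \<one>) S"
      unfolding P_def using SG by (intro finprod_cong') (auto simp: subset_iff)
    also have "\<dots> = b i" using finprod_singleton[OF bS fS, of "\<lambda>s. s"] SG by auto
    finally have "b i [^] (1::int) = P (\<lambda>s. if s = b i then 1 else 0)" using bi by simp
    moreover have "b j = b i \<longleftrightarrow> j = i" for j using b by (auto simp: bij_betw_def inj_on_def)
    ultimately show "R (b i) (axis i 1)"
      unfolding R_def by (intro exI[of _ 1] exI[of _ "\<lambda>s. if s = b i then 1 else 0"]) (auto simp: vec_eq_iff axis_def)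
  qed
  have factor: "\<exists>\<xi>. \<forall>x\<in>carrier G. c x = \<xi> \<bullet> \<pi> x"
    if c: "\<And>x y. x \<in> carrier G \<Longrightarrow> y \<in> carrier G \<Longrightarrow> c (x \<otimes> y) = c x + c y" for c :: "'a \<Rightarrow> real"
  proof (intro exI[of _ "\<chi> i. c (b i)"] ballI)
    fix x assume x: "x \<in> carrier G"
    obtain m k where 1: "m \<noteq> 0" "x [^] m = P k" "\<pi> x = (\<chi> i. real_of_int (k (b i)) / real_of_int m)"
      using R\<pi>[OF x] unfolding R_def by auto
    have "m * c x = c (P k)" using additive_int_pow[OF c x, of m] 1 by simp
    also have "\<dots> = (\<Sum>s\<in>S. c (s [^] k s))"
      unfolding P_def by (rule additive_finprod[OF c fS]) (use SG in auto)
    also have "\<dots> = (\<Sum>s\<in>S. k s * c s)" using additive_int_pow[OF c] SG by (intro sum.cong) auto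
    also have "\<dots> = (\<Sum>i\<in>UNIV. k (b i) * c (b i))" by (rule sum.reindex_bij_betw[OF b, symmetric])
    finally have "c x = (\<Sum>i\<in>UNIV. k (b i) * c (b i)) / m" using 1 by (simp add: field_simps)
    then show "c x = (\<chi> i. c (b i)) \<bullet> \<pi> x"
      by (simp add: inner_vec_def 1 sum_divide_distrib mult.commute)
  qed
  show ?thesis
  proof (intro exI[of _ \<pi>] conjI ballI allI impI)
    show "\<exists>x\<in>carrier G. \<pi> x = axis i 1" for i using basis bS SG by blast
  qed (use add factor in auto)
qed

end

text \<open>An additive real function vanishes on commutators, hence is constant on the cosets of
  the derived subgroup and descends to the quotient, where the coordinates are already
  available.\<close>

lemma (in group) abelianization_coordinates:
  assumes "has_rank (G Mod derived G (carrier G)) CARD('n::finite)"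
  shows "\<exists>\<pi> :: 'a \<Rightarrow> real ^ 'n. (\<forall>x\<in>carrier G. \<forall>y\<in>carrier G. \<pi> (x \<otimes> y) = \<pi> x + \<pi> y) \<and>
    (\<forall>i. \<exists>x\<in>carrier G. \<pi> x = axis i 1) \<and>
    (\<forall>c :: 'a \<Rightarrow> real. (\<forall>x\<in>carrier G. \<forall>y\<in>carrier G. c (x \<otimes> y) = c x + c y) \<longrightarrow>
       (\<exists>\<xi>. \<forall>x\<in>carrier G. c x = \<xi> \<bullet> \<pi> x))"
proof -
  let ?N = "derived G (carrier G)"
  let ?H = "G Mod ?N"
  interpret N: normal ?N G by (rule derived_self_is_normal)
  interpret H: comm_group ?H by (rule derived_quot_is_comm_group)
  obtain \<pi> :: "'a set \<Rightarrow> real ^ 'n" where \<pi>: "\<And>x y. x \<in> carrier ?H \<Longrightarrow> y \<in> carrier ?H \<Longrightarrow> \<pi> (x \<otimes>\<^bsub>?H\<^esub> y) = \<pi> x + \<pi> y"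
    "\<And>i. \<exists>x\<in>carrier ?H. \<pi> x = axis i 1"
    "\<And>c :: 'a set \<Rightarrow> real. (\<forall>x\<in>carrier ?H. \<forall>y\<in>carrier ?H. c (x \<otimes>\<^bsub>?H\<^esub> y) = c x + c y) \<Longrightarrow>
       (\<exists>\<xi>. \<forall>x\<in>carrier ?H. c x = \<xi> \<bullet> \<pi> x)"
    using H.rank_coordinates[OF assms] by auto
  have cosets: "carrier ?H = (\<lambda>x. ?N #> x) ` carrier G" by (simp add: carrier_FactGroup)
  have mult: "(?N #> x) \<otimes>\<^bsub>?H\<^esub> (?N #> y) = ?N #> (x \<otimes> y)" if "x \<in> carrier G" "y \<in> carrier G" for x y
    using that by (simp add: N.rcos_sum)
  have factor: "\<exists>\<xi>. \<forall>x\<in>carrier G. c x = \<xi> \<bullet> \<pi> (?N #> x)"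
    if c: "\<And>x y. x \<in> carrier G \<Longrightarrow> y \<in> carrier G \<Longrightarrow> c (x \<otimes> y) = c x + c y" for c :: "'a \<Rightarrow> real"
  proof -
    have one: "c \<one> = 0" using c[of \<one> \<one>] by simp
    have inv: "c (inv y) = - c y" if "y \<in> carrier G" for y
      using c[of "inv y" y] that one by (simp add: eq_neg_iff_add_eq_0)
    have "subgroup {x \<in> carrier G. c x = 0} G"
      by (rule subgroupI) (use one in \<open>auto simp: c inv\<close>)
    moreover have "derived_set G (carrier G) \<subseteq> {x \<in> carrier G. c x = 0}" by (auto simp: c inv)
    ultimately have "?N \<subseteq> {x \<in> carrier G. c x = 0}"
      unfolding derived_def by (intro generate_subgroup_incl)
    then have cN: "c z = 0" if "z \<in> ?N" for z using that by auto
    have const: "c x = c y" if xy: "x \<in> carrier G" "y \<in> carrier G" "?N #> x = ?N #> y" for x y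
    proof -
      have "x \<in> ?N #> y" using rcos_self[OF xy(1) N.subgroup_axioms] xy(3) by simp
      then obtain z where "z \<in> ?N" "x = z \<otimes> y" by (auto simp: r_coset_def)
      then show ?thesis using xy c[of z y] cN N.subset by auto
    qed
    define d where "d X = c (SOME x. x \<in> carrier G \<and> ?N #> x = X)" for X
    have d: "d (?N #> x) = c x" if x: "x \<in> carrier G" for x
    proof -
      have "(SOME y. y \<in> carrier G \<and> ?N #> y = ?N #> x) \<in> carrier G \<and>
          ?N #> (SOME y. y \<in> carrier G \<and> ?N #> y = ?N #> x) = ?N #> x"
        by (rule someI[of _ x]) (use x in simp)
      then show ?thesis unfolding d_def using const x by blast
    qed
    have "\<forall>X\<in>carrier ?H. \<forall>Z\<in>carrier ?H. d (X \<otimes>\<^bsub>?H\<^esub> Z) = d X + d Z"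
      unfolding cosets by (auto simp: mult d c simp del: mult_FactGroup)
    then obtain \<xi> where "\<forall>X\<in>carrier ?H. d X = \<xi> \<bullet> \<pi> X" using \<pi>(3) by blast
    then show ?thesis using d unfolding cosets by (intro exI[of _ \<xi>]) auto
  qed
  show ?thesis
  proof (intro exI[of _ "\<lambda>x. \<pi> (?N #> x)"] conjI ballI allI impI)
    fix x y assume xy: "x \<in> carrier G" "y \<in> carrier G"
    then show "\<pi> (?N #> (x \<otimes> y)) = \<pi> (?N #> x) + \<pi> (?N #> y)"
      using \<pi>(1)[of "?N #> x" "?N #> y"] by (simp add: mult cosets del: mult_FactGroup)
  next
    show "\<exists>x\<in>carrier G. \<pi> (?N #> x) = axis i 1" for i using \<pi>(2)[of i] unfolding cosets by auto
  qed (use factor in auto)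
qed

section \<open>Polynomials in the weights of a probability vector\<close>

text \<open>With \<open>\<phi> = mon q\<close> this is a polynomial in the weights of
  \<open>q\<close>; with the vector of a state it is the mean of that polynomial over the
  mixture.\<close>

definition word_poly :: "(real \<times> 'g list) list \<Rightarrow> ('g list \<Rightarrow> real) \<Rightarrow> real" where
  "word_poly l \<phi> = (\<Sum>(c, t)\<leftarrow>l. c * \<phi> t)"

lemma word_poly_simps [simp]:
  "word_poly [] \<phi> = 0" "word_poly ((c, t) # l) \<phi> = c * \<phi> t + word_poly l \<phi>"
  "word_poly (l @ l') \<phi> = word_poly l \<phi> + word_poly l' \<phi>"
  by (auto simp: word_poly_def)

text \<open>Concatenation of words multiplies their monomials and the empty word gives the
  constants, so these polynomials form an algebra to which the Stone-Weierstrass theorem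
  applies.\<close>

lemma word_poly_dense:
  fixes \<kappa> :: "'x::t2_space \<Rightarrow> 'g \<Rightarrow> real"
  assumes X: "compact X" and cont: "\<And>s. s \<in> Y \<Longrightarrow> continuous_on X (\<lambda>x. \<kappa> x s)"
    and sep: "\<And>x y. x \<in> X \<Longrightarrow> y \<in> X \<Longrightarrow> x \<noteq> y \<Longrightarrow> \<exists>s\<in>Y. \<kappa> x s \<noteq> \<kappa> y s"
    and f: "continuous_on X f" and \<epsilon>: "\<epsilon> > 0"
  shows "\<exists>l. (\<forall>(c, t)\<in>set l. t \<in> lists Y) \<and>
    (\<forall>x\<in>X. \<bar>f x - word_poly l (\<lambda>t. prod_list (map (\<kappa> x) t))\<bar> < \<epsilon>)"
proof -
  define h where "h l x = word_poly l (\<lambda>t. prod_list (map (\<kappa> x) t))" for l x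
  define R where "R = h ` {l. \<forall>(c, t)\<in>set l. t \<in> lists Y}"
  have mult1: "(c * prod_list (map (\<kappa> x) t)) * h l x = h (map (\<lambda>(d, u). (c * d, t @ u)) l) x" for c t l x
    by (induction l) (auto simp: h_def algebra_simps)
  have mult: "\<exists>l3. (\<forall>(c, t)\<in>set l3. t \<in> lists Y) \<and> (\<forall>x. h l x * h l' x = h l3 x)"
    if "\<forall>(c, t)\<in>set l. t \<in> lists Y" "\<forall>(c, t)\<in>set l'. t \<in> lists Y" for l l'
    using that(1)
  proof (induction l)
    case Nil
    then show ?case by (intro exI[of _ "[]"]) (simp add: h_def)
  next
    case (Cons a l)
    obtain c t where a: "a = (c, t)" by (cases a)
    have "\<exists>l3. (\<forall>(c, t)\<in>set l3. t \<in> lists Y) \<and> (\<forall>x. h l x * h l' x = h l3 x)"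
      by (rule Cons.IH) (use Cons.prems in simp)
    then obtain l3 where l3: "\<forall>(c, t)\<in>set l3. t \<in> lists Y" "\<And>x. h l x * h l' x = h l3 x" by blast
    have "h (a # l) x * h l' x = h (map (\<lambda>(d, u). (c * d, t @ u)) l' @ l3) x" for x
    proof -
      have "h (a # l) x * h l' x = (c * prod_list (map (\<kappa> x) t)) * h l' x + h l x * h l' x"
        by (simp add: h_def a algebra_simps)
      then show ?thesis unfolding mult1 l3(2) by (simp add: h_def)
    qed
    moreover have "\<forall>(c, t)\<in>set (map (\<lambda>(d, u). (c * d, t @ u)) l' @ l3). t \<in> lists Y"
      using Cons.prems that(2) l3(1) unfolding a by (fastforce simp: ball_Un)
    ultimately show ?case by blast
  qed
  interpret function_ring_on R X
  proof
    fix f assume "f \<in> R"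
    then obtain l where l: "\<forall>(c, t)\<in>set l. t \<in> lists Y" "f = h l" by (auto simp: R_def)
    have c: "continuous_on X (\<lambda>x. prod_list (map (\<kappa> x) t))" if "t \<in> lists Y" for t
      using that by (induction t) (auto intro!: continuous_intros cont)
    have "continuous_on X (h l)"
      using l(1) unfolding h_def by (induction l) (auto intro!: continuous_intros c)
    then show "continuous_on X f" using l by simp
  next
    fix f g assume "f \<in> R" "g \<in> R"
    then obtain l l' where l: "\<forall>(c, t)\<in>set l. t \<in> lists Y" "f = h l" "\<forall>(c, t)\<in>set l'. t \<in> lists Y" "g = h l'"
      by (auto simp: R_def)
    show "(\<lambda>x. f x + g x) \<in> R"
      unfolding R_def using l by (intro image_eqI[of _ _ "l @ l'"]) (auto simp: h_def)
    obtain l3 where "\<forall>(c, t)\<in>set l3. t \<in> lists Y" "\<And>x. h l x * h l' x = h l3 x"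
      using mult[OF l(1,3)] by blast
    then show "(\<lambda>x. f x * g x) \<in> R" unfolding R_def using l by (intro image_eqI[of _ _ l3]) auto
  next
    show "(\<lambda>_. c) \<in> R" for c unfolding R_def by (intro image_eqI[of _ _ "[(c, [])]"]) (auto simp: h_def)
  next
    fix x y assume "x \<in> X" "y \<in> X" "x \<noteq> y"
    then obtain s where s: "s \<in> Y" "\<kappa> x s \<noteq> \<kappa> y s" using sep by blast
    have "h [(1, [s])] \<in> R" unfolding R_def using s by auto
    moreover have "h [(1, [s])] x \<noteq> h [(1, [s])] y" using s by (simp add: h_def)
    ultimately show "\<exists>f\<in>R. f x \<noteq> f y" by blast
  qed (rule X)
  obtain g where g: "g \<in> R" "\<forall>x\<in>X. \<bar>f x - g x\<bar> < \<epsilon>" using Stone_Weierstrass_basic[OF f \<epsilon>] by blast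
  then obtain l where "\<forall>(c, t)\<in>set l. t \<in> lists Y" "g = h l" by (auto simp: R_def)
  then show ?thesis using g(2) unfolding h_def by (intro exI[of _ l]) simp
qed

section \<open>Borel probability measures on compact sets\<close>

lemma borel_probabilitiesD:
  assumes "\<mu> \<in> borel_probabilities S"
  shows "sets \<mu> = sets (restrict_space borel S)" "space \<mu> = S" "finite_measure \<mu>" "measure \<mu> S = 1"
proof -
  show s: "sets \<mu> = sets (restrict_space borel S)" using assms by (simp add: borel_probabilities_def)
  show sp: "space \<mu> = S" using sets_eq_imp_space_eq[OF s] by (simp add: space_restrict_space)
  have e: "emeasure \<mu> (space \<mu>) = 1" using assms by (simp add: borel_probabilities_def)
  then show "finite_measure \<mu>" by (intro finite_measureI) simp
  show "measure \<mu> S = 1" using e sp by (simp add: measure_def)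
qed

lemma borel_probabilities_measurable:
  fixes f :: "'b::topological_space \<Rightarrow> 'c::topological_space"
  assumes "\<mu> \<in> borel_probabilities S" "continuous_on S f"
  shows "f \<in> borel_measurable \<mu>"
  using borel_measurable_continuous_on_restrict[OF assms(2)]
    measurable_cong_sets[OF borel_probabilitiesD(1)[OF assms(1)] refl] by blast

lemma borel_probabilities_integrable:
  fixes f :: "'b::topological_space \<Rightarrow> 'c::{banach, second_countable_topology}"
  assumes \<mu>: "\<mu> \<in> borel_probabilities S" and f: "continuous_on S f" "\<And>x. x \<in> S \<Longrightarrow> norm (f x) \<le> C"
  shows "integrable \<mu> f"
proof -
  interpret finite_measure \<mu> by (rule borel_probabilitiesD[OF \<mu>])
  show ?thesis
    by (rule integrable_const_bound[where B = C])
       (use f borel_probabilitiesD[OF \<mu>] borel_probabilities_measurable[OF \<mu>] in auto)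
qed

text \<open>On a closed set the identity follows from the continuous functions
  \<open>max 0 (1 - m * infdist x C)\<close>, which converge boundedly to its indicator. It extends
  to Borel sets by induction; complements work because all three measures have mass one and the
  coefficients sum to one. Uniqueness of the measure is the case \<open>t = 0\<close>.\<close>

lemma measure_convex_combination_eqI:
  fixes S :: "'b::metric_space set"
  assumes \<mu>: "\<mu>1 \<in> borel_probabilities S" "\<mu>2 \<in> borel_probabilities S" "\<mu>3 \<in> borel_probabilities S"
    and eq: "\<And>f :: 'b \<Rightarrow> real. continuous_on S f \<Longrightarrow> (\<forall>x. \<bar>f x\<bar> \<le> 1) \<Longrightarrow>
      integral\<^sup>L \<mu>1 f = (1 - t) * integral\<^sup>L \<mu>2 f + t * integral\<^sup>L \<mu>3 f"
    and B: "B \<in> sets (restrict_space borel S)"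
  shows "measure \<mu>1 B = (1 - t) * measure \<mu>2 B + t * measure \<mu>3 B"
proof -
  have meas: "S \<inter> C \<in> sets \<mu>" if "C \<in> sets borel" "\<mu> \<in> borel_probabilities S" for \<mu> C
    using that borel_probabilitiesD(1)[OF that(2)] by (auto simp: sets_restrict_space)
  have key: "measure \<mu>1 (S \<inter> C) = (1 - t) * measure \<mu>2 (S \<inter> C) + t * measure \<mu>3 (S \<inter> C)"
    if "C \<in> sigma_sets UNIV (Collect closed)" for C :: "'b set"
  proof (rule sigma_sets_induct_disjoint[OF _ _ that,
      where P = "\<lambda>C. measure \<mu>1 (S \<inter> C) = (1 - t) * measure \<mu>2 (S \<inter> C) + t * measure \<mu>3 (S \<inter> C)"])
    show "Int_stable (Collect closed)" by (auto simp: Int_stable_def)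
    show "Collect closed \<subseteq> Pow UNIV" by simp
    fix C :: "'b set" assume "C \<in> Collect closed"
    then have C: "closed C" by simp
    show "measure \<mu>1 (S \<inter> C) = (1 - t) * measure \<mu>2 (S \<inter> C) + t * measure \<mu>3 (S \<inter> C)"
    proof (cases "C = {}")
      case False
      define f where "f m x = max 0 (1 - real m * infdist x C)" for m x
      have cf: "continuous_on S (f m)" for m unfolding f_def by (intro continuous_intros)
      have f1: "\<bar>f m x\<bar> \<le> 1" for m x using infdist_nonneg[of x C] by (auto simp: f_def)
      have lim: "(\<lambda>m. f m x) \<longlonglongrightarrow> indicator C x" for x
      proof (cases "x \<in> C")
        case True
        then show ?thesis by (simp add: f_def)
      next
        case False
        have d: "infdist x C > 0" using C False \<open>C \<noteq> {}\<close> in_closed_iff_infdist_zero[of C x] infdist_nonneg[of x C] by fastforce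
        obtain N where N: "real N * infdist x C > 1" using ex_less_of_nat_mult[OF d] by blast
        have "f m x = 0" if "m \<ge> N" for m
        proof -
          have "real N * infdist x C \<le> real m * infdist x C" using that d by (intro mult_right_mono) auto
          then show ?thesis using N by (simp add: f_def)
        qed
        then have "eventually (\<lambda>m. f m x = 0) sequentially" by (auto simp: eventually_sequentially)
        then show ?thesis using False by (simp add: tendsto_eventually)
      qed
      have int: "(\<lambda>m. integral\<^sup>L \<mu> (f m)) \<longlonglongrightarrow> measure \<mu> (S \<inter> C)" if \<mu>: "\<mu> \<in> borel_probabilities S" for \<mu>
      proof -
        interpret finite_measure \<mu> by (rule borel_probabilitiesD[OF \<mu>])
        have SC: "S \<inter> C \<in> sets \<mu>" using C by (intro meas \<mu>) auto
        have "(\<lambda>m. integral\<^sup>L \<mu> (f m)) \<longlonglongrightarrow> integral\<^sup>L \<mu> (indicator (S \<inter> C))"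
        proof (rule integral_dominated_convergence[where w = "\<lambda>_. 1"])
          show "AE x in \<mu>. (\<lambda>m. f m x) \<longlonglongrightarrow> indicator (S \<inter> C) x"
            using lim borel_probabilitiesD(2)[OF \<mu>] by (intro AE_I2) (auto simp: indicator_def)
        qed (use SC f1 borel_probabilities_measurable[OF \<mu> cf] in auto)
        then show ?thesis using SC borel_probabilitiesD(2)[OF \<mu>] by (simp add: Int_ac)
      qed
      have "(\<lambda>m. integral\<^sup>L \<mu>1 (f m)) \<longlonglongrightarrow> (1 - t) * measure \<mu>2 (S \<inter> C) + t * measure \<mu>3 (S \<inter> C)"
        using eq[OF cf] f1 by (simp, intro tendsto_intros int \<mu>)
      then show ?thesis using int[OF \<mu>(1)] LIMSEQ_unique by blast
    qed simp
  next
    fix C assume C: "C \<in> sigma_sets UNIV (Collect closed)"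
      and IH: "measure \<mu>1 (S \<inter> C) = (1 - t) * measure \<mu>2 (S \<inter> C) + t * measure \<mu>3 (S \<inter> C)"
    have Cb: "C \<in> sets borel" using C by (simp add: borel_eq_closed)
    have "measure \<mu> (S \<inter> (UNIV - C)) = 1 - measure \<mu> (S \<inter> C)" if \<mu>: "\<mu> \<in> borel_probabilities S" for \<mu>
    proof -
      interpret finite_measure \<mu> by (rule borel_probabilitiesD[OF \<mu>])
      have "S \<inter> (UNIV - C) = space \<mu> - S \<inter> C" using borel_probabilitiesD(2)[OF \<mu>] by auto
      then show ?thesis using finite_measure_compl[OF meas[OF Cb \<mu>]] borel_probabilitiesD[OF \<mu>] by simp
    qed
    note c = this
    show "measure \<mu>1 (S \<inter> (UNIV - C)) = (1 - t) * measure \<mu>2 (S \<inter> (UNIV - C)) + t * measure \<mu>3 (S \<inter> (UNIV - C))"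
      unfolding c[OF \<mu>(1)] c[OF \<mu>(2)] c[OF \<mu>(3)] IH by (simp add: algebra_simps)
  next
    fix C :: "nat \<Rightarrow> 'b set"
    assume C: "disjoint_family C" "range C \<subseteq> sigma_sets UNIV (Collect closed)"
      and IH: "\<And>i. measure \<mu>1 (S \<inter> C i) = (1 - t) * measure \<mu>2 (S \<inter> C i) + t * measure \<mu>3 (S \<inter> C i)"
    have Cb: "C i \<in> sets borel" for i using C by (auto simp: borel_eq_closed)
    have sums: "(\<lambda>i. measure \<mu> (S \<inter> C i)) sums measure \<mu> (S \<inter> (\<Union>i. C i))" if \<mu>: "\<mu> \<in> borel_probabilities S" for \<mu>
    proof -
      interpret finite_measure \<mu> by (rule borel_probabilitiesD[OF \<mu>])
      have "(\<lambda>i. measure \<mu> (S \<inter> C i)) sums measure \<mu> (\<Union>i. S \<inter> C i)"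
        by (rule finite_measure_UNION) (use C meas[OF Cb \<mu>] in \<open>auto simp: disjoint_family_on_def\<close>)
      then show ?thesis by simp
    qed
    have "(\<lambda>i. measure \<mu>1 (S \<inter> C i)) sums ((1 - t) * measure \<mu>2 (S \<inter> (\<Union>i. C i)) + t * measure \<mu>3 (S \<inter> (\<Union>i. C i)))"
      unfolding IH by (intro sums_add sums_mult sums \<mu>)
    then show "measure \<mu>1 (S \<inter> (\<Union>i. C i)) = (1 - t) * measure \<mu>2 (S \<inter> (\<Union>i. C i)) + t * measure \<mu>3 (S \<inter> (\<Union>i. C i))"
      using sums[OF \<mu>(1)] sums_unique2 by blast
  qed simp
  obtain C where "C \<in> sets borel" "B = S \<inter> C" using B by (auto simp: sets_restrict_space)
  then show ?thesis using key by (simp add: borel_eq_closed)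
qed

section \<open>Gibbs vectors and their zero-temperature limits\<close>

lemma pointwise_convergent_subsequence:
  fixes x :: "nat \<Rightarrow> 'g \<Rightarrow> real"
  assumes "finite Y" "\<And>n s. s \<in> Y \<Longrightarrow> x n s \<in> {0..1}"
  shows "\<exists>r q. strict_mono r \<and> (\<forall>s\<in>Y. (\<lambda>n. x (r n) s) \<longlonglongrightarrow> q s)"
  using assms
proof (induction Y rule: finite_induct)
  case empty
  show ?case by (intro exI[of _ id]) (auto simp: strict_mono_def)
next
  case (insert s Y)
  then obtain r q where r: "strict_mono r" "\<forall>s\<in>Y. (\<lambda>n. x (r n) s) \<longlonglongrightarrow> q s" by auto
  have "\<forall>n. x (r n) s \<in> {0..1::real}" using insert.prems by simp
  then obtain l r' where r': "strict_mono r'" "((\<lambda>n. x (r n) s) \<circ> r') \<longlonglongrightarrow> l"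
    using compact_imp_seq_compact[OF compact_Icc, of 0 "1::real"] unfolding seq_compact_def by metis
  have "(\<lambda>n. x ((r \<circ> r') n) s') \<longlonglongrightarrow> (q(s := l)) s'" if "s' \<in> insert s Y" for s'
  proof (cases "s' = s")
    case False
    then have "((\<lambda>n. x (r n) s') \<circ> r') \<longlonglongrightarrow> q s'" using that r r' by (intro LIMSEQ_subseq_LIMSEQ) auto
    then show ?thesis using False by (simp add: o_def)
  qed (use r' in \<open>simp add: o_def\<close>)
  then show ?case using strict_mono_o[OF r(1) r'(1)] by blast
qed

text \<open>One summand of the relative entropy; the correction \<open>- x + y\<close>, whose sum
  vanishes for equal masses, makes every single summand nonnegative.\<close>

definition entropy_gap :: "real \<Rightarrow> real \<Rightarrow> real" where
  "entropy_gap x y = x * (ln x - ln y) - x + y"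

lemma entropy_gap_nonneg: "x > 0 \<Longrightarrow> y > 0 \<Longrightarrow> entropy_gap x y \<ge> 0"
  and entropy_gap_eq_0: "x > 0 \<Longrightarrow> y > 0 \<Longrightarrow> entropy_gap x y = 0 \<Longrightarrow> x = y"
proof -
  have eq: "entropy_gap x y = x * ((y / x - 1) - ln (y / x))" if "x > 0" "y > 0"
    using that by (simp add: entropy_gap_def ln_div field_simps)
  show "x > 0 \<Longrightarrow> y > 0 \<Longrightarrow> entropy_gap x y \<ge> 0"
    using ln_le_minus_one[of "y / x"] eq by simp
  show "x > 0 \<Longrightarrow> y > 0 \<Longrightarrow> entropy_gap x y = 0 \<Longrightarrow> x = y"
    using ln_eq_minus_one[of "y / x"] eq by simp
qed

text \<open>For equal masses the sum in \<open>zero\<close> is the relative entropy of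
  \<open>q\<close> with respect to \<open>q'\<close> plus \<open>c\<close> times the reversed one,
  so both vanish. The factor \<open>c\<close> accommodates means that are parallel but of different
  length.\<close>

lemma relative_entropy_rigidity:
  fixes q q' :: "'g \<Rightarrow> real"
  assumes "finite Z" and pos: "\<And>s. s \<in> Z \<Longrightarrow> q s > 0" "\<And>s. s \<in> Z \<Longrightarrow> q' s > 0"
    and sum: "(\<Sum>s\<in>Z. q s) = (\<Sum>s\<in>Z. q' s)" and c: "c > 0"
    and zero: "(\<Sum>s\<in>Z. (q s - c * q' s) * (ln (q s) - ln (q' s))) = 0" and s: "s \<in> Z"
  shows "q s = q' s"
proof -
  have "(\<Sum>s\<in>Z. entropy_gap (q s) (q' s)) + c * (\<Sum>s\<in>Z. entropy_gap (q' s) (q s)) =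
     (\<Sum>s\<in>Z. (q s - c * q' s) * (ln (q s) - ln (q' s))) - (1 - c) * ((\<Sum>s\<in>Z. q s) - (\<Sum>s\<in>Z. q' s))"
    unfolding entropy_gap_def sum_distrib_left sum_subtractf[symmetric] sum.distrib[symmetric]
    by (rule sum.cong) (auto simp: algebra_simps)
  then have eq: "(\<Sum>s\<in>Z. entropy_gap (q s) (q' s)) + c * (\<Sum>s\<in>Z. entropy_gap (q' s) (q s)) = 0"
    using zero sum by simp
  have n1: "(\<Sum>s\<in>Z. entropy_gap (q s) (q' s)) \<ge> 0" using pos by (intro sum_nonneg entropy_gap_nonneg) auto
  have n2: "c * (\<Sum>s\<in>Z. entropy_gap (q' s) (q s)) \<ge> 0"
    using pos c by (intro mult_nonneg_nonneg sum_nonneg entropy_gap_nonneg) auto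
  have "(\<Sum>s\<in>Z. entropy_gap (q s) (q' s)) = 0" using eq n1 n2 by linarith
  then have "entropy_gap (q s) (q' s) = 0"
    using assms(1) pos s by (subst (asm) sum_nonneg_eq_0_iff) (auto intro: entropy_gap_nonneg)
  then show ?thesis using entropy_gap_eq_0 pos s by blast
qed

text \<open>
  \<open>Gibbs \<beta>\<close> consists of the probability vectors \<open>q\<^sub>s = exp (\<xi>\<cdot>\<pi> s - \<beta> F s)\<close>; taking products along
  words they give the multiplicative solutions of the KMS equations at \<open>\<beta>\<close>. The limits as \<open>\<beta>\<close>
  tends to infinity satisfy the multiplicative relations that define \<open>Ground\<close>. For large \<open>\<beta>\<close>
  both sets are mapped homeomorphically onto the sphere by the normalised mean of \<open>\<pi>\<close>.
\<close>

locale zero_temperature =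
  fixes Y :: "'g set" and F :: "'g \<Rightarrow> real" and \<pi> :: "'g \<Rightarrow> real ^ 'n::finite"
  assumes finite_Y': "finite Y" and Y_nonempty: "Y \<noteq> {}" and F_pos': "\<And>s. s \<in> Y \<Longrightarrow> F s > 0"
    and spanning: "\<And>i e. e \<in> {1, -1} \<Longrightarrow> \<exists>a. (\<forall>s\<in>Y. a s \<ge> 0) \<and> (\<Sum>s\<in>Y. a s *\<^sub>R \<pi> s) = e *\<^sub>R axis i (1::real)"
begin

definition Simplex :: "('g \<Rightarrow> real) set" where
  "Simplex = {q. (\<forall>s\<in>Y. q s \<ge> 0) \<and> (\<Sum>s\<in>Y. q s) = 1 \<and> (\<forall>s. s \<notin> Y \<longrightarrow> q s = 0)}"

definition Gibbs :: "real \<Rightarrow> ('g \<Rightarrow> real) set" where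
  "Gibbs \<beta> = {q \<in> Simplex. \<exists>\<xi>. \<forall>s\<in>Y. q s = exp (\<xi> \<bullet> \<pi> s - \<beta> * F s)}"

text \<open>Since \<open>0 powr 0\<close> is 0, restricting to positive exponents makes a letter
  with exponent zero contribute the factor one. The absolute value gives continuity in
  \<open>q\<close> on the whole space.\<close>

definition pw :: "('g \<Rightarrow> real) \<Rightarrow> ('g \<Rightarrow> real) \<Rightarrow> real" where
  "pw q m = (\<Prod>s\<in>{s \<in> Y. m s > 0}. \<bar>q s\<bar> powr m s)"

definition balanced :: "('g \<Rightarrow> real) \<Rightarrow> ('g \<Rightarrow> real) \<Rightarrow> bool" where
  "balanced m m' \<longleftrightarrow> (\<forall>s\<in>Y. m s \<ge> 0 \<and> m' s \<ge> 0) \<and> (\<Sum>s\<in>Y. m s *\<^sub>R \<pi> s) = (\<Sum>s\<in>Y. m' s *\<^sub>R \<pi> s)"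

definition wF :: "('g \<Rightarrow> real) \<Rightarrow> real" where "wF m = (\<Sum>s\<in>Y. F s * m s)"

text \<open>The balance relation \<open>pw q m = exp (- \<beta> * (wF m - wF m')) * pw q m'\<close>
  of Gibbs vectors as \<beta> tends to infinity: equal energies leave an identity, and a strictly
  larger energy makes its monomial vanish.\<close>

definition Ground :: "('g \<Rightarrow> real) set" where
  "Ground = {q \<in> Simplex. \<forall>m m'. balanced m m' \<longrightarrow>
     (wF m = wF m' \<longrightarrow> pw q m = pw q m') \<and> (wF m > wF m' \<longrightarrow> pw q m = 0)}"

definition mean :: "('g \<Rightarrow> real) \<Rightarrow> real ^ 'n" where "mean q = (\<Sum>s\<in>Y. q s *\<^sub>R \<pi> s)"

definition direction :: "('g \<Rightarrow> real) \<Rightarrow> real ^ 'n" where "direction q = mean q /\<^sub>R norm (mean q)"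

lemma Simplex_le_1: "q \<in> Simplex \<Longrightarrow> s \<in> Y \<Longrightarrow> q s \<le> 1"
  using member_le_sum[of s Y q] finite_Y' by (auto simp: Simplex_def)

lemma Simplex_eqI: "q \<in> Simplex \<Longrightarrow> q' \<in> Simplex \<Longrightarrow> (\<And>s. s \<in> Y \<Longrightarrow> q s = q' s) \<Longrightarrow> q = q'"
  unfolding Simplex_def fun_eq_iff by (metis (mono_tags, lifting) mem_Collect_eq)

lemma pw_nonneg: "pw q m \<ge> 0"
  by (simp add: pw_def prod_nonneg)

lemma pw_le_1: "q \<in> Simplex \<Longrightarrow> pw q m \<le> 1"
  unfolding pw_def using Simplex_le_1[of q]
  by (intro prod_le_1) (auto simp: Simplex_def intro!: powr_le1)

lemma pw_pos:
  assumes "\<And>s. s \<in> Y \<Longrightarrow> m s > 0 \<Longrightarrow> q s > 0"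
  shows "pw q m = exp (\<Sum>s\<in>{s \<in> Y. m s > 0}. m s * ln (q s))"
proof -
  have "\<bar>q s\<bar> powr m s = exp (m s * ln (q s))" if "s \<in> {s \<in> Y. m s > 0}" for s
    using assms[of s] that by (simp add: powr_def)
  then show ?thesis unfolding pw_def using finite_Y' by (simp add: exp_sum)
qed

lemma pw_tendsto:
  assumes "\<And>s. s \<in> Y \<Longrightarrow> ((\<lambda>n. q n s) \<longlongrightarrow> q' s) A"
  shows "((\<lambda>n. pw (q n) m) \<longlongrightarrow> pw q' m) A"
  unfolding pw_def by (intro tendsto_prod tendsto_powr' tendsto_rabs assms tendsto_const) auto

text \<open>The vector \<xi> enters only through its inner product with the sum shared by
  \<open>m\<close> and \<open>m'\<close>, so it cancels.\<close>

lemma Gibbs_balance: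
  assumes q: "q \<in> Gibbs \<beta>" and m: "balanced m m'"
  shows "pw q m = exp (- \<beta> * (wF m - wF m')) * pw q m'"
proof -
  obtain \<xi> where \<xi>: "\<And>s. s \<in> Y \<Longrightarrow> q s = exp (\<xi> \<bullet> \<pi> s - \<beta> * F s)" using q by (auto simp: Gibbs_def)
  have pw: "pw q m = exp (\<xi> \<bullet> (\<Sum>s\<in>Y. m s *\<^sub>R \<pi> s) - \<beta> * wF m)" if "\<forall>s\<in>Y. m s \<ge> 0" for m
  proof -
    have "pw q m = exp (\<Sum>s\<in>{s \<in> Y. m s > 0}. m s * ln (q s))" by (rule pw_pos) (simp add: \<xi>)
    also have "(\<Sum>s\<in>{s \<in> Y. m s > 0}. m s * ln (q s)) = (\<Sum>s\<in>Y. m s * (\<xi> \<bullet> \<pi> s - \<beta> * F s))"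
      using that finite_Y' by (intro sum.mono_neutral_cong_left) (auto simp: \<xi> order_le_less)
    also have "\<dots> = \<xi> \<bullet> (\<Sum>s\<in>Y. m s *\<^sub>R \<pi> s) - \<beta> * wF m"
      by (simp add: wF_def inner_sum_right sum_distrib_left sum_subtractf algebra_simps)
    finally show ?thesis .
  qed
  show ?thesis using m unfolding balanced_def
    by (simp add: pw mult_exp_exp algebra_simps)
qed

lemma Gibbs_limit:
  assumes \<beta>: "filterlim \<beta> at_top sequentially" and q: "\<And>n. q n \<in> Gibbs (\<beta> n)"
    and lim: "\<And>s. s \<in> Y \<Longrightarrow> (\<lambda>n. q n s) \<longlonglongrightarrow> q' s" and off: "\<And>s. s \<notin> Y \<Longrightarrow> q' s = 0"
  shows "q' \<in> Ground"
proof -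
  have S: "q n \<in> Simplex" for n using q by (simp add: Gibbs_def)
  have "q' s \<ge> 0" if "s \<in> Y" for s
    by (rule tendsto_lowerbound[OF lim[OF that]]) (use S that in \<open>auto simp: Simplex_def\<close>)
  moreover have "(\<Sum>s\<in>Y. q' s) = 1"
  proof -
    have "(\<lambda>n. \<Sum>s\<in>Y. q n s) \<longlonglongrightarrow> (\<Sum>s\<in>Y. q' s)" by (intro tendsto_sum lim)
    then show ?thesis using S by (simp add: Simplex_def LIMSEQ_const_iff)
  qed
  ultimately have S': "q' \<in> Simplex" using off by (simp add: Simplex_def)
  have rel: "(wF m = wF m' \<longrightarrow> pw q' m = pw q' m') \<and> (wF m > wF m' \<longrightarrow> pw q' m = 0)" if m: "balanced m m'" for m m'
  proof (intro conjI impI)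
    have l: "(\<lambda>n. pw (q n) m) \<longlonglongrightarrow> pw q' m" "(\<lambda>n. pw (q n) m') \<longlonglongrightarrow> pw q' m'" by (intro pw_tendsto lim; assumption)+
    show "pw q' m = pw q' m'" if "wF m = wF m'"
    proof -
      have "pw (q n) m = pw (q n) m'" for n using Gibbs_balance[OF q m, of n] that by simp
      then show ?thesis using l LIMSEQ_unique by auto
    qed
    show "pw q' m = 0" if w: "wF m > wF m'"
    proof -
      have "filterlim (\<lambda>n. (wF m - wF m') * \<beta> n) at_top sequentially"
        using w by (intro filterlim_tendsto_pos_mult_at_top[OF tendsto_const _ \<beta>]) simp
      then have "filterlim (\<lambda>n. - ((wF m - wF m') * \<beta> n)) at_bot sequentially"
        by (simp add: filterlim_uminus_at_top)
      then have e: "(\<lambda>n. exp (- ((wF m - wF m') * \<beta> n))) \<longlonglongrightarrow> 0"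
        by (rule filterlim_compose[OF exp_at_bot])
      have "(\<lambda>n. pw (q n) m) \<longlonglongrightarrow> 0"
      proof (rule Lim_null_comparison[OF _ e], rule always_eventually, rule allI)
        fix n
        have "pw (q n) m \<le> exp (- ((wF m - wF m') * \<beta> n)) * 1"
          unfolding Gibbs_balance[OF q m, of n] using pw_le_1[OF S, of n m']
          by (simp add: mult.commute)
        then show "norm (pw (q n) m) \<le> exp (- ((wF m - wF m') * \<beta> n))" using pw_nonneg by simp
      qed
      then show ?thesis using l LIMSEQ_unique by blast
    qed
  qed
  show ?thesis unfolding Ground_def using S' rel by blast
qed

lemma compact_box: "compact (PiE UNIV (\<lambda>s. if s \<in> Y then {0..1::real} else {0}))"
proof -
  have "compactin (product_topology (\<lambda>_. euclidean) UNIV) (PiE UNIV (\<lambda>s. if s \<in> Y then {0..1::real} else {0}))"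
    by (subst compactin_PiE) auto
  then show ?thesis by (simp add: euclidean_product_topology)
qed

lemma continuous_on_coordinate [continuous_intros]:
  "continuous_on A (\<lambda>q :: 'g \<Rightarrow> real. q s)"
  by (rule continuous_on_subset[OF continuous_on_product_coordinates]) auto

lemma compact_Ground: "compact Ground"
proof -
  have cpw: "continuous_on UNIV (\<lambda>q. pw q m)" for m
    unfolding pw_def by (intro continuous_on_prod continuous_on_powr' continuous_intros) auto
  have "Simplex = PiE UNIV (\<lambda>s. if s \<in> Y then {0..1::real} else {0}) \<inter> {q. (\<Sum>s\<in>Y. q s) = 1}"
    using Simplex_le_1 by (auto simp: PiE_def Pi_def Simplex_def split: if_splits)
  moreover have "closed {q :: 'g \<Rightarrow> real. (\<Sum>s\<in>Y. q s) = 1}"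
    by (intro closed_Collect_eq continuous_intros)
  ultimately have cS: "compact Simplex" using compact_Int_closed[OF compact_box] by simp
  have "closed {q. \<forall>m m'. balanced m m' \<and> wF m = wF m' \<longrightarrow> pw q m = pw q m'}"
    by (intro closed_Collect_all closed_Collect_imp open_Collect_const closed_Collect_eq cpw)
  moreover have "closed {q. \<forall>m m'. balanced m m' \<and> wF m > wF m' \<longrightarrow> pw q m = 0}"
    by (intro closed_Collect_all closed_Collect_imp open_Collect_const closed_Collect_eq cpw continuous_on_const)
  ultimately have "compact (Simplex \<inter> ({q. \<forall>m m'. balanced m m' \<and> wF m = wF m' \<longrightarrow> pw q m = pw q m'} \<inter>
      {q. \<forall>m m'. balanced m m' \<and> wF m > wF m' \<longrightarrow> pw q m = 0}))"
    by (intro compact_Int_closed cS closed_Int)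
  also have "Simplex \<inter> ({q. \<forall>m m'. balanced m m' \<and> wF m = wF m' \<longrightarrow> pw q m = pw q m'} \<inter>
      {q. \<forall>m m'. balanced m m' \<and> wF m > wF m' \<longrightarrow> pw q m = 0}) = Ground"
    unfolding Ground_def by blast
  finally show ?thesis .
qed

lemma mean_continuous: "continuous_on A mean"
  unfolding mean_def by (intro continuous_intros)

lemma GroundD:
  assumes "q \<in> Ground" "balanced m m'"
  shows "wF m = wF m' \<Longrightarrow> pw q m = pw q m'" "wF m > wF m' \<Longrightarrow> pw q m = 0"
  using assms unfolding Ground_def by blast+

text \<open>If the mean were zero, the exponents \<open>q\<close> and 0 would be balanced, and
  \<open>q\<close> has positive energy; so \<open>pw q q\<close> would vanish, although it only
  involves letters of positive weight.\<close>

lemma Ground_mean_nonzero: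
  assumes q: "q \<in> Ground"
  shows "mean q \<noteq> 0"
proof
  assume 0: "mean q = 0"
  have S: "q \<in> Simplex" using q by (simp add: Ground_def)
  have "balanced q (\<lambda>_. 0)" using 0 S by (auto simp: balanced_def mean_def Simplex_def)
  moreover have "wF q > wF (\<lambda>_. 0)"
  proof -
    have "\<exists>s\<in>Y. q s \<noteq> 0" using S by (auto simp: Simplex_def intro: ccontr)
    then obtain s where "s \<in> Y" "q s > 0" using S by (force simp: Simplex_def)
    then show ?thesis unfolding wF_def using F_pos' S finite_Y'
      by (auto simp: Simplex_def order_le_less intro!: sum_pos2[of Y s] mult_nonneg_nonneg)
  qed
  ultimately have "pw q q = 0" using q by (auto simp: Ground_def)
  then show False using pw_pos[of q q] by simp
qed

section \<open>Injectivity of the direction on ground vectors\<close>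

lemma direction_eqD:
  assumes "direction q = direction q'" "mean q \<noteq> 0" "mean q' \<noteq> 0"
  obtains c where "c > 0" "mean q = c *\<^sub>R mean q'"
proof
  show "norm (mean q) / norm (mean q') > 0" using assms by simp
  have "mean q = norm (mean q) *\<^sub>R direction q" using assms(2) by (simp add: direction_def)
  also have "direction q = direction q'" by (rule assms)
  finally have "mean q = norm (mean q) *\<^sub>R direction q'" .
  also have "\<dots> = (norm (mean q) / norm (mean q')) *\<^sub>R mean q'"
    by (simp only: direction_def divide_inverse scaleR_scaleR)
  finally show "mean q = (norm (mean q) / norm (mean q')) *\<^sub>R mean q'" .
qed

text \<open>If the directions agree, then \<open>mean q = c *\<^sub>R mean q'\<close>, and the
  exponents \<open>q\<close> and \<open>m' = c * q'\<close> are balanced. The relations at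
  \<open>q\<close> and at \<open>q'\<close> show that energies and supports agree; their logarithms
  on the common support supply the hypothesis of \<open>relative_entropy_rigidity\<close>.\<close>

lemma Ground_inj:
  assumes q: "q \<in> Ground" "q' \<in> Ground" and d: "direction q = direction q'"
  shows "q = q'"
proof -
  obtain c where c: "c > 0" "mean q = c *\<^sub>R mean q'"
    using direction_eqD[OF d Ground_mean_nonzero[OF q(1)] Ground_mean_nonzero[OF q(2)]] .
  have S: "q \<in> Simplex" "q' \<in> Simplex" using q by (auto simp: Ground_def)
  define m' where "m' s = c * q' s" for s
  have bal: "balanced q m'" "balanced m' q"
    using c S by (auto simp: balanced_def mean_def m'_def Simplex_def scaleR_sum_right)
  have pos: "pw q q \<noteq> 0" "pw q' m' \<noteq> 0"
    using pw_pos[of q q] pw_pos[of m' q'] c by (auto simp: m'_def zero_less_mult_iff)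
  \<comment> \<open>Were the energies different, the relation at \<open>q\<close> or at
    \<open>q'\<close> would annihilate a monomial all of whose letters have positive weight.\<close>
  have w: "wF q = wF m'"
    using GroundD(2)[OF q(1) bal(1)] GroundD(2)[OF q(2) bal(2)] pos by (meson linorder_neqE_linordered_idom)
  have eq: "pw q q = pw q m'" "pw q' m' = pw q' q"
    using GroundD(1)[OF q(1) bal(1)] GroundD(1)[OF q(2) bal(2)] w by auto
  have zero: "pw p m = 0" if "s \<in> Y" "m s > 0" "p s = 0" for p m s
    unfolding pw_def using that finite_Y' by (intro prod_zero) auto
  have supp: "q s > 0 \<longleftrightarrow> q' s > 0" if s: "s \<in> Y" for s
  proof -
    have "q s = 0 \<Longrightarrow> \<not> q' s > 0" using zero[of s m' q] s eq pos c by (auto simp: m'_def)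
    moreover have "q' s = 0 \<Longrightarrow> \<not> q s > 0" using zero[of s q q'] s eq pos by auto
    ultimately show ?thesis using S s by (auto simp: Simplex_def order_le_less)
  qed
  define Z where "Z = {s \<in> Y. q s > 0}"
  have Z': "Z = {s \<in> Y. q' s > 0}" "Z = {s \<in> Y. m' s > 0}"
    using supp c by (auto simp: Z_def m'_def zero_less_mult_iff)
  have fZ: "finite Z" using finite_Y' by (simp add: Z_def)
  have off: "q s = 0" "q' s = 0" if "s \<notin> Z" for s
    using that S supp[of s] by (cases "s \<in> Y"; auto simp: Z_def Simplex_def order_le_less)+
  have l1: "(\<Sum>s\<in>Z. q s * ln (q s)) = (\<Sum>s\<in>Z. m' s * ln (q s))"
    using eq(1) pw_pos[of q q] pw_pos[of m' q] supp c unfolding Z'(2)[symmetric] Z_def[symmetric]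
    by (auto simp: m'_def zero_less_mult_iff)
  have l2: "(\<Sum>s\<in>Z. m' s * ln (q' s)) = (\<Sum>s\<in>Z. q s * ln (q' s))"
    using eq(2) pw_pos[of m' q'] pw_pos[of q q'] supp c unfolding Z'(2)[symmetric] Z_def[symmetric]
    by (auto simp: m'_def zero_less_mult_iff)
  have "q s = q' s" if "s \<in> Z" for s
  proof (rule relative_entropy_rigidity[OF fZ _ _ _ c(1) _ that])
    show "(\<Sum>s\<in>Z. q s) = (\<Sum>s\<in>Z. q' s)"
    proof -
      have "(\<Sum>s\<in>Z. q s) = (\<Sum>s\<in>Y. q s)" "(\<Sum>s\<in>Z. q' s) = (\<Sum>s\<in>Y. q' s)"
        using finite_Y' off by (auto intro!: sum.mono_neutral_left simp: Z_def)
      then show ?thesis using S by (simp add: Simplex_def)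
    qed
    have "(\<Sum>s\<in>Z. (q s - c * q' s) * (ln (q s) - ln (q' s))) =
      (\<Sum>s\<in>Z. q s * ln (q s)) - (\<Sum>s\<in>Z. m' s * ln (q s)) - (\<Sum>s\<in>Z. q s * ln (q' s)) + (\<Sum>s\<in>Z. m' s * ln (q' s))"
      unfolding sum_subtractf[symmetric] sum.distrib[symmetric]
      by (rule sum.cong) (auto simp: m'_def algebra_simps)
    then show "(\<Sum>s\<in>Z. (q s - c * q' s) * (ln (q s) - ln (q' s))) = 0" using l1 l2 by simp
  qed (use Z' in \<open>auto simp: Z_def\<close>)
  then show ?thesis using off by (auto simp: fun_eq_iff) metis
qed

text \<open>Beyond this value \<open>\<beta> * F s\<close> exceeds \<open>card Y\<close> for every
  letter. That excludes a vanishing mean by an entropy estimate, and it gives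
  \<open>Z \<beta> 0 \<le> 1\<close>, where the maximisation in \<open>Gibbs_exists\<close>
  starts.\<close>

definition threshold :: real where "threshold = real (card Y) / Min (F ` Y)"

lemma threshold_bound:
  assumes "\<beta> > threshold" "s \<in> Y"
  shows "\<beta> * F s > real (card Y)" "\<beta> > 0"
proof -
  have F: "Min (F ` Y) \<le> F s" "Min (F ` Y) > 0"
    using finite_Y' assms F_pos' Y_nonempty by auto
  then have 1: "\<beta> * Min (F ` Y) > real (card Y)" using assms by (simp add: threshold_def field_simps)
  show b: "\<beta> > 0" using assms(1) F(2) by (auto simp: threshold_def intro: le_less_trans[rotated])
  have "\<beta> * Min (F ` Y) \<le> \<beta> * F s" using F b by (intro mult_left_mono) auto
  then show "\<beta> * F s > real (card Y)" using 1 by simp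
qed

text \<open>With zero mean, the sum of \<open>q s * ln (q s)\<close> is minus the average of
  \<open>\<beta> * F s\<close>, hence at most \<open>- card Y\<close>, whereas
  \<open>x * ln x \<ge> x - 1\<close> bounds it below by \<open>1 - card Y\<close>.\<close>

lemma Gibbs_mean_nonzero:
  assumes q: "q \<in> Gibbs \<beta>" and \<beta>: "\<beta> > threshold"
  shows "mean q \<noteq> 0"
proof
  assume 0: "mean q = 0"
  obtain \<xi> where \<xi>: "\<And>s. s \<in> Y \<Longrightarrow> q s = exp (\<xi> \<bullet> \<pi> s - \<beta> * F s)" using q by (auto simp: Gibbs_def)
  have S: "(\<Sum>s\<in>Y. q s) = 1" using q by (simp add: Gibbs_def Simplex_def)
  have "(\<Sum>s\<in>Y. q s * ln (q s)) = \<xi> \<bullet> mean q - (\<Sum>s\<in>Y. q s * (\<beta> * F s))"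
    unfolding mean_def inner_sum_right sum_subtractf[symmetric]
    by (rule sum.cong) (auto simp: \<xi> algebra_simps)
  also have "\<dots> = - (\<Sum>s\<in>Y. q s * (\<beta> * F s))" using 0 by simp
  also have "(\<Sum>s\<in>Y. q s * (\<beta> * F s)) \<ge> (\<Sum>s\<in>Y. q s * real (card Y))"
    using threshold_bound[OF \<beta>] \<xi> by (intro sum_mono mult_left_mono) (auto intro: less_imp_le)
  then have "- (\<Sum>s\<in>Y. q s * (\<beta> * F s)) \<le> - real (card Y)" by (simp add: sum_distrib_right[symmetric] S)
  finally have "(\<Sum>s\<in>Y. q s * ln (q s)) \<le> - real (card Y)" .
  moreover have "(\<Sum>s\<in>Y. q s - 1) \<le> (\<Sum>s\<in>Y. q s * ln (q s))"
  proof (rule sum_mono)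
    fix s assume "s \<in> Y"
    then show "q s - 1 \<le> q s * ln (q s)" using entropy_gap_nonneg[of "q s" 1] \<xi> by (simp add: entropy_gap_def)
  qed
  ultimately show False using S by (simp add: sum_subtractf)
qed

text \<open>Here \<open>ln (q s) - ln (q' s)\<close> is
  \<open>(\<xi> - \<xi>') \<bullet> \<pi> s\<close>, so the sum required by the rigidity lemma is
  the inner product of \<open>\<xi> - \<xi>'\<close> with
  \<open>mean q - c *\<^sub>R mean q' = 0\<close>.\<close>

lemma Gibbs_inj:
  assumes q: "q \<in> Gibbs \<beta>" "q' \<in> Gibbs \<beta>" and \<beta>: "\<beta> > threshold" and d: "direction q = direction q'"
  shows "q = q'"
proof -
  obtain c where c: "c > 0" "mean q = c *\<^sub>R mean q'"
    using direction_eqD[OF d Gibbs_mean_nonzero[OF q(1) \<beta>] Gibbs_mean_nonzero[OF q(2) \<beta>]] .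
  obtain \<xi> \<xi>' where \<xi>: "\<And>s. s \<in> Y \<Longrightarrow> q s = exp (\<xi> \<bullet> \<pi> s - \<beta> * F s)" "\<And>s. s \<in> Y \<Longrightarrow> q' s = exp (\<xi>' \<bullet> \<pi> s - \<beta> * F s)"
    using q by (auto simp: Gibbs_def)
  have S: "q \<in> Simplex" "q' \<in> Simplex" using q by (auto simp: Gibbs_def)
  show ?thesis
  proof (rule Simplex_eqI[OF S])
    fix s assume s: "s \<in> Y"
    show "q s = q' s"
    proof (rule relative_entropy_rigidity[OF finite_Y' _ _ _ c(1) _ s])
      have "(\<Sum>s\<in>Y. (q s - c * q' s) * (ln (q s) - ln (q' s))) = (\<xi> - \<xi>') \<bullet> (mean q - c *\<^sub>R mean q')"
        unfolding mean_def scaleR_sum_right sum_subtractf[symmetric] inner_sum_right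
        by (rule sum.cong) (auto simp: \<xi> algebra_simps)
      then show "(\<Sum>s\<in>Y. (q s - c * q' s) * (ln (q s) - ln (q' s))) = 0" using c by simp
    qed (use S \<xi> in \<open>auto simp: Simplex_def\<close>)
  qed
qed

text \<open>The partition function; \<open>Gibbs \<beta>\<close> corresponds to its level set at
  one.\<close>

definition Z :: "real \<Rightarrow> real ^ 'n \<Rightarrow> real" where
  "Z \<beta> \<xi> = (\<Sum>s\<in>Y. exp (\<xi> \<bullet> \<pi> s - \<beta> * F s))"

lemma Z_continuous: "continuous_on A (Z \<beta>)"
  unfolding Z_def by (intro continuous_intros)

text \<open>Every term being at most one bounds each \<open>\<xi> \<bullet> \<pi> s\<close> from
  above. By \<open>spanning\<close> both signs of every axis vector are nonnegative combinations of
  the \<open>\<pi> s\<close>, which bounds the coordinates on both sides.\<close>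

lemma bounded_Z: "bounded {\<xi>. Z \<beta> \<xi> \<le> 1}"
proof -
  have le: "\<xi> \<bullet> \<pi> s \<le> \<beta> * F s" if "Z \<beta> \<xi> \<le> 1" "s \<in> Y" for \<xi> s
  proof -
    have "exp (\<xi> \<bullet> \<pi> s - \<beta> * F s) \<le> Z \<beta> \<xi>"
      unfolding Z_def by (rule member_le_sum[OF that(2)]) (use finite_Y' in auto)
    then have "exp (\<xi> \<bullet> \<pi> s - \<beta> * F s) \<le> 1" using that(1) by (rule order_trans)
    then show ?thesis by simp
  qed
  have "\<exists>C. \<forall>\<xi>. Z \<beta> \<xi> \<le> 1 \<longrightarrow> e * (\<xi> $ i) \<le> C" if e: "e \<in> {1, -1}" for e i
  proof -
    obtain a where a: "\<forall>s\<in>Y. a s \<ge> 0" "(\<Sum>s\<in>Y. a s *\<^sub>R \<pi> s) = e *\<^sub>R axis i (1::real)" using spanning[OF e] by blast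
    have "e * (\<xi> $ i) \<le> (\<Sum>s\<in>Y. a s * (\<beta> * F s))" if "Z \<beta> \<xi> \<le> 1" for \<xi>
    proof -
      have "e * (\<xi> $ i) = \<xi> \<bullet> (e *\<^sub>R axis i 1)" by (simp add: inner_axis)
      also have "\<dots> = (\<Sum>s\<in>Y. a s * (\<xi> \<bullet> \<pi> s))" unfolding a(2)[symmetric] by (simp add: inner_sum_right)
      also have "\<dots> \<le> (\<Sum>s\<in>Y. a s * (\<beta> * F s))" using a le[OF that] by (intro sum_mono mult_left_mono) auto
      finally show ?thesis .
    qed
    then show ?thesis by blast
  qed
  then have "\<forall>e i. \<exists>C. e \<in> {1, -1} \<longrightarrow> (\<forall>\<xi>. Z \<beta> \<xi> \<le> 1 \<longrightarrow> e * (\<xi> $ i) \<le> C)" by blast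
  then obtain C where C: "\<And>e i \<xi>. e \<in> {1, -1::real} \<Longrightarrow> Z \<beta> \<xi> \<le> 1 \<Longrightarrow> e * (\<xi> $ i) \<le> C e i" by metis
  have "norm \<xi> \<le> (\<Sum>i\<in>UNIV. \<bar>C 1 i\<bar> + \<bar>C (-1) i\<bar>)" if "Z \<beta> \<xi> \<le> 1" for \<xi>
  proof -
    have "norm \<xi> \<le> (\<Sum>i\<in>UNIV. \<bar>\<xi> $ i\<bar>)" by (rule norm_le_l1_cart)
    also have "\<dots> \<le> (\<Sum>i\<in>UNIV. \<bar>C 1 i\<bar> + \<bar>C (-1) i\<bar>)"
      using C[of 1 \<xi>] C[of "-1" \<xi>] that by (intro sum_mono) (smt (verit) insertCI)
    finally show ?thesis .
  qed
  then show ?thesis unfolding bounded_iff by blast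
qed

text \<open>The linear form given by \<open>v\<close> attains its maximum over the compact set where
  \<open>Z \<beta> \<le> 1\<close>, necessarily at a point of the level set. The gradient of
  \<open>Z\<close> there is the mean of the Gibbs vector, and by optimality it is a positive
  multiple of \<open>v\<close>.\<close>

lemma Gibbs_exists:
  assumes \<beta>: "\<beta> > threshold" and v: "norm v = 1"
  shows "\<exists>q\<in>Gibbs \<beta>. direction q = v"
proof -
  define C where "C = {\<xi>. Z \<beta> \<xi> \<le> 1}"
  have "closed C" unfolding C_def by (intro closed_Collect_le Z_continuous continuous_on_const)
  then have cC: "compact C" using bounded_Z by (simp add: C_def compact_eq_bounded_closed)
  have "0 \<in> C"
  proof -
    have N: "real (card Y) > 0" using finite_Y' Y_nonempty by (simp add: card_gt_0_iff)
    have "exp (- (\<beta> * F s)) \<le> 1 / real (card Y)" if s: "s \<in> Y" for s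
    proof -
      have "real (card Y) \<le> exp (real (card Y))" using exp_ge_add_one_self[of "real (card Y)"] by linarith
      also have "\<dots> \<le> exp (\<beta> * F s)" using threshold_bound(1)[OF \<beta> s] by simp
      finally have "real (card Y) \<le> exp (\<beta> * F s)" .
      then have "inverse (exp (\<beta> * F s)) \<le> inverse (real (card Y))" using N by (rule le_imp_inverse_le)
      then show ?thesis by (simp add: exp_minus inverse_eq_divide)
    qed
    then have "Z \<beta> 0 \<le> (\<Sum>s\<in>Y. 1 / real (card Y))" unfolding Z_def by (intro sum_mono) simp
    also have "\<dots> = 1" using N by simp
    finally show ?thesis by (simp add: C_def)
  qed
  then have "\<exists>\<xi>\<in>C. \<forall>\<eta>\<in>C. \<eta> \<bullet> v \<le> \<xi> \<bullet> v"
    by (intro continuous_attains_sup[OF cC] continuous_intros) auto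
  then obtain \<xi> where \<xi>C: "\<xi> \<in> C" and max: "\<And>\<eta>. \<eta> \<in> C \<Longrightarrow> \<eta> \<bullet> v \<le> \<xi> \<bullet> v" by blast
  have Z1: "Z \<beta> \<xi> = 1"
  proof (rule ccontr)
    assume "Z \<beta> \<xi> \<noteq> 1"
    then have lt: "Z \<beta> \<xi> < 1" using \<xi>C by (simp add: C_def)
    have "open {\<eta>. Z \<beta> \<eta> < 1}" by (intro open_Collect_less Z_continuous continuous_on_const)
    then obtain e where e: "e > 0" "ball \<xi> e \<subseteq> {\<eta>. Z \<beta> \<eta> < 1}" using lt open_contains_ball by blast
    have "\<xi> + (e/2) *\<^sub>R v \<in> ball \<xi> e" using e v by (simp add: dist_norm)
    then have "\<xi> + (e/2) *\<^sub>R v \<in> C" using e by (auto simp: C_def)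
    then have "(\<xi> + (e/2) *\<^sub>R v) \<bullet> v \<le> \<xi> \<bullet> v" by (rule max)
    then show False using e v by (simp add: inner_add_left dot_square_norm)
  qed
  define q where "q s = (if s \<in> Y then exp (\<xi> \<bullet> \<pi> s - \<beta> * F s) else 0)" for s
  have qG: "q \<in> Gibbs \<beta>" using Z1 by (auto simp: Gibbs_def Simplex_def q_def Z_def)
  define g where "g = mean q"
  have g0: "g \<noteq> 0" unfolding g_def by (rule Gibbs_mean_nonzero[OF qG \<beta>])
  \<comment> \<open>A direction along which \<open>Z\<close> decreases stays in \<open>C\<close> for
    a short time, so it cannot increase the inner product with \<open>v\<close>.\<close>
  have desc: "h \<bullet> v \<le> 0" if h: "g \<bullet> h < 0" for h
  proof -
    define f where "f x = (\<Sum>s\<in>Y. exp ((\<xi> \<bullet> \<pi> s - \<beta> * F s) + x * (h \<bullet> \<pi> s)))" for x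
    have f: "f x = Z \<beta> (\<xi> + x *\<^sub>R h)" for x
      unfolding f_def Z_def by (rule sum.cong) (auto simp: inner_add_left algebra_simps)
    have "DERIV f 0 :> (\<Sum>s\<in>Y. exp ((\<xi> \<bullet> \<pi> s - \<beta> * F s) + 0 * (h \<bullet> \<pi> s)) * (h \<bullet> \<pi> s))"
      unfolding f_def by (rule DERIV_sum) (auto intro!: derivative_eq_intros)
    also have "(\<Sum>s\<in>Y. exp ((\<xi> \<bullet> \<pi> s - \<beta> * F s) + 0 * (h \<bullet> \<pi> s)) * (h \<bullet> \<pi> s)) = g \<bullet> h"
      unfolding g_def mean_def inner_sum_left by (rule sum.cong) (auto simp: q_def inner_commute)
    finally obtain d where d: "d > 0" "\<And>x. x > 0 \<Longrightarrow> x < d \<Longrightarrow> f (0 + x) < f 0"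
      using DERIV_neg_dec_right h by blast
    have "f (d/2) < f 0" using d(2)[of "d/2"] d(1) by simp
    then have "\<xi> + (d/2) *\<^sub>R h \<in> C" using Z1 by (simp add: f C_def)
    then have "(\<xi> + (d/2) *\<^sub>R h) \<bullet> v \<le> \<xi> \<bullet> v" by (rule max)
    then show ?thesis using d(1) by (simp add: inner_add_left mult_le_0_iff)
  qed
  have gv: "g \<bullet> v \<ge> norm g"
  proof (rule ccontr)
    assume lt: "\<not> g \<bullet> v \<ge> norm g"
    \<comment> \<open>If \<open>g\<close> were not a nonnegative multiple of \<open>v\<close>, a
      move along this \<open>h\<close> would decrease \<open>Z\<close> to first order and yet
      increase the inner product with \<open>v\<close>.\<close>
    define h where "h = norm g *\<^sub>R v - g"
    have "g \<bullet> h = norm g * (g \<bullet> v - norm g)"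
      by (simp add: h_def inner_diff_right dot_square_norm power2_eq_square algebra_simps)
    then have "g \<bullet> h < 0" using lt g0 by (simp add: mult_less_0_iff)
    then have "h \<bullet> v \<le> 0" by (rule desc)
    moreover have "h \<bullet> v = norm g - g \<bullet> v" using v by (simp add: h_def inner_diff_left dot_square_norm)
    ultimately show False using lt by simp
  qed
  then have "g \<bullet> v = norm g * norm v" using norm_cauchy_schwarz[of g v] v by simp
  then have "norm g *\<^sub>R v = norm v *\<^sub>R g" by (simp add: norm_cauchy_schwarz_eq)
  then have "norm g *\<^sub>R v = g" using v by simp
  then have "direction q = v" using g0 unfolding direction_def g_def[symmetric]
    by (metis inverse_inverse_eq left_inverse norm_eq_zero scaleR_one scaleR_scaleR)
  then show ?thesis using qG by blast
qed

section \<open>Compactness and limits of Gibbs vectors\<close>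

lemma compact_Gibbs: "compact (Gibbs \<beta>)"
proof -
  define f where "f \<xi> = (\<lambda>s. if s \<in> Y then exp (\<xi> \<bullet> \<pi> s - \<beta> * F s) else 0)" for \<xi>
  have "Gibbs \<beta> = f ` {\<xi>. Z \<beta> \<xi> = 1}"
  proof (intro equalityI subsetI)
    fix q assume "q \<in> Gibbs \<beta>"
    then obtain \<xi> where "q \<in> Simplex" "\<forall>s\<in>Y. q s = exp (\<xi> \<bullet> \<pi> s - \<beta> * F s)" by (auto simp: Gibbs_def)
    then show "q \<in> f ` {\<xi>. Z \<beta> \<xi> = 1}"
      by (intro image_eqI[of _ _ \<xi>]) (auto simp: f_def Simplex_def Z_def fun_eq_iff)
  qed (auto simp: Gibbs_def Simplex_def f_def Z_def)
  moreover have "compact {\<xi>. Z \<beta> \<xi> = 1}"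
  proof -
    have "bounded {\<xi>. Z \<beta> \<xi> = 1}" by (rule bounded_subset[OF bounded_Z[of \<beta>]]) auto
    moreover have "closed {\<xi>. Z \<beta> \<xi> = 1}" by (intro closed_Collect_eq Z_continuous continuous_on_const)
    ultimately show ?thesis by (simp add: compact_eq_bounded_closed)
  qed
  moreover have "continuous_on A f" for A
  proof (rule continuous_on_coordinatewise_then_product)
    show "continuous_on A (\<lambda>\<xi>. f \<xi> s)" for s
      unfolding f_def by (cases "s \<in> Y") (auto intro!: continuous_intros)
  qed
  ultimately show ?thesis using compact_continuous_image by metis
qed

lemma direction_tendsto:
  assumes "\<And>s. s \<in> Y \<Longrightarrow> ((\<lambda>n. q n s) \<longlongrightarrow> q' s) A" "mean q' \<noteq> 0"
  shows "((\<lambda>n. direction (q n)) \<longlongrightarrow> direction q') A"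
  unfolding direction_def using assms
  by (intro tendsto_intros) (auto simp: mean_def intro!: tendsto_intros)

lemma Gibbs_subsequence:
  assumes \<beta>: "filterlim \<beta> at_top sequentially" and q: "\<And>n. q n \<in> Gibbs (\<beta> n)"
  shows "\<exists>r q'. strict_mono r \<and> q' \<in> Ground \<and> (\<forall>s\<in>Y. (\<lambda>n. q (r n) s) \<longlonglongrightarrow> q' s)"
proof -
  have "q n s \<in> {0..1}" if "s \<in> Y" for n s
    using q[of n] Simplex_le_1[of "q n" s] that by (auto simp: Gibbs_def Simplex_def)
  then obtain r q0 where r: "strict_mono r" "\<forall>s\<in>Y. (\<lambda>n. q (r n) s) \<longlonglongrightarrow> q0 s"
    using pointwise_convergent_subsequence[OF finite_Y', of q] by blast
  define q' where "q' s = (if s \<in> Y then q0 s else 0)" for s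
  have lim: "\<forall>s\<in>Y. (\<lambda>n. q (r n) s) \<longlonglongrightarrow> q' s" using r by (simp add: q'_def)
  have "q' \<in> Ground"
    by (rule Gibbs_limit[where \<beta> = "\<beta> \<circ> r" and q = "q \<circ> r"])
       (use lim q in \<open>auto simp: q'_def o_def intro: filterlim_compose[OF \<beta> filterlim_subseq[OF r(1)]]\<close>)
  then show ?thesis using r lim by blast
qed

text \<open>Gibbs vectors with direction \<open>v\<close> accumulate at a ground vector. As its mean
  is nonzero, \<open>direction\<close> is continuous there and the direction persists.\<close>

lemma Ground_exists:
  assumes v: "norm v = 1"
  shows "\<exists>q\<in>Ground. direction q = v"
proof -
  define \<beta> where "\<beta> n = threshold + 1 + real n" for n
  have \<beta>: "filterlim \<beta> at_top sequentially" unfolding \<beta>_def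
    by (intro filterlim_tendsto_add_at_top[OF tendsto_const] filterlim_real_sequentially)
  have "\<exists>q\<in>Gibbs (\<beta> n). direction q = v" for n by (rule Gibbs_exists[OF _ v]) (simp add: \<beta>_def)
  then obtain q where q: "\<And>n. q n \<in> Gibbs (\<beta> n)" "\<And>n. direction (q n) = v" by metis
  obtain r q' where r: "strict_mono r" "q' \<in> Ground" "\<forall>s\<in>Y. (\<lambda>n. q (r n) s) \<longlonglongrightarrow> q' s"
    using Gibbs_subsequence[OF \<beta> q(1)] by blast
  have "(\<lambda>n. direction (q (r n))) \<longlonglongrightarrow> direction q'"
    by (rule direction_tendsto) (use r Ground_mean_nonzero in auto)
  then have "direction q' = v" using q(2) by (simp add: LIMSEQ_const_iff)
  then show ?thesis using r by blast
qed

lemma norm_direction: "mean q \<noteq> 0 \<Longrightarrow> norm (direction q) = 1"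
  by (simp add: direction_def)

text \<open>The inverse of \<open>direction\<close> on a set \<open>K\<close> which it maps
  bijectively onto the sphere.\<close>

definition section_of :: "('g \<Rightarrow> real) set \<Rightarrow> real ^ 'n \<Rightarrow> 'g \<Rightarrow> real" where
  "section_of K v = (THE q. q \<in> K \<and> direction q = v)"

abbreviation ground where "ground \<equiv> section_of Ground"
abbreviation gibbs where "gibbs \<beta> \<equiv> section_of (Gibbs \<beta>)"

lemma ground:
  assumes "v \<in> sphere 0 1"
  shows "ground v \<in> Ground" "direction (ground v) = v"
proof -
  have "\<exists>!q. q \<in> Ground \<and> direction q = v" using Ground_exists[of v] Ground_inj assms by (auto simp: Ex1_def)
  from theI'[OF this] show "ground v \<in> Ground" "direction (ground v) = v" by (auto simp: section_of_def)
qed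

lemma gibbs:
  assumes "\<beta> > threshold" "v \<in> sphere 0 1"
  shows "gibbs \<beta> v \<in> Gibbs \<beta>" "direction (gibbs \<beta> v) = v"
proof -
  have "\<exists>!q. q \<in> Gibbs \<beta> \<and> direction q = v"
    using Gibbs_exists[OF assms(1), of v] Gibbs_inj[OF _ _ assms(1)] assms by (auto simp: Ex1_def)
  from theI'[OF this] show "gibbs \<beta> v \<in> Gibbs \<beta>" "direction (gibbs \<beta> v) = v" by (auto simp: section_of_def)
qed

lemma ground_direction: "q \<in> Ground \<Longrightarrow> ground (direction q) = q"
  using Ground_inj ground[of "direction q"] norm_direction[OF Ground_mean_nonzero] by auto

text \<open>The inverse of a continuous injection on a compact set is continuous.\<close>

lemma section_continuous:
  assumes K: "compact K" "\<And>q. q \<in> K \<Longrightarrow> mean q \<noteq> 0" "\<And>q. q \<in> K \<Longrightarrow> section_of K (direction q) = q"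
    "\<And>v. v \<in> sphere 0 1 \<Longrightarrow> \<exists>q\<in>K. direction q = v"
  shows "continuous_on (sphere 0 1) (\<lambda>v. section_of K v s)"
proof -
  have cd: "continuous_on K direction"
    unfolding direction_def using K(2) by (intro continuous_intros mean_continuous) auto
  have "continuous_on (direction ` K) (section_of K)"
    by (rule continuous_on_inv[OF cd K(1)]) (use K(3) in auto)
  moreover have "sphere 0 1 \<subseteq> direction ` K" using K(4) by force
  ultimately have "continuous_on (sphere 0 1) (section_of K)" by (rule continuous_on_subset)
  then show ?thesis by (rule continuous_on_product_then_coordinatewise)
qed

lemma ground_continuous: "continuous_on (sphere 0 1) (\<lambda>v. ground v s)"
  by (rule section_continuous[OF compact_Ground Ground_mean_nonzero ground_direction])
     (use Ground_exists in auto)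

lemma gibbs_continuous:
  assumes \<beta>: "\<beta> > threshold"
  shows "continuous_on (sphere 0 1) (\<lambda>v. gibbs \<beta> v s)"
proof (rule section_continuous[OF compact_Gibbs Gibbs_mean_nonzero[OF _ \<beta>]])
  show "gibbs \<beta> (direction q) = q" if "q \<in> Gibbs \<beta>" for q
    using Gibbs_inj[OF _ _ \<beta>] gibbs[OF \<beta>, of "direction q"] norm_direction[OF Gibbs_mean_nonzero[OF _ \<beta>]] that by auto
qed (use Gibbs_exists[OF \<beta>] in auto)

lemma ground_separates:
  assumes "v \<in> sphere 0 1" "w \<in> sphere 0 1" "v \<noteq> w"
  shows "\<exists>s\<in>Y. ground v s \<noteq> ground w s"
proof (rule ccontr)
  assume "\<not> (\<exists>s\<in>Y. ground v s \<noteq> ground w s)"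
  then have "ground v = ground w" using ground[OF assms(1)] ground[OF assms(2)]
    by (intro Simplex_eqI) (auto simp: Ground_def)
  then show False using ground assms by metis
qed

text \<open>A subsequence that stays away would have a further subsequence converging to a ground
  vector of direction \<open>v\<close>, and there is only one.\<close>

lemma gibbs_tendsto_ground:
  assumes \<beta>: "filterlim \<beta> at_top sequentially" "\<And>n. \<beta> n > threshold" and v: "v \<in> sphere 0 1" and s: "s \<in> Y"
  shows "(\<lambda>n. gibbs (\<beta> n) v s) \<longlonglongrightarrow> ground v s"
proof (rule ccontr)
  assume "\<not> ?thesis"
  then obtain e where e: "e > 0" "\<And>N. \<exists>n\<ge>N. dist (gibbs (\<beta> n) v s) (ground v s) \<ge> e"
    unfolding lim_sequentially by (meson not_less)
  then have "infinite {n. dist (gibbs (\<beta> n) v s) (ground v s) \<ge> e}" by (auto simp: infinite_nat_iff_unbounded_le)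
  then obtain r :: "nat \<Rightarrow> nat" where r: "strict_mono r" "\<And>n. dist (gibbs (\<beta> (r n)) v s) (ground v s) \<ge> e"
    using infinite_enumerate by blast
  have \<beta>r: "filterlim (\<lambda>n. \<beta> (r n)) at_top sequentially" by (rule filterlim_compose[OF \<beta>(1) filterlim_subseq[OF r(1)]])
  obtain r' q' where r': "strict_mono r'" "q' \<in> Ground" "\<forall>s\<in>Y. (\<lambda>n. gibbs (\<beta> (r (r' n))) v s) \<longlonglongrightarrow> q' s"
    using Gibbs_subsequence[OF \<beta>r gibbs(1)[OF \<beta>(2) v]] by blast
  have "(\<lambda>n. direction (gibbs (\<beta> (r (r' n))) v)) \<longlonglongrightarrow> direction q'"
    by (rule direction_tendsto) (use r' Ground_mean_nonzero in auto)
  then have "direction q' = v" using gibbs(2)[OF \<beta>(2) v] by (simp add: LIMSEQ_const_iff)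
  then have "q' = ground v" using ground_direction[OF r'(2)] by simp
  then have "(\<lambda>n. dist (gibbs (\<beta> (r (r' n))) v s) (ground v s)) \<longlonglongrightarrow> dist (ground v s) (ground v s)"
    using r'(3) s by (intro tendsto_intros) auto
  then have "e \<le> dist (ground v s) (ground v s)" by (rule tendsto_lowerbound) (use r in auto)
  then show False using e by simp
qed

end

section \<open>Gibbs vectors in the Cuntz dynamics\<close>

locale cuntz_rank = cuntz_dynamics G Y V F \<alpha>
  for G :: "('g, 'b) monoid_scheme" (structure)
    and Y :: "'g set" and V :: "'g \<Rightarrow> 'a::unital_cstar_algebra" and F and \<alpha> +
  fixes \<pi> :: "'g \<Rightarrow> real ^ 'n::finite"
  assumes \<pi>_mult: "x \<in> carrier G \<Longrightarrow> y \<in> carrier G \<Longrightarrow> \<pi> (x \<otimes> y) = \<pi> x + \<pi> y"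
    and \<pi>_axis: "\<exists>x\<in>carrier G. \<pi> x = axis i 1"
    and \<pi>_factor: "(\<And>x y. x \<in> carrier G \<Longrightarrow> y \<in> carrier G \<Longrightarrow> c (x \<otimes> y) = c x + c y) \<Longrightarrow>
      \<exists>\<xi>. \<forall>x\<in>carrier G. c x = \<xi> \<bullet> \<pi> x"
begin

lemma \<pi>_one: "\<pi> \<one> = 0"
  using \<pi>_mult[of \<one> \<one>] by simp

lemma \<pi>_val: "t \<in> lists Y \<Longrightarrow> \<pi> (val t) = (\<Sum>s\<leftarrow>t. \<pi> s)"
proof (induction t)
  case (Cons s t)
  then show ?case using \<pi>_mult[of s "val t"] Y_carrier val_closed by auto
qed (simp add: \<pi>_one)

text \<open>Since \<open>Y\<close> generates \<open>G\<close> as a semigroup, group elements mapped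
  to plus or minus an axis vector are values of words; the letter counts are the nonnegative
  coefficients required by \<open>spanning\<close>.\<close>

sublocale zero_temperature Y F \<pi>
proof
  show "finite Y" by (rule finite_Y)
  show "Y \<noteq> {}" using card_Y by auto
  show "F s > 0" if "s \<in> Y" for s using F_pos that by simp
  fix i and e :: real assume e: "e \<in> {1, -1}"
  obtain x where x: "x \<in> carrier G" "\<pi> x = axis i 1" using \<pi>_axis by blast
  have "\<pi> (inv x) = - \<pi> x" using \<pi>_mult[of "inv x" x] x \<pi>_one by (simp add: eq_neg_iff_add_eq_0)
  then obtain y where y: "y \<in> carrier G" "\<pi> y = e *\<^sub>R axis i 1"
    using e x by (metis insertE inv_closed scaleR_minus1_left scaleR_one singletonD)
  obtain t where t: "t \<in> lists Y" "val t = y" using val_surj[OF y(1)] by blast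
  have "(\<Sum>s\<leftarrow>t. \<pi> s) = (\<Sum>s\<in>Y. real (count (mset t) s) *\<^sub>R \<pi> s)"
    using t(1)
  proof (induction t)
    case (Cons r t)
    have "(\<Sum>s\<in>Y. real (count (mset (r # t)) s) *\<^sub>R \<pi> s) =
        (\<Sum>s\<in>Y. (if s = r then \<pi> s else 0) + real (count (mset t) s) *\<^sub>R \<pi> s)"
      by (rule sum.cong) (auto simp: scaleR_add_left)
    also have "\<dots> = \<pi> r + (\<Sum>s\<in>Y. real (count (mset t) s) *\<^sub>R \<pi> s)"
      using Cons finite_Y by (simp add: sum.distrib)
    finally show ?case using Cons by simp
  qed simp
  then show "\<exists>a. (\<forall>s\<in>Y. a s \<ge> 0) \<and> (\<Sum>s\<in>Y. a s *\<^sub>R \<pi> s) = e *\<^sub>R axis i 1"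
    using y t \<pi>_val[OF t(1)] by (intro exI[of _ "\<lambda>s. real (count (mset t) s)"]) auto
qed

abbreviation Sph :: "(real ^ 'n) set" where "Sph \<equiv> sphere 0 1"

lemma Simplex_prob_vector: "q \<in> Simplex \<Longrightarrow> prob_vector q"
  by (simp add: Simplex_def prob_vector_def)

lemma Gibbs_mon:
  assumes "\<And>s. s \<in> Y \<Longrightarrow> q s = exp (\<xi> \<bullet> \<pi> s - \<beta> * F s)" "t \<in> lists Y"
  shows "exp (\<beta> * wt t) * mon q t = exp (\<xi> \<bullet> \<pi> (val t))"
proof -
  have "exp (\<beta> * wt t) * mon q t = exp (\<xi> \<bullet> (\<Sum>s\<leftarrow>t. \<pi> s))"
    using assms(2)
  proof (induction t)
    case (Cons s t)
    have "exp (\<beta> * wt (s # t)) * mon q (s # t) = exp (\<beta> * F s) * q s * (exp (\<beta> * wt t) * mon q t)"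
      by (simp add: distrib_left exp_add)
    also have "exp (\<beta> * F s) * q s = exp (\<xi> \<bullet> \<pi> s)" using Cons assms(1)[of s] by (simp add: mult_exp_exp)
    finally show ?case using Cons by (simp add: inner_add_right exp_add)
  qed simp
  then show ?thesis using \<pi>_val[OF assms(2)] by simp
qed

subsection \<open>Mixtures of product states\<close>

definition continuous_field :: "(real ^ 'n \<Rightarrow> 'g \<Rightarrow> real) \<Rightarrow> bool" where
  "continuous_field \<kappa> \<longleftrightarrow> (\<forall>s\<in>Y. continuous_on Sph (\<lambda>v. \<kappa> v s)) \<and> (\<forall>v\<in>Sph. prob_vector (\<kappa> v))"

definition mixture :: "(real ^ 'n \<Rightarrow> 'g \<Rightarrow> real) \<Rightarrow> (real ^ 'n) measure \<Rightarrow> 'a \<Rightarrow> complex" where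
  "mixture \<kappa> \<mu> = (\<lambda>x\<in>A. \<integral>v. product_state (\<kappa> v) x \<partial>\<mu>)"

lemma ground_field: "continuous_field ground"
  using ground_continuous ground(1) by (auto simp: continuous_field_def Ground_def intro!: Simplex_prob_vector)

lemma gibbs_field: "\<beta> > threshold \<Longrightarrow> continuous_field (gibbs \<beta>)"
  using gibbs_continuous gibbs(1) by (auto simp: continuous_field_def Gibbs_def intro!: Simplex_prob_vector)

lemma field_state:
  assumes "continuous_field \<kappa>" "v \<in> Sph"
  shows "product_state (\<kappa> v) \<in> states A" "x \<in> A \<Longrightarrow> cmod (product_state (\<kappa> v) x) \<le> norm x"
proof -
  show s: "product_state (\<kappa> v) \<in> states A" using assms by (auto simp: continuous_field_def intro: product_state)
  show "x \<in> A \<Longrightarrow> cmod (product_state (\<kappa> v) x) \<le> norm x" by (rule state_norm_le[OF s A_props])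
qed

lemma field_continuous:
  assumes \<kappa>: "continuous_field \<kappa>" and x: "x \<in> A"
  shows "continuous_on Sph (\<lambda>v. product_state (\<kappa> v) x)"
  unfolding continuous_on_def
proof
  fix v assume v: "v \<in> Sph"
  \<comment> \<open>Nothing is known about \<open>\<kappa>\<close> off the sphere; the modified
    field has probability vectors as values everywhere, as \<open>product_state_tendsto\<close>
    demands.\<close>
  define \<kappa>' where "\<kappa>' w = (if w \<in> Sph then \<kappa> w else \<kappa> v)" for w
  have "((\<lambda>w. product_state (\<kappa>' w) x) \<longlongrightarrow> product_state (\<kappa> v) x) (at v within Sph)"
  proof (rule product_state_tendsto[OF _ _ _ x])
    show "prob_vector (\<kappa>' w)" for w using \<kappa> v by (auto simp: continuous_field_def \<kappa>'_def)
    show "prob_vector (\<kappa> v)" using \<kappa> v by (auto simp: continuous_field_def)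
    fix s assume "s \<in> Y"
    then have "((\<lambda>w. \<kappa> w s) \<longlongrightarrow> \<kappa> v s) (at v within Sph)"
      using \<kappa> v by (auto simp: continuous_field_def continuous_on_def)
    then show "((\<lambda>w. \<kappa>' w s) \<longlongrightarrow> \<kappa> v s) (at v within Sph)"
      by (rule Lim_transform_eventually) (auto simp: \<kappa>'_def eventually_at_filter)
  qed
  then show "((\<lambda>w. product_state (\<kappa> w) x) \<longlongrightarrow> product_state (\<kappa> v) x) (at v within Sph)"
    by (rule Lim_transform_eventually) (auto simp: \<kappa>'_def eventually_at_filter)
qed

lemma field_integrable:
  assumes "continuous_field \<kappa>" "x \<in> A" "\<mu> \<in> borel_probabilities Sph"
  shows "integrable \<mu> (\<lambda>v. product_state (\<kappa> v) x)"
  by (rule borel_probabilities_integrable[OF assms(3) field_continuous[OF assms(1,2)] field_state(2)[OF assms(1) _ assms(2)]])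

lemma mixture_state:
  assumes \<kappa>: "continuous_field \<kappa>" and \<mu>: "\<mu> \<in> borel_probabilities Sph"
  shows "mixture \<kappa> \<mu> \<in> states A"
proof -
  interpret finite_measure \<mu> by (rule borel_probabilitiesD[OF \<mu>])
  have sp: "space \<mu> = Sph" by (rule borel_probabilitiesD[OF \<mu>])
  have int: "integrable \<mu> (\<lambda>v. product_state (\<kappa> v) x)" if "x \<in> A" for x
    by (rule field_integrable[OF \<kappa> that \<mu>])
  note st = field_state(1)[OF \<kappa>]
  show ?thesis unfolding states_def
  proof (intro CollectI conjI ballI allI)
    fix x y assume xy: "x \<in> A" "y \<in> A"
    have "(\<integral>v. product_state (\<kappa> v) (x + y) \<partial>\<mu>) = (\<integral>v. product_state (\<kappa> v) x + product_state (\<kappa> v) y \<partial>\<mu>)"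
      using xy statesD(2)[OF st] sp by (intro Bochner_Integration.integral_cong) auto
    then show "mixture \<kappa> \<mu> (x + y) = mixture \<kappa> \<mu> x + mixture \<kappa> \<mu> y"
      using xy int complex_subspaceD(2)[OF A_subspace] by (simp add: mixture_def)
  next
    fix c x assume x: "x \<in> A"
    have "(\<integral>v. product_state (\<kappa> v) (c *\<^sub>C x) \<partial>\<mu>) = (\<integral>v. c * product_state (\<kappa> v) x \<partial>\<mu>)"
      using x statesD(3)[OF st] sp by (intro Bochner_Integration.integral_cong) auto
    then show "mixture \<kappa> \<mu> (c *\<^sub>C x) = c * mixture \<kappa> \<mu> x"
      using x int complex_subspaceD(3)[OF A_subspace] by (simp add: mixture_def)
  next
    fix x assume x: "x \<in> A"
    have xx: "star x * x \<in> A" using x star_subalgebraD[OF A_star_subalgebra] by blast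
    have pos: "product_state (\<kappa> v) (star x * x) \<in> \<real>\<^sub>\<ge>\<^sub>0" if "v \<in> Sph" for v
      using statesD(4)[OF st[OF that] x] .
    have "(\<integral>v. product_state (\<kappa> v) (star x * x) \<partial>\<mu>) =
        (\<integral>v. complex_of_real (Re (product_state (\<kappa> v) (star x * x))) \<partial>\<mu>)"
      using pos sp by (intro Bochner_Integration.integral_cong) (auto simp: complex_nonneg_Reals_iff complex_eq_iff)
    also have "\<dots> = complex_of_real (\<integral>v. Re (product_state (\<kappa> v) (star x * x)) \<partial>\<mu>)" by (rule integral_complex_of_real)
    also have "\<dots> \<in> \<real>\<^sub>\<ge>\<^sub>0"
      using pos sp by (auto simp: nonneg_Reals_of_real_iff complex_nonneg_Reals_iff intro!: Bochner_Integration.integral_nonneg)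
    finally show "mixture \<kappa> \<mu> (star x * x) \<in> \<real>\<^sub>\<ge>\<^sub>0" using xx by (simp add: mixture_def)
  next
    have "(\<integral>v. product_state (\<kappa> v) 1 \<partial>\<mu>) = (\<integral>v. 1 \<partial>\<mu>)"
      using statesD(5)[OF st] sp by (intro Bochner_Integration.integral_cong) auto
    then show "mixture \<kappa> \<mu> 1 = 1" using one_A borel_probabilitiesD[OF \<mu>] by (simp add: mixture_def)
  qed (simp add: mixture_def)
qed

lemma mixture_gen:
  assumes \<kappa>: "continuous_field \<kappa>" and \<mu>: "\<mu> \<in> borel_probabilities Sph"
    and tu: "t \<in> lists Y" "u \<in> lists Y" "val t = val u"
  shows "mixture \<kappa> \<mu> (W t * star (W u)) = (if t = u then complex_of_real (\<integral>v. mon (\<kappa> v) t \<partial>\<mu>) else 0)"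
proof -
  have sp: "space \<mu> = Sph" by (rule borel_probabilitiesD[OF \<mu>])
  have "(\<integral>v. product_state (\<kappa> v) (W t * star (W u)) \<partial>\<mu>) =
      (\<integral>v. (if t = u then complex_of_real (mon (\<kappa> v) t) else 0) \<partial>\<mu>)"
    using \<kappa> sp tu by (intro Bochner_Integration.integral_cong) (auto simp: continuous_field_def product_state)
  then show ?thesis using A_gen[OF tu] by (auto simp: mixture_def integral_complex_of_real)
qed

lemma mon_continuous:
  assumes "continuous_field \<kappa>" "t \<in> lists Y"
  shows "continuous_on Sph (\<lambda>v. mon (\<kappa> v) t)"
  using assms(2) by (induction t) (use assms(1) in \<open>auto simp: continuous_field_def intro!: continuous_intros\<close>)

lemma mon_integrable:
  assumes "continuous_field \<kappa>" "t \<in> lists Y" "\<mu> \<in> borel_probabilities Sph"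
  shows "integrable \<mu> (\<lambda>v. mon (\<kappa> v) t)"
proof (rule borel_probabilities_integrable[OF assms(3) mon_continuous[OF assms(1,2)]])
  fix v assume "v \<in> Sph"
  then have "prob_vector (\<kappa> v)" using assms(1) by (simp add: continuous_field_def)
  then show "norm (mon (\<kappa> v) t) \<le> 1" using mon_nonneg[of "\<kappa> v" t] mon_le_1[of "\<kappa> v" t] assms(2) by simp
qed

lemma state_vector_mixture:
  assumes "continuous_field \<kappa>" "\<mu> \<in> borel_probabilities Sph" "t \<in> lists Y"
  shows "state_vector (mixture \<kappa> \<mu>) t = (\<integral>v. mon (\<kappa> v) t \<partial>\<mu>)"
  using mixture_gen[OF assms(1,2,3,3) refl] by (simp add: state_vector_def)

text \<open>A single Gibbs vector contributes the function
  \<open>exp (\<xi> v \<bullet> \<pi> g)\<close> of \<open>g\<close>. It factors through the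
  commutative image under \<pi>, and this persists under integration.\<close>

lemma mixture_gibbs:
  assumes \<beta>: "\<beta> > threshold" and \<mu>: "\<mu> \<in> borel_probabilities Sph"
  shows "mixture (gibbs \<beta>) \<mu> \<in> abelian_KMS_states G Y V F \<alpha> \<beta>"
proof -
  note \<kappa> = gibbs_field[OF \<beta>]
  have sp: "space \<mu> = Sph" by (rule borel_probabilitiesD[OF \<mu>])
  have "\<forall>v\<in>Sph. \<exists>\<xi>. \<forall>s\<in>Y. gibbs \<beta> v s = exp (\<xi> \<bullet> \<pi> s - \<beta> * F s)"
    using gibbs(1)[OF \<beta>] by (auto simp: Gibbs_def)
  then obtain \<xi> where \<xi>: "\<And>v s. v \<in> Sph \<Longrightarrow> s \<in> Y \<Longrightarrow> gibbs \<beta> v s = exp (\<xi> v \<bullet> \<pi> s - \<beta> * F s)" by metis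
  \<comment> \<open>The vectors \<open>\<xi> v\<close> are merely chosen. At values of words the
    integrand nevertheless agrees on the sphere with
    \<open>exp (\<beta> * wt t) * mon (gibbs \<beta> v) t\<close>, which is continuous in
    \<open>v\<close>.\<close>
  define \<psi> where "\<psi> g = (\<integral>v. exp (\<xi> v \<bullet> \<pi> g) \<partial>\<mu>)" for g
  show ?thesis
  proof (rule abelian_KMS_stateI[OF mixture_state[OF \<kappa> \<mu>]])
    show "mixture (gibbs \<beta>) \<mu> (W t * star (W u)) = 0" if "t \<in> lists Y" "u \<in> lists Y" "val t = val u" "t \<noteq> u" for t u
      using mixture_gen[OF \<kappa> \<mu> that(1-3)] that(4) by simp
    fix t assume t: "t \<in> lists Y"
    have "exp (\<beta> * wt t) * state_vector (mixture (gibbs \<beta>) \<mu>) t = (\<integral>v. exp (\<beta> * wt t) * mon (gibbs \<beta> v) t \<partial>\<mu>)"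
      using mon_integrable[OF \<kappa> t \<mu>] by (simp add: state_vector_mixture[OF \<kappa> \<mu> t])
    also have "\<dots> = \<psi> (val t)" unfolding \<psi>_def
      using sp Gibbs_mon[OF \<xi> t] by (intro Bochner_Integration.integral_cong) auto
    finally show "exp (\<beta> * wt t) * state_vector (mixture (gibbs \<beta>) \<mu>) t = \<psi> (val t)" .
  next
    fix h g k assume "h \<in> carrier G" "g \<in> carrier G" "k \<in> carrier G"
    then have "\<pi> (h \<otimes> g \<otimes> k) = \<pi> (h \<otimes> k \<otimes> g)" by (simp add: \<pi>_mult)
    then show "\<psi> (h \<otimes> g \<otimes> k) = \<psi> (h \<otimes> k \<otimes> g)" by (simp add: \<psi>_def)
  qed
qed

subsection \<open>The limit states\<close>

definition K where "K = abelian_KMS_infinity_states G Y V F \<alpha>"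

text \<open>This closed and convex description of the limit states only involves the values on the
  elements \<open>V\<^sub>tV\<^sub>u\<^sup>*\<close>.\<close>

definition ground_bounded :: "('a \<Rightarrow> complex) \<Rightarrow> bool" where
  "ground_bounded \<omega> \<longleftrightarrow>
    (\<forall>t\<in>lists Y. \<forall>u\<in>lists Y. val t = val u \<longrightarrow> t \<noteq> u \<longrightarrow> \<omega> (W t * star (W u)) = 0) \<and>
    (\<forall>l C. (\<forall>(c, t)\<in>set l. t \<in> lists Y) \<longrightarrow> (\<forall>v\<in>Sph. \<bar>word_poly l (mon (ground v))\<bar> \<le> C) \<longrightarrow>
      \<bar>word_poly l (state_vector \<omega>)\<bar> \<le> C)"

text \<open>A state satisfies the sum rule for a letter appended at the end, whereas the locale puts
  the newest letter first; invariance under permutations bridges the two conventions.\<close>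

lemma exchangeable_state:
  assumes \<omega>: "\<omega> \<in> states A"
    and perm: "\<And>t u. t \<in> lists Y \<Longrightarrow> u \<in> lists Y \<Longrightarrow> mset t = mset u \<Longrightarrow> state_vector \<omega> t = state_vector \<omega> u"
  shows "exchangeable Y (state_vector \<omega>)"
proof (rule exchangeable.intro)
  fix r assume r: "r \<in> lists Y"
  have "(\<Sum>s\<in>Y. state_vector \<omega> (s # r)) = (\<Sum>s\<in>Y. state_vector \<omega> (r @ [s]))"
  proof (rule sum.cong)
    fix s assume "s \<in> Y"
    then show "state_vector \<omega> (s # r) = state_vector \<omega> (r @ [s])" using r by (intro perm) auto
  qed simp
  then show "(\<Sum>s\<in>Y. state_vector \<omega> (s # r)) = state_vector \<omega> r" using state_vector_sum[OF \<omega> r] by simp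
  show "state_vector \<omega> r \<ge> 0" by (rule state_vector_real(2)[OF \<omega> r])
next
  show "state_vector \<omega> t = state_vector \<omega> u" if "t \<in> lists Y" "u \<in> lists Y" "mset t = mset u" for t u
    using that by (rule perm)
qed (rule finite_Y state_vector_Nil[OF \<omega>])+

text \<open>A directing random vector in the sense of de Finetti, on an unspecified probability
  space.\<close>

definition represents :: "real measure \<Rightarrow> ('g \<Rightarrow> real \<Rightarrow> real) \<Rightarrow> ('g list \<Rightarrow> real) \<Rightarrow> bool" where
  "represents N q p \<longleftrightarrow> finite_measure N \<and> measure N (space N) = 1 \<and> (\<forall>s\<in>Y. q s \<in> borel_measurable N) \<and>
    (AE x in N. (\<forall>s\<in>Y. 0 \<le> q s x) \<and> (\<Sum>s\<in>Y. q s x) = 1) \<and>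
    (\<forall>t\<in>lists Y. integrable N (\<lambda>x. mon (\<lambda>s. q s x) t) \<and> (\<integral>x. mon (\<lambda>s. q s x) t \<partial>N) = p t)"

lemma exchangeable_represents:
  assumes "exchangeable Y p"
  shows "\<exists>N q. represents N q p"
proof -
  interpret exchangeable Y p by (rule assms)
  show ?thesis using de_finetti finite_measure_axioms measure_M unfolding represents_def mon_def by blast
qed

lemma represents_word_poly:
  assumes r: "represents N q p" and l: "\<forall>(c, t)\<in>set l. t \<in> lists Y"
  shows "integrable N (\<lambda>x. word_poly l (mon (\<lambda>s. q s x)))"
    "(\<integral>x. word_poly l (mon (\<lambda>s. q s x)) \<partial>N) = word_poly l p"
proof -
  have "integrable N (\<lambda>x. word_poly l (mon (\<lambda>s. q s x))) \<and>
    (\<integral>x. word_poly l (mon (\<lambda>s. q s x)) \<partial>N) = word_poly l p"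
    using l
  proof (induction l)
    case (Cons a l)
    obtain c t where a: "a = (c, t)" by (cases a)
    have t: "t \<in> lists Y" using Cons.prems by (simp add: a)
    have "integrable N (\<lambda>x. mon (\<lambda>s. q s x) t)" "(\<integral>x. mon (\<lambda>s. q s x) t \<partial>N) = p t"
      using r t by (auto simp: represents_def)
    moreover have "integrable N (\<lambda>x. word_poly l (mon (\<lambda>s. q s x))) \<and>
      (\<integral>x. word_poly l (mon (\<lambda>s. q s x)) \<partial>N) = word_poly l p" by (rule Cons.IH) (use Cons.prems in simp)
    ultimately show ?case by (simp add: a)
  qed simp
  then show "integrable N (\<lambda>x. word_poly l (mon (\<lambda>s. q s x)))"
    "(\<integral>x. word_poly l (mon (\<lambda>s. q s x)) \<partial>N) = word_poly l p" by auto
qed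

lemma mon_cong: "(\<And>s. s \<in> Y \<Longrightarrow> q s = q' s) \<Longrightarrow> t \<in> lists Y \<Longrightarrow> mon q t = mon q' t"
  by (induction t) auto

lemma word_poly_cong:
  "(\<And>t. t \<in> lists Y \<Longrightarrow> \<phi> t = \<phi>' t) \<Longrightarrow> \<forall>(c, t)\<in>set l. t \<in> lists Y \<Longrightarrow> word_poly l \<phi> = word_poly l \<phi>'"
proof -
  assume eq: "\<And>t. t \<in> lists Y \<Longrightarrow> \<phi> t = \<phi>' t" and l: "\<forall>(c, t)\<in>set l. t \<in> lists Y"
  show ?thesis
    using l
  proof (induction l)
    case (Cons a l)
    obtain c t where "a = (c, t)" by (cases a)
    then show ?case using Cons eq[of t] by simp
  qed simp
qed

lemma word_poly_tendsto:
  assumes "\<And>t. t \<in> lists Y \<Longrightarrow> ((\<lambda>n. \<phi> n t) \<longlongrightarrow> \<phi>' t) X" "\<forall>(c, t)\<in>set l. t \<in> lists Y"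
  shows "((\<lambda>n. word_poly l (\<phi> n)) \<longlongrightarrow> word_poly l \<phi>') X"
  using assms(2) by (induction l) (auto intro!: tendsto_intros assms(1) simp del: in_lists_conv_set)

lemma mon_tendsto:
  assumes "\<And>s. s \<in> Y \<Longrightarrow> ((\<lambda>n. q n s) \<longlongrightarrow> q' s) X" "t \<in> lists Y"
  shows "((\<lambda>n. mon (q n) t) \<longlongrightarrow> mon q' t) X"
  using assms(2) by (induction t) (auto intro!: tendsto_intros assms(1))

text \<open>The relations make \<open>val t \<mapsto> exp (\<beta> * wt t) * mon q t\<close> a homomorphism from \<open>G\<close> to the positive
  reals.\<close>

lemma multiplicative_Gibbs:
  assumes q: "prob_vector q"
    and rel: "\<And>t u. t \<in> lists Y \<Longrightarrow> u \<in> lists Y \<Longrightarrow> val t = val u \<Longrightarrow> exp (\<beta> * wt t) * mon q t = exp (\<beta> * wt u) * mon q u"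
  shows "(\<lambda>s. if s \<in> Y then q s else 0) \<in> Gibbs \<beta>"
proof -
  define c where "c g = (let t = (SOME t. t \<in> lists Y \<and> val t = g) in exp (\<beta> * wt t) * mon q t)" for g
  have c: "c (val t) = exp (\<beta> * wt t) * mon q t" if t: "t \<in> lists Y" for t
  proof -
    define u where "u = (SOME u. u \<in> lists Y \<and> val u = val t)"
    have "u \<in> lists Y \<and> val u = val t" unfolding u_def by (rule someI_ex) (use t in blast)
    then show ?thesis using rel[OF _ t, of u] by (simp add: c_def u_def[symmetric])
  qed
  have c_mult: "c (x \<otimes> y) = c x * c y" if xy: "x \<in> carrier G" "y \<in> carrier G" for x y
  proof -
    obtain t u where "t \<in> lists Y" "val t = x" "u \<in> lists Y" "val u = y" using val_surj xy by metis
    then show ?thesis using c[of "t @ u"] c[of t] c[of u]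
      by (simp add: val_append distrib_left exp_add mult_ac)
  qed
  have c_one: "c \<one> = 1" using c[of "[]"] by simp
  have c_pos: "c x > 0" if x: "x \<in> carrier G" for x
  proof -
    obtain t where "t \<in> lists Y" "val t = x" using val_surj x by metis
    then have "c x \<ge> 0" using c[of t] mon_nonneg[OF q] by auto
    moreover have "c x * c (inv x) = 1" using c_mult[of x "inv x"] x c_one by simp
    ultimately show ?thesis by (auto simp: order_le_less)
  qed
  have "\<exists>\<xi>. \<forall>x\<in>carrier G. ln (c x) = \<xi> \<bullet> \<pi> x"
  proof (rule \<pi>_factor)
    fix x y assume xy: "x \<in> carrier G" "y \<in> carrier G"
    show "ln (c (x \<otimes> y)) = ln (c x) + ln (c y)"
      using c_pos[OF xy(1)] c_pos[OF xy(2)] by (simp add: c_mult[OF xy] ln_mult)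
  qed
  then obtain \<xi> where \<xi>: "\<And>x. x \<in> carrier G \<Longrightarrow> ln (c x) = \<xi> \<bullet> \<pi> x" by blast
  have "q s = exp (\<xi> \<bullet> \<pi> s - \<beta> * F s)" if s: "s \<in> Y" for s
  proof -
    have sG: "s \<in> carrier G" using s Y_carrier by blast
    have "exp (\<beta> * F s) * q s = c s" using c[of "[s]"] s sG by simp
    also have "c s = exp (\<xi> \<bullet> \<pi> s)" using \<xi>[OF sG] c_pos[OF sG] by (metis exp_ln)
    finally show ?thesis by (simp add: exp_diff field_simps)
  qed
  then show ?thesis using q by (auto simp: Gibbs_def Simplex_def prob_vector_def)
qed

text \<open>The KMS relations hold a priori only in mean. But the square of the difference of both
  sides expands into the words \<open>t @ t\<close>, \<open>t @ u\<close> and \<open>u @ u\<close>,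
  which all have the same value in \<open>G\<close>; so its mean vanishes, and the relation holds
  almost everywhere. There are only countably many pairs of words.\<close>

lemma abelian_KMS_state_represents:
  assumes \<omega>: "\<omega> \<in> abelian_KMS_states G Y V F \<alpha> \<beta>" and \<beta>: "\<beta> > 0"
  shows "\<exists>N q. represents N q (state_vector \<omega>) \<and> (AE x in N. (\<lambda>s. if s \<in> Y then q s x else 0) \<in> Gibbs \<beta>)"
proof -
  have k: "\<omega> \<in> KMS_states A \<alpha> \<beta>" using \<omega> by (simp add: abelian_KMS_states_def A_def)
  then have \<omega>s: "\<omega> \<in> states A" by (simp add: KMS_states_def)
  obtain N q where r: "represents N q (state_vector \<omega>)"
    using exchangeable_represents[OF exchangeable_state[OF \<omega>s abelian_KMS_state_exchangeable[OF \<omega> \<beta>]]] by blast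
  have rel: "AE x in N. exp (\<beta> * wt t) * mon (\<lambda>s. q s x) t = exp (\<beta> * wt u) * mon (\<lambda>s. q s x) u"
    if tu: "t \<in> lists Y" "u \<in> lists Y" "val t = val u" for t u
  proof -
    let ?a = "exp (\<beta> * wt t)" and ?b = "exp (\<beta> * wt u)"
    define l where "l = [(?a * ?a, t @ t), (- (2 * ?a * ?b), t @ u), (?b * ?b, u @ u)]"
    have l: "\<forall>(c, t)\<in>set l. t \<in> lists Y" using tu by (auto simp: l_def)
    have sq: "(?a * mon (\<lambda>s. q s x) t - ?b * mon (\<lambda>s. q s x) u)\<^sup>2 = word_poly l (mon (\<lambda>s. q s x))" for x
      by (simp add: l_def power2_eq_square algebra_simps)
    have v: "val (t @ t) = val (t @ u)" "val (u @ u) = val (t @ u)" using tu by (simp_all add: val_append)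
    have "exp (\<beta> * wt (t @ t)) * state_vector \<omega> (t @ t) = exp (\<beta> * wt (t @ u)) * state_vector \<omega> (t @ u)"
      "exp (\<beta> * wt (u @ u)) * state_vector \<omega> (u @ u) = exp (\<beta> * wt (t @ u)) * state_vector \<omega> (t @ u)"
      by (rule KMS_state_diagonal(2)[OF k \<beta>]; use tu v in auto)+
    moreover have "exp (\<beta> * wt (x @ y)) = exp (\<beta> * wt x) * exp (\<beta> * wt y)" for x y
      by (simp add: mult_exp_exp distrib_left)
    ultimately have p: "?a * ?a * state_vector \<omega> (t @ t) = ?a * ?b * state_vector \<omega> (t @ u)"
      "?b * ?b * state_vector \<omega> (u @ u) = ?a * ?b * state_vector \<omega> (t @ u)" by metis+
    have "word_poly l (state_vector \<omega>) = ?a * ?a * state_vector \<omega> (t @ t)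
        - 2 * (?a * ?b * state_vector \<omega> (t @ u)) + ?b * ?b * state_vector \<omega> (u @ u)"
      by (simp add: l_def)
    then have "word_poly l (state_vector \<omega>) = 0" unfolding p by simp
    then have "(\<integral>x. (?a * mon (\<lambda>s. q s x) t - ?b * mon (\<lambda>s. q s x) u)\<^sup>2 \<partial>N) = 0"
      unfolding sq using represents_word_poly(2)[OF r l] by simp
    moreover have "integrable N (\<lambda>x. (?a * mon (\<lambda>s. q s x) t - ?b * mon (\<lambda>s. q s x) u)\<^sup>2)"
      unfolding sq by (rule represents_word_poly(1)[OF r l])
    ultimately have "AE x in N. (?a * mon (\<lambda>s. q s x) t - ?b * mon (\<lambda>s. q s x) u)\<^sup>2 = 0"
      by (subst (asm) integral_nonneg_eq_0_iff_AE) auto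
    then show ?thesis by eventually_elim simp
  qed
  have cnt: "countable {(t, u). t \<in> lists Y \<and> u \<in> lists Y \<and> val t = val u}"
  proof (rule countable_subset)
    have "countable (lists Y)" by (intro countable_lists countable_finite finite_Y)
    then show "countable (lists Y \<times> lists Y)" by (intro countable_SIGMA)
  qed auto
  have "AE x in N. \<forall>(t, u)\<in>{(t, u). t \<in> lists Y \<and> u \<in> lists Y \<and> val t = val u}.
      exp (\<beta> * wt t) * mon (\<lambda>s. q s x) t = exp (\<beta> * wt u) * mon (\<lambda>s. q s x) u"
    unfolding AE_ball_countable[OF cnt] using rel by auto
  moreover have "AE x in N. (\<forall>s\<in>Y. 0 \<le> q s x) \<and> (\<Sum>s\<in>Y. q s x) = 1" using r by (simp add: represents_def)
  ultimately have "AE x in N. (\<lambda>s. if s \<in> Y then q s x else 0) \<in> Gibbs \<beta>"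
  proof eventually_elim
    case (elim x)
    have "prob_vector (\<lambda>s. q s x)" using elim by (simp add: prob_vector_def)
    then show ?case
    proof (rule multiplicative_Gibbs)
      fix t u assume "t \<in> lists Y" "u \<in> lists Y" "val t = val u"
      then show "exp (\<beta> * wt t) * mon (\<lambda>s. q s x) t = exp (\<beta> * wt u) * mon (\<lambda>s. q s x) u"
        using bspec[OF elim(1), of "(t, u)"] by (simp del: in_lists_conv_set)
    qed
  qed
  then show ?thesis using r by blast
qed

text \<open>Gibbs vectors violating the bound for arbitrarily large \<open>n\<close> would
  accumulate at a ground vector that violates the bound by \<open>C\<close>.\<close>

lemma Gibbs_word_poly_bound:
  assumes \<beta>: "filterlim \<beta> at_top sequentially" and l: "\<forall>(c, t)\<in>set l. t \<in> lists Y"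
    and C: "\<forall>v\<in>Sph. \<bar>word_poly l (mon (ground v))\<bar> \<le> C" and \<epsilon>: "\<epsilon> > 0"
  shows "\<exists>N. \<forall>n\<ge>N. \<forall>q\<in>Gibbs (\<beta> n). \<bar>word_poly l (mon q)\<bar> \<le> C + \<epsilon>"
proof (rule ccontr)
  assume "\<not> ?thesis"
  then have "infinite {n. \<exists>q\<in>Gibbs (\<beta> n). \<not> \<bar>word_poly l (mon q)\<bar> \<le> C + \<epsilon>}"
    unfolding infinite_nat_iff_unbounded_le by simp
  from infinite_enumerate[OF this]
  obtain r :: "nat \<Rightarrow> nat" where r: "strict_mono r"
    "\<forall>n. r n \<in> {n. \<exists>q\<in>Gibbs (\<beta> n). \<not> \<bar>word_poly l (mon q)\<bar> \<le> C + \<epsilon>}"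
    by (elim exE conjE)
  have "\<exists>q. q \<in> Gibbs (\<beta> (r n)) \<and> \<bar>word_poly l (mon q)\<bar> \<ge> C + \<epsilon>" for n
    using spec[OF r(2), of n] unfolding mem_Collect_eq Bex_def by (meson linear)
  then obtain q where q: "\<And>n. q n \<in> Gibbs (\<beta> (r n))" "\<And>n. \<bar>word_poly l (mon (q n))\<bar> \<ge> C + \<epsilon>"
    by metis
  have "filterlim (\<lambda>n. \<beta> (r n)) at_top sequentially" by (rule filterlim_compose[OF \<beta> filterlim_subseq[OF r(1)]])
  then obtain r' q' where r': "q' \<in> Ground" "\<forall>s\<in>Y. (\<lambda>n. q (r' n) s) \<longlonglongrightarrow> q' s"
    using Gibbs_subsequence[of "\<lambda>n. \<beta> (r n)" q] q(1) by blast
  have "(\<lambda>n. \<bar>word_poly l (mon (q (r' n)))\<bar>) \<longlonglongrightarrow> \<bar>word_poly l (mon q')\<bar>"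
    by (intro tendsto_rabs word_poly_tendsto[OF _ l] mon_tendsto) (use r' in auto)
  then have "C + \<epsilon> \<le> \<bar>word_poly l (mon q')\<bar>" by (rule tendsto_lowerbound) (use q(2) in auto)
  moreover have "direction q' \<in> Sph" using norm_direction[OF Ground_mean_nonzero[OF r'(1)]] by simp
  then have "\<bar>word_poly l (mon q')\<bar> \<le> C" using C ground_direction[OF r'(1)] by metis
  ultimately show False using \<epsilon> by simp
qed

section \<open>Polynomial bounds for limit states\<close>

lemma limitin_state_topology:
  "limitin (state_topology A) \<omega>s \<omega> sequentially \<longleftrightarrow>
    \<omega> \<in> states A \<and> (\<forall>\<^sub>F k in sequentially. \<omega>s k \<in> states A) \<and> (\<forall>x\<in>A. (\<lambda>k. \<omega>s k x) \<longlonglongrightarrow> \<omega> x)"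
  unfolding state_topology_def limitin_subtopology limitin_componentwise
  by (auto simp: statesD(1) extensional_arb[OF statesD(1)] elim!: eventually_mono)

text \<open>At finite \<beta> a polynomial in the state vector is an average of its values at Gibbs
  vectors, which eventually are at most \<open>C + \<epsilon>\<close> in modulus. Off-diagonal
  values vanish as soon as \<beta> is positive.\<close>

lemma K_ground_bounded:
  assumes \<omega>: "\<omega> \<in> K"
  shows "\<omega> \<in> states A" "ground_bounded \<omega>"
proof -
  obtain \<beta> \<omega>s where \<beta>: "filterlim \<beta> at_top sequentially"
    and kms: "\<And>k. \<omega>s k \<in> abelian_KMS_states G Y V F \<alpha> (\<beta> k)"
    and lim: "limitin (state_topology A) \<omega>s \<omega> sequentially"
    using \<omega> unfolding K_def abelian_KMS_infinity_states_def A_def[symmetric] by blast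
  show "\<omega> \<in> states A" using lim by (simp add: limitin_state_topology)
  have conv: "(\<lambda>k. \<omega>s k x) \<longlonglongrightarrow> \<omega> x" if "x \<in> A" for x using lim that by (simp add: limitin_state_topology)
  have k: "\<omega>s n \<in> KMS_states A \<alpha> (\<beta> n)" for n using kms[of n] by (simp add: abelian_KMS_states_def A_def)
  have pos: "\<forall>\<^sub>F n in sequentially. \<beta> n > 0" using \<beta> by (simp add: filterlim_at_top_dense)
  show "ground_bounded \<omega>"
    unfolding ground_bounded_def
  proof (intro conjI ballI allI impI)
    fix t u assume tu: "t \<in> lists Y" "u \<in> lists Y" "val t = val u" "t \<noteq> u"
    have "\<forall>\<^sub>F n in sequentially. \<omega>s n (W t * star (W u)) = 0"
      using pos by eventually_elim (use KMS_state_diagonal(1)[OF k _ tu(1-3)] tu(4) in blast)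
    then have "(\<lambda>n. \<omega>s n (W t * star (W u))) \<longlonglongrightarrow> 0" by (rule tendsto_eventually)
    then show "\<omega> (W t * star (W u)) = 0" using conv[OF A_gen[OF tu(1-3)]] LIMSEQ_unique by blast
  next
    fix l C assume l: "\<forall>(c, t)\<in>set l. t \<in> lists Y" and C: "\<forall>v\<in>Sph. \<bar>word_poly l (mon (ground v))\<bar> \<le> C"
    have lim: "(\<lambda>n. \<bar>word_poly l (state_vector (\<omega>s n))\<bar>) \<longlonglongrightarrow> \<bar>word_poly l (state_vector \<omega>)\<bar>"
      unfolding state_vector_def
      by (intro tendsto_rabs word_poly_tendsto[OF _ l] tendsto_Re conv A_gen) auto
    show "\<bar>word_poly l (state_vector \<omega>)\<bar> \<le> C"
    proof (rule field_le_epsilon)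
      fix \<epsilon> :: real assume \<epsilon>: "\<epsilon> > 0"
      obtain M where M: "\<forall>n\<ge>M. \<forall>q\<in>Gibbs (\<beta> n). \<bar>word_poly l (mon q)\<bar> \<le> C + \<epsilon>"
        using Gibbs_word_poly_bound[OF \<beta> l C \<epsilon>] by blast
      have "\<forall>\<^sub>F n in sequentially. \<bar>word_poly l (state_vector (\<omega>s n))\<bar> \<le> C + \<epsilon>"
        using pos eventually_ge_at_top[of M]
      proof eventually_elim
        case (elim n)
        obtain N q where r: "represents N q (state_vector (\<omega>s n))"
          and G: "AE x in N. (\<lambda>s. if s \<in> Y then q s x else 0) \<in> Gibbs (\<beta> n)"
          using abelian_KMS_state_represents[OF kms elim(1)] by blast
        interpret finite_measure N using r by (simp add: represents_def)
        have b: "AE x in N. \<bar>word_poly l (mon (\<lambda>s. q s x))\<bar> \<le> C + \<epsilon>"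
          using G
        proof eventually_elim
          case (elim x)
          have "word_poly l (mon (\<lambda>s. q s x)) = word_poly l (mon (\<lambda>s. if s \<in> Y then q s x else 0))"
            by (rule word_poly_cong[OF mon_cong l]) auto
          then show ?case using M elim \<open>M \<le> n\<close> by simp
        qed
        have "\<bar>word_poly l (state_vector (\<omega>s n))\<bar> = \<bar>\<integral>x. word_poly l (mon (\<lambda>s. q s x)) \<partial>N\<bar>"
          using represents_word_poly(2)[OF r l] by simp
        also have "\<dots> \<le> (\<integral>x. \<bar>word_poly l (mon (\<lambda>s. q s x))\<bar> \<partial>N)" by (rule integral_abs_bound)
        also have "\<dots> \<le> (\<integral>x. C + \<epsilon> \<partial>N)"
          by (rule integral_mono_AE) (use represents_word_poly(1)[OF r l] b in auto)
        also have "\<dots> = C + \<epsilon>" using r by (simp add: represents_def)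
        finally show ?case .
      qed
      then show "\<bar>word_poly l (state_vector \<omega>)\<bar> \<le> C + \<epsilon>"
        by (intro tendsto_upperbound[OF lim]) auto
    qed
  qed
qed

subsection \<open>Representation by measures on the sphere\<close>

text \<open>The l1 distance to the set of ground vectors, which is zero exactly when
  \<open>q\<close> agrees on \<open>Y\<close> with one of them. It serves to locate the support of a
  mixture.\<close>

definition gap :: "('g \<Rightarrow> real) \<Rightarrow> real" where
  "gap q = (INF v\<in>Sph. \<Sum>s\<in>Y. \<bar>q s - ground v s\<bar>)"

lemma Sph_nonempty: "Sph \<noteq> {}"
  by simp

lemma gap_attained: "\<exists>v\<in>Sph. gap q = (\<Sum>s\<in>Y. \<bar>q s - ground v s\<bar>)"
proof -
  have "\<exists>v\<in>Sph. \<forall>w\<in>Sph. (\<Sum>s\<in>Y. \<bar>q s - ground v s\<bar>) \<le> (\<Sum>s\<in>Y. \<bar>q s - ground w s\<bar>)"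
    by (intro continuous_attains_inf compact_sphere Sph_nonempty continuous_intros ground_continuous)
  then obtain v where v: "v \<in> Sph" "\<And>w. w \<in> Sph \<Longrightarrow> (\<Sum>s\<in>Y. \<bar>q s - ground v s\<bar>) \<le> (\<Sum>s\<in>Y. \<bar>q s - ground w s\<bar>)"
    by blast
  have "gap q = (\<Sum>s\<in>Y. \<bar>q s - ground v s\<bar>)"
    unfolding gap_def by (rule cInf_eq_minimum) (use v in auto)
  then show ?thesis using v by blast
qed

lemma gap_le: "v \<in> Sph \<Longrightarrow> gap q \<le> (\<Sum>s\<in>Y. \<bar>q s - ground v s\<bar>)"
  unfolding gap_def by (rule cINF_lower[OF bdd_belowI[of _ 0]]) (auto intro: sum_nonneg)

lemma gap_nonneg: "gap q \<ge> 0"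
  using gap_attained[of q] by (auto intro: sum_nonneg)

lemma gap_ground: "v \<in> Sph \<Longrightarrow> gap (ground v) = 0"
  using gap_le[of v "ground v"] gap_nonneg[of "ground v"] by simp

lemma gap_diff: "\<bar>gap q - gap q'\<bar> \<le> (\<Sum>s\<in>Y. \<bar>q s - q' s\<bar>)"
proof -
  have le: "gap q \<le> gap q' + (\<Sum>s\<in>Y. \<bar>q s - q' s\<bar>)" for q q'
  proof -
    obtain v where v: "v \<in> Sph" "gap q' = (\<Sum>s\<in>Y. \<bar>q' s - ground v s\<bar>)" using gap_attained by blast
    have "gap q \<le> (\<Sum>s\<in>Y. \<bar>q s - ground v s\<bar>)" by (rule gap_le[OF v(1)])
    also have "\<dots> \<le> (\<Sum>s\<in>Y. \<bar>q' s - ground v s\<bar> + \<bar>q s - q' s\<bar>)" by (rule sum_mono) linarith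
    finally show ?thesis using v by (simp add: sum.distrib)
  qed
  show ?thesis using le[of q q'] le[of q' q] by (simp add: abs_minus_commute abs_le_iff)
qed

text \<open>By \<open>gap_diff\<close> the distance is continuous on the cube of weights, so it can
  be approximated by polynomials. Numbering the letters by \<open>idx\<close> places the cube in the
  metric space \<open>nat \<Rightarrow> real\<close>.\<close>

lemma gap_word_poly:
  assumes \<epsilon>: "\<epsilon> > 0"
  shows "\<exists>l. (\<forall>(c, t)\<in>set l. t \<in> lists Y) \<and>
    (\<forall>q. (\<forall>s\<in>Y. q s \<in> {0..1}) \<longrightarrow> \<bar>gap q - word_poly l (mon q)\<bar> < \<epsilon>)"
proof -
  obtain idx :: "'g \<Rightarrow> nat" where idx: "inj_on idx Y" using finite_imp_inj_to_nat_seg[OF finite_Y] by blast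
  define X where "X = PiE UNIV (\<lambda>n. if n \<in> idx ` Y then {0..1::real} else {0})"
  define \<kappa> where "\<kappa> x s = (x (idx s) :: real)" for x s
  have "compactin (product_topology (\<lambda>_. euclidean) UNIV) X"
    unfolding X_def by (subst compactin_PiE) auto
  then have cX: "compact X" by (simp add: euclidean_product_topology)
  have coord: "continuous_on X (\<lambda>x. x n)" for n
    by (rule continuous_on_subset[OF continuous_on_product_coordinates]) auto
  have cont: "continuous_on X (\<lambda>x. gap (\<kappa> x))"
    unfolding continuous_on_def
  proof
    fix x assume "x \<in> X"
    have "((\<lambda>y. \<Sum>s\<in>Y. \<bar>\<kappa> y s - \<kappa> x s\<bar>) \<longlongrightarrow> (\<Sum>s\<in>Y. \<bar>\<kappa> x s - \<kappa> x s\<bar>)) (at x within X)"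
      unfolding \<kappa>_def using coord \<open>x \<in> X\<close> by (intro tendsto_intros) (auto simp: continuous_on_def)
    then have lim: "((\<lambda>y. \<Sum>s\<in>Y. \<bar>\<kappa> y s - \<kappa> x s\<bar>) \<longlongrightarrow> 0) (at x within X)" by simp
    have "((\<lambda>y. gap (\<kappa> y) - gap (\<kappa> x)) \<longlongrightarrow> 0) (at x within X)"
      by (rule Lim_null_comparison[OF _ lim]) (auto intro!: always_eventually gap_diff)
    then show "((\<lambda>y. gap (\<kappa> y)) \<longlongrightarrow> gap (\<kappa> x)) (at x within X)" by (rule LIM_zero_cancel)
  qed
  have "\<exists>l. (\<forall>(c, t)\<in>set l. t \<in> lists Y) \<and>
    (\<forall>x\<in>X. \<bar>gap (\<kappa> x) - word_poly l (\<lambda>t. prod_list (map (\<kappa> x) t))\<bar> < \<epsilon>)"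
  proof (rule word_poly_dense[OF cX _ _ cont \<epsilon>])
    show "continuous_on X (\<lambda>x. \<kappa> x s)" for s unfolding \<kappa>_def by (rule coord)
    fix x y assume xy: "x \<in> X" "y \<in> X" "x \<noteq> y"
    then obtain n where n: "x n \<noteq> y n" by blast
    have "n \<in> idx ` Y"
    proof (rule ccontr)
      assume "n \<notin> idx ` Y"
      then have "x n = 0" "y n = 0" using xy by (auto simp: X_def PiE_iff split: if_splits)
      then show False using n by simp
    qed
    then show "\<exists>s\<in>Y. \<kappa> x s \<noteq> \<kappa> y s" using n by (auto simp: \<kappa>_def)
  qed
  then obtain l where l: "\<forall>(c, t)\<in>set l. t \<in> lists Y"
    "\<And>x. x \<in> X \<Longrightarrow> \<bar>gap (\<kappa> x) - word_poly l (mon (\<kappa> x))\<bar> < \<epsilon>"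
    unfolding mon_def[abs_def] by blast
  have "\<bar>gap q - word_poly l (mon q)\<bar> < \<epsilon>" if q: "\<forall>s\<in>Y. q s \<in> {0..1}" for q
  proof -
    define x where "x n = (if n \<in> idx ` Y then q (inv_into Y idx n) else 0)" for n
    have xX: "x \<in> X" using q by (auto simp: X_def x_def inv_into_into)
    have e: "\<kappa> x s = q s" if "s \<in> Y" for s using that idx by (simp add: \<kappa>_def x_def)
    have "gap (\<kappa> x) = gap q" unfolding gap_def by (intro INF_cong sum.cong refl) (simp add: e)
    moreover have "word_poly l (mon (\<kappa> x)) = word_poly l (mon q)"
      by (rule word_poly_cong[OF mon_cong l(1)]) (auto simp: e)
    ultimately show ?thesis using l(2)[OF xX] by simp
  qed
  then show ?thesis using l(1) by blast
qed

text \<open>A polynomial close to \<open>gap\<close> is small on all ground vectors, so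
  \<open>ground_bounded\<close> makes its mean small. The functions \<open>u n\<close>, which
  dominate \<open>gap\<close>, therefore tend to zero in mean and almost everywhere along a
  subsequence, forcing \<open>gap\<close> to vanish.\<close>

lemma ground_bounded_represents:
  assumes r: "represents N q (state_vector \<omega>)" and b: "ground_bounded \<omega>"
  shows "AE x in N. \<exists>v\<in>Sph. \<forall>s\<in>Y. q s x = ground v s"
proof -
  interpret finite_measure N using r by (simp add: represents_def)
  have "\<forall>n. \<exists>l. (\<forall>(c, t)\<in>set l. t \<in> lists Y) \<and>
    (\<forall>q. (\<forall>s\<in>Y. q s \<in> {0..1}) \<longrightarrow> \<bar>gap q - word_poly l (mon q)\<bar> < inverse (real (Suc n)))"
    using gap_word_poly by simp
  then obtain l where l: "\<And>n. \<forall>(c, t)\<in>set (l n). t \<in> lists Y"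
    "\<And>n q. (\<forall>s\<in>Y. q s \<in> {0..1}) \<Longrightarrow> \<bar>gap q - word_poly (l n) (mon q)\<bar> < inverse (real (Suc n))" by metis
  define u where "u n x = word_poly (l n) (mon (\<lambda>s. q s x)) + inverse (real (Suc n))" for n x
  have cube: "AE x in N. \<forall>s\<in>Y. q s x \<in> {0..1}"
  proof -
    have "AE x in N. (\<forall>s\<in>Y. 0 \<le> q s x) \<and> (\<Sum>s\<in>Y. q s x) = 1" using r by (simp add: represents_def)
    then show ?thesis
    proof eventually_elim
      case (elim x)
      then show ?case using prob_vector_le_1[of "\<lambda>s. q s x"] by (auto simp: prob_vector_def)
    qed
  qed
  have int: "integrable N (u n)" for n
    unfolding u_def using represents_word_poly(1)[OF r l(1)] by simp
  have u: "AE x in N. \<forall>n. gap (\<lambda>s. q s x) \<le> u n x"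
    using cube
  proof eventually_elim
    case (elim x)
    then show ?case unfolding u_def using l(2)[of "\<lambda>s. q s x"] by (smt (verit, best))
  qed
  have "(\<integral>x. norm (u n x) \<partial>N) \<le> 2 * inverse (real (Suc n))" for n
  proof -
    have "(\<integral>x. norm (u n x) \<partial>N) = (\<integral>x. u n x \<partial>N)"
    proof (rule integral_cong_AE)
      show "AE x in N. norm (u n x) = u n x"
        using u
      proof eventually_elim
        case (elim x)
        have "0 \<le> u n x" using elim gap_nonneg order_trans by blast
        then show ?case by simp
      qed
    qed (use int in \<open>auto simp: borel_measurable_integrable\<close>)
    also have "\<dots> = word_poly (l n) (state_vector \<omega>) + inverse (real (Suc n))"
      unfolding u_def using represents_word_poly[OF r l(1), of n] r by (simp add: represents_def)
    also have "\<bar>word_poly (l n) (state_vector \<omega>)\<bar> \<le> inverse (real (Suc n))"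
    proof -
      have "\<bar>word_poly (l n) (mon (ground v))\<bar> \<le> inverse (real (Suc n))" if v: "v \<in> Sph" for v
      proof -
        have "\<forall>s\<in>Y. ground v s \<in> {0..1}"
          using ground(1)[OF v] Simplex_le_1[of "ground v"] by (auto simp: Ground_def Simplex_def)
        then show ?thesis using l(2)[of "ground v" n] gap_ground[OF v] by simp
      qed
      then show ?thesis using b l(1)[of n] unfolding ground_bounded_def by blast
    qed
    then have "word_poly (l n) (state_vector \<omega>) + inverse (real (Suc n)) \<le> 2 * inverse (real (Suc n))" by linarith
    finally show ?thesis .
  qed
  then have "(\<lambda>n. \<integral>x. norm (u n x) \<partial>N) \<longlonglongrightarrow> 0"
    by (intro Lim_null_comparison[OF _ tendsto_mult_right_zero[OF LIMSEQ_inverse_real_of_nat]])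
       (auto intro!: always_eventually simp: Bochner_Integration.integral_nonneg)
  then obtain r' where r': "strict_mono r'" "AE x in N. (\<lambda>n. u (r' n) x) \<longlonglongrightarrow> 0"
    using tendsto_L1_AE_subseq[of N u, OF int] by blast
  show ?thesis using r'(2) u cube
  proof eventually_elim
    case (elim x)
    have "gap (\<lambda>s. q s x) \<le> 0" by (rule tendsto_lowerbound[OF elim(1)]) (use elim(2) in auto)
    then have "gap (\<lambda>s. q s x) = 0" using gap_nonneg[of "\<lambda>s. q s x"] by simp
    then obtain v where v: "v \<in> Sph" "(\<Sum>s\<in>Y. \<bar>q s x - ground v s\<bar>) = 0" using gap_attained[of "\<lambda>s. q s x"] by auto
    then show ?case using finite_Y by (intro bexI[of _ v]) (auto simp: sum_nonneg_eq_0_iff)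
  qed
qed

text \<open>For permuted words the difference of monomials vanishes on all ground vectors, so the
  bound with \<open>C = 0\<close> yields exchangeability. The measure sought is the law of the
  direction of the directing vector, which almost surely is a ground vector.\<close>

lemma ground_bounded_mixture:
  assumes \<omega>: "\<omega> \<in> states A" and b: "ground_bounded \<omega>"
  shows "\<exists>\<mu>\<in>borel_probabilities Sph. \<omega> = mixture ground \<mu>"
proof -
  have perm: "state_vector \<omega> t = state_vector \<omega> u" if tu: "t \<in> lists Y" "u \<in> lists Y" "mset t = mset u" for t u
  proof -
    have "mon q t = mon q u" for q using tu(3) unfolding mon_def by (metis mset_map prod_mset_prod_list)
    then have "\<forall>v\<in>Sph. \<bar>word_poly [(1, t), (-1, u)] (mon (ground v))\<bar> \<le> 0" by simp
    moreover have "\<forall>(c, t)\<in>set [(1, t), (-1::real, u)]. t \<in> lists Y" using tu by auto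
    ultimately have "\<bar>word_poly [(1, t), (-1, u)] (state_vector \<omega>)\<bar> \<le> 0"
      using b unfolding ground_bounded_def by blast
    then show ?thesis by simp
  qed
  obtain N q where r: "represents N q (state_vector \<omega>)"
    using exchangeable_represents[OF exchangeable_state[OF \<omega> perm]] by blast
  interpret finite_measure N using r by (simp add: represents_def)
  have qm: "q s \<in> borel_measurable N" if "s \<in> Y" for s using r that by (simp add: represents_def)
  obtain v0 where v0: "v0 \<in> Sph" using Sph_nonempty by blast
  define d where "d x = direction (\<lambda>s. q s x)" for x
  have mm: "(\<lambda>x. mean (\<lambda>s. q s x)) \<in> borel_measurable N"
    unfolding mean_def by (intro borel_measurable_sum borel_measurable_scaleR qm borel_measurable_const)
  have dm: "d \<in> borel_measurable N"
    unfolding d_def direction_def using mm by measurable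
  \<comment> \<open>Almost everywhere \<open>d x\<close> lies on the sphere; \<open>v0\<close> is a
    default that makes \<open>w\<close> take values there everywhere.\<close>
  define w where "w x = (if d x \<in> Sph then d x else v0)" for x
  have "{x \<in> space N. d x \<in> Sph} \<in> sets N"
    by (rule measurable_sets_Collect[OF dm]) (auto intro: borel_closed)
  then have wm0: "w \<in> borel_measurable N"
    unfolding w_def by (intro measurable_If dm measurable_const) auto
  have wm: "w \<in> measurable N (restrict_space borel Sph)"
    by (rule measurable_restrict_space2[OF _ wm0]) (use v0 in \<open>auto simp: w_def\<close>)
  define \<mu> where "\<mu> = distr N (restrict_space borel Sph) w"
  have eN: "emeasure N (space N) = 1" using r by (simp add: represents_def emeasure_eq_measure)
  have \<mu>: "\<mu> \<in> borel_probabilities Sph"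
  proof -
    have "emeasure \<mu> (space \<mu>) = emeasure N (w -` space (restrict_space borel Sph) \<inter> space N)"
      unfolding \<mu>_def space_distr by (rule emeasure_distr[OF wm sets.top])
    also have "w -` space (restrict_space borel Sph) \<inter> space N = space N"
      using measurable_space[OF wm] by auto
    finally show ?thesis using eN by (simp add: borel_probabilities_def \<mu>_def)
  qed
  have q_eq: "AE x in N. \<forall>s\<in>Y. q s x = ground (w x) s"
    using ground_bounded_represents[OF r b]
  proof eventually_elim
    case (elim x)
    then obtain v where v: "v \<in> Sph" "\<forall>s\<in>Y. q s x = ground v s" by blast
    then have "mean (\<lambda>s. q s x) = mean (ground v)" unfolding mean_def by (intro sum.cong) auto
    then have "d x = v" using ground(2)[OF v(1)] by (simp add: d_def direction_def)
    then show ?case using v by (simp add: w_def)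
  qed
  have p: "state_vector \<omega> t = (\<integral>v. mon (ground v) t \<partial>\<mu>)" if t: "t \<in> lists Y" for t
  proof -
    have mc: "(\<lambda>v. mon (ground v) t) \<in> borel_measurable (restrict_space borel Sph)"
      by (rule borel_measurable_continuous_on_restrict[OF mon_continuous[OF ground_field t]])
    have "(\<integral>v. mon (ground v) t \<partial>\<mu>) = (\<integral>x. mon (ground (w x)) t \<partial>N)"
      unfolding \<mu>_def by (rule integral_distr[OF wm mc])
    also have "\<dots> = (\<integral>x. mon (\<lambda>s. q s x) t \<partial>N)"
    proof (rule integral_cong_AE)
      show "(\<lambda>x. mon (ground (w x)) t) \<in> borel_measurable N" by (rule measurable_compose[OF wm mc])
      show "(\<lambda>x. mon (\<lambda>s. q s x) t) \<in> borel_measurable N"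
        using r t by (auto simp: represents_def intro: borel_measurable_integrable)
      show "AE x in N. mon (ground (w x)) t = mon (\<lambda>s. q s x) t"
        using q_eq by eventually_elim (rule mon_cong[OF _ t], simp)
    qed
    finally show ?thesis using r t by (simp add: represents_def)
  qed
  have "\<omega> = mixture ground \<mu>"
  proof (rule state_eqI[OF \<omega> mixture_state[OF ground_field \<mu>]])
    fix t u assume tu: "t \<in> lists Y" "u \<in> lists Y" "val t = val u"
    show "\<omega> (W t * star (W u)) = mixture ground \<mu> (W t * star (W u))"
    proof (cases "t = u")
      case True
      then show ?thesis
        using mixture_gen[OF ground_field \<mu> tu] state_vector_real(1)[OF \<omega> tu(1)] p[OF tu(1)] by simp
    next
      case False
      then show ?thesis using mixture_gen[OF ground_field \<mu> tu] b tu by (auto simp: ground_bounded_def)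
    qed
  qed
  then show ?thesis using \<mu> by blast
qed

lemma mixture_ground_in_K:
  assumes \<mu>: "\<mu> \<in> borel_probabilities Sph"
  shows "mixture ground \<mu> \<in> K"
proof -
  define \<beta> where "\<beta> n = threshold + 1 + real n" for n
  have \<beta>: "filterlim \<beta> at_top sequentially" unfolding \<beta>_def
    by (intro filterlim_tendsto_add_at_top[OF tendsto_const] filterlim_real_sequentially)
  have \<beta>t: "\<beta> n > threshold" for n by (simp add: \<beta>_def)
  interpret finite_measure \<mu> by (rule borel_probabilitiesD[OF \<mu>])
  have sp: "space \<mu> = Sph" by (rule borel_probabilitiesD[OF \<mu>])
  have "limitin (state_topology A) (\<lambda>n. mixture (gibbs (\<beta> n)) \<mu>) (mixture ground \<mu>) sequentially"
    unfolding limitin_state_topology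
  proof (intro conjI ballI)
    show "mixture ground \<mu> \<in> states A" by (rule mixture_state[OF ground_field \<mu>])
    show "\<forall>\<^sub>F n in sequentially. mixture (gibbs (\<beta> n)) \<mu> \<in> states A"
      by (intro always_eventually allI mixture_state gibbs_field \<beta>t \<mu>)
    fix x assume x: "x \<in> A"
    have "(\<lambda>n. \<integral>v. product_state (gibbs (\<beta> n) v) x \<partial>\<mu>) \<longlonglongrightarrow> (\<integral>v. product_state (ground v) x \<partial>\<mu>)"
    proof (rule integral_dominated_convergence[where w = "\<lambda>_. norm x"])
      show "AE v in \<mu>. (\<lambda>n. product_state (gibbs (\<beta> n) v) x) \<longlonglongrightarrow> product_state (ground v) x"
      proof (rule AE_I2)
        fix v assume v: "v \<in> space \<mu>"
        show "(\<lambda>n. product_state (gibbs (\<beta> n) v) x) \<longlonglongrightarrow> product_state (ground v) x"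
          by (rule product_state_tendsto[OF _ _ _ x])
             (use v sp gibbs_field[OF \<beta>t] ground_field gibbs_tendsto_ground[OF \<beta> \<beta>t] in \<open>auto simp: continuous_field_def\<close>)
      qed
      show "AE v in \<mu>. norm (product_state (gibbs (\<beta> n) v) x) \<le> norm x" for n
        using field_state(2)[OF gibbs_field[OF \<beta>t] _ x] sp by (intro AE_I2) auto
    qed (use borel_measurable_integrable[OF field_integrable[OF ground_field x \<mu>]]
          borel_measurable_integrable[OF field_integrable[OF gibbs_field[OF \<beta>t] x \<mu>]] in auto)
    then show "(\<lambda>n. mixture (gibbs (\<beta> n)) \<mu> x) \<longlonglongrightarrow> mixture ground \<mu> x" using x by (simp add: mixture_def)
  qed
  then show ?thesis
    unfolding K_def abelian_KMS_infinity_states_def A_def[symmetric]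
    using mixture_state[OF ground_field \<mu>] mixture_gibbs[OF \<beta>t \<mu>] \<beta>
    by (intro CollectI conjI exI[of _ \<beta>] exI[of _ "\<lambda>n. mixture (gibbs (\<beta> n)) \<mu>"]) auto
qed

lemma K_eq_mixtures: "K = mixture ground ` borel_probabilities Sph"
  using mixture_ground_in_K ground_bounded_mixture K_ground_bounded by blast

lemma K_eq_ground_bounded: "K = {\<omega> \<in> states A. ground_bounded \<omega>}"
  using mixture_ground_in_K ground_bounded_mixture K_ground_bounded by blast

end

section \<open>The topology on the limit states\<close>

lemma closedin_constraints:
  assumes "\<And>i. i \<in> I \<Longrightarrow> continuous_map T euclidean (g i)" "\<And>i. i \<in> I \<Longrightarrow> closed (C i)"
  shows "closedin T {\<omega> \<in> topspace T. \<forall>i\<in>I. g i \<omega> \<in> C i}"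
proof (cases "I = {}")
  case False
  have "closedin T (\<Inter>i\<in>I. {\<omega> \<in> topspace T. g i \<omega> \<in> C i})"
    using False assms by (intro closedin_INT closedin_continuous_map_preimage[of T euclidean]) auto
  also have "(\<Inter>i\<in>I. {\<omega> \<in> topspace T. g i \<omega> \<in> C i}) = {\<omega> \<in> topspace T. \<forall>i\<in>I. g i \<omega> \<in> C i}"
    using False by auto
  finally show ?thesis .
qed auto

lemma continuous_map_euclidean_iff:
  "continuous_map T euclidean f \<longleftrightarrow> (\<forall>x\<in>topspace T. (f \<longlongrightarrow> f x) (atin T x))"
  by (simp add: continuous_map_atin limitin_canonical_iff)

lemma eventually_atin_topspace: "\<forall>\<^sub>F x in atin T a. x \<in> topspace T"
  by (auto simp: eventually_atin)

lemma integral_continuous_map: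
  assumes "continuous_on S f"
  shows "continuous_map (probability_topology S) euclidean (\<lambda>\<mu>. integral\<^sup>L \<mu> (f :: _ \<Rightarrow> real))"
proof -
  have "continuous_map (product_topology (\<lambda>_. euclidean) {f :: _ \<Rightarrow> real. continuous_on S f}) euclidean (\<lambda>h. h f)"
    using assms by (intro continuous_map_product_projection) simp
  then have "continuous_map (probability_topology S) euclidean
      ((\<lambda>h. h f) \<circ> (\<lambda>\<mu>. \<lambda>f\<in>{f :: _ \<Rightarrow> real. continuous_on S f}. integral\<^sup>L \<mu> f))"
    unfolding probability_topology_def by (rule continuous_map_pullback)
  then show ?thesis using assms by (simp add: o_def)
qed

lemma topspace_probability_topology: "topspace (probability_topology S) = borel_probabilities S"
  unfolding probability_topology_def topspace_pullback_topology by auto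

lemma word_poly_convex:
  assumes "\<And>t. t \<in> lists Y \<Longrightarrow> \<phi> t = (1 - r) * \<phi>1 t + r * \<phi>2 t" "\<forall>(c, t)\<in>set l. t \<in> lists Y"
  shows "word_poly l \<phi> = (1 - r) * word_poly l \<phi>1 + r * word_poly l \<phi>2"
  using assms(2)
proof (induction l)
  case (Cons a l)
  obtain c t where a: "a = (c, t)" by (cases a)
  have "word_poly l \<phi> = (1 - r) * word_poly l \<phi>1 + r * word_poly l \<phi>2"
    by (rule Cons.IH) (use Cons.prems in simp)
  moreover have "\<phi> t = (1 - r) * \<phi>1 t + r * \<phi>2 t" using Cons.prems assms(1)[of t] by (simp add: a)
  moreover have "word_poly (a # l) \<psi> = c * \<psi> t + word_poly l \<psi>" for \<psi> by (simp add: a)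
  ultimately show ?case by (simp only:) (simp add: algebra_simps)
qed simp

context cuntz_rank
begin

text \<open>The ambient product space of all functionals, in which the set of limit states is closed
  as well.\<close>

definition T where "T = product_topology (\<lambda>_. euclidean :: complex topology) A"

lemma topspace_T: "topspace T = extensional A"
  by (auto simp: T_def PiE_def)

lemma proj_tendsto:
  assumes "x \<in> A" "\<omega> \<in> topspace T"
  shows "((\<lambda>\<omega>. \<omega> x) \<longlongrightarrow> \<omega> x) (atin T \<omega>)"
proof -
  have "continuous_map T euclidean (\<lambda>\<omega>. \<omega> x)"
    unfolding T_def using assms(1) by (rule continuous_map_product_projection)
  then show ?thesis using assms(2) by (simp add: continuous_map_euclidean_iff)
qed

lemma state_vector_tendsto:
  "t \<in> lists Y \<Longrightarrow> \<omega> \<in> topspace T \<Longrightarrow> ((\<lambda>\<omega>. state_vector \<omega> t) \<longlongrightarrow> state_vector \<omega> t) (atin T \<omega>)"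
  unfolding state_vector_def by (intro tendsto_Re proj_tendsto A_gen) auto

text \<open>Being a state and being \<open>ground_bounded\<close> are conditions on finitely many
  values at a time, hence closed for pointwise convergence. By \<open>state_norm_le\<close> all
  limit states lie in a product of discs, which is compact.\<close>

lemma compactin_K: "compactin (state_topology A) K"
proof -
  have st: "K = {\<omega> \<in> topspace T. \<forall>(x, y)\<in>A \<times> A. \<omega> (x + y) - (\<omega> x + \<omega> y) \<in> {0}} \<inter>
    ({\<omega> \<in> topspace T. \<forall>(c, x)\<in>UNIV \<times> A. \<omega> (c *\<^sub>C x) - c * \<omega> x \<in> {0}} \<inter>
    ({\<omega> \<in> topspace T. \<forall>x\<in>A. \<omega> (star x * x) \<in> \<real>\<^sub>\<ge>\<^sub>0} \<inter>
    ({\<omega> \<in> topspace T. \<forall>i\<in>{()}. \<omega> 1 \<in> {1}} \<inter>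
    ({\<omega> \<in> topspace T. \<forall>(t, u)\<in>{(t, u). t \<in> lists Y \<and> u \<in> lists Y \<and> val t = val u \<and> t \<noteq> u}. \<omega> (W t * star (W u)) \<in> {0}} \<inter>
    {\<omega> \<in> topspace T. \<forall>(l, C)\<in>{(l, C). (\<forall>(c, t)\<in>set l. t \<in> lists Y) \<and> (\<forall>v\<in>Sph. \<bar>word_poly l (mon (ground v))\<bar> \<le> C)}.
       \<bar>word_poly l (state_vector \<omega>)\<bar> \<in> {..C}}))))" (is "K = ?S1 \<inter> (?S2 \<inter> (?S3 \<inter> (?S4 \<inter> (?S5 \<inter> ?S6))))")
  proof -
    have "\<omega> \<in> K \<longleftrightarrow> \<omega> \<in> ?S1 \<and> \<omega> \<in> ?S2 \<and> \<omega> \<in> ?S3 \<and> \<omega> \<in> ?S4 \<and> \<omega> \<in> ?S5 \<and> \<omega> \<in> ?S6" for \<omega>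
    proof -
      have "\<omega> \<in> states A \<longleftrightarrow> \<omega> \<in> ?S1 \<and> \<omega> \<in> ?S2 \<and> \<omega> \<in> ?S3 \<and> \<omega> \<in> ?S4"
        unfolding states_def topspace_T by auto
      moreover have "ground_bounded \<omega> \<longleftrightarrow> \<omega> \<in> ?S5 \<and> \<omega> \<in> ?S6" if "\<omega> \<in> states A"
      proof -
        have e: "\<omega> \<in> topspace T" using that by (simp add: topspace_T statesD)
        show ?thesis using e unfolding ground_bounded_def mem_Collect_eq split_paired_Ball_Sigma
          by (simp add: split_paired_all) blast
      qed
      ultimately show ?thesis unfolding K_eq_ground_bounded by blast
    qed
    then show ?thesis by blast
  qed
  note xy = star_subalgebraD[OF A_star_subalgebra]
  have c1: "closedin T ?S1" unfolding case_prod_unfold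
    by (rule closedin_constraints[where C = "\<lambda>_. {0}"])
       (auto simp: continuous_map_euclidean_iff intro!: tendsto_intros proj_tendsto xy)
  have c2: "closedin T ?S2" unfolding case_prod_unfold
    by (rule closedin_constraints[where C = "\<lambda>_. {0}"])
       (auto simp: continuous_map_euclidean_iff intro!: tendsto_intros proj_tendsto xy)
  have c3: "closedin T ?S3"
    by (rule closedin_constraints[where C = "\<lambda>_. \<real>\<^sub>\<ge>\<^sub>0"])
       (auto simp: continuous_map_euclidean_iff intro!: proj_tendsto xy)
  have c4: "closedin T ?S4"
    by (rule closedin_constraints[where C = "\<lambda>_. {1}"])
       (auto simp: continuous_map_euclidean_iff intro!: proj_tendsto one_A)
  have c5: "closedin T ?S5" unfolding case_prod_unfold
    by (rule closedin_constraints[where C = "\<lambda>_. {0}"])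
       (auto simp: continuous_map_euclidean_iff intro!: proj_tendsto A_gen)
  have c6: "closedin T ?S6" unfolding case_prod_unfold
  proof (rule closedin_constraints[where C = "\<lambda>p. {..snd p}"])
    fix p assume "p \<in> {p :: (real \<times> 'g list) list \<times> real.
      (\<forall>x\<in>set (fst p). snd x \<in> lists Y) \<and> (\<forall>v\<in>Sph. \<bar>word_poly (fst p) (mon (ground v))\<bar> \<le> snd p)}"
    then have l: "\<forall>(c, t)\<in>set (fst p). t \<in> lists Y" by (simp add: case_prod_unfold)
    show "continuous_map T euclidean (\<lambda>\<omega>. \<bar>word_poly (fst p) (state_vector \<omega>)\<bar>)"
      unfolding continuous_map_euclidean_iff
      by (intro ballI tendsto_rabs word_poly_tendsto[OF _ l] state_vector_tendsto)
  qed auto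
  have closed: "closedin T K" unfolding st by (intro closedin_Int c1 c2 c3 c4 c5 c6)
  have "compactin T (PiE A (\<lambda>x. cball 0 (norm x)))"
    unfolding T_def by (subst compactin_PiE) auto
  moreover have "K \<subseteq> PiE A (\<lambda>x. cball 0 (norm x))"
  proof
    fix \<omega> assume "\<omega> \<in> K"
    then have "\<omega> \<in> states A" by (rule K_ground_bounded)
    then show "\<omega> \<in> PiE A (\<lambda>x. cball 0 (norm x))"
      using state_norm_le[OF _ A_props] statesD(1) by (auto simp: PiE_def)
  qed
  ultimately have "compactin T K" using closed by (rule closed_compactin)
  then show ?thesis
    unfolding state_topology_def T_def[symmetric] compactin_subtopology using K_ground_bounded by blast
qed

lemma mix_state_vector:
  assumes "t \<in> lists Y"
  shows "state_vector (mix_functionals A r \<omega> \<omega>') t = (1 - r) * state_vector \<omega> t + r * state_vector \<omega>' t"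
  using A_gen[OF assms assms refl] by (simp add: state_vector_def mix_functionals_def)

text \<open>The polynomial bounds and the vanishing of off-diagonal values are preserved by mixing,
  so the description by \<open>ground_bounded\<close> gives convexity even though the sequences
  behind two limit states may use different values of \<beta>.\<close>

lemma convex_K: "convex_functionals A K"
  unfolding convex_functionals_def
proof (intro ballI)
  fix \<omega> \<omega>' and r :: real assume \<omega>: "\<omega> \<in> K" "\<omega>' \<in> K" and r: "r \<in> {0..1}"
  note s = K_ground_bounded[OF \<omega>(1)] K_ground_bounded[OF \<omega>(2)]
  let ?m = "mix_functionals A r \<omega> \<omega>'"
  have "?m \<in> states A"
    unfolding states_def
  proof (intro CollectI conjI ballI allI)
    fix x y assume "x \<in> A" "y \<in> A"
    then show "?m (x + y) = ?m x + ?m y"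
      using complex_subspaceD(2)[OF A_subspace] statesD(2)[OF s(1)] statesD(2)[OF s(3)]
      by (simp add: mix_functionals_def algebra_simps)
  next
    fix c x assume "x \<in> A"
    then show "?m (c *\<^sub>C x) = c * ?m x"
      using complex_subspaceD(3)[OF A_subspace] statesD(3)[OF s(1)] statesD(3)[OF s(3)]
      by (simp add: mix_functionals_def algebra_simps)
  next
    fix x assume x: "x \<in> A"
    then have xx: "star x * x \<in> A" using star_subalgebraD[OF A_star_subalgebra] by blast
    show "?m (star x * x) \<in> \<real>\<^sub>\<ge>\<^sub>0"
      using statesD(4)[OF s(1) x] statesD(4)[OF s(3) x] r xx
      by (simp add: mix_functionals_def complex_nonneg_Reals_iff)
  next
    show "?m 1 = 1" using one_A statesD(5)[OF s(1)] statesD(5)[OF s(3)] by (simp add: mix_functionals_def)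
  qed (simp add: mix_functionals_def)
  moreover have "ground_bounded ?m"
    unfolding ground_bounded_def
  proof (intro conjI ballI allI impI)
    fix t u assume tu: "t \<in> lists Y" "u \<in> lists Y" "val t = val u" "t \<noteq> u"
    then have "\<omega> (W t * star (W u)) = 0" "\<omega>' (W t * star (W u)) = 0"
      using s(2,4) unfolding ground_bounded_def by blast+
    then show "?m (W t * star (W u)) = 0" using A_gen[OF tu(1-3)] by (simp add: mix_functionals_def)
  next
    fix l C assume l: "\<forall>(c, t)\<in>set l. t \<in> lists Y" and C: "\<forall>v\<in>Sph. \<bar>word_poly l (mon (ground v))\<bar> \<le> C"
    have b: "\<bar>word_poly l (state_vector \<omega>)\<bar> \<le> C" "\<bar>word_poly l (state_vector \<omega>')\<bar> \<le> C"
      using s(2,4) l C unfolding ground_bounded_def by blast+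
    have "word_poly l (state_vector ?m) = (1 - r) * word_poly l (state_vector \<omega>) + r * word_poly l (state_vector \<omega>')"
      by (rule word_poly_convex[OF mix_state_vector l])
    also have "\<bar>\<dots>\<bar> \<le> (1 - r) * \<bar>word_poly l (state_vector \<omega>)\<bar> + r * \<bar>word_poly l (state_vector \<omega>')\<bar>"
      using r abs_triangle_ineq[of "(1 - r) * word_poly l (state_vector \<omega>)" "r * word_poly l (state_vector \<omega>')"]
      by (simp add: abs_mult)
    also have "\<dots> \<le> (1 - r) * C + r * C" using r b by (intro add_mono mult_left_mono) auto
    finally show "\<bar>word_poly l (state_vector ?m)\<bar> \<le> C" by (simp add: algebra_simps)
  qed
  ultimately show "?m \<in> K" by (simp add: K_eq_ground_bounded)
qed

text \<open>Integrals of \<open>f\<close> are approximated by values of states with one polynomial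
  for all measures. This uniformity yields uniqueness, affinity and continuity of the representing
  measure.\<close>

lemma integral_approx:
  assumes f: "continuous_on Sph f" and \<epsilon>: "\<epsilon> > 0"
  shows "\<exists>l. (\<forall>(c, t)\<in>set l. t \<in> lists Y) \<and>
    (\<forall>\<mu>\<in>borel_probabilities Sph. \<bar>integral\<^sup>L \<mu> f - word_poly l (state_vector (mixture ground \<mu>))\<bar> \<le> \<epsilon>)"
proof -
  have "\<exists>l. (\<forall>(c, t)\<in>set l. t \<in> lists Y) \<and>
    (\<forall>v\<in>Sph. \<bar>f v - word_poly l (\<lambda>t. prod_list (map (ground v) t))\<bar> < \<epsilon>)"
    by (rule word_poly_dense[OF compact_sphere ground_continuous ground_separates f \<epsilon>])
  then obtain l where l: "\<forall>(c, t)\<in>set l. t \<in> lists Y" "\<And>v. v \<in> Sph \<Longrightarrow> \<bar>f v - word_poly l (mon (ground v))\<bar> < \<epsilon>"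
    unfolding mon_def[abs_def] by blast
  have "\<bar>integral\<^sup>L \<mu> f - word_poly l (state_vector (mixture ground \<mu>))\<bar> \<le> \<epsilon>" if \<mu>: "\<mu> \<in> borel_probabilities Sph" for \<mu>
  proof -
    interpret finite_measure \<mu> by (rule borel_probabilitiesD[OF \<mu>])
    have sp: "space \<mu> = Sph" "measure \<mu> Sph = 1" by (rule borel_probabilitiesD[OF \<mu>])+
    have p: "integrable \<mu> (\<lambda>v. word_poly l (mon (ground v))) \<and>
        (\<integral>v. word_poly l (mon (ground v)) \<partial>\<mu>) = word_poly l (state_vector (mixture ground \<mu>))"
      using l(1)
    proof (induction l)
      case (Cons a l)
      obtain c t where a: "a = (c, t)" by (cases a)
      have t: "t \<in> lists Y" using Cons.prems by (simp add: a)
      have "integrable \<mu> (\<lambda>v. word_poly l (mon (ground v))) \<and>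
        (\<integral>v. word_poly l (mon (ground v)) \<partial>\<mu>) = word_poly l (state_vector (mixture ground \<mu>))"
        by (rule Cons.IH) (use Cons.prems in simp)
      then show ?case using mon_integrable[OF ground_field t \<mu>] state_vector_mixture[OF ground_field \<mu> t]
        by (simp add: a)
    qed simp
    obtain C where C: "\<And>v. v \<in> Sph \<Longrightarrow> norm (f v) \<le> C"
      using compact_imp_bounded[OF compact_continuous_image[OF f compact_sphere]] unfolding bounded_iff by blast
    have fi: "integrable \<mu> f" by (rule borel_probabilities_integrable[OF \<mu> f C])
    have "\<bar>integral\<^sup>L \<mu> f - word_poly l (state_vector (mixture ground \<mu>))\<bar> = \<bar>\<integral>v. f v - word_poly l (mon (ground v)) \<partial>\<mu>\<bar>"
      using p fi by simp
    also have "\<dots> \<le> (\<integral>v. \<bar>f v - word_poly l (mon (ground v))\<bar> \<partial>\<mu>)" by (rule integral_abs_bound)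
    also have "\<dots> \<le> (\<integral>v. \<epsilon> \<partial>\<mu>)"
      using p fi l(2) sp by (intro integral_mono integrable_abs Bochner_Integration.integrable_diff) (auto intro: less_imp_le)
    also have "\<dots> = \<epsilon>" using sp by simp
    finally show ?thesis .
  qed
  then show ?thesis using l(1) by blast
qed

lemma integral_convex:
  assumes \<mu>: "\<mu>1 \<in> borel_probabilities Sph" "\<mu>2 \<in> borel_probabilities Sph" "\<mu>3 \<in> borel_probabilities Sph"
    and r: "r \<in> {0..1}"
    and eq: "\<And>t. t \<in> lists Y \<Longrightarrow> state_vector (mixture ground \<mu>1) t =
      (1 - r) * state_vector (mixture ground \<mu>2) t + r * state_vector (mixture ground \<mu>3) t"
    and f: "continuous_on Sph f"
  shows "integral\<^sup>L \<mu>1 f = (1 - r) * integral\<^sup>L \<mu>2 f + r * integral\<^sup>L \<mu>3 f"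
proof -
  have "\<bar>integral\<^sup>L \<mu>1 f - ((1 - r) * integral\<^sup>L \<mu>2 f + r * integral\<^sup>L \<mu>3 f)\<bar> \<le> 0 + \<epsilon>" if \<epsilon>: "\<epsilon> > 0" for \<epsilon>
  proof -
    obtain l where l: "\<forall>(c, t)\<in>set l. t \<in> lists Y"
      "\<And>\<mu>. \<mu> \<in> borel_probabilities Sph \<Longrightarrow> \<bar>integral\<^sup>L \<mu> f - word_poly l (state_vector (mixture ground \<mu>))\<bar> \<le> \<epsilon> / 2"
      using integral_approx[OF f, of "\<epsilon> / 2"] \<epsilon> by auto
    let ?w = "\<lambda>\<mu>. word_poly l (state_vector (mixture ground \<mu>))"
    let ?d = "\<lambda>\<mu>. integral\<^sup>L \<mu> f - ?w \<mu>"
    have "?w \<mu>1 = (1 - r) * ?w \<mu>2 + r * ?w \<mu>3" by (rule word_poly_convex[OF eq l(1)])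
    then have "integral\<^sup>L \<mu>1 f - ((1 - r) * integral\<^sup>L \<mu>2 f + r * integral\<^sup>L \<mu>3 f) = ?d \<mu>1 - ((1 - r) * ?d \<mu>2 + r * ?d \<mu>3)"
      by (simp add: algebra_simps)
    moreover have "\<bar>(1 - r) * ?d \<mu>2 + r * ?d \<mu>3\<bar> \<le> (1 - r) * (\<epsilon> / 2) + r * (\<epsilon> / 2)"
    proof -
      have "\<bar>(1 - r) * ?d \<mu>2 + r * ?d \<mu>3\<bar> \<le> (1 - r) * \<bar>?d \<mu>2\<bar> + r * \<bar>?d \<mu>3\<bar>"
        using r abs_triangle_ineq[of "(1 - r) * ?d \<mu>2" "r * ?d \<mu>3"] by (simp add: abs_mult)
      also have "\<dots> \<le> (1 - r) * (\<epsilon> / 2) + r * (\<epsilon> / 2)" using r l(2) \<mu> by (intro add_mono mult_left_mono) auto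
      finally show ?thesis .
    qed
    moreover have "(1 - r) * (\<epsilon> / 2) + r * (\<epsilon> / 2) = \<epsilon> / 2" by (simp add: field_simps)
    ultimately show ?thesis using l(2)[OF \<mu>(1)] by linarith
  qed
  then have "\<bar>integral\<^sup>L \<mu>1 f - ((1 - r) * integral\<^sup>L \<mu>2 f + r * integral\<^sup>L \<mu>3 f)\<bar> \<le> 0"
    by (rule field_le_epsilon)
  then show ?thesis by simp
qed

lemma measure_convex:
  assumes \<mu>: "\<mu>1 \<in> borel_probabilities Sph" "\<mu>2 \<in> borel_probabilities Sph" "\<mu>3 \<in> borel_probabilities Sph"
    and r: "r \<in> {0..1}"
    and eq: "\<And>t. t \<in> lists Y \<Longrightarrow> state_vector (mixture ground \<mu>1) t =
      (1 - r) * state_vector (mixture ground \<mu>2) t + r * state_vector (mixture ground \<mu>3) t"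
    and E: "E \<in> sets (restrict_space borel Sph)"
  shows "measure \<mu>1 E = (1 - r) * measure \<mu>2 E + r * measure \<mu>3 E"
  by (rule measure_convex_combination_eqI[OF \<mu> integral_convex[OF \<mu> r eq] E])

text \<open>The affine relation with \<open>r = 0\<close> identifies the two measures.\<close>

lemma mixture_inj:
  assumes \<mu>: "\<mu> \<in> borel_probabilities Sph" "\<mu>' \<in> borel_probabilities Sph" and eq: "mixture ground \<mu> = mixture ground \<mu>'"
  shows "\<mu> = \<mu>'"
proof (rule measure_eqI)
  show "sets \<mu> = sets \<mu>'" using borel_probabilitiesD(1)[OF \<mu>(1)] borel_probabilitiesD(1)[OF \<mu>(2)] by simp
  fix E assume "E \<in> sets \<mu>"
  then have "E \<in> sets (restrict_space borel Sph)" using borel_probabilitiesD(1)[OF \<mu>(1)] by simp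
  then have "measure \<mu> E = (1 - 0) * measure \<mu>' E + 0 * measure \<mu>' E"
    by (intro measure_convex \<mu>) (auto simp: eq)
  then show "emeasure \<mu> E = emeasure \<mu>' E"
    using finite_measure.emeasure_eq_measure[OF borel_probabilitiesD(3)[OF \<mu>(1)]]
      finite_measure.emeasure_eq_measure[OF borel_probabilitiesD(3)[OF \<mu>(2)]] by simp
qed

definition \<Phi> :: "('a \<Rightarrow> complex) \<Rightarrow> (real ^ 'n) measure" where
  "\<Phi> \<omega> = (THE \<mu>. \<mu> \<in> borel_probabilities Sph \<and> mixture ground \<mu> = \<omega>)"

lemma \<Phi>_mixture: "\<mu> \<in> borel_probabilities Sph \<Longrightarrow> \<Phi> (mixture ground \<mu>) = \<mu>"
  unfolding \<Phi>_def by (rule the_equality) (auto intro: mixture_inj)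

lemma \<Phi>: "\<omega> \<in> K \<Longrightarrow> \<Phi> \<omega> \<in> borel_probabilities Sph" "\<omega> \<in> K \<Longrightarrow> mixture ground (\<Phi> \<omega>) = \<omega>"
  unfolding K_eq_mixtures by (auto simp: \<Phi>_mixture)

lemma \<Phi>_mix:
  assumes \<omega>: "\<omega> \<in> K" "\<omega>' \<in> K" and r: "r \<in> {0..1}" and E: "E \<in> sets (restrict_space borel Sph)"
  shows "measure (\<Phi> (mix_functionals A r \<omega> \<omega>')) E = (1 - r) * measure (\<Phi> \<omega>) E + r * measure (\<Phi> \<omega>') E"
proof -
  have m: "mix_functionals A r \<omega> \<omega>' \<in> K" using convex_K \<omega> r by (auto simp: convex_functionals_def)
  show ?thesis
    by (rule measure_convex[OF \<Phi>(1)[OF m] \<Phi>(1)[OF \<omega>(1)] \<Phi>(1)[OF \<omega>(2)] r _ E])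
       (simp add: \<Phi>(2) m \<omega> mix_state_vector)
qed

lemma state_topology_K: "subtopology (state_topology A) K = subtopology T K"
  unfolding state_topology_def T_def subtopology_subtopology
  using K_ground_bounded(1) by (metis inf.absorb2 subsetI)

text \<open>Values of \<open>mixture ground\<close> are integrals of continuous functions on the
  sphere, split into real and imaginary parts since the topology on measures tests real functions.
  Conversely, by \<open>integral_approx\<close>, each integral against
  \<open>\<Phi> \<omega>\<close> is a uniform limit of polynomials in finitely many values of
  \<open>\<omega>\<close>.\<close>

lemma homeomorphic_\<Phi>: "homeomorphic_map (subtopology (state_topology A) K) (probability_topology Sph) \<Phi>"
proof -
  have tsK: "topspace (subtopology T K) = K"
    using K_ground_bounded(1) statesD(1) by (auto simp: topspace_T)
  have m: "continuous_map (probability_topology Sph) (subtopology T K) (mixture ground)"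
    unfolding continuous_map_in_subtopology
  proof
    show "mixture ground \<in> topspace (probability_topology Sph) \<rightarrow> K"
      using mixture_ground_in_K by (auto simp: topspace_probability_topology)
    show "continuous_map (probability_topology Sph) T (mixture ground)"
      unfolding T_def continuous_map_componentwise
    proof (intro conjI ballI)
      show "mixture ground ` topspace (probability_topology Sph) \<subseteq> extensional A"
        by (auto simp: mixture_def)
      fix x assume x: "x \<in> A"
      let ?h = "\<lambda>v. product_state (ground v) x"
      have hc: "continuous_on Sph ?h" by (rule field_continuous[OF ground_field x])
      have re: "continuous_map (probability_topology Sph) euclidean (\<lambda>\<mu>. \<integral>v. Re (?h v) \<partial>\<mu>)"
        "continuous_map (probability_topology Sph) euclidean (\<lambda>\<mu>. \<integral>v. Im (?h v) \<partial>\<mu>)"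
        by (intro integral_continuous_map continuous_intros hc)+
      have "continuous_map (probability_topology Sph) euclidean (\<lambda>\<mu>. Complex (\<integral>v. Re (?h v) \<partial>\<mu>) (\<integral>v. Im (?h v) \<partial>\<mu>))"
        using re unfolding continuous_map_euclidean_iff by (auto intro: tendsto_Complex)
      then show "continuous_map (probability_topology Sph) euclidean (\<lambda>\<mu>. mixture ground \<mu> x)"
      proof (rule continuous_map_eq)
        fix \<mu> assume "\<mu> \<in> topspace (probability_topology Sph)"
        then have "integrable \<mu> ?h" using field_integrable[OF ground_field x] by (simp add: topspace_probability_topology)
        then show "Complex (\<integral>v. Re (?h v) \<partial>\<mu>) (\<integral>v. Im (?h v) \<partial>\<mu>) = mixture ground \<mu> x"
          using x by (simp add: mixture_def complex_eq_iff)
      qed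
    qed
  qed
  have p: "continuous_map (subtopology T K) (probability_topology Sph) \<Phi>"
    unfolding probability_topology_def
  proof (rule continuous_map_pullback')
    show "topspace (subtopology T K) \<subseteq> \<Phi> -` borel_probabilities Sph" unfolding tsK using \<Phi>(1) by auto
    show "continuous_map (subtopology T K) (product_topology (\<lambda>_. euclidean) {f. continuous_on Sph f})
        ((\<lambda>\<mu>. \<lambda>f\<in>{f :: _ \<Rightarrow> real. continuous_on Sph f}. integral\<^sup>L \<mu> f) \<circ> \<Phi>)"
      unfolding continuous_map_componentwise
    proof (intro conjI ballI)
      fix f :: "real ^ 'n \<Rightarrow> real" assume "f \<in> {f. continuous_on Sph f}"
      then have f: "continuous_on Sph f" by simp
      have "continuous_map (subtopology T K) euclidean (\<lambda>\<omega>. integral\<^sup>L (\<Phi> \<omega>) f)"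
        unfolding continuous_map_euclidean_iff tsK
      proof
        fix \<omega>0 assume \<omega>0: "\<omega>0 \<in> K"
        show "((\<lambda>\<omega>. integral\<^sup>L (\<Phi> \<omega>) f) \<longlongrightarrow> integral\<^sup>L (\<Phi> \<omega>0) f) (atin (subtopology T K) \<omega>0)"
          unfolding tendsto_iff
        proof (intro allI impI)
          fix \<epsilon> :: real assume \<epsilon>: "\<epsilon> > 0"
          obtain l where l: "\<forall>(c, t)\<in>set l. t \<in> lists Y"
            "\<And>\<mu>. \<mu> \<in> borel_probabilities Sph \<Longrightarrow> \<bar>integral\<^sup>L \<mu> f - word_poly l (state_vector (mixture ground \<mu>))\<bar> \<le> \<epsilon> / 4"
            using integral_approx[OF f, of "\<epsilon> / 4"] \<epsilon> by auto
          have app: "\<bar>integral\<^sup>L (\<Phi> \<omega>) f - word_poly l (state_vector \<omega>)\<bar> \<le> \<epsilon> / 4" if "\<omega> \<in> K" for \<omega>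
            using l(2)[OF \<Phi>(1)[OF that]] \<Phi>(2)[OF that] by simp
          have "continuous_map T euclidean (\<lambda>\<omega>. word_poly l (state_vector \<omega>))"
            unfolding continuous_map_euclidean_iff
            by (intro ballI word_poly_tendsto[OF _ l(1)] state_vector_tendsto)
          then have "continuous_map (subtopology T K) euclidean (\<lambda>\<omega>. word_poly l (state_vector \<omega>))"
            by (rule continuous_map_from_subtopology)
          then have "((\<lambda>\<omega>. word_poly l (state_vector \<omega>)) \<longlongrightarrow> word_poly l (state_vector \<omega>0)) (atin (subtopology T K) \<omega>0)"
            unfolding continuous_map_euclidean_iff tsK using \<omega>0 by blast
          then have "\<forall>\<^sub>F \<omega> in atin (subtopology T K) \<omega>0. dist (word_poly l (state_vector \<omega>)) (word_poly l (state_vector \<omega>0)) < \<epsilon> / 4"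
            by (rule tendstoD) (use \<epsilon> in simp)
          moreover have "\<forall>\<^sub>F \<omega> in atin (subtopology T K) \<omega>0. \<omega> \<in> K"
            using eventually_atin_topspace[of "subtopology T K" \<omega>0] unfolding tsK .
          ultimately show "\<forall>\<^sub>F \<omega> in atin (subtopology T K) \<omega>0. dist (integral\<^sup>L (\<Phi> \<omega>) f) (integral\<^sup>L (\<Phi> \<omega>0) f) < \<epsilon>"
          proof eventually_elim
            case (elim \<omega>)
            then show ?case using app[OF elim(2)] app[OF \<omega>0] \<epsilon> unfolding dist_real_def by linarith
          qed
        qed
      qed
      then show "continuous_map (subtopology T K) euclidean
          (\<lambda>\<omega>. ((\<lambda>\<mu>. \<lambda>f\<in>{f :: _ \<Rightarrow> real. continuous_on Sph f}. integral\<^sup>L \<mu> f) \<circ> \<Phi>) \<omega> f)"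
        using f by simp
    qed auto
  qed
  have "homeomorphic_maps (subtopology T K) (probability_topology Sph) \<Phi> (mixture ground)"
    unfolding homeomorphic_maps_def tsK topspace_probability_topology
    using m p \<Phi>(2) \<Phi>_mixture by blast
  then show ?thesis unfolding state_topology_K by (rule homeomorphic_maps_imp_map)
qed

end

theorem corollary5p4:
  fixes G :: "('g, 'b) monoid_scheme"
    and Y :: "'g set"
    and F :: "'g \<Rightarrow> real"
    and V :: "'g \<Rightarrow> 'a::unital_cstar_algebra"
    and \<alpha> :: "real \<Rightarrow> 'a \<Rightarrow> 'a"
  assumes "group G"
    and "finite Y" and "Y \<subseteq> carrier G" and "card Y \<ge> 2"
    and "generates_as_semigroup G Y"
    and "cuntz_family Y V"
    and "cuntz_flow Y V F \<alpha>"
    and "has_rank (G Mod derived G (carrier G)) CARD('n::finite)"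
    and "\<forall>s\<in>Y. F s > 0"
  defines "A \<equiv> cuntz_group_algebra G Y V"
    and "K \<equiv> abelian_KMS_infinity_states G Y V F \<alpha>"
  shows "compactin (state_topology A) K \<and>
         convex_functionals A K \<and>
         affinely_homeomorphic_to_probabilities A K (sphere (0 :: real ^ 'n) 1)"
proof -
  obtain \<pi> :: "'g \<Rightarrow> real ^ 'n" where \<pi>: "\<forall>x\<in>carrier G. \<forall>y\<in>carrier G. \<pi> (x \<otimes>\<^bsub>G\<^esub> y) = \<pi> x + \<pi> y"
    "\<forall>i. \<exists>x\<in>carrier G. \<pi> x = axis i 1"
    "\<forall>c :: 'g \<Rightarrow> real. (\<forall>x\<in>carrier G. \<forall>y\<in>carrier G. c (x \<otimes>\<^bsub>G\<^esub> y) = c x + c y) \<longrightarrow>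
       (\<exists>\<xi>. \<forall>x\<in>carrier G. c x = \<xi> \<bullet> \<pi> x)"
    using group.abelianization_coordinates[OF assms(1,8)] by blast
  interpret cuntz_rank G Y V F \<alpha> \<pi>
  proof (intro cuntz_rank.intro cuntz_dynamics.intro cuntz.intro)
    show "group G" by (rule assms)
    show "cuntz_axioms G Y V" using assms by unfold_locales auto
    show "cuntz_dynamics_axioms G Y V F \<alpha>" using assms by unfold_locales auto
    show "cuntz_rank_axioms G \<pi>" using \<pi> by unfold_locales auto
  qed
  have A: "A = cuntz.A G Y V" by (simp add: assms(10) A_def)
  have K: "K = cuntz_rank.K G Y V F \<alpha>" by (simp add: assms(11) K_def)
  show ?thesis
    unfolding A K affinely_homeomorphic_to_probabilities_def
    using compactin_K convex_K homeomorphic_\<Phi> \<Phi>_mix by blast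
qed

end
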